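(* Let $p$ be an odd prime and $n\ge 2$ an integer. With the notation of the context, for all $\lambda,\mu\in\Lambda_{\emptyset,1}$ and all $w,w'\in\Lambda_{\emptyset,2}$: (i) $d_{\lambda,\mu_{w}}=d_{\lambda,\mu_w^*}$; $\;d_{\lambda_{w'},\mu}=d_{\lambda_{w'}^*,\mu}$; $\;d_{\lambda_{w'},\mu_w}=d_{\lambda_{w'}^*,\mu_w^*}$ and $d_{\lambda_{w'},\mu_w^*}=d_{\lambda_{w'}^*,\mu_w}$. (ii) $d'_{\lambda;+,\mu;+}+d'_{\lambda;-,\mu;+}=d_{\lambda,\mu}=d'_{\lambda;+,\mu;-}+d'_{\lambda;-,\mu;-}$; $\;d'_{\lambda;+,\mu;+}=d'_{\lambda;-,\mu;-}$ and $d'_{\lambda;+,\mu;-}=d'_{\lambda;-,\mu;+}$; $\;d'_{\lambda;+,\mu_w}=d'_{\lambda;-,\mu_w}=d_{\lambda,\mu_{w}}$. (iii) $d_{\lambda_{w'},\mu_w}+d_{\lambda_{w'},\mu_w^*}=d'_{\lambda_{w'},\mu_{w}}$; $\;d'_{\lambda_{w'},\mu;+}=d'_{\lambda_{w'},\mu;-}=d_{\lambda_{w'},\mu}$.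
   Context: Decomposition numbers: for a finite group $G$, $\operatorname{IBr}(G)$ is the set of irreducible $p$-Brauer characters (viewed as class functions on $G$ vanishing off the $p$-regular elements), $\chi^{p\text{-reg}}$ is the class function equal to $\chi$ on $p$-regular elements and $0$ elsewhere, and $\chi^{p\text{-reg}}=\sum_{\theta\in\operatorname{IBr}(G)}d_{\chi,\theta}\theta$ with integers $d_{\chi,\theta}\ge0$, for $\chi\in\operatorname{Irr}(G)$. A $p$-basic set of $G$ is a subset $B\subseteq\operatorname{Irr}(G)$ such that $(\chi^{p\text{-reg}})_{\chi\in B}$ is a $\mathbb{Z}$-basis of the $\mathbb{Z}$-span of $\{\chi^{p\text{-reg}}\mid\chi\in\operatorname{Irr}(G)\}$. $p$-quotient: for a partition $\lambda$ (extended by zeros) let $X_\lambda=\{\lambda_i-i\mid i\ge1\}\subset\mathbb{Z}$. For $1\le j\le p$ the $j$-th part $\alpha_\lambda^j$ of the $p$-quotient $\alpha_\lambda$ is the partition whose parts are the nonzero numbers among $\#\{m'<m\mid pm'+(j-1)\notin X_\lambda\}$, one for each $m\in\mathbb{Z}$ with $pm+(j-1)\in X_\lambda$. (With this convention $\alpha_{\lambda^*}=((\alpha_\lambda^p)^*,\ldots,(\alpha_\lambda^1)^* )$, where $^*$ is conjugation of partitions.) Symmetric group: $\chi_\lambda$ ($\lambda\vdash n$) are the irreducible characters of $\mathfrak{S}_n$, $\varepsilon$ is the sign character, and $\varepsilon\chi_\lambda=\chi_{\lambda^*}$. Let $\Lambda_\emptyset=\{\lambda\vdash n\mid\alpha_\lambda^{(p+1)/2}=\emptyset\}$,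 let $\Lambda_{\emptyset,1}$ be the set of $\lambda\in\Lambda_\emptyset$ with $\lambda=\lambda^*$, and let $\Lambda_{\emptyset,2}$ be the set of pairs $\{\lambda,\lambda^*\}$ with $\lambda\in\Lambda_\emptyset$, $\lambda\ne\lambda^*$. For each $w\in\Lambda_{\emptyset,2}$ fix $\lambda_w\in w$, so $w=\{\lambda_w,\lambda_w^*\}$; the same chosen element is also written $\mu_w$ when it indexes Brauer characters. The set $\mathcal{B}_\emptyset=\{\chi_\lambda\mid\lambda\in\Lambda_\emptyset\}$ is an $\varepsilon$-stable $p$-basic set of $\mathfrak{S}_n$, and there is a bijection $\Phi:\mathcal{B}_\emptyset\to\operatorname{IBr}(\mathfrak{S}_n)$ that is equivariant for multiplication by $\varepsilon$; fix any such $\Phi$. For $\lambda,\mu\in\Lambda_\emptyset$ put $\theta_\mu=\Phi(\chi_\mu)$ and $d_{\lambda,\mu}=d_{\chi_\lambda,\theta_\mu}$. Alternating group: for $\lambda\in\Lambda_{\emptyset,1}$, $\operatorname{Res}^{\mathfrak{S}_n}_{\mathfrak{A}_n}(\chi_\lambda)=\rho_{\lambda,+}+\rho_{\lambda,-}$ with distinct irreducible $\rho_{\lambda,\pm}$; for $w\in\Lambda_{\emptyset,2}$, $\rho_{\lambda_w}=\operatorname{Res}^{\mathfrak{S}_n}_{\mathfrak{A}_n}(\chi_{\lambda_w})$ is irreducible. For $\mu\in\Lambda_{\emptyset,1}$, $\operatorname{Res}^{\mathfrak{S}_n}_{\mathfrak{A}_n}(\theta_\mu)=\theta'_{\mu,+}+\theta'_{\mu,-}$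 with distinct irreducible Brauer characters; for $w\in\Lambda_{\emptyset,2}$, $\theta'_{\mu_w}=\operatorname{Res}^{\mathfrak{S}_n}_{\mathfrak{A}_n}(\theta_{\mu_w})\in\operatorname{IBr}(\mathfrak{A}_n)$. One has $\operatorname{IBr}(\mathfrak{A}_n)=\{\theta'_{\mu,\pm}\mid\mu\in\Lambda_{\emptyset,1}\}\cup\{\theta'_{\mu_w}\mid w\in\Lambda_{\emptyset,2}\}$. The non-negative integers $d'$ are the decomposition numbers of $\mathfrak{A}_n$: $$\rho_{\lambda,\pm}^{p\text{-reg}}=\sum_{\mu\in\Lambda_{\emptyset,1}}(d'_{\lambda;\pm,\mu;+}\theta'_{\mu,+}+d'_{\lambda;\pm,\mu;-}\theta'_{\mu,-})+\sum_{w\in\Lambda_{\emptyset,2}}d'_{\lambda;\pm,\mu_w}\theta'_{\mu_w},$$ $$\rho_{\lambda_{w'}}^{p\text{-reg}}=\sum_{\mu\in\Lambda_{\emptyset,1}}(d'_{\lambda_{w'},\mu;+}\theta'_{\mu,+}+d'_{\lambda_{w'},\mu;-}\theta'_{\mu,-})+\sum_{w\in\Lambda_{\emptyset,2}}d'_{\lambda_{w'},\mu_w}\theta'_{\mu_w}.$$ *)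

theory Defs
  imports
    "HOL-Algebra.Sym_Groups"
    "HOL-Algebra.Multiplicative_Group"
    "HOL-Computational_Algebra.Primes"
    "HOL-Library.Multiset"
    "Jordan_Normal_Form.VS_Connect"
    "Jordan_Normal_Form.Char_Poly"
begin

section \<open>Matrix representations and ordinary characters\<close>

definition representation ::
  "('g, 'b) monoid_scheme \<Rightarrow> nat \<Rightarrow> ('g \<Rightarrow> 'k :: field mat) \<Rightarrow> bool" where
  "representation G d R \<longleftrightarrow> R \<in> hom G (units_of (ring_mat TYPE('k) d ()))"

definition irreducible_representation ::
  "('g, 'b) monoid_scheme \<Rightarrow> nat \<Rightarrow> ('g \<Rightarrow> 'k :: field mat) \<Rightarrow> bool" where
  "irreducible_representation G d R \<longleftrightarrow>
     representation G d R \<and> 0 < d \<and>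
     (\<forall>W. VectorSpace.subspace class_ring W (module_vec TYPE('k) d) \<and>
          (\<forall>g\<in>carrier G. \<forall>v\<in>W. R g *\<^sub>v v \<in> W)
          \<longrightarrow> W = {0\<^sub>v d} \<or> W = carrier_vec d)"

text \<open>Class functions on \<^term>\<open>G\<close> are total functions that vanish outside
  \<^term>\<open>carrier G\<close>, so that equality of functions is equality of class functions.\<close>

definition character ::
  "('g, 'b) monoid_scheme \<Rightarrow> ('g \<Rightarrow> complex mat) \<Rightarrow> 'g \<Rightarrow> complex" where
  "character G R g = (if g \<in> carrier G then \<Sum>i<dim_row (R g). R g $$ (i, i) else 0)"

definition Irr :: "('g, 'b) monoid_scheme \<Rightarrow> ('g \<Rightarrow> complex) set" where
  "Irr G = {character G R | d R. irreducible_representation G d R}"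

definition Res :: "('g, 'b) monoid_scheme \<Rightarrow> ('g \<Rightarrow> complex) \<Rightarrow> 'g \<Rightarrow> complex" where
  "Res H f g = (if g \<in> carrier H then f g else 0)"

section \<open>Brauer characters and decomposition numbers\<close>

text \<open>A surjective ring homomorphism \<^term>\<open>r\<close> from the ring of algebraic integers onto a field
  of characteristic \<^term>\<open>p\<close>. Up to isomorphism this is the quotient map by a maximal ideal
  containing \<^term>\<open>p\<close>, which is the usual choice underlying Brauer characters; the field
  is then an algebraic closure of the field with \<^term>\<open>p\<close> elements. Values of \<^term>\<open>r\<close>
  outside the algebraic integers are irrelevant.\<close>

definition modular_reduction :: "nat \<Rightarrow> (complex \<Rightarrow> 'k :: field) \<Rightarrow> bool" where
  "modular_reduction p r \<longleftrightarrow>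
     r 1 = 1 \<and> r (of_nat p) = 0 \<and>
     (\<forall>x y. algebraic_int x \<and> algebraic_int y \<longrightarrow>
        r (x + y) = r x + r y \<and> r (x * y) = r x * r y) \<and>
     r ` {x. algebraic_int x} = UNIV"

definition p_regular :: "nat \<Rightarrow> ('g, 'b) monoid_scheme \<Rightarrow> 'g \<Rightarrow> bool" where
  "p_regular p G g \<longleftrightarrow> g \<in> carrier G \<and> \<not> p dvd group.ord G g"

definition preg :: "nat \<Rightarrow> ('g, 'b) monoid_scheme \<Rightarrow> ('g \<Rightarrow> complex) \<Rightarrow> 'g \<Rightarrow> complex" where
  "preg p G f g = (if p_regular p G g then f g else 0)"

text \<open>If \<^term>\<open>g\<close> is \<^term>\<open>p\<close>-regular of order \<^term>\<open>m\<close>, the eigenvalues of the matrix of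
  \<^term>\<open>g\<close> are \<^term>\<open>m\<close>-th roots of unity, and \<^term>\<open>r\<close> maps the complex \<^term>\<open>m\<close>-th roots
  of unity bijectively onto those of the residue field. Hence the sum below runs over the lifted
  eigenvalues, counted with algebraic multiplicity.\<close>

definition brauer_character ::
  "nat \<Rightarrow> (complex \<Rightarrow> 'k :: field) \<Rightarrow> ('g, 'b) monoid_scheme \<Rightarrow> ('g \<Rightarrow> 'k mat) \<Rightarrow> 'g \<Rightarrow> complex"
  where
  "brauer_character p r G R g =
     (if p_regular p G g
      then \<Sum>z | z ^ group.ord G g = 1. of_nat (Polynomial.order (r z) (char_poly (R g))) * z
      else 0)"

definition IBr ::
  "nat \<Rightarrow> (complex \<Rightarrow> 'k :: field) \<Rightarrow> ('g, 'b) monoid_scheme \<Rightarrow> ('g \<Rightarrow> complex) set" where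
  "IBr p r G = {brauer_character p r G R | d R. irreducible_representation G d R}"

text \<open>Since \<^term>\<open>IBr p r G\<close> is linearly independent, this determines
  \<^term>\<open>d \<chi> \<theta>\<close> for all \<^term>\<open>\<chi> \<in> Irr G\<close> and \<^term>\<open>\<theta> \<in> IBr p r G\<close>.\<close>

definition decomposition_numbers ::
  "nat \<Rightarrow> (complex \<Rightarrow> 'k :: field) \<Rightarrow> ('g, 'b) monoid_scheme \<Rightarrow>
     (('g \<Rightarrow> complex) \<Rightarrow> ('g \<Rightarrow> complex) \<Rightarrow> nat) \<Rightarrow> bool" where
  "decomposition_numbers p r G d \<longleftrightarrow>
     (\<forall>\<chi>\<in>Irr G. preg p G \<chi> = (\<lambda>g. \<Sum>\<theta>\<in>IBr p r G. of_nat (d \<chi> \<theta>) * \<theta> g))"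

section \<open>Partitions, conjugates and quotients\<close>

definition partitions :: "nat \<Rightarrow> nat list set" where
  "partitions n = {la. sorted_wrt (\<ge>) la \<and> 0 \<notin> set la \<and> sum_list la = n}"

definition conj_part :: "nat list \<Rightarrow> nat list" where
  "conj_part la = map (\<lambda>j. length (filter (\<lambda>a. j < a) la)) [0..<Max (insert 0 (set la))]"

text \<open>The parts of \<^term>\<open>la\<close> are numbered from 0 here, whence the shift by 1.\<close>

definition X_set :: "nat list \<Rightarrow> int set" where
  "X_set la = {int (if i < length la then la ! i else 0) - int (i + 1) | i. True}"

definition quotient_count :: "nat \<Rightarrow> nat list \<Rightarrow> nat \<Rightarrow> int \<Rightarrow> nat" where
  "quotient_count p la j m = card {m'. m' < m \<and> int p * m' + (int j - 1) \<notin> X_set la}"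

definition p_quotient_part :: "nat \<Rightarrow> nat list \<Rightarrow> nat \<Rightarrow> nat list" where
  "p_quotient_part p la j =
     rev (sorted_list_of_multiset (image_mset (quotient_count p la j)
       (mset_set {m. int p * m + (int j - 1) \<in> X_set la \<and> quotient_count p la j m \<noteq> 0})))"

definition Lam :: "nat \<Rightarrow> nat \<Rightarrow> nat list set" where
  "Lam p n = {la \<in> partitions n. p_quotient_part p la ((p + 1) div 2) = []}"

definition Lam1 :: "nat \<Rightarrow> nat \<Rightarrow> nat list set" where
  "Lam1 p n = {la \<in> Lam p n. conj_part la = la}"

definition Lam2 :: "nat \<Rightarrow> nat \<Rightarrow> nat list set set" where
  "Lam2 p n = {{la, conj_part la} | la. la \<in> Lam p n \<and> conj_part la \<noteq> la}"

section \<open>Irreducible characters of symmetric groups\<close>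

definition sgn_times :: "((nat \<Rightarrow> nat) \<Rightarrow> complex) \<Rightarrow> (nat \<Rightarrow> nat) \<Rightarrow> complex" where
  "sgn_times f g = of_int (sign g) * f g"

text \<open>The Young subgroup stabilises consecutive blocks of sizes \<^term>\<open>la ! 0\<close>, \<^term>\<open>la ! 1\<close>, ...\<close>

definition young_subgroup :: "nat \<Rightarrow> nat list \<Rightarrow> (nat \<Rightarrow> nat) set" where
  "young_subgroup n la =
     {g. g permutes {1..n} \<and>
         (\<forall>j<length la. let B = {sum_list (take j la)<..sum_list (take (Suc j) la)} in g ` B = B)}"

text \<open>The irreducible character labelled by \<^term>\<open>la\<close> is the unique common irreducible
  constituent of the trivial character induced from the Young subgroup of \<^term>\<open>la\<close> and the
  sign character induced from the Young subgroup of the conjugate partition. By Frobenius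
  reciprocity the two sums below are, up to the orders of the subgroups, its multiplicities
  in these induced characters. In particular the partition \<^term>\<open>[n]\<close> labels the trivial
  character.\<close>

definition chi :: "nat \<Rightarrow> nat list \<Rightarrow> (nat \<Rightarrow> nat) \<Rightarrow> complex" where
  "chi n la = (THE \<chi>. \<chi> \<in> Irr (sym_group n) \<and>
     (\<Sum>g\<in>young_subgroup n la. \<chi> g) \<noteq> 0 \<and>
     (\<Sum>g\<in>young_subgroup n (conj_part la). of_int (sign g) * \<chi> g) \<noteq> 0)"

definition B_empty :: "nat \<Rightarrow> nat \<Rightarrow> ((nat \<Rightarrow> nat) \<Rightarrow> complex) set" where
  "B_empty p n = chi n ` Lam p n"

end

theory Submission
  imports Defs
begin

text \<open>
  The alternating group is the kernel of the sign. So multiplication by the sign acts on the class functions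
  of the symmetric group, and conjugation by a transposition acts on those of the alternating group. Both
  operations permute the irreducible characters and the irreducible Brauer characters, and they
  commute with the restriction to \<open>p\<close>-regular elements. As irreducible Brauer characters are independent over
  the integers, decomposition numbers are unique, hence invariant under both operations
  (\<open>decomposition_equivariant\<close>). As the sign maps \<open>\<chi>\<^sub>\<lambda>\<close> to the character of the conjugate partition, and
  \<open>\<Phi>\<close> is equivariant, the first invariance is (i). The second one gives the symmetries in (ii), because the
  conjugation exchanges the two constituents of a restriction and fixes the restriction itself.

  The remaining equalities come from restricting the expansion of an ordinary character \<open>\<chi>\<close> to the
  alternating group and comparing coefficients, where Clifford theory describes the restrictions of
  Brauer characters. A Brauer character \<open>\<theta>\<close> that differs from its product with the sign restricts irreducibly
  (\<open>restriction_irreducible\<close>), and only \<open>\<theta>\<close> and this product have this restriction. So its coefficient is the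
  sum of two decomposition numbers (\<open>coefficient_of_restriction\<close>). A constituent \<open>\<psi>\<close> that differs from its
  conjugate \<open>\<psi>'\<close> occurs in one restriction only, namely \<open>\<psi> + \<psi>'\<close> (\<open>clifford_split\<close>), so its
  coefficient is a single decomposition number (\<open>coefficient_of_constituent\<close>).

  The independence of Brauer characters (\<open>IBr_independent\<close>) rests on the independence of the matrix coefficients
  of irreducible representations without intertwiners over an algebraically closed field
  (\<open>rows_independent\<close>). The residue field of the algebraic integers is algebraically closed, and a Brauer character
  reduces to a trace over it. So an integral relation between Brauer characters has all its coefficients
  divisible by \<open>p\<close>, and it can be divided by \<open>p\<close> again and again.

  What has to be known about the symmetric group is that the characters \<^term>\<open>chi n la\<close> exist, are pairwise
  different, and are permuted by the sign according to the conjugation of partitions. The character is the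
  one on which the row symmetriser of \<open>\<lambda>\<close> and the antisymmetriser of the conjugate of \<open>\<lambda>\<close> are both
  nonzero. It exists, since a product of these two has nonzero trace on the regular
  representation (\<open>selects_exists\<close>). It is unique, since the elements between the two symmetrisers span a
  space of dimension one (\<open>selects_unique\<close>). Different partitions have different characters by the
  combinatorics of the dominance order (\<open>chi_inj\<close>). Finally, \<^term>\<open>Lam p n\<close> is closed under conjugation, because the
  middle part of the quotient of \<open>\<lambda>\<close> is empty if and only if that of the conjugate is (\<open>Lam_conj\<close>). So a
  partition in \<^term>\<open>Lam p n\<close> that differs from its conjugate gives a character, and by the injectivity of
  \<open>\<Phi>\<close> also a Brauer character, that differs from its product with the sign.
\<close>

section \<open>Invariant subspaces and block triangular form\<close>

text \<open>A subspace in terms of the vector operations alone, free of the locale structure; the lemma after it shows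
  that this is the notion in the definition of an irreducible representation.\<close>

definition vec_subspace :: "nat \<Rightarrow> 'k :: field vec set \<Rightarrow> bool" where
  "vec_subspace d W \<longleftrightarrow> W \<subseteq> carrier_vec d \<and> 0\<^sub>v d \<in> W \<and>
     (\<forall>v\<in>W. \<forall>w\<in>W. v + w \<in> W) \<and> (\<forall>c. \<forall>v\<in>W. c \<cdot>\<^sub>v v \<in> W)"

lemma vec_subspace_iff:
  fixes W :: "'k :: field vec set"
  shows "VectorSpace.subspace class_ring W (module_vec TYPE('k) d) \<longleftrightarrow> vec_subspace d W"
proof
  assume a: "VectorSpace.subspace class_ring W (module_vec TYPE('k) d)"
  interpret VectorSpace.subspace class_ring W "module_vec TYPE('k) d" by (rule a)
  interpret s: submodule class_ring W "module_vec TYPE('k) d" by (rule submod)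
  show "vec_subspace d W"
    using s.subset s.m_closed s.zero_closed s.smult_closed
    unfolding vec_subspace_def by (auto simp: module_vec_simps class_ring_simps)
next
  assume W: "vec_subspace d W"
  have "submodule class_ring W (module_vec TYPE('k) d)"
    using W vec_module[of d] unfolding vec_subspace_def submodule_def
    by (auto simp: module_vec_simps class_ring_simps)
  then show "VectorSpace.subspace class_ring W (module_vec TYPE('k) d)"
    using vec_vs unfolding VectorSpace.subspace_def by blast
qed

lemma vec_subspaceD:
  assumes "vec_subspace d W"
  shows "\<And>v. v \<in> W \<Longrightarrow> v \<in> carrier_vec d" "0\<^sub>v d \<in> W"
    "\<And>v w. v \<in> W \<Longrightarrow> w \<in> W \<Longrightarrow> v + w \<in> W" "\<And>v c. v \<in> W \<Longrightarrow> c \<cdot>\<^sub>v v \<in> W"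
  using assms unfolding vec_subspace_def by auto

lemma invertible_mat_of_injective:
  fixes A :: "'k :: field mat"
  assumes A: "A \<in> carrier_mat n n"
    and inj: "\<And>v. v \<in> carrier_vec n \<Longrightarrow> A *\<^sub>v v = 0\<^sub>v n \<Longrightarrow> v = 0\<^sub>v n"
  obtains B where "B \<in> carrier_mat n n" "A * B = 1\<^sub>m n" "B * A = 1\<^sub>m n"
proof -
  have "det A \<noteq> 0" using det_0_iff_vec_prod_zero_field[OF A] inj by auto
  then have "A \<in> Units (ring_mat TYPE('k) n ())" by (rule det_non_zero_imp_unit[OF A])
  then show thesis using that unfolding Units_def ring_mat_simps by auto
qed

text \<open>The exchange step of Gaussian elimination. If the span of the first \<open>m\<close> columns of the
  invertible matrix \<open>P\<close> lies in \<open>W\<close> but does not exhaust it, then some column can be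
  replaced by a vector of \<open>W\<close>, and the span grows.\<close>

lemma basis_exchange:
  fixes W :: "'k :: field vec set"
  assumes W: "vec_subspace d W" and P: "P \<in> carrier_mat d d" and Q: "Q \<in> carrier_mat d d"
    and PQ: "P * Q = 1\<^sub>m d" "Q * P = 1\<^sub>m d"
    and m: "\<And>u. u \<in> carrier_vec d \<Longrightarrow> \<forall>i<d. m \<le> i \<longrightarrow> u $ i = 0 \<Longrightarrow> P *\<^sub>v u \<in> W"
    and w: "w \<in> W" and i0: "i0 < d" "m \<le> i0" "(Q *\<^sub>v w) $ i0 \<noteq> 0"
  obtains P' Q' where "P' \<in> carrier_mat d d" "Q' \<in> carrier_mat d d"
    "P' * Q' = 1\<^sub>m d" "Q' * P' = 1\<^sub>m d"
    "\<And>u. u \<in> carrier_vec d \<Longrightarrow> \<forall>i<d. Suc m \<le> i \<longrightarrow> u $ i = 0 \<Longrightarrow> P' *\<^sub>v u \<in> W"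
proof -
  define u0 where "u0 = Q *\<^sub>v w"
  have wc: "w \<in> carrier_vec d" using W w by (auto simp: vec_subspace_def)
  have u0c: "u0 \<in> carrier_vec d" unfolding u0_def using Q wc by auto
  define E where "E = mat d d (\<lambda>(i,j). if j = m then u0 $ i
     else if j = i0 then (if i = m then 1 else 0) else if i = j then 1 else 0)"
  have Ec: "E \<in> carrier_mat d d" by (simp add: E_def)
  have md: "m < d" using i0 by auto
  have E_mult: "(E *\<^sub>v x) $ i = u0 $ i * x $ m + (if i = m \<and> i0 \<noteq> m then x $ i0 else 0)
     + (if i \<noteq> m \<and> i \<noteq> i0 then x $ i else 0)" if x: "x \<in> carrier_vec d" and i: "i < d" for x i
  proof -
    have "(E *\<^sub>v x) $ i = (\<Sum>j<d. E $$ (i,j) * x $ j)"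
      using x i Ec by (simp add: scalar_prod_def atLeast0LessThan)
    also have "\<dots> = (\<Sum>j<d. (if j = m then u0 $ i * x $ m else 0)
        + (if j = i0 then (if i = m \<and> i0 \<noteq> m then x $ i0 else 0) else 0)
        + (if j = i then (if i \<noteq> m \<and> i \<noteq> i0 then x $ i else 0) else 0))"
      using i by (intro sum.cong) (auto simp: E_def)
    also have "\<dots> = u0 $ i * x $ m + (if i = m \<and> i0 \<noteq> m then x $ i0 else 0)
       + (if i \<noteq> m \<and> i \<noteq> i0 then x $ i else 0)"
      using i i0 md by (simp add: sum.distrib)
    finally show ?thesis .
  qed
  have inj: "x = 0\<^sub>v d" if x: "x \<in> carrier_vec d" and Ex: "E *\<^sub>v x = 0\<^sub>v d" for x
  proof -
    have e: "u0 $ i * x $ m + (if i = m \<and> i0 \<noteq> m then x $ i0 else 0)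
     + (if i \<noteq> m \<and> i \<noteq> i0 then x $ i else 0) = 0" if "i < d" for i
      using E_mult[OF x that] Ex that by simp
    have xm: "x $ m = 0" using e[OF i0(1)] i0 by (auto simp: u0_def split: if_splits)
    have "x $ i0 = 0" using e[OF md] xm by (auto split: if_splits)
    moreover have "x $ i = 0" if "i < d" "i \<noteq> i0" for i
      using e[OF that(1)] xm that by (auto split: if_splits)
    ultimately show ?thesis using x by (intro eq_vecI) (metis carrier_vecD index_zero_vec, simp)
  qed
  obtain F where F: "F \<in> carrier_mat d d" "E * F = 1\<^sub>m d" "F * E = 1\<^sub>m d"
    using invertible_mat_of_injective[OF Ec inj] by blast
  have "(P * E) * (F * Q) = P * (E * F) * Q" using P Q Ec F(1)
    by (simp add: assoc_mult_mat[of _ d d _ d _ d])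
  also have "\<dots> = 1\<^sub>m d" using F(2) P PQ by simp
  finally have 1: "(P * E) * (F * Q) = 1\<^sub>m d" .
  have 2: "(F * Q) * (P * E) = 1\<^sub>m d"
    by (rule mat_mult_left_right_inverse[OF _ _ 1]) (use P Q Ec F(1) in auto)
  have 3: "(P * E) *\<^sub>v x \<in> W" if x: "x \<in> carrier_vec d" "\<forall>i<d. Suc m \<le> i \<longrightarrow> x $ i = 0" for x
  proof -
    define x' where "x' = vec d (\<lambda>i. if i = m then 0 else x $ i)"
    have x': "x' \<in> carrier_vec d" by (simp add: x'_def)
    have "E *\<^sub>v x = x' + x $ m \<cdot>\<^sub>v u0"
    proof (rule eq_vecI)
      fix i assume "i < dim_vec (x' + x $ m \<cdot>\<^sub>v u0)"
      then have i: "i < d" using u0c by simp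
      show "(E *\<^sub>v x) $ i = (x' + x $ m \<cdot>\<^sub>v u0) $ i"
        unfolding E_mult[OF x(1) i] using i u0c x(2) i0 by (auto simp: x'_def)
    qed (use u0c Ec in auto)
    then have "(P * E) *\<^sub>v x = P *\<^sub>v (x' + x $ m \<cdot>\<^sub>v u0)" using P Ec x(1) by simp
    also have "\<dots> = P *\<^sub>v x' + x $ m \<cdot>\<^sub>v (P *\<^sub>v u0)"
      using P x' u0c by (simp add: mult_add_distrib_mat_vec mult_mat_vec)
    also have "P *\<^sub>v u0 = w" unfolding u0_def using P Q PQ wc
      by (simp add: assoc_mult_mat_vec[symmetric, OF P Q wc])
    finally have eq: "(P * E) *\<^sub>v x = P *\<^sub>v x' + x $ m \<cdot>\<^sub>v w" .
    have "P *\<^sub>v x' \<in> W"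
      by (rule m[OF x']) (use x(2) in \<open>auto simp: x'_def\<close>)
    then show ?thesis unfolding eq using W w by (auto simp: vec_subspace_def)
  qed
  show thesis by (rule that[OF _ _ 1 2 3]) (use P Q Ec F(1) in auto)
qed

text \<open>Among the invertible matrices whose first \<open>m\<close> columns lie in \<open>W\<close>, take one with
  \<open>m\<close> as large as possible; by the exchange step these columns span \<open>W\<close>.\<close>

lemma subspace_adapted_basis:
  fixes W :: "'k :: field vec set"
  assumes W: "vec_subspace d W"
  obtains m P Q where "m \<le> d" "P \<in> carrier_mat d d" "Q \<in> carrier_mat d d"
    "P * Q = 1\<^sub>m d" "Q * P = 1\<^sub>m d"
    "\<And>v. v \<in> carrier_vec d \<Longrightarrow> v \<in> W \<longleftrightarrow> (\<forall>i<d. m \<le> i \<longrightarrow> (Q *\<^sub>v v) $ i = 0)"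
proof -
  define G where "G m \<longleftrightarrow> m \<le> d \<and> (\<exists>P Q. P \<in> carrier_mat d d \<and> Q \<in> carrier_mat d d \<and>
     P * Q = 1\<^sub>m d \<and> Q * P = 1\<^sub>m d \<and>
     (\<forall>u\<in>carrier_vec d. (\<forall>i<d. m \<le> i \<longrightarrow> u $ i = 0) \<longrightarrow> P *\<^sub>v u \<in> W))" for m
  have "G 0"
  proof -
    have "1\<^sub>m d *\<^sub>v u \<in> W" if "u \<in> carrier_vec d" "\<forall>i<d. 0 \<le> i \<longrightarrow> u $ i = 0" for u
    proof -
      have "u = 0\<^sub>v d" using that by (intro eq_vecI) auto
      then show ?thesis using vec_subspaceD(2)[OF W] by simp
    qed
    then show ?thesis unfolding G_def by (intro conjI exI[of _ "1\<^sub>m d"]) auto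
  qed
  moreover have "\<And>m. G m \<Longrightarrow> m \<le> d" by (simp add: G_def)
  ultimately obtain m where m: "G m" and max: "\<And>m'. G m' \<Longrightarrow> m' \<le> m"
    using Greatest_le_nat[of G _ d] GreatestI_nat[of G _ d] by metis
  from m obtain P Q where PQ: "m \<le> d" "P \<in> carrier_mat d d" "Q \<in> carrier_mat d d"
    "P * Q = 1\<^sub>m d" "Q * P = 1\<^sub>m d"
    and PW: "\<And>u. u \<in> carrier_vec d \<Longrightarrow> \<forall>i<d. m \<le> i \<longrightarrow> u $ i = 0 \<Longrightarrow> P *\<^sub>v u \<in> W"
    unfolding G_def by blast
  have "v \<in> W \<longleftrightarrow> (\<forall>i<d. m \<le> i \<longrightarrow> (Q *\<^sub>v v) $ i = 0)" if v: "v \<in> carrier_vec d" for v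
  proof
    assume vW: "v \<in> W"
    show "\<forall>i<d. m \<le> i \<longrightarrow> (Q *\<^sub>v v) $ i = 0"
    proof (rule ccontr)
      assume "\<not> ?thesis"
      then obtain i0 where i0: "i0 < d" "m \<le> i0" "(Q *\<^sub>v v) $ i0 \<noteq> 0" by auto
      obtain P' Q' where 1: "P' \<in> carrier_mat d d" "Q' \<in> carrier_mat d d"
        "P' * Q' = 1\<^sub>m d" "Q' * P' = 1\<^sub>m d"
        "\<And>u. u \<in> carrier_vec d \<Longrightarrow> \<forall>i<d. Suc m \<le> i \<longrightarrow> u $ i = 0 \<Longrightarrow> P' *\<^sub>v u \<in> W"
        using basis_exchange[OF W PQ(2-5) PW vW i0] by blast
      have "G (Suc m)" unfolding G_def
        by (intro conjI exI[of _ P'] exI[of _ Q']) (use 1 i0 in auto)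
      with max show False by fastforce
    qed
  next
    assume "\<forall>i<d. m \<le> i \<longrightarrow> (Q *\<^sub>v v) $ i = 0"
    then have "P *\<^sub>v (Q *\<^sub>v v) \<in> W" using PW v PQ by auto
    then show "v \<in> W" using PQ v
      by (simp add: assoc_mult_mat_vec[symmetric, OF PQ(2,3) v])
  qed
  then show thesis using that[OF PQ] by blast
qed

text \<open>In a basis adapted to \<open>W\<close>, matrices that preserve \<open>W\<close> are block triangular. The
  columns of \<open>B\<close> are the part of the basis that spans \<open>W\<close>, so \<open>A i\<close> is the
  restriction of \<open>M i\<close> to \<open>W\<close>; the left inverse \<open>C\<close> of \<open>B\<close> computes
  coordinates in \<open>W\<close>.\<close>

lemma invariant_block_form:
  fixes W :: "'k :: field vec set" and M :: "'i \<Rightarrow> 'k mat"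
  assumes W: "vec_subspace d W"
    and M: "\<And>i. i \<in> I \<Longrightarrow> M i \<in> carrier_mat d d"
    and inv: "\<And>i v. i \<in> I \<Longrightarrow> v \<in> W \<Longrightarrow> M i *\<^sub>v v \<in> W"
  obtains m P Q A X D B C where "m \<le> d" "P \<in> carrier_mat d d" "Q \<in> carrier_mat d d"
    "P * Q = 1\<^sub>m d" "Q * P = 1\<^sub>m d"
    "\<And>i. A i \<in> carrier_mat m m" "\<And>i. X i \<in> carrier_mat m (d - m)"
    "\<And>i. D i \<in> carrier_mat (d - m) (d - m)"
    "\<And>i. i \<in> I \<Longrightarrow> M i = P * four_block_mat (A i) (X i) (0\<^sub>m (d - m) m) (D i) * Q"
    "B \<in> carrier_mat d m" "C \<in> carrier_mat m d" "C * B = 1\<^sub>m m"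
    "W = (\<lambda>u. B *\<^sub>v u) ` carrier_vec m"
    "\<And>i. i \<in> I \<Longrightarrow> M i * B = B * A i"
    "m = 0 \<Longrightarrow> W = {0\<^sub>v d}" "m = d \<Longrightarrow> W = carrier_vec d"
proof -
  obtain m P Q where PQ: "m \<le> d" "P \<in> carrier_mat d d" "Q \<in> carrier_mat d d"
    "P * Q = 1\<^sub>m d" "Q * P = 1\<^sub>m d"
    and WQ: "\<And>v. v \<in> carrier_vec d \<Longrightarrow> v \<in> W \<longleftrightarrow> (\<forall>i<d. m \<le> i \<longrightarrow> (Q *\<^sub>v v) $ i = 0)"
    using subspace_adapted_basis[OF W] by blast
  define N where "N i = Q * M i * P" for i
  define A where "A i = mat m m (\<lambda>(a,b). N i $$ (a,b))" for i
  define X where "X i = mat m (d - m) (\<lambda>(a,b). N i $$ (a, b + m))" for i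
  define D where "D i = mat (d - m) (d - m) (\<lambda>(a,b). N i $$ (a + m, b + m))" for i
  define B where "B = mat d m (\<lambda>(a,b). P $$ (a,b))"
  define C where "C = mat m d (\<lambda>(a,b). Q $$ (a,b))"
  have car: "\<And>i. A i \<in> carrier_mat m m" "\<And>i. X i \<in> carrier_mat m (d - m)"
    "\<And>i. D i \<in> carrier_mat (d - m) (d - m)" "B \<in> carrier_mat d m" "C \<in> carrier_mat m d"
    by (auto simp: A_def X_def D_def B_def C_def)
  have N: "N i \<in> carrier_mat d d" if "i \<in> I" for i using M[OF that] PQ by (simp add: N_def)
  have QPv: "Q *\<^sub>v (P *\<^sub>v v) = v" "P *\<^sub>v (Q *\<^sub>v v) = v" if "v \<in> carrier_vec d" for v
    using that PQ by (auto simp: assoc_mult_mat_vec[symmetric, OF PQ(3,2) that] assoc_mult_mat_vec[symmetric, OF PQ(2,3) that])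
  have zero: "N i $$ (a,b) = 0" if i: "i \<in> I" and ab: "m \<le> a" "a < d" "b < m" for i a b
  proof -
    let ?e = "unit_vec d b :: 'k vec"
    have e: "?e \<in> carrier_vec d" by simp
    have "P *\<^sub>v ?e \<in> W"
      using WQ[of "P *\<^sub>v ?e"] PQ ab QPv(1)[OF e] by auto
    then have "M i *\<^sub>v (P *\<^sub>v ?e) \<in> W" by (rule inv[OF i])
    moreover have c: "M i *\<^sub>v (P *\<^sub>v ?e) \<in> carrier_vec d" using M[OF i] PQ by auto
    ultimately have "(Q *\<^sub>v (M i *\<^sub>v (P *\<^sub>v ?e))) $ a = 0" using WQ ab by blast
    moreover have "Q *\<^sub>v (M i *\<^sub>v (P *\<^sub>v ?e)) = N i *\<^sub>v ?e"
      using M[OF i] PQ by (simp add: N_def assoc_mult_mat_vec[of _ d d _ d])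
    ultimately show ?thesis using N[OF i] ab PQ(1)
      by (auto simp: scalar_prod_right_unit)
  qed
  have NB: "N i = four_block_mat (A i) (X i) (0\<^sub>m (d - m) m) (D i)" if i: "i \<in> I" for i
    by (rule eq_matI) (use N[OF i] PQ(1) zero[OF i] in \<open>auto simp: A_def X_def D_def\<close>)
  have MN: "M i = P * N i * Q" if i: "i \<in> I" for i
  proof -
    have "P * N i * Q = (P * Q) * M i * (P * Q)" unfolding N_def
      using PQ(2,3) M[OF i] by (simp add: assoc_mult_mat[of _ d d _ d _ d])
    then show ?thesis using PQ M[OF i] by simp
  qed
  have CB: "C * B = 1\<^sub>m m"
  proof (rule eq_matI)
    fix a b assume ab: "a < dim_row (1\<^sub>m m)" "b < dim_col (1\<^sub>m m)"
    have "(C * B) $$ (a,b) = (Q * P) $$ (a,b)"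
      using ab PQ(1-3) by (simp add: C_def B_def scalar_prod_def)
    then show "(C * B) $$ (a,b) = 1\<^sub>m m $$ (a,b)" using PQ ab by simp
  qed (use car in auto)
  have pad: "B *\<^sub>v u = P *\<^sub>v (u @\<^sub>v 0\<^sub>v (d - m))" if u: "u \<in> carrier_vec m" for u
  proof (rule eq_vecI)
    fix a assume "a < dim_vec (P *\<^sub>v (u @\<^sub>v 0\<^sub>v (d - m)))"
    then have a: "a < d" using PQ by simp
    have "(B *\<^sub>v u) $ a = (\<Sum>b<m. P $$ (a,b) * u $ b)"
      using a u by (simp add: B_def scalar_prod_def atLeast0LessThan)
    also have "\<dots> = (\<Sum>b<d. P $$ (a,b) * (u @\<^sub>v 0\<^sub>v (d - m)) $ b)"
      using PQ(1) u by (intro sum.mono_neutral_cong_left) auto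
    also have "\<dots> = (P *\<^sub>v (u @\<^sub>v 0\<^sub>v (d - m))) $ a"
      using a u PQ by (simp add: scalar_prod_def atLeast0LessThan)
    finally show "(B *\<^sub>v u) $ a = (P *\<^sub>v (u @\<^sub>v 0\<^sub>v (d - m))) $ a" .
  qed (use car PQ in auto)
  have WB: "W = (\<lambda>u. B *\<^sub>v u) ` carrier_vec m"
  proof (intro equalityI subsetI)
    fix w assume w: "w \<in> W"
    then have wc: "w \<in> carrier_vec d" using W by (auto simp: vec_subspace_def)
    define u where "u = vec m (\<lambda>i. (Q *\<^sub>v w) $ i)"
    have u: "u \<in> carrier_vec m" by (simp add: u_def)
    have "u @\<^sub>v 0\<^sub>v (d - m) = Q *\<^sub>v w"
      by (rule eq_vecI) (use WQ[OF wc] w PQ in \<open>auto simp: u_def\<close>)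
    then have "B *\<^sub>v u = w" unfolding pad[OF u] using QPv(2)[OF wc] by simp
    then show "w \<in> (\<lambda>u. B *\<^sub>v u) ` carrier_vec m" using u by blast
  next
    fix w assume "w \<in> (\<lambda>u. B *\<^sub>v u) ` carrier_vec m"
    then obtain u where u: "u \<in> carrier_vec m" "w = B *\<^sub>v u" by auto
    have uc: "u @\<^sub>v 0\<^sub>v (d - m) \<in> carrier_vec d"
      using u PQ(1) by (metis append_carrier_vec le_add_diff_inverse zero_carrier_vec)
    then have "Q *\<^sub>v w = u @\<^sub>v 0\<^sub>v (d - m)" unfolding u(2) pad[OF u(1)] by (rule QPv(1))
    then show "w \<in> W" using WQ[of w] u car PQ(1) by auto
  qed
  have MB: "M i * B = B * A i" if i: "i \<in> I" for i
  proof -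
    have "M i * P = P * N i" unfolding MN[OF i] using PQ N[OF i]
      by (simp add: assoc_mult_mat[of _ d d _ d _ d])
    then have e: "(M i * P) $$ (a,b) = (P * N i) $$ (a,b)" for a b by simp
    show ?thesis
    proof (rule eq_matI)
      fix a b assume "a < dim_row (B * A i)" "b < dim_col (B * A i)"
      then have ab: "a < d" "b < m" using car(4) car(1)[of i] by auto
      have "(M i * B) $$ (a,b) = (M i * P) $$ (a,b)"
        using ab M[OF i] PQ by (simp add: B_def scalar_prod_def)
      also have "\<dots> = (\<Sum>c<d. P $$ (a,c) * N i $$ (c,b))"
        unfolding e using ab PQ N[OF i] by (simp add: scalar_prod_def atLeast0LessThan)
      also have "\<dots> = (\<Sum>c<m. B $$ (a,c) * A i $$ (c,b))"
        using PQ(1) ab zero[OF i] by (intro sum.mono_neutral_cong_right) (auto simp: B_def A_def)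
      also have "\<dots> = (B * A i) $$ (a,b)"
        using ab car(4) car(1)[of i] by (simp add: scalar_prod_def atLeast0LessThan)
      finally show "(M i * B) $$ (a,b) = (B * A i) $$ (a,b)" .
    qed (use car(4) car(1)[of i] M[OF i] in auto)
  qed
  have m0: "W = {0\<^sub>v d}" if "m = 0"
  proof -
    have "v = 0\<^sub>v d" if "v \<in> W" for v
    proof -
      have v: "v \<in> carrier_vec d" using that W by (auto simp: vec_subspace_def)
      have "Q *\<^sub>v v = 0\<^sub>v d" using WQ[OF v] that \<open>m = 0\<close> PQ by (intro eq_vecI) auto
      then have "P *\<^sub>v 0\<^sub>v d = v" using QPv(2)[OF v] by simp
      then show ?thesis using PQ(2) by auto
    qed
    then show ?thesis using W by (auto simp: vec_subspace_def)
  qed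
  have md: "W = carrier_vec d" if "m = d"
    using WQ that W by (auto simp: vec_subspace_def)
  show thesis
    by (rule that[OF PQ car(1-3) _ car(4,5) CB WB MB m0 md]) (use MN NB in auto)
qed

definition mat_trace :: "'k :: comm_ring_1 mat \<Rightarrow> 'k" where
  "mat_trace A = (\<Sum>i<dim_row A. A $$ (i,i))"

lemma mat_trace_mult_comm:
  assumes "A \<in> carrier_mat n m" "B \<in> carrier_mat m n"
  shows "mat_trace (A * B) = mat_trace (B * A)"
proof -
  have "mat_trace (A * B) = (\<Sum>i<n. \<Sum>j<m. A $$ (i,j) * B $$ (j,i))"
    using assms by (simp add: mat_trace_def scalar_prod_def atLeast0LessThan)
  also have "\<dots> = (\<Sum>j<m. \<Sum>i<n. B $$ (j,i) * A $$ (i,j))"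
    by (subst sum.swap) (simp add: mult.commute)
  also have "\<dots> = mat_trace (B * A)"
    using assms by (simp add: mat_trace_def scalar_prod_def atLeast0LessThan)
  finally show ?thesis .
qed

lemma mat_trace_similar:
  assumes "P \<in> carrier_mat n n" "Q \<in> carrier_mat n n" "Q * P = 1\<^sub>m n" "A \<in> carrier_mat n n"
  shows "mat_trace (P * A * Q) = mat_trace A"
proof -
  have "mat_trace (P * A * Q) = mat_trace (Q * (P * A))"
    using assms by (intro mat_trace_mult_comm) auto
  also have "Q * (P * A) = (Q * P) * A"
    using assms(1,2,4) by (simp add: assoc_mult_mat[of _ n n _ n _ n])
  finally show ?thesis using assms by simp
qed

lemma mat_trace_four_block:
  assumes "A \<in> carrier_mat n n" "D \<in> carrier_mat m m"
  shows "mat_trace (four_block_mat A B C D) = mat_trace A + mat_trace D"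
proof -
  have "mat_trace (four_block_mat A B C D) =
    (\<Sum>i\<in>{..<n} \<union> {n..<n+m}. four_block_mat A B C D $$ (i,i))"
    using assms by (auto simp: mat_trace_def ivl_disj_un intro!: sum.cong)
  also have "\<dots> = (\<Sum>i<n. four_block_mat A B C D $$ (i,i)) + (\<Sum>i=n..<n+m. four_block_mat A B C D $$ (i,i))"
    by (intro sum.union_disjoint) auto
  also have "(\<Sum>i<n. four_block_mat A B C D $$ (i,i)) = mat_trace A"
    using assms by (auto simp: mat_trace_def)
  also have "(\<Sum>i=n..<n+m. four_block_mat A B C D $$ (i,i)) = (\<Sum>i<m. four_block_mat A B C D $$ (i+n,i+n))"
    by (intro sum.reindex_bij_witness[of _ "\<lambda>i. i + n" "\<lambda>i. i - n"]) auto
  also have "\<dots> = mat_trace D" using assms by (auto simp: mat_trace_def)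
  finally show ?thesis .
qed

lemma char_poly_four_block_upper:
  fixes A :: "'k :: field mat"
  assumes A: "A \<in> carrier_mat n n" and B: "B \<in> carrier_mat n m" and D: "D \<in> carrier_mat m m"
  shows "char_poly (four_block_mat A B (0\<^sub>m m n) D) = char_poly A * char_poly D"
proof -
  have "char_poly_matrix (four_block_mat A B (0\<^sub>m m n) D) =
    four_block_mat (char_poly_matrix A) (map_mat (\<lambda>a. [:- a:]) B) (0\<^sub>m m n) (char_poly_matrix D)"
    using assms by (intro eq_matI) (auto simp: char_poly_matrix_def)
  then show ?thesis unfolding char_poly_def
    using assms by (simp add: det_four_block_mat_lower_left_zero[of _ n _ m])
qed

lemma char_poly_similar':
  fixes A :: "'k :: field mat"
  assumes "P \<in> carrier_mat n n" "Q \<in> carrier_mat n n" "P * Q = 1\<^sub>m n" "Q * P = 1\<^sub>m n"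
    "A \<in> carrier_mat n n"
  shows "char_poly (P * A * Q) = char_poly A"
  by (rule char_poly_similar, rule similar_matI[of _ _ P Q n]) (use assms in auto)

section \<open>Eigenvalues over algebraically closed fields\<close>

definition alg_closed :: "'k :: field itself \<Rightarrow> bool" where
  "alg_closed _ \<longleftrightarrow> (\<forall>f :: 'k poly. degree f > 0 \<longrightarrow> (\<exists>x. poly f x = 0))"

lemma alg_closed_complex: "alg_closed TYPE(complex)"
  unfolding alg_closed_def
  using fundamental_theorem_of_algebra by (auto simp: constant_degree)

lemma exists_eigenvector:
  fixes A :: "'k :: field mat"
  assumes "alg_closed TYPE('k)" "A \<in> carrier_mat n n" "n > 0"
  obtains v a where "v \<in> carrier_vec n" "v \<noteq> 0\<^sub>v n" "A *\<^sub>v v = a \<cdot>\<^sub>v v"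
proof -
  have "degree (char_poly A) > 0" using degree_monic_char_poly[OF assms(2)] assms(3) by simp
  then obtain a where "poly (char_poly A) a = 0" using assms(1) by (auto simp: alg_closed_def)
  then have "eigenvalue A a" using eigenvalue_root_char_poly[OF assms(2)] by simp
  then show thesis using that assms(2) by (auto simp: eigenvalue_def eigenvector_def)
qed

lemma vec_subspace_eigenspace:
  fixes A :: "'k :: field mat"
  assumes A: "A \<in> carrier_mat n n"
  shows "vec_subspace n {v \<in> carrier_vec n. A *\<^sub>v v = a \<cdot>\<^sub>v v}"
  unfolding vec_subspace_def
proof (intro conjI ballI allI)
  show "0\<^sub>v n \<in> {v \<in> carrier_vec n. A *\<^sub>v v = a \<cdot>\<^sub>v v}" using A by auto
  fix v assume v: "v \<in> {v \<in> carrier_vec n. A *\<^sub>v v = a \<cdot>\<^sub>v v}"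
  show "c \<cdot>\<^sub>v v \<in> {v \<in> carrier_vec n. A *\<^sub>v v = a \<cdot>\<^sub>v v}" for c
    using v A by (auto simp: mult_mat_vec smult_smult_assoc mult.commute)
  fix w assume w: "w \<in> {v \<in> carrier_vec n. A *\<^sub>v v = a \<cdot>\<^sub>v v}"
  show "v + w \<in> {v \<in> carrier_vec n. A *\<^sub>v v = a \<cdot>\<^sub>v v}"
    using v w A by (auto simp: mult_add_distrib_mat_vec smult_add_distrib_vec)
qed auto

lemma similar_pow:
  fixes A :: "'k :: field mat"
  assumes "P \<in> carrier_mat n n" "Q \<in> carrier_mat n n" "P * Q = 1\<^sub>m n" "Q * P = 1\<^sub>m n"
    "N \<in> carrier_mat n n"
  shows "(P * N * Q) ^\<^sub>m q = P * N ^\<^sub>m q * Q"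
proof -
  have "similar_mat_wit (P * N * Q) N P Q"
    by (rule similar_mat_witI[of P Q n]) (use assms in auto)
  then show ?thesis by (rule similar_mat_wit_pow_id)
qed

lemma four_block_upper_pow:
  fixes A :: "'k :: field mat"
  assumes A: "A \<in> carrier_mat n n" and X: "X \<in> carrier_mat n m" and D: "D \<in> carrier_mat m m"
  obtains Y where "Y \<in> carrier_mat n m"
    "(four_block_mat A X (0\<^sub>m m n) D) ^\<^sub>m q = four_block_mat (A ^\<^sub>m q) Y (0\<^sub>m m n) (D ^\<^sub>m q)"
proof -
  have "\<exists>Y\<in>carrier_mat n m.
    (four_block_mat A X (0\<^sub>m m n) D) ^\<^sub>m q = four_block_mat (A ^\<^sub>m q) Y (0\<^sub>m m n) (D ^\<^sub>m q)"
  proof (induction q)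
    case 0
    show ?case using A D by (intro bexI[of _ "0\<^sub>m n m"]) auto
  next
    case (Suc q)
    then obtain Y where Y: "Y \<in> carrier_mat n m"
      "(four_block_mat A X (0\<^sub>m m n) D) ^\<^sub>m q = four_block_mat (A ^\<^sub>m q) Y (0\<^sub>m m n) (D ^\<^sub>m q)"
      by blast
    show ?case
      by (rule bexI[of _ "A ^\<^sub>m q * X + Y * D"])
        (use A X D Y in \<open>auto simp: mult_four_block_mat[of _ n n _ m _ m _ _ n _ m] left_mult_zero_mat[of _ n n] right_mult_zero_mat[of _ m m]\<close>)
  qed
  then show thesis using that by blast
qed

text \<open>Triangularisation, by induction on the degree: an eigenspace is invariant, and the matrix acts on it as a
  scalar, so the block form of \<open>invariant_block_form\<close> has a scalar block and a smaller one. The third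
  clause gives the eigenvalues of \<open>- M\<close>, which occur for a representation twisted by a sign.\<close>

lemma eigenvalue_list:
  fixes M :: "'k :: field mat"
  assumes ac: "alg_closed TYPE('k)" and "M \<in> carrier_mat d d"
  obtains as where "char_poly M = (\<Prod>a\<leftarrow>as. [:- a, 1:])"
    "\<And>q. mat_trace (M ^\<^sub>m q) = (\<Sum>a\<leftarrow>as. a ^ q)"
    "\<And>c. char_poly (c \<cdot>\<^sub>m M) = (\<Prod>a\<leftarrow>as. [:- (c * a), 1:])"
proof -
  have "\<exists>as. (\<forall>c. char_poly (c \<cdot>\<^sub>m M) = (\<Prod>a\<leftarrow>as. [:- (c * a), 1:])) \<and>
    (\<forall>q. mat_trace (M ^\<^sub>m q) = (\<Sum>a\<leftarrow>as. a ^ q))"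
    using assms(2)
  proof (induction d arbitrary: M rule: less_induct)
    case (less d)
    note M = less.prems
    show ?case
    proof (cases "d = 0")
      case True
      have "char_poly (c \<cdot>\<^sub>m M) = 1" for c
      proof -
        have c: "c \<cdot>\<^sub>m M \<in> carrier_mat d d" using M by simp
        have "upper_triangular (c \<cdot>\<^sub>m M)" using M True by (auto simp: upper_triangular_def)
        then have "char_poly (c \<cdot>\<^sub>m M) = (\<Prod>a\<leftarrow>diag_mat (c \<cdot>\<^sub>m M). [:- a, 1:])"
          by (rule char_poly_upper_triangular[OF c])
        then show ?thesis using M True by (simp add: diag_mat_def)
      qed
      then show ?thesis using M True by (intro exI[of _ "[]"]) (auto simp: mat_trace_def)
    next
      case False
      then obtain v a where v: "v \<in> carrier_vec d" "v \<noteq> 0\<^sub>v d" "M *\<^sub>v v = a \<cdot>\<^sub>v v"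
        using exists_eigenvector[OF ac M] by blast
      define W where "W = {v \<in> carrier_vec d. M *\<^sub>v v = a \<cdot>\<^sub>v v}"
      have W: "vec_subspace d W" unfolding W_def by (rule vec_subspace_eigenspace[OF M])
      have inv: "M *\<^sub>v w \<in> W" if "w \<in> W" for w
      proof -
        have "M *\<^sub>v w = a \<cdot>\<^sub>v w" using that by (simp add: W_def)
        then show ?thesis using vec_subspaceD(4)[OF W that] by simp
      qed
      obtain m P Q A X D B C where *: "m \<le> d" "P \<in> carrier_mat d d" "Q \<in> carrier_mat d d"
        "P * Q = 1\<^sub>m d" "Q * P = 1\<^sub>m d"
        "A () \<in> carrier_mat m m" "X () \<in> carrier_mat m (d - m)"
        "D () \<in> carrier_mat (d - m) (d - m)"
        "M = P * four_block_mat (A ()) (X ()) (0\<^sub>m (d - m) m) (D ()) * Q"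
        and B: "B \<in> carrier_mat d m" "C \<in> carrier_mat m d" "C * B = 1\<^sub>m m"
        "W = (\<lambda>u. B *\<^sub>v u) ` carrier_vec m" "M * B = B * A ()" "m = 0 \<Longrightarrow> W = {0\<^sub>v d}"
        by (rule invariant_block_form[OF W, of "{()}" "\<lambda>_. M"]) (use M inv in auto)
      have m: "m > 0" using B(6) v by (auto simp: W_def)
      have A_eq: "A () = a \<cdot>\<^sub>m 1\<^sub>m m"
      proof (rule eq_matI)
        fix i j assume ij: "i < dim_row (a \<cdot>\<^sub>m 1\<^sub>m m)" "j < dim_col (a \<cdot>\<^sub>m 1\<^sub>m m)"
        let ?e = "unit_vec m j :: 'k vec"
        have "B *\<^sub>v ?e \<in> W" unfolding B(4) by auto
        then have e: "M *\<^sub>v (B *\<^sub>v ?e) = a \<cdot>\<^sub>v (B *\<^sub>v ?e)" by (simp add: W_def)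
        have "A () *\<^sub>v ?e = (C * B) *\<^sub>v (A () *\<^sub>v ?e)" using B(3) *(6) by simp
        also have "\<dots> = C *\<^sub>v ((B * A ()) *\<^sub>v ?e)" using B(1,2) *(6)
          by (simp add: assoc_mult_mat_vec[of _ _ m _ _])
        also have "\<dots> = C *\<^sub>v (M *\<^sub>v (B *\<^sub>v ?e))" unfolding B(5)[symmetric] using B(1,2) M
          by (simp add: assoc_mult_mat_vec[of M d d B m])
        also have "\<dots> = a \<cdot>\<^sub>v ((C * B) *\<^sub>v ?e)" unfolding e using B(1,2)
          by (simp add: mult_mat_vec[of C m d] assoc_mult_mat_vec[of C m d B m])
        also have "\<dots> = a \<cdot>\<^sub>v ?e" using B(3) by simp
        finally have "(A () *\<^sub>v ?e) $ i = (a \<cdot>\<^sub>v ?e) $ i" by simp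
        then show "A () $$ (i,j) = (a \<cdot>\<^sub>m 1\<^sub>m m) $$ (i,j)" using ij *(6)
          by (auto simp: scalar_prod_right_unit)
      qed (use *(6) in auto)
      have cA: "char_poly (c \<cdot>\<^sub>m A ()) = (\<Prod>b\<leftarrow>replicate m a. [:- (c * b), 1:])" for c
      proof -
        have e: "c \<cdot>\<^sub>m A () = (c * a) \<cdot>\<^sub>m 1\<^sub>m m" unfolding A_eq by (intro eq_matI) auto
        have "upper_triangular ((c * a) \<cdot>\<^sub>m 1\<^sub>m m)" by auto
        moreover have "diag_mat ((c * a) \<cdot>\<^sub>m 1\<^sub>m m) = replicate m (c * a)"
          by (rule nth_equalityI) (auto simp: diag_mat_def)
        ultimately show ?thesis unfolding e
          using char_poly_upper_triangular[of "(c * a) \<cdot>\<^sub>m 1\<^sub>m m" m] by simp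
      qed
      have tA: "mat_trace (A () ^\<^sub>m q) = (\<Sum>b\<leftarrow>replicate m a. b ^ q)" for q
      proof -
        have "A () ^\<^sub>m q = a ^ q \<cdot>\<^sub>m 1\<^sub>m m" unfolding A_eq
          by (induction q) (auto simp: mult_smult_distrib[of _ m m] mult.commute)
        then show ?thesis by (simp add: mat_trace_def sum_list_replicate)
      qed
      have "d - m < d" using m False by simp
      from less.IH[OF this *(8)] obtain bs where bs: "\<And>c. char_poly (c \<cdot>\<^sub>m D ()) = (\<Prod>a\<leftarrow>bs. [:- (c * a), 1:])"
        "\<And>q. mat_trace (D () ^\<^sub>m q) = (\<Sum>a\<leftarrow>bs. a ^ q)" by blast
      let ?F = "four_block_mat (A ()) (X ()) (0\<^sub>m (d - m) m) (D ())"
      have F: "?F \<in> carrier_mat d d" using *(1,6,8) four_block_carrier_mat[OF *(6,8)] by simp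
      have c: "char_poly (c \<cdot>\<^sub>m M) = (\<Prod>a\<leftarrow>replicate m a @ bs. [:- (c * a), 1:])" for c
      proof -
        have PF: "P * ?F \<in> carrier_mat d d" using *(2) F by simp
        have "c \<cdot>\<^sub>m M = c \<cdot>\<^sub>m (P * ?F * Q)" by (subst *(9)) (rule refl)
        also have "\<dots> = P * (c \<cdot>\<^sub>m ?F) * Q"
          unfolding mult_smult_distrib[OF *(2) F] mult_smult_assoc_mat[OF PF *(3)] ..
        also have "char_poly \<dots> = char_poly (c \<cdot>\<^sub>m ?F)" by (rule char_poly_similar'[OF *(2-5)]) (use F in simp)
        also have "c \<cdot>\<^sub>m ?F = four_block_mat (c \<cdot>\<^sub>m A ()) (c \<cdot>\<^sub>m X ()) (0\<^sub>m (d - m) m) (c \<cdot>\<^sub>m D ())"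
          using smult_four_block_mat[OF *(6,7) zero_carrier_mat *(8)] by simp
        also have "char_poly \<dots> = (\<Prod>a\<leftarrow>replicate m a @ bs. [:- (c * a), 1:])"
          by (subst char_poly_four_block_upper[of _ m _ "d - m"]) (use *(6-8) in \<open>auto simp: cA bs\<close>)
        finally show ?thesis .
      qed
      have t: "mat_trace (M ^\<^sub>m q) = (\<Sum>a\<leftarrow>replicate m a @ bs. a ^ q)" for q
      proof -
        obtain Y where Y: "Y \<in> carrier_mat m (d - m)"
          "?F ^\<^sub>m q = four_block_mat (A () ^\<^sub>m q) Y (0\<^sub>m (d - m) m) (D () ^\<^sub>m q)"
          by (rule four_block_upper_pow[OF *(6-8)])
        have "mat_trace (M ^\<^sub>m q) = mat_trace (P * ?F ^\<^sub>m q * Q)"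
          by (subst *(9)) (simp add: similar_pow[OF *(2-5) F])
        also have "\<dots> = mat_trace (?F ^\<^sub>m q)"
          by (rule mat_trace_similar[OF *(2,3,5)]) (use F in auto)
        also have "\<dots> = mat_trace (A () ^\<^sub>m q) + mat_trace (D () ^\<^sub>m q)"
          unfolding Y(2) by (rule mat_trace_four_block) (use *(6,8) in auto)
        finally show ?thesis unfolding tA bs(2) by simp
      qed
      from c t show ?thesis by blast
    qed
  qed
  then obtain as where as: "\<And>c. char_poly (c \<cdot>\<^sub>m M) = (\<Prod>a\<leftarrow>as. [:- (c * a), 1:])"
    "\<And>q. mat_trace (M ^\<^sub>m q) = (\<Sum>a\<leftarrow>as. a ^ q)" by blast
  have "1 \<cdot>\<^sub>m M = M" by (rule eq_matI) auto
  then have "char_poly M = (\<Prod>a\<leftarrow>as. [:- a, 1:])" using as(1)[of 1] by simp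
  then show thesis using that as by blast
qed

section \<open>Representations\<close>

lemma representation_iff:
  fixes R :: "'g \<Rightarrow> 'k :: field mat"
  assumes "group G"
  shows "representation G d R \<longleftrightarrow> (\<forall>g\<in>carrier G. R g \<in> carrier_mat d d) \<and>
    R \<one>\<^bsub>G\<^esub> = 1\<^sub>m d \<and> (\<forall>g\<in>carrier G. \<forall>h\<in>carrier G. R (g \<otimes>\<^bsub>G\<^esub> h) = R g * R h)"
proof -
  interpret group G by fact
  interpret r: ring "ring_mat TYPE('k) d ()" by (rule ring_mat)
  have U: "group (units_of (ring_mat TYPE('k) d ()))" by (rule r.units_group)
  show ?thesis
  proof
    assume "representation G d R"
    then have h: "R \<in> hom G (units_of (ring_mat TYPE('k) d ()))" by (simp add: representation_def)
    have "R \<one>\<^bsub>G\<^esub> = 1\<^sub>m d" using hom_one[OF h is_group U]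
      by (simp add: units_of_one ring_mat_simps)
    then show "(\<forall>g\<in>carrier G. R g \<in> carrier_mat d d) \<and>
      R \<one>\<^bsub>G\<^esub> = 1\<^sub>m d \<and> (\<forall>g\<in>carrier G. \<forall>h\<in>carrier G. R (g \<otimes>\<^bsub>G\<^esub> h) = R g * R h)"
      using h by (auto simp: hom_def units_of_def Units_def ring_mat_simps)
  next
    assume a: "(\<forall>g\<in>carrier G. R g \<in> carrier_mat d d) \<and>
      R \<one>\<^bsub>G\<^esub> = 1\<^sub>m d \<and> (\<forall>g\<in>carrier G. \<forall>h\<in>carrier G. R (g \<otimes>\<^bsub>G\<^esub> h) = R g * R h)"
    have "R g \<in> Units (ring_mat TYPE('k) d ())" if g: "g \<in> carrier G" for g
    proof -
      have "R (inv\<^bsub>G\<^esub> g) * R g = 1\<^sub>m d" "R g * R (inv\<^bsub>G\<^esub> g) = 1\<^sub>m d"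
        using a g by (metis inv_closed l_inv, metis inv_closed r_inv)
      then show ?thesis using a g unfolding Units_def ring_mat_simps
        by (auto intro!: bexI[of _ "R (inv\<^bsub>G\<^esub> g)"])
    qed
    then show "representation G d R" using a
      unfolding representation_def hom_def units_of_def by (auto simp: ring_mat_simps)
  qed
qed

lemma representationD:
  fixes R :: "'g \<Rightarrow> 'k :: field mat"
  assumes "group G" "representation G d R"
  shows "\<And>g. g \<in> carrier G \<Longrightarrow> R g \<in> carrier_mat d d" "R \<one>\<^bsub>G\<^esub> = 1\<^sub>m d"
    "\<And>g h. g \<in> carrier G \<Longrightarrow> h \<in> carrier G \<Longrightarrow> R (g \<otimes>\<^bsub>G\<^esub> h) = R g * R h"
  using assms(2) unfolding representation_iff[OF assms(1)] by auto

lemma representation_inv: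
  fixes R :: "'g \<Rightarrow> 'k :: field mat"
  assumes "group G" "representation G d R" "g \<in> carrier G"
  shows "R (inv\<^bsub>G\<^esub> g) * R g = 1\<^sub>m d" "R g * R (inv\<^bsub>G\<^esub> g) = 1\<^sub>m d"
  using representationD[OF assms(1,2)] assms(1,3)
  by (metis group.inv_closed group.l_inv, metis group.inv_closed group.r_inv)

lemma representation_pow:
  fixes R :: "'g \<Rightarrow> 'k :: field mat"
  assumes "group G" "representation G d R" "g \<in> carrier G"
  shows "R (g [^]\<^bsub>G\<^esub> (q::nat)) = R g ^\<^sub>m q"
proof -
  interpret group G by fact
  note D = representationD[OF assms(1,2)]
  show ?thesis using assms(3) by (induction q) (auto simp: D(2,3) dest: D(1))
qed

definition invariant_under :: "('g, 'b) monoid_scheme \<Rightarrow> ('g \<Rightarrow> 'k :: field mat) \<Rightarrow> 'k vec set \<Rightarrow> bool" where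
  "invariant_under G R W \<longleftrightarrow> (\<forall>g\<in>carrier G. \<forall>v\<in>W. R g *\<^sub>v v \<in> W)"

lemma irreducible_iff:
  fixes R :: "'g \<Rightarrow> 'k :: field mat"
  shows "irreducible_representation G d R \<longleftrightarrow> representation G d R \<and> 0 < d \<and>
    (\<forall>W. vec_subspace d W \<and> invariant_under G R W \<longrightarrow> W = {0\<^sub>v d} \<or> W = carrier_vec d)"
  unfolding irreducible_representation_def vec_subspace_iff invariant_under_def by blast

lemma irreducibleD:
  fixes R :: "'g \<Rightarrow> 'k :: field mat"
  assumes "irreducible_representation G d R"
  shows "representation G d R" "0 < d"
    "\<And>W. vec_subspace d W \<Longrightarrow> invariant_under G R W \<Longrightarrow> W = {0\<^sub>v d} \<or> W = carrier_vec d"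
  using assms unfolding irreducible_iff by auto

text \<open>The diagonal blocks of a product of block triangular matrices are the products of the diagonal blocks, so
  each of the two blocks is a representation, of smaller degree because \<open>W\<close> is proper.\<close>

lemma reducible_block_form:
  fixes R :: "'g \<Rightarrow> 'k :: field mat"
  assumes G: "group G" and R: "representation G d R"
    and W: "vec_subspace d W" "invariant_under G R W" "W \<noteq> {0\<^sub>v d}" "W \<noteq> carrier_vec d"
  obtains m P Q A X D B C where "0 < m" "m < d" "P \<in> carrier_mat d d" "Q \<in> carrier_mat d d"
    "P * Q = 1\<^sub>m d" "Q * P = 1\<^sub>m d"
    "representation G m A" "representation G (d - m) D" "\<And>g. X g \<in> carrier_mat m (d - m)"
    "\<And>g. g \<in> carrier G \<Longrightarrow> R g = P * four_block_mat (A g) (X g) (0\<^sub>m (d - m) m) (D g) * Q"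
    "B \<in> carrier_mat d m" "C \<in> carrier_mat m d" "C * B = 1\<^sub>m m"
    "\<And>g. g \<in> carrier G \<Longrightarrow> R g * B = B * A g"
proof -
  interpret group G by fact
  note RD = representationD[OF G R]
  have inv: "R g *\<^sub>v v \<in> W" if "g \<in> carrier G" "v \<in> W" for g v
    using W(2) that by (auto simp: invariant_under_def)
  obtain m P Q A X D B C where PQ: "m \<le> d" "P \<in> carrier_mat d d" "Q \<in> carrier_mat d d"
    "P * Q = 1\<^sub>m d" "Q * P = 1\<^sub>m d"
    and blk: "\<And>i. A i \<in> carrier_mat m m" "\<And>i. X i \<in> carrier_mat m (d - m)"
    "\<And>i. D i \<in> carrier_mat (d - m) (d - m)"
    and R_eq: "\<And>i. i \<in> carrier G \<Longrightarrow> R i = P * four_block_mat (A i) (X i) (0\<^sub>m (d - m) m) (D i) * Q"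
    and BC: "B \<in> carrier_mat d m" "C \<in> carrier_mat m d" "C * B = 1\<^sub>m m"
    and "W = (\<lambda>u. B *\<^sub>v u) ` carrier_vec m"
    and RB: "\<And>i. i \<in> carrier G \<Longrightarrow> R i * B = B * A i"
    and W': "m = 0 \<Longrightarrow> W = {0\<^sub>v d}" "m = d \<Longrightarrow> W = carrier_vec d"
  proof (rule invariant_block_form[OF W(1), of "carrier G" R], goal_cases)
    case (3 m P Q A X D B C)
    show ?case by (rule that[of m P Q A X D B C]) (fact 3)+
  qed (use RD(1) inv in auto)
  define F where "F g = four_block_mat (A g) (X g) (0\<^sub>m (d - m) m) (D g)" for g
  have Fc: "F g \<in> carrier_mat d d" for g
    using four_block_carrier_mat[OF blk(1)[of g] blk(3)[of g]] PQ(1) by (simp add: F_def)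
  have FR: "F g = Q * R g * P" if "g \<in> carrier G" for g
  proof -
    have "Q * R g * P = (Q * P) * F g * (Q * P)" unfolding R_eq[OF that] F_def[symmetric]
      using PQ(2,3) Fc[of g] by (simp add: assoc_mult_mat[of _ d d _ d _ d])
    then show ?thesis using PQ(5) Fc[of g] by simp
  qed
  have F1: "F \<one>\<^bsub>G\<^esub> = 1\<^sub>m d" using FR[of "\<one>\<^bsub>G\<^esub>"] RD(2) PQ by simp
  have Fm: "F (g \<otimes>\<^bsub>G\<^esub> h) = F g * F h" if g: "g \<in> carrier G" "h \<in> carrier G" for g h
  proof -
    have "F g * F h = Q * R g * (P * Q) * R h * P" unfolding FR[OF g(1)] FR[OF g(2)]
      using PQ(2,3) RD(1)[OF g(1)] RD(1)[OF g(2)] by (simp add: assoc_mult_mat[of _ d d _ d _ d])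
    also have "\<dots> = Q * (R g * R h) * P"
      using PQ RD(1)[OF g(1)] RD(1)[OF g(2)] by (simp add: assoc_mult_mat[of _ d d _ d _ d])
    finally show ?thesis using FR[of "g \<otimes>\<^bsub>G\<^esub> h"] RD(3) g by simp
  qed
  have Fm': "F g * F h = four_block_mat (A g * A h) (A g * X h + X g * D h) (0\<^sub>m (d - m) m) (D g * D h)" for g h
    unfolding F_def
    using mult_four_block_mat[OF blk(1,2) zero_carrier_mat blk(3) blk(1,2) zero_carrier_mat blk(3), of g g g h h h]
      blk(1)[of g] blk(1)[of h] blk(2)[of g] blk(2)[of h] blk(3)[of g] blk(3)[of h] by simp
  have blockeq: "A1 = A2 \<and> D1 = D2"
    if e: "four_block_mat A1 X1 (0\<^sub>m (d - m) m) D1 = four_block_mat A2 X2 (0\<^sub>m (d - m) m) D2"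
      and c: "A1 \<in> carrier_mat m m" "A2 \<in> carrier_mat m m"
        "D1 \<in> carrier_mat (d - m) (d - m)" "D2 \<in> carrier_mat (d - m) (d - m)" for A1 A2 X1 X2 D1 D2 :: "'k mat"
  proof
    have ij: "four_block_mat A1 X1 (0\<^sub>m (d - m) m) D1 $$ (i,j) = four_block_mat A2 X2 (0\<^sub>m (d - m) m) D2 $$ (i,j)" for i j
      using e by simp
    show "A1 = A2"
    proof (rule eq_matI)
      fix i j assume "i < dim_row A2" "j < dim_col A2"
      then show "A1 $$ (i,j) = A2 $$ (i,j)" using ij[of i j] c by simp
    qed (use c in auto)
    show "D1 = D2"
    proof (rule eq_matI)
      fix i j assume "i < dim_row D2" "j < dim_col D2"
      then show "D1 $$ (i,j) = D2 $$ (i,j)" using ij[of "i + m" "j + m"] c by simp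
    qed (use c in auto)
  qed
  have one: "A \<one>\<^bsub>G\<^esub> = 1\<^sub>m m \<and> D \<one>\<^bsub>G\<^esub> = 1\<^sub>m (d - m)"
  proof (rule blockeq)
    have "(1\<^sub>m d :: 'k mat) = four_block_mat (1\<^sub>m m) (0\<^sub>m m (d - m)) (0\<^sub>m (d - m) m) (1\<^sub>m (d - m))"
      using PQ(1) by simp
    then show "four_block_mat (A \<one>\<^bsub>G\<^esub>) (X \<one>\<^bsub>G\<^esub>) (0\<^sub>m (d - m) m) (D \<one>\<^bsub>G\<^esub>) =
      four_block_mat (1\<^sub>m m) (0\<^sub>m m (d - m)) (0\<^sub>m (d - m) m) (1\<^sub>m (d - m))"
      using F1 by (simp add: F_def)
  qed (use blk in auto)
  have mult: "A (g \<otimes>\<^bsub>G\<^esub> h) = A g * A h \<and> D (g \<otimes>\<^bsub>G\<^esub> h) = D g * D h"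
    if g: "g \<in> carrier G" "h \<in> carrier G" for g h
  proof (rule blockeq)
    show "four_block_mat (A (g \<otimes>\<^bsub>G\<^esub> h)) (X (g \<otimes>\<^bsub>G\<^esub> h)) (0\<^sub>m (d - m) m) (D (g \<otimes>\<^bsub>G\<^esub> h)) =
      four_block_mat (A g * A h) (A g * X h + X g * D h) (0\<^sub>m (d - m) m) (D g * D h)"
      using Fm[OF g] Fm'[of g h] by (simp add: F_def)
  qed (use blk(1)[of g] blk(1)[of h] blk(3)[of g] blk(3)[of h] blk(1)[of "g \<otimes>\<^bsub>G\<^esub> h"] blk(3)[of "g \<otimes>\<^bsub>G\<^esub> h"] in auto)
  have "m \<noteq> 0" "m \<noteq> d" using W' W by auto
  then have m: "0 < m" "m < d" using PQ(1) by auto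
  have "representation G m A" "representation G (d - m) D"
    using blk one mult by (auto simp: representation_iff[OF G])
  then show thesis using that[OF m PQ(2-5) _ _ blk(2) R_eq BC RB] by blast
qed

lemma intertwiner_mult:
  fixes R :: "'k :: field mat"
  assumes c: "R \<in> carrier_mat d d" "B \<in> carrier_mat d m" "A \<in> carrier_mat m m"
      "B' \<in> carrier_mat m m'" "A' \<in> carrier_mat m' m'"
    and e: "R * B = B * A" "A * B' = B' * A'"
  shows "R * (B * B') = (B * B') * A'"
proof -
  have "R * (B * B') = (R * B) * B'" by (rule assoc_mult_mat[symmetric, OF c(1,2,4)])
  also have "\<dots> = B * (A * B')" unfolding e(1) by (rule assoc_mult_mat[OF c(2-4)])
  also have "\<dots> = (B * B') * A'" unfolding e(2) by (rule assoc_mult_mat[symmetric, OF c(2,4,5)])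
  finally show ?thesis .
qed

text \<open>Induction on the degree: an invariant subspace that is proper and nonzero contains an irreducible
  subrepresentation. The matrix \<open>B\<close> is the inclusion, and its left inverse \<open>C\<close> expresses that
  it is injective.\<close>

lemma irreducible_subrepresentation:
  fixes R :: "'g \<Rightarrow> 'k :: field mat"
  assumes G: "group G" and "representation G d R" "d > 0"
  obtains m A B C where "irreducible_representation G m A" "B \<in> carrier_mat d m" "C \<in> carrier_mat m d"
    "C * B = 1\<^sub>m m" "\<And>g. g \<in> carrier G \<Longrightarrow> R g * B = B * A g"
proof -
  have "\<exists>m A B C. irreducible_representation G m A \<and> B \<in> carrier_mat d m \<and> C \<in> carrier_mat m d \<and>
    C * B = 1\<^sub>m m \<and> (\<forall>g\<in>carrier G. R g * B = B * A g)"
    using assms(2,3)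
  proof (induction d arbitrary: R rule: less_induct)
    case (less d)
    note RD = representationD[OF G less.prems(1)]
    show ?case
    proof (cases "irreducible_representation G d R")
      case True
      then show ?thesis
        by (intro exI[of _ d] exI[of _ R] exI[of _ "1\<^sub>m d"]) (auto dest!: RD(1))
    next
      case False
      then obtain W where W: "vec_subspace d W" "invariant_under G R W" "W \<noteq> {0\<^sub>v d}" "W \<noteq> carrier_vec d"
        using less.prems unfolding irreducible_iff by blast
      obtain m A B C where m: "0 < m" "m < d" and A: "representation G m A"
        and B: "B \<in> carrier_mat d m" "C \<in> carrier_mat m d" "C * B = 1\<^sub>m m"
        "\<And>g. g \<in> carrier G \<Longrightarrow> R g * B = B * A g"
        by (rule reducible_block_form[OF G less.prems(1) W]) blast
      from less.IH[OF m(2) A m(1)] obtain m' A' B' C' where IH: "irreducible_representation G m' A'"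
        "B' \<in> carrier_mat m m'" "C' \<in> carrier_mat m' m" "C' * B' = 1\<^sub>m m'"
        "\<And>g. g \<in> carrier G \<Longrightarrow> A g * B' = B' * A' g" by blast
      have "(C' * C) * (B * B') = C' * (C * (B * B'))"
        by (rule assoc_mult_mat) (use B(1,2) IH(2,3) in auto)
      also have "C * (B * B') = (C * B) * B'"
        by (rule assoc_mult_mat[symmetric]) (use B(1,2) IH(2,3) in auto)
      also have "C' * ((C * B) * B') = C' * (C * B) * B'"
        by (rule assoc_mult_mat[symmetric]) (use B IH(2,3) in auto)
      finally have "(C' * C) * (B * B') = C' * (C * B) * B'" .
      then have 1: "(C' * C) * (B * B') = 1\<^sub>m m'" using B(3) IH(2,3,4) by simp
      have 2: "R g * (B * B') = B * B' * A' g" if g: "g \<in> carrier G" for g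
      proof -
        have "A g \<in> carrier_mat m m" "A' g \<in> carrier_mat m' m'"
          using representationD(1)[OF G A g] representationD(1)[OF G irreducibleD(1)[OF IH(1)] g] .
        then show ?thesis
          using intertwiner_mult[OF RD(1)[OF g] B(1) _ IH(2) _ B(4)[OF g] IH(5)[OF g]] by simp
      qed
      show ?thesis
        by (intro exI[of _ m'] exI[of _ A'] exI[of _ "B * B'"] exI[of _ "C' * C"])
          (use 1 2 IH B in auto)
    qed
  qed
  then show thesis using that by blast
qed

text \<open>Traces are additive on block triangular matrices, so the factors of a composition series account for the
  trace of a representation.\<close>

lemma composition_factors:
  fixes R :: "'g \<Rightarrow> 'k :: field mat"
  assumes G: "group G" and "representation G d R"
  obtains Rs where "\<And>S. S \<in> set Rs \<Longrightarrow> \<exists>m. irreducible_representation G m S"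
    "\<And>g. g \<in> carrier G \<Longrightarrow> mat_trace (R g) = (\<Sum>S\<leftarrow>Rs. mat_trace (S g))"
proof -
  have "\<exists>Rs. (\<forall>S\<in>set Rs. \<exists>m. irreducible_representation G m S) \<and>
    (\<forall>g\<in>carrier G. mat_trace (R g) = (\<Sum>S\<leftarrow>Rs. mat_trace (S g)))"
    using assms(2)
  proof (induction d arbitrary: R rule: less_induct)
    case (less d)
    note RD = representationD[OF G less.prems(1)]
    consider "d = 0" | "irreducible_representation G d R" | "d > 0" "\<not> irreducible_representation G d R"
      by blast
    then show ?case
    proof cases
      case 1
      then have "mat_trace (R g) = 0" if "g \<in> carrier G" for g
        using RD(1)[OF that] by (auto simp: mat_trace_def)
      then show ?thesis by (intro exI[of _ "[]"]) auto
    next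
      case 2
      then show ?thesis by (intro exI[of _ "[R]"]) auto
    next
      case 3
      then obtain W where W: "vec_subspace d W" "invariant_under G R W" "W \<noteq> {0\<^sub>v d}" "W \<noteq> carrier_vec d"
        using less.prems unfolding irreducible_iff by blast
      obtain m P Q A X D where m: "0 < m" "m < d" and PQ: "P \<in> carrier_mat d d" "Q \<in> carrier_mat d d"
        "P * Q = 1\<^sub>m d" "Q * P = 1\<^sub>m d"
        and AD: "representation G m A" "representation G (d - m) D"
        and R_eq: "\<And>g. g \<in> carrier G \<Longrightarrow> R g = P * four_block_mat (A g) (X g) (0\<^sub>m (d - m) m) (D g) * Q"
        by (rule reducible_block_form[OF G less.prems(1) W]) blast
      from less.IH[OF m(2) AD(1)] obtain As where As: "\<forall>S\<in>set As. \<exists>m. irreducible_representation G m S"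
        "\<forall>g\<in>carrier G. mat_trace (A g) = (\<Sum>S\<leftarrow>As. mat_trace (S g))" by blast
      from less.IH[OF _ AD(2)] m obtain Ds where Ds: "\<forall>S\<in>set Ds. \<exists>m. irreducible_representation G m S"
        "\<forall>g\<in>carrier G. mat_trace (D g) = (\<Sum>S\<leftarrow>Ds. mat_trace (S g))" by auto
      have "mat_trace (R g) = mat_trace (A g) + mat_trace (D g)" if g: "g \<in> carrier G" for g
      proof -
        note c = representationD(1)[OF G AD(1) g] representationD(1)[OF G AD(2) g]
        have F: "four_block_mat (A g) (X g) (0\<^sub>m (d - m) m) (D g) \<in> carrier_mat d d"
          using four_block_carrier_mat[OF c] m by simp
        show ?thesis unfolding R_eq[OF g] mat_trace_similar[OF PQ(1,2,4) F]
          by (rule mat_trace_four_block[OF c])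
      qed
      then show ?thesis using As Ds by (intro exI[of _ "As @ Ds"]) auto
    qed
  qed
  then show thesis using that by blast
qed

section \<open>Schur's lemma and linear independence of matrix coefficients\<close>

lemma mult_mat_vec_unit:
  fixes A :: "'k :: field mat"
  assumes "A \<in> carrier_mat n m" "j < m"
  shows "A *\<^sub>v unit_vec m j = col A j"
  using assms by (intro eq_vecI) (auto simp: scalar_prod_right_unit)

lemma mult_mat_vec_zero:
  fixes A :: "'k :: field mat"
  assumes "A \<in> carrier_mat n m"
  shows "A *\<^sub>v 0\<^sub>v m = 0\<^sub>v n"
  using assms by (intro eq_vecI) auto

lemma zero_mult_mat_vec:
  fixes v :: "'k :: field vec"
  assumes "v \<in> carrier_vec m"
  shows "0\<^sub>m n m *\<^sub>v v = 0\<^sub>v n"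
  using assms by (intro eq_vecI) auto

lemma smult_one_mat_mult_vec:
  fixes v :: "'k :: field vec"
  assumes "v \<in> carrier_vec n"
  shows "(c \<cdot>\<^sub>m 1\<^sub>m n) *\<^sub>v v = c \<cdot>\<^sub>v v"
proof (rule eq_vecI)
  fix i assume "i < dim_vec (c \<cdot>\<^sub>v v)"
  then have i: "i < n" using assms by simp
  have "((c \<cdot>\<^sub>m 1\<^sub>m n) *\<^sub>v v) $ i = (\<Sum>j<n. if j = i then c * v $ j else 0)"
  proof -
    have "(\<Sum>j<n. c * (if j = i then 1 else 0) * v $ j) = (\<Sum>j<n. if j = i then c * v $ j else 0)"
      by (rule sum.cong) auto
    then show ?thesis using i assms by (simp add: scalar_prod_def atLeast0LessThan)
  qed
  then show "((c \<cdot>\<^sub>m 1\<^sub>m n) *\<^sub>v v) $ i = (c \<cdot>\<^sub>v v) $ i" using i assms by simp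
qed (use assms in auto)

lemma mat_eq_of_vec:
  fixes A :: "'k :: field mat"
  assumes "A \<in> carrier_mat n m" "B \<in> carrier_mat n m"
    and "\<And>v. v \<in> carrier_vec m \<Longrightarrow> A *\<^sub>v v = B *\<^sub>v v"
  shows "A = B"
proof (rule eq_matI)
  fix i j assume ij: "i < dim_row B" "j < dim_col B"
  have "col A j = col B j"
    using assms(3)[of "unit_vec m j"] mult_mat_vec_unit[OF assms(1)] mult_mat_vec_unit[OF assms(2)]
      ij assms(2) by auto
  then show "A $$ (i,j) = B $$ (i,j)" using ij assms(1,2)
    by (metis carrier_matD(1) carrier_matD(2) index_col)
qed (use assms in auto)

lemma vec_subspace_kernel:
  fixes T :: "'k :: field mat"
  assumes T: "T \<in> carrier_mat n m"
  shows "vec_subspace m {v \<in> carrier_vec m. T *\<^sub>v v = 0\<^sub>v n}"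
  unfolding vec_subspace_def using T
  by (auto simp: mult_add_distrib_mat_vec mult_mat_vec)

lemma vec_subspace_range:
  fixes T :: "'k :: field mat"
  assumes T: "T \<in> carrier_mat n m"
  shows "vec_subspace n ((\<lambda>v. T *\<^sub>v v) ` carrier_vec m)"
  unfolding vec_subspace_def
proof (intro conjI ballI allI)
  show "0\<^sub>v n \<in> (\<lambda>v. T *\<^sub>v v) ` carrier_vec m"
    using T by (intro image_eqI[of _ _ "0\<^sub>v m"]) auto
  fix v assume "v \<in> (\<lambda>v. T *\<^sub>v v) ` carrier_vec m"
  then obtain v' where v: "v' \<in> carrier_vec m" "v = T *\<^sub>v v'" by auto
  show "c \<cdot>\<^sub>v v \<in> (\<lambda>v. T *\<^sub>v v) ` carrier_vec m" for c
    using v T by (intro image_eqI[of _ _ "c \<cdot>\<^sub>v v'"]) (auto simp: mult_mat_vec)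
  fix w assume "w \<in> (\<lambda>v. T *\<^sub>v v) ` carrier_vec m"
  then obtain w' where w: "w' \<in> carrier_vec m" "w = T *\<^sub>v w'" by auto
  show "v + w \<in> (\<lambda>v. T *\<^sub>v v) ` carrier_vec m"
    using v w T by (intro image_eqI[of _ _ "v' + w'"]) (auto simp: mult_add_distrib_mat_vec)
qed (use T in auto)

definition intertwines :: "('g, 'b) monoid_scheme \<Rightarrow> 'k :: field mat \<Rightarrow> ('g \<Rightarrow> 'k mat) \<Rightarrow> ('g \<Rightarrow> 'k mat) \<Rightarrow> bool" where
  "intertwines G T R S \<longleftrightarrow> (\<forall>g\<in>carrier G. R g * T = T * S g)"

lemma intertwinesD: "intertwines G T R S \<Longrightarrow> g \<in> carrier G \<Longrightarrow> R g * T = T * S g"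
  by (simp add: intertwines_def)

lemma invertible_mat_of_bijective:
  fixes T :: "'k :: field mat"
  assumes T: "T \<in> carrier_mat n m"
    and inj: "\<And>v. v \<in> carrier_vec m \<Longrightarrow> T *\<^sub>v v = 0\<^sub>v n \<Longrightarrow> v = 0\<^sub>v m"
    and surj: "(\<lambda>v. T *\<^sub>v v) ` carrier_vec m = carrier_vec n"
  obtains U where "n = m" "U \<in> carrier_mat m n" "T * U = 1\<^sub>m n" "U * T = 1\<^sub>m m"
proof -
  have "\<exists>v\<in>carrier_vec m. T *\<^sub>v v = unit_vec n j" for j
    using surj by (metis imageE unit_vec_carrier)
  then obtain f where f: "\<And>j. f j \<in> carrier_vec m" "\<And>j. T *\<^sub>v f j = unit_vec n j" by metis
  define U where "U = mat_of_cols m (map f [0..<n])"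
  have U: "U \<in> carrier_mat m n" unfolding U_def by (rule carrier_matI) auto
  have TU: "T * U = 1\<^sub>m n"
  proof (rule eq_matI)
    fix i j assume ij: "i < dim_row (1\<^sub>m n :: 'k mat)" "j < dim_col (1\<^sub>m n :: 'k mat)"
    have "col U j = f j" using ij f(1) by (simp add: U_def)
    then have "(T * U) $$ (i,j) = (T *\<^sub>v f j) $ i" using ij T U by simp
    then show "(T * U) $$ (i,j) = 1\<^sub>m n $$ (i,j)" using ij by (simp add: f(2))
  qed (use T U in auto)
  have UT: "U * T = 1\<^sub>m m"
  proof (rule mat_eq_of_vec[of _ m m])
    fix v :: "'k vec" assume v: "v \<in> carrier_vec m"
    have c: "(U * T) *\<^sub>v v \<in> carrier_vec m" using U T v by auto
    have Tv: "T *\<^sub>v v \<in> carrier_vec n" using T v by auto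
    have "T *\<^sub>v ((U * T) *\<^sub>v v) = (T * U) *\<^sub>v (T *\<^sub>v v)"
      unfolding assoc_mult_mat_vec[OF U T v] assoc_mult_mat_vec[OF T U Tv] ..
    also have "\<dots> = T *\<^sub>v v" using TU Tv by simp
    finally have e: "T *\<^sub>v ((U * T) *\<^sub>v v) = T *\<^sub>v v" .
    have "T *\<^sub>v ((U * T) *\<^sub>v v - v) = 0\<^sub>v n"
      unfolding mult_minus_distrib_mat_vec[OF T c v] e by (rule minus_cancel_vec[OF Tv])
    then have 0: "(U * T) *\<^sub>v v - v = 0\<^sub>v m" by (rule inj[OF minus_carrier_vec[OF c v]])
    have "((U * T) *\<^sub>v v) $ i = v $ i" if "i < m" for i
    proof -
      have "((U * T) *\<^sub>v v - v) $ i = 0" using 0 that by simp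
      then show ?thesis using that v c by (simp del: index_mult_mat_vec)
    qed
    then show "(U * T) *\<^sub>v v = 1\<^sub>m m *\<^sub>v v"
      using v c U T by (intro eq_vecI) (auto simp del: index_mult_mat_vec)
  qed (use U T in auto)
  have "n = m"
  proof (rule ccontr)
    assume "n \<noteq> m"
    then consider "n < m" | "m < n" by linarith
    then show False
    proof cases
      case 1
      \<comment> \<open>If \<open>T\<close> had more columns than rows or vice versa, then padding by zeros to square matrices would
        give a one-sided inverse that is not two-sided.\<close>
      let ?T = "four_block_mat T (0\<^sub>m n 0) (0\<^sub>m (m - n) m) (0\<^sub>m (m - n) 0)"
      let ?U = "four_block_mat U (0\<^sub>m m (m - n)) (0\<^sub>m 0 n) (0\<^sub>m 0 (m - n))"
      have c: "?T \<in> carrier_mat m m" "?U \<in> carrier_mat m m"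
        using 1 T U by (metis four_block_carrier_mat zero_carrier_mat le_add_diff_inverse less_imp_le add_0_right)+
      have UT': "?U * ?T = 1\<^sub>m m"
        using mult_four_block_mat[OF U zero_carrier_mat zero_carrier_mat zero_carrier_mat T zero_carrier_mat zero_carrier_mat zero_carrier_mat, of "m - n" 0 0] UT
        by (intro eq_matI) (use T U in auto)
      then have "?T * ?U = 1\<^sub>m m" by (rule mat_mult_left_right_inverse[OF c(2,1)])
      then have "(?T * ?U) $$ (n,n) = 1" using 1 by simp
      moreover have "row ?T n = 0\<^sub>v m" using 1 T by (intro eq_vecI) auto
      then have "(?T * ?U) $$ (n,n) = 0" using 1 c T U by (simp add: scalar_prod_def)
      ultimately show False by simp
    next
      case 2
      let ?T = "four_block_mat T (0\<^sub>m n (n - m)) (0\<^sub>m 0 m) (0\<^sub>m 0 (n - m))"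
      let ?U = "four_block_mat U (0\<^sub>m m 0) (0\<^sub>m (n - m) n) (0\<^sub>m (n - m) 0)"
      have c: "?T \<in> carrier_mat n n" "?U \<in> carrier_mat n n"
        using 2 T U by (metis four_block_carrier_mat zero_carrier_mat le_add_diff_inverse less_imp_le add_0_right)+
      have TU': "?T * ?U = 1\<^sub>m n"
        using mult_four_block_mat[OF T zero_carrier_mat zero_carrier_mat zero_carrier_mat U zero_carrier_mat zero_carrier_mat zero_carrier_mat, of "n - m" 0 0] TU
        by (intro eq_matI) (use T U in auto)
      then have "?U * ?T = 1\<^sub>m n" by (rule mat_mult_left_right_inverse[OF c])
      then have "(?U * ?T) $$ (m,m) = 1" using 2 by simp
      moreover have "row ?U m = 0\<^sub>v n" using 2 U by (intro eq_vecI) auto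
      then have "(?U * ?T) $$ (m,m) = 0" using 2 c T U by (simp add: scalar_prod_def)
      ultimately show False by simp
    qed
  qed
  then show thesis using that U TU UT by blast
qed

text \<open>Schur's lemma: kernel and range of an intertwiner are invariant.\<close>

lemma schur_nonzero:
  fixes R S :: "'g \<Rightarrow> 'k :: field mat"
  assumes G: "group G" and R: "irreducible_representation G n R" and S: "irreducible_representation G m S"
    and T: "T \<in> carrier_mat n m" "intertwines G T R S" "T \<noteq> 0\<^sub>m n m"
  obtains U where "n = m" "U \<in> carrier_mat m n" "T * U = 1\<^sub>m n" "U * T = 1\<^sub>m m"
proof -
  note RD = representationD[OF G irreducibleD(1)[OF R]]
  note SD = representationD[OF G irreducibleD(1)[OF S]]
  have comm: "R g *\<^sub>v (T *\<^sub>v v) = T *\<^sub>v (S g *\<^sub>v v)" if "g \<in> carrier G" "v \<in> carrier_vec m" for g v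
    using intertwinesD[OF T(2) that(1)] RD(1)[OF that(1)] SD(1)[OF that(1)] T(1) that(2)
    by (metis assoc_mult_mat_vec)
  define K where "K = {v \<in> carrier_vec m. T *\<^sub>v v = 0\<^sub>v n}"
  have K: "vec_subspace m K" unfolding K_def by (rule vec_subspace_kernel[OF T(1)])
  have "invariant_under G S K"
    unfolding invariant_under_def
  proof (intro ballI)
    fix g v assume g: "g \<in> carrier G" and v: "v \<in> K"
    then have vc: "v \<in> carrier_vec m" "T *\<^sub>v v = 0\<^sub>v n" by (auto simp: K_def)
    have "T *\<^sub>v (S g *\<^sub>v v) = 0\<^sub>v n"
      using comm[OF g vc(1)] vc(2) mult_mat_vec_zero[OF RD(1)[OF g]] by simp
    then show "S g *\<^sub>v v \<in> K" using SD(1)[OF g] vc by (auto simp: K_def)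
  qed
  moreover have "K \<noteq> carrier_vec m"
  proof
    assume "K = carrier_vec m"
    then have "T *\<^sub>v v = 0\<^sub>m n m *\<^sub>v v" if "v \<in> carrier_vec m" for v
      using that zero_mult_mat_vec[OF that, of n] by (auto simp: K_def)
    then show False using mat_eq_of_vec[OF T(1), of "0\<^sub>m n m"] T(3) by auto
  qed
  ultimately have K0: "K = {0\<^sub>v m}" using irreducibleD(3)[OF S K] by blast
  define W where "W = (\<lambda>v. T *\<^sub>v v) ` carrier_vec m"
  have W: "vec_subspace n W" unfolding W_def by (rule vec_subspace_range[OF T(1)])
  have "invariant_under G R W"
    unfolding invariant_under_def W_def
  proof (intro ballI)
    fix g w assume g: "g \<in> carrier G" and "w \<in> (\<lambda>v. T *\<^sub>v v) ` carrier_vec m"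
    then obtain v where v: "v \<in> carrier_vec m" "w = T *\<^sub>v v" by auto
    show "R g *\<^sub>v w \<in> (\<lambda>v. T *\<^sub>v v) ` carrier_vec m"
      using comm[OF g v(1)] v SD(1)[OF g] by (auto intro!: imageI)
  qed
  moreover have "W \<noteq> {0\<^sub>v n}"
  proof
    assume W0: "W = {0\<^sub>v n}"
    have "K = carrier_vec m" using W0 T(1) by (auto simp: K_def W_def)
    with \<open>K \<noteq> carrier_vec m\<close> show False by simp
  qed
  ultimately have W1: "W = carrier_vec n" using irreducibleD(3)[OF R W] by blast
  have inj: "v = 0\<^sub>v m" if "v \<in> carrier_vec m" "T *\<^sub>v v = 0\<^sub>v n" for v
    using K0 that by (auto simp: K_def)
  show thesis using invertible_mat_of_bijective[OF T(1) inj W1[unfolded W_def]] that by blast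
qed

text \<open>An eigenspace of \<open>T\<close> is invariant, so it is everything.\<close>

lemma schur_scalar:
  fixes R :: "'g \<Rightarrow> 'k :: field mat"
  assumes ac: "alg_closed TYPE('k)"
    and G: "group G" and R: "irreducible_representation G n R"
    and T: "T \<in> carrier_mat n n" "intertwines G T R R"
  obtains c where "T = c \<cdot>\<^sub>m 1\<^sub>m n"
proof -
  note RD = representationD[OF G irreducibleD(1)[OF R]]
  obtain v c where v: "v \<in> carrier_vec n" "v \<noteq> 0\<^sub>v n" "T *\<^sub>v v = c \<cdot>\<^sub>v v"
    using exists_eigenvector[OF ac T(1) irreducibleD(2)[OF R]] by blast
  define W where "W = {v \<in> carrier_vec n. T *\<^sub>v v = c \<cdot>\<^sub>v v}"
  have W: "vec_subspace n W" unfolding W_def by (rule vec_subspace_eigenspace[OF T(1)])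
  have "invariant_under G R W" unfolding invariant_under_def
  proof (intro ballI)
    fix g v assume g: "g \<in> carrier G" and "v \<in> W"
    then have v: "v \<in> carrier_vec n" "T *\<^sub>v v = c \<cdot>\<^sub>v v" by (auto simp: W_def)
    have "T *\<^sub>v (R g *\<^sub>v v) = R g *\<^sub>v (T *\<^sub>v v)"
      using intertwinesD[OF T(2) g] RD(1)[OF g] T(1) v(1) by (metis assoc_mult_mat_vec)
    then show "R g *\<^sub>v v \<in> W" using v RD(1)[OF g] by (auto simp: W_def mult_mat_vec)
  qed
  then have "W = carrier_vec n" using irreducibleD(3)[OF R W] v by (auto simp: W_def)
  then have "T *\<^sub>v v = (c \<cdot>\<^sub>m 1\<^sub>m n) *\<^sub>v v" if "v \<in> carrier_vec n" for v
    using that smult_one_mat_mult_vec[OF that, of c] by (auto simp: W_def)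
  then show thesis using that mat_eq_of_vec[OF T(1), of "c \<cdot>\<^sub>m 1\<^sub>m n"] by auto
qed

text \<open>Index the rows of the matrices \<open>R i\<close> by pairs \<open>(i, k)\<close>. Coefficient families \<open>v\<close> for
  which the combination of the rows in \<open>J\<close> vanishes on \<open>G\<close> are closed under the action of \<open>G\<close>. If
  \<open>J\<close> is extended by one row, then the new component of the families is an invariant subspace, and a
  family is determined by it, by induction. So if the subspace is everything, the
  other components are intertwiners applied to the new one; these are scalars or zero by
  Schur's lemma, and the relation at the identity gives a contradiction.\<close>

lemma rows_independent:
  fixes R :: "'i \<Rightarrow> 'g \<Rightarrow> 'k :: field mat"
  assumes ac: "alg_closed TYPE('k)" and G: "group G"
    and R: "\<And>i. i \<in> I \<Longrightarrow> irreducible_representation G (d i) (R i)"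
    and noniso: "\<And>i j T. i \<in> I \<Longrightarrow> j \<in> I \<Longrightarrow> i \<noteq> j \<Longrightarrow> T \<in> carrier_mat (d i) (d j) \<Longrightarrow>
      intertwines G T (R i) (R j) \<Longrightarrow> T = 0\<^sub>m (d i) (d j)"
    and J: "finite J" "\<And>i k. (i,k) \<in> J \<Longrightarrow> i \<in> I \<and> k < d i"
    and v: "\<And>i k. (i,k) \<in> J \<Longrightarrow> v (i,k) \<in> carrier_vec (d i)"
    and rel: "\<And>g. g \<in> carrier G \<Longrightarrow> (\<Sum>(i,k)\<in>J. (R i g *\<^sub>v v (i,k)) $ k) = 0"
  shows "\<forall>(i,k)\<in>J. v (i,k) = 0\<^sub>v (d i)"
  using J v rel
proof (induction J arbitrary: v rule: finite_induct)
  case empty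
  then show ?case by simp
next
  case (insert j0 J)
  obtain i0 k0 where j0: "j0 = (i0,k0)" by (cases j0)
  have i0: "i0 \<in> I" "k0 < d i0" using insert.prems(1) j0 by auto
  have RD: "R i g \<in> carrier_mat (d i) (d i)" "R i \<one>\<^bsub>G\<^esub> = 1\<^sub>m (d i)"
    "R i (g \<otimes>\<^bsub>G\<^esub> h) = R i g * R i h" if "i \<in> I" "g \<in> carrier G" "h \<in> carrier G" for i g h
    using representationD[OF G irreducibleD(1)[OF R[OF that(1)]]] that by auto
  have JI: "i \<in> I" "k < d i" if "(i,k) \<in> insert j0 J" for i k using insert.prems(1) that by auto
  define dd where "dd j = d (fst j)" for j :: "'i \<times> nat"
  define f where "f g w = (\<Sum>j\<in>insert j0 J. (R (fst j) g *\<^sub>v w j) $ snd j)" for g and w :: "'i \<times> nat \<Rightarrow> 'k vec"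
  define K where "K = {w. (\<forall>j\<in>insert j0 J. w j \<in> carrier_vec (dd j)) \<and> (\<forall>g\<in>carrier G. f g w = 0)}"
  have vK: "v \<in> K"
  proof -
    have "v j \<in> carrier_vec (dd j)" if "j \<in> insert j0 J" for j
      using insert.prems(2)[of "fst j" "snd j"] that by (simp add: dd_def)
    then show ?thesis using insert.prems(3) by (auto simp: K_def f_def case_prod_beta)
  qed
  have Rc: "R (fst j) g \<in> carrier_mat (dd j) (dd j)" "snd j < dd j" "fst j \<in> I"
    if "j \<in> insert j0 J" "g \<in> carrier G" for j g
    using RD(1)[of "fst j" g g] JI[of "fst j" "snd j"] that by (auto simp: dd_def)
  have Kadd: "(\<lambda>j. w j + w' j) \<in> K" if "w \<in> K" "w' \<in> K" for w w'
  proof -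
    have "f g (\<lambda>j. w j + w' j) = f g w + f g w'" if g: "g \<in> carrier G" for g
      unfolding f_def sum.distrib[symmetric]
    proof (intro sum.cong refl)
      fix j assume j: "j \<in> insert j0 J"
      show "(R (fst j) g *\<^sub>v (w j + w' j)) $ snd j = (R (fst j) g *\<^sub>v w j) $ snd j + (R (fst j) g *\<^sub>v w' j) $ snd j"
        using Rc[OF j g] \<open>w \<in> K\<close> \<open>w' \<in> K\<close> j
        by (subst mult_add_distrib_mat_vec[OF Rc(1)[OF j g]]) (auto simp: K_def)
    qed
    then show ?thesis using that by (auto simp: K_def)
  qed
  have Ksmult: "(\<lambda>j. c \<cdot>\<^sub>v w j) \<in> K" if "w \<in> K" for w c
  proof -
    have "f g (\<lambda>j. c \<cdot>\<^sub>v w j) = c * f g w" if g: "g \<in> carrier G" for g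
      unfolding f_def sum_distrib_left
    proof (intro sum.cong refl)
      fix j assume j: "j \<in> insert j0 J"
      show "(R (fst j) g *\<^sub>v (c \<cdot>\<^sub>v w j)) $ snd j = c * (R (fst j) g *\<^sub>v w j) $ snd j"
        using Rc[OF j g] \<open>w \<in> K\<close> j
        by (subst mult_mat_vec[OF Rc(1)[OF j g]]) (auto simp: K_def)
    qed
    then show ?thesis using that by (auto simp: K_def)
  qed
  have Kact: "(\<lambda>j. R (fst j) h *\<^sub>v w j) \<in> K" if w: "w \<in> K" and h: "h \<in> carrier G" for w h
  proof -
    interpret group G by fact
    have "f g (\<lambda>j. R (fst j) h *\<^sub>v w j) = f (g \<otimes>\<^bsub>G\<^esub> h) w" if g: "g \<in> carrier G" for g
      unfolding f_def
    proof (intro sum.cong refl)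
      fix j assume j: "j \<in> insert j0 J"
      have wj: "w j \<in> carrier_vec (dd j)" using w j by (auto simp: K_def)
      show "(R (fst j) g *\<^sub>v (R (fst j) h *\<^sub>v w j)) $ snd j = (R (fst j) (g \<otimes>\<^bsub>G\<^esub> h) *\<^sub>v w j) $ snd j"
        unfolding RD(3)[OF Rc(3)[OF j g] g h] assoc_mult_mat_vec[OF Rc(1)[OF j g] Rc(1)[OF j h] wj] ..
    qed
    moreover have "f (g \<otimes>\<^bsub>G\<^esub> h) w = 0" if g: "g \<in> carrier G" for g
      using w m_closed[OF g h] by (auto simp: K_def)
    moreover have "R (fst j) h *\<^sub>v w j \<in> carrier_vec (dd j)" if j: "j \<in> insert j0 J" for j
      using mult_mat_vec_carrier[OF Rc(1)[OF j h], of "w j"] w j by (auto simp: K_def)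
    ultimately show ?thesis by (simp add: K_def)
  qed
  have K0: "w j = 0\<^sub>v (dd j)" if w: "w \<in> K" "w j0 = 0\<^sub>v (dd j0)" and j: "j \<in> insert j0 J" for w j
  proof -
    have "\<forall>(i,k)\<in>J. w (i,k) = 0\<^sub>v (d i)"
    proof (rule insert.IH)
      fix g assume g: "g \<in> carrier G"
      have z: "(R (fst j0) g *\<^sub>v w j0) $ snd j0 = 0" unfolding w(2) using Rc[OF _ g, of j0] by auto
      have "f g w = 0" using w g by (auto simp: K_def)
      then have "(\<Sum>j\<in>J. (R (fst j) g *\<^sub>v w j) $ snd j) = 0"
        unfolding f_def using insert.hyps z by simp
      then show "(\<Sum>(i,k)\<in>J. (R i g *\<^sub>v w (i,k)) $ k) = 0" by (simp add: case_prod_beta)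
    qed (use w insert.prems in \<open>auto simp: K_def dd_def\<close>)
    then show ?thesis using w(2) j by (auto simp: dd_def)
  qed
  show ?case
  proof (cases "v j0 = 0\<^sub>v (dd j0)")
    case True
    then show ?thesis using K0[OF vK True] by (auto simp: dd_def)
  next
    case False
    define W where "W = (\<lambda>w. w j0) ` K"
    have W: "vec_subspace (dd j0) W" unfolding vec_subspace_def
    proof (intro conjI ballI allI)
      show "W \<subseteq> carrier_vec (dd j0)" by (auto simp: W_def K_def)
      have "(\<lambda>j. 0 \<cdot>\<^sub>v v j) j0 \<in> W" unfolding W_def by (rule imageI[OF Ksmult[OF vK]])
      moreover have "0 \<cdot>\<^sub>v v j0 = 0\<^sub>v (dd j0)" using vK by (intro eq_vecI) (auto simp: K_def)
      ultimately show "0\<^sub>v (dd j0) \<in> W" by simp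
      fix x assume "x \<in> W"
      then obtain w where w: "w \<in> K" "x = w j0" by (auto simp: W_def)
      show "c \<cdot>\<^sub>v x \<in> W" for c unfolding W_def w(2) by (rule image_eqI[OF _ Ksmult[OF w(1), of c]]) simp
      fix y assume "y \<in> W"
      then obtain w' where w': "w' \<in> K" "y = w' j0" by (auto simp: W_def)
      show "x + y \<in> W" unfolding W_def w(2) w'(2) by (rule image_eqI[OF _ Kadd[OF w(1) w'(1)]]) simp
    qed
    have "invariant_under G (R i0) W" unfolding invariant_under_def
    proof (intro ballI)
      fix g x assume g: "g \<in> carrier G" and "x \<in> W"
      then obtain w where w: "w \<in> K" "x = w j0" by (auto simp: W_def)
      show "R i0 g *\<^sub>v x \<in> W" unfolding W_def w(2) by (rule image_eqI[OF _ Kact[OF w(1) g]]) (simp add: j0)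
    qed
    moreover have "v j0 \<in> W" unfolding W_def using vK by blast
    ultimately have Wall: "W = carrier_vec (dd j0)"
      using irreducibleD(3)[OF R[OF i0(1)], of W] W False j0 by (auto simp: dd_def)
    have "\<exists>w\<in>K. w j0 = unit_vec (dd j0) l" for l
    proof -
      have "unit_vec (dd j0) l \<in> W" using Wall by simp
      then show ?thesis by (auto simp: W_def)
    qed
    then obtain e where e: "\<And>l. e l \<in> K" "\<And>l. e l j0 = unit_vec (dd j0) l" by metis
    have ec: "e l j \<in> carrier_vec (dd j)" if "j \<in> insert j0 J" for l j
      using e(1)[of l] that by (auto simp: K_def)
    define T where "T j = mat (dd j) (dd j0) (\<lambda>(a,l). e l j $ a)" for j
    have Tc: "T j \<in> carrier_mat (dd j) (dd j0)" for j by (simp add: T_def)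
    \<comment> \<open>By linearity, \<open>T j\<close> takes the value \<open>u\<close> of the new component to the component \<open>j\<close> of the
      family in \<open>K\<close> with that value.\<close>
    define ext where "ext u L j = vec (dd j) (\<lambda>a. \<Sum>l<L. u $ l * e l j $ a)" for u :: "'k vec" and L j
    have extK: "ext u L \<in> K" if "L \<le> dd j0" for u L
      using that
    proof (induction L)
      case 0
      have "f g (ext u 0) = 0" if g: "g \<in> carrier G" for g
        unfolding f_def
      proof (intro sum.neutral ballI)
        fix j assume j: "j \<in> insert j0 J"
        have "ext u 0 j = 0\<^sub>v (dd j)" by (auto simp: ext_def)
        then show "(R (fst j) g *\<^sub>v ext u 0 j) $ snd j = 0" using Rc[OF j g] by auto
      qed
      moreover have "ext u 0 j \<in> carrier_vec (dd j)" for j by (simp add: ext_def)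
      ultimately show ?case by (simp add: K_def)
    next
      case (Suc L)
      have 1: "(\<lambda>j. ext u L j + u $ L \<cdot>\<^sub>v e L j) \<in> K"
        using Kadd[OF Suc.IH Ksmult[OF e(1)]] Suc.prems by simp
      have 2: "ext u (Suc L) j = ext u L j + u $ L \<cdot>\<^sub>v e L j" if "j \<in> insert j0 J" for j
        using ec[OF that, of L] by (intro eq_vecI) (auto simp: ext_def)
      have "f g (ext u (Suc L)) = f g (\<lambda>j. ext u L j + u $ L \<cdot>\<^sub>v e L j)" for g
        unfolding f_def by (intro sum.cong refl) (simp add: 2)
      moreover have "ext u (Suc L) j \<in> carrier_vec (dd j)" for j by (simp add: ext_def)
      ultimately show ?case using 1 by (simp add: K_def)
    qed
    have extT: "ext u (dd j0) j = T j *\<^sub>v u" if "u \<in> carrier_vec (dd j0)" for u j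
      using that by (intro eq_vecI) (auto simp: ext_def T_def scalar_prod_def atLeast0LessThan mult.commute)
    have TK: "(\<lambda>j. T j *\<^sub>v u) \<in> K" if u: "u \<in> carrier_vec (dd j0)" for u
      using extK[of "dd j0" u] extT[OF u] by (metis (no_types, lifting) ext order_refl)
    have T0: "T j0 = 1\<^sub>m (dd j0)"
      by (rule eq_matI) (auto simp: T_def e(2) unit_vec_def)
    have Tint: "intertwines G (T j) (R (fst j)) (R i0)" if j: "j \<in> insert j0 J" for j
      unfolding intertwines_def
    proof
      fix g assume g: "g \<in> carrier G"
      have Rg0: "R i0 g \<in> carrier_mat (dd j0) (dd j0)" using Rc(1)[OF _ g, of j0] j0 by simp
      show "R (fst j) g * T j = T j * R i0 g"
      proof (rule mat_eq_of_vec[of _ "dd j" "dd j0"])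
        fix u :: "'k vec" assume u: "u \<in> carrier_vec (dd j0)"
        have Ru: "R i0 g *\<^sub>v u \<in> carrier_vec (dd j0)" using Rg0 u by auto
        define w where "w j = R (fst j) g *\<^sub>v (T j *\<^sub>v u) + (-1) \<cdot>\<^sub>v (T j *\<^sub>v (R i0 g *\<^sub>v u))" for j
        have wK: "w \<in> K"
          using Kadd[OF Kact[OF TK[OF u] g] Ksmult[OF TK[OF Ru], of "-1"]] by (simp add: w_def[abs_def])
        have "w j0 = 0\<^sub>v (dd j0)" unfolding w_def T0 using u Ru j0 Rg0 by (intro eq_vecI) auto
        from K0[OF wK this j] have z: "w j = 0\<^sub>v (dd j)" .
        have c1: "R (fst j) g *\<^sub>v (T j *\<^sub>v u) \<in> carrier_vec (dd j)"
          by (rule mult_mat_vec_carrier[OF Rc(1)[OF j g] mult_mat_vec_carrier[OF Tc u]])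
        have c2: "T j *\<^sub>v (R i0 g *\<^sub>v u) \<in> carrier_vec (dd j)"
          by (rule mult_mat_vec_carrier[OF Tc Ru])
        have "R (fst j) g *\<^sub>v (T j *\<^sub>v u) = T j *\<^sub>v (R i0 g *\<^sub>v u)"
        proof (rule eq_vecI)
          fix a assume "a < dim_vec (T j *\<^sub>v (R i0 g *\<^sub>v u))"
          then have a: "a < dd j" using carrier_vecD[OF c2] by (simp del: dim_mult_mat_vec)
          have "w j $ a = 0" using z a by simp
          moreover have "w j $ a = (R (fst j) g *\<^sub>v (T j *\<^sub>v u)) $ a - (T j *\<^sub>v (R i0 g *\<^sub>v u)) $ a"
            using a c1 c2 Tc[of j] unfolding w_def by (simp del: index_mult_mat_vec)
          ultimately show "(R (fst j) g *\<^sub>v (T j *\<^sub>v u)) $ a = (T j *\<^sub>v (R i0 g *\<^sub>v u)) $ a" by simp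
        qed (use carrier_vecD[OF c1] carrier_vecD[OF c2] in simp)
        then show "(R (fst j) g * T j) *\<^sub>v u = (T j * R i0 g) *\<^sub>v u"
          using Rc(1)[OF j g] Tc[of j] Rg0 u by (simp add: assoc_mult_mat_vec[of _ "dd j"])
      qed (use Rc(1)[OF j g] Tc[of j] Rg0 in auto)
    qed
    have one: "\<one>\<^bsub>G\<^esub> \<in> carrier G" using G by (simp add: group.is_monoid monoid.one_closed)
    have zero: "(R (fst j) \<one>\<^bsub>G\<^esub> *\<^sub>v (T j *\<^sub>v unit_vec (dd j0) k0)) $ snd j = 0" if j: "j \<in> J" for j
    proof -
      have j': "j \<in> insert j0 J" using j by simp
      have "R (fst j) \<one>\<^bsub>G\<^esub> = 1\<^sub>m (dd j)" using RD(2)[OF Rc(3)[OF j' one] one one] by (simp add: dd_def)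
      then have 1: "R (fst j) \<one>\<^bsub>G\<^esub> *\<^sub>v (T j *\<^sub>v unit_vec (dd j0) k0) = T j *\<^sub>v unit_vec (dd j0) k0"
        using Tc[of j] by simp
      show ?thesis
      proof (cases "fst j = i0")
        case True
        then obtain c where c: "T j = c \<cdot>\<^sub>m 1\<^sub>m (d i0)"
          using schur_scalar[OF ac G R[OF i0(1)], of "T j"] Tint[OF j'] Tc[of j] j0 by (auto simp: dd_def)
        have "snd j \<noteq> k0" using True j insert.hyps(2) j0 by (metis prod.collapse)
        moreover have "T j *\<^sub>v unit_vec (dd j0) k0 = c \<cdot>\<^sub>v unit_vec (d i0) k0"
          using smult_one_mat_mult_vec[of "unit_vec (d i0) k0" "d i0" c] j0 by (simp add: c dd_def)
        ultimately show ?thesis unfolding 1 using i0 True Rc(2)[OF j' one] by (simp add: dd_def)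
      next
        case False
        then have "T j = 0\<^sub>m (dd j) (dd j0)"
          using noniso[OF Rc(3)[OF j' one] i0(1) False, of "T j"] Tint[OF j'] Tc[of j] j0 by (simp add: dd_def)
        then show ?thesis unfolding 1 using Rc(2)[OF j' one] by simp
      qed
    qed
    have "f \<one>\<^bsub>G\<^esub> (\<lambda>j. T j *\<^sub>v unit_vec (dd j0) k0) = 0"
      using TK[of "unit_vec (dd j0) k0"] one by (auto simp: K_def)
    then have "(R i0 \<one>\<^bsub>G\<^esub> *\<^sub>v (T j0 *\<^sub>v unit_vec (dd j0) k0)) $ k0 = 0"
      unfolding f_def using insert.hyps zero j0 by (simp del: index_mult_mat_vec)
    then have False unfolding T0 using RD(2)[OF i0(1) one one] i0 j0 by (simp add: dd_def)
    then show ?thesis ..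
  qed
qed

text \<open>A relation between traces is a relation between diagonal matrix coefficients.\<close>

lemma traces_independent:
  fixes R :: "'i \<Rightarrow> 'g \<Rightarrow> 'k :: field mat"
  assumes ac: "alg_closed TYPE('k)" and G: "group G" and I: "finite I"
    and R: "\<And>i. i \<in> I \<Longrightarrow> irreducible_representation G (d i) (R i)"
    and noniso: "\<And>i j T. i \<in> I \<Longrightarrow> j \<in> I \<Longrightarrow> i \<noteq> j \<Longrightarrow> T \<in> carrier_mat (d i) (d j) \<Longrightarrow>
      intertwines G T (R i) (R j) \<Longrightarrow> T = 0\<^sub>m (d i) (d j)"
    and rel: "\<And>g. g \<in> carrier G \<Longrightarrow> (\<Sum>i\<in>I. c i * mat_trace (R i g)) = 0"
    and i: "i \<in> I"
  shows "c i = 0"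
proof -
  have Rc: "R i g \<in> carrier_mat (d i) (d i)" if "i \<in> I" "g \<in> carrier G" for i g
    using representationD(1)[OF G irreducibleD(1)[OF R]] that by blast
  define v where "v = (\<lambda>(i,k). c i \<cdot>\<^sub>v (unit_vec (d i) k :: 'k vec))"
  have "\<forall>(i,k)\<in>Sigma I (\<lambda>i. {..<d i}). v (i,k) = 0\<^sub>v (d i)"
  proof (rule rows_independent[OF ac G R noniso])
    fix g assume g: "g \<in> carrier G"
    have "(R i g *\<^sub>v v (i,k)) $ k = c i * R i g $$ (k,k)" if "i \<in> I" "k < d i" for i k
      using Rc[OF that(1) g] that(2) by (auto simp: v_def mult_mat_vec scalar_prod_right_unit)
    then have "(\<Sum>(i,k)\<in>Sigma I (\<lambda>i. {..<d i}). (R i g *\<^sub>v v (i,k)) $ k) =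
      (\<Sum>(i,k)\<in>Sigma I (\<lambda>i. {..<d i}). c i * R i g $$ (k,k))"
      by (intro sum.cong) auto
    also have "\<dots> = (\<Sum>i\<in>I. \<Sum>k<d i. c i * R i g $$ (k,k))"
      using I by (simp add: sum.Sigma)
    also have "\<dots> = (\<Sum>i\<in>I. c i * mat_trace (R i g))"
    proof (intro sum.cong refl)
      fix i assume "i \<in> I"
      then have "dim_row (R i g) = d i" using Rc[OF _ g] by auto
      then show "(\<Sum>k<d i. c i * R i g $$ (k,k)) = c i * mat_trace (R i g)"
        by (simp add: mat_trace_def sum_distrib_left)
    qed
    finally show "(\<Sum>(i,k)\<in>Sigma I (\<lambda>i. {..<d i}). (R i g *\<^sub>v v (i,k)) $ k) = 0"
      using rel[OF g] by simp
  qed (use I in \<open>auto simp: v_def\<close>)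
  moreover have d: "0 < d i" using irreducibleD(2)[OF R[OF i]] .
  ultimately have "v (i,0) = 0\<^sub>v (d i)" using i by auto
  then have "v (i,0) $ 0 = 0" using d by simp
  then show ?thesis using d by (simp add: v_def)
qed

lemma similar_of_intertwiner:
  fixes R S :: "'g \<Rightarrow> 'k :: field mat"
  assumes G: "group G" and R: "irreducible_representation G n R" and S: "irreducible_representation G m S"
    and T: "T \<in> carrier_mat n m" "intertwines G T R S" "T \<noteq> 0\<^sub>m n m"
    and g: "g \<in> carrier G"
  shows "char_poly (R g) = char_poly (S g)" "mat_trace (R g) = mat_trace (S g)"
proof -
  obtain U where U: "n = m" "U \<in> carrier_mat m n" "T * U = 1\<^sub>m n" "U * T = 1\<^sub>m m"
    by (rule schur_nonzero[OF G R S T])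
  have c: "R g \<in> carrier_mat n n" "S g \<in> carrier_mat n n"
    using representationD(1)[OF G irreducibleD(1)[OF R] g] representationD(1)[OF G irreducibleD(1)[OF S] g] U(1) by auto
  have T': "T \<in> carrier_mat n n" "U \<in> carrier_mat n n" using T(1) U by auto
  have "T * S g * U = R g * T * U" using intertwinesD[OF T(2) g] by simp
  also have "\<dots> = R g * (T * U)" by (rule assoc_mult_mat[OF c(1) T'])
  finally have e: "R g = T * S g * U" using c(1) U(3) by simp
  show "char_poly (R g) = char_poly (S g)" unfolding e
    by (rule char_poly_similar') (use T' c U in auto)
  show "mat_trace (R g) = mat_trace (S g)" unfolding e
    by (rule mat_trace_similar) (use T' c U in auto)
qed

section \<open>Ordinary characters\<close>

lemma character_eq_trace: "g \<in> carrier G \<Longrightarrow> character G R g = mat_trace (R g)"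
  by (simp add: character_def mat_trace_def)

lemma Irr_cases:
  assumes "\<chi> \<in> Irr G"
  obtains d R where "irreducible_representation G d R" "\<chi> = character G R"
  using assms by (auto simp: Irr_def)

lemma character_in_Irr: "irreducible_representation G d R \<Longrightarrow> character G R \<in> Irr G"
  unfolding Irr_def by blast

lemma Irr_independent:
  assumes G: "group G" and T: "finite T" "T \<subseteq> Irr G"
    and rel: "\<And>g. g \<in> carrier G \<Longrightarrow> (\<Sum>\<chi>\<in>T. c \<chi> * \<chi> g) = 0" and "\<chi> \<in> T"
  shows "c \<chi> = 0"
proof -
  have "\<forall>\<chi>\<in>T. \<exists>d R. irreducible_representation G d R \<and> \<chi> = character G R"
    using T(2) by (metis Irr_cases subsetD)
  then obtain d R where R: "\<And>\<chi>. \<chi> \<in> T \<Longrightarrow> irreducible_representation G (d \<chi>) (R \<chi>)"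
    "\<And>\<chi>. \<chi> \<in> T \<Longrightarrow> \<chi> = character G (R \<chi>)" by metis
  show ?thesis
  proof (rule traces_independent[where c = c and i = \<chi>, OF alg_closed_complex G T(1) R(1)])
    fix \<chi> \<psi> A assume *: "\<chi> \<in> T" "\<psi> \<in> T" "\<chi> \<noteq> \<psi>" "A \<in> carrier_mat (d \<chi>) (d \<psi>)"
      "intertwines G A (R \<chi>) (R \<psi>)"
    show "A = 0\<^sub>m (d \<chi>) (d \<psi>)"
    proof (rule ccontr)
      assume "A \<noteq> 0\<^sub>m (d \<chi>) (d \<psi>)"
      then have "mat_trace (R \<chi> g) = mat_trace (R \<psi> g)" if "g \<in> carrier G" for g
        using similar_of_intertwiner(2)[OF G R(1)[OF *(1)] R(1)[OF *(2)] *(4,5) _ that] by blast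
      then have "character G (R \<chi>) = character G (R \<psi>)"
        by (auto simp: character_def mat_trace_def)
      then show False using R(2) *(1-3) by metis
    qed
  next
    fix g assume g: "g \<in> carrier G"
    have "(\<Sum>\<chi>\<in>T. c \<chi> * mat_trace (R \<chi> g)) = (\<Sum>\<chi>\<in>T. c \<chi> * \<chi> g)"
      using character_eq_trace[OF g, of "R _"] R(2) by (intro sum.cong refl) metis
    then show "(\<Sum>\<chi>\<in>T. c \<chi> * mat_trace (R \<chi> g)) = 0" using rel[OF g] by simp
  qed (use \<open>\<chi> \<in> T\<close> in auto)
qed

section \<open>Algebraic integers form an integrally closed ring\<close>

text \<open>A subring of the complex numbers that is finitely generated as an abelian group. Its elements are algebraic
  integers, and conversely finitely many algebraic integers lie in one such ring, which gives closure under sums and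
  products.\<close>

definition fg_subring :: "complex set \<Rightarrow> bool" where
  "fg_subring S \<longleftrightarrow> 1 \<in> S \<and> (\<forall>x\<in>S. \<forall>y\<in>S. x + y \<in> S \<and> x * y \<in> S) \<and> (\<forall>x\<in>S. - x \<in> S) \<and>
     (\<exists>A. finite A \<and> A \<subseteq> S \<and> (\<forall>x\<in>S. \<exists>c. x = (\<Sum>a\<in>A. of_int (c a) * a)))"

lemma fg_subring_zero: "fg_subring S \<Longrightarrow> 0 \<in> S"
  unfolding fg_subring_def by (metis add.right_inverse)

lemma fg_subring_Ints: "fg_subring \<int>"
  unfolding fg_subring_def
proof (intro conjI ballI exI[of _ "{1}"])
  fix x :: complex assume "x \<in> \<int>"
  then obtain n where "x = of_int n" by (auto elim: Ints_cases)
  then show "\<exists>c. x = (\<Sum>a\<in>{1}. of_int (c a) * a)" by (intro exI[of _ "\<lambda>_. n"]) simp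
qed auto

text \<open>The determinant trick: multiplication by \<open>x\<close> acts on the generators by an integer matrix, so
  \<open>x\<close> is a root of its characteristic polynomial.\<close>

lemma fg_subring_algebraic_int:
  assumes S: "fg_subring S" and x: "x \<in> S"
  shows "algebraic_int x"
proof -
  obtain A where A: "finite A" "A \<subseteq> S" "\<And>y. y \<in> S \<Longrightarrow> \<exists>c. y = (\<Sum>a\<in>A. of_int (c a :: int) * a)"
    using S unfolding fg_subring_def by blast
  obtain n and f :: "nat \<Rightarrow> complex" where f: "bij_betw f {..<n} A"
    using A(1) ex_bij_betw_nat_finite[of A] by (auto simp: atLeast0LessThan)
  have span: "\<exists>c :: nat \<Rightarrow> int. y = (\<Sum>i<n. of_int (c i) * f i)" if y: "y \<in> S" for y
  proof -
    obtain c :: "complex \<Rightarrow> int" where "y = (\<Sum>a\<in>A. of_int (c a) * a)" using A(3)[OF y] by blast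
    also have "\<dots> = (\<Sum>i<n. of_int (c (f i)) * f i)" by (rule sum.reindex_bij_betw[OF f, symmetric])
    finally show ?thesis by (intro exI[of _ "c \<circ> f"]) simp
  qed
  have "x * f i \<in> S" if "i < n" for i
    using f that A(2) S x unfolding fg_subring_def bij_betw_def by blast
  then have "\<forall>i. \<exists>c :: nat \<Rightarrow> int. i < n \<longrightarrow> x * f i = (\<Sum>j<n. of_int (c j) * f j)"
    using span by blast
  then obtain c :: "nat \<Rightarrow> nat \<Rightarrow> int" where c: "\<And>i. i < n \<Longrightarrow> x * f i = (\<Sum>j<n. of_int (c i j) * f j)"
    by metis
  define M where "M = mat n n (\<lambda>(i,j). c i j)"
  define N where "N = (map_mat of_int M :: complex mat)"
  have M: "M \<in> carrier_mat n n" and N: "N \<in> carrier_mat n n" by (auto simp: M_def N_def)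
  define v where "v = vec n f"
  have Nv: "N *\<^sub>v v = x \<cdot>\<^sub>v v"
  proof (rule eq_vecI)
    fix i assume "i < dim_vec (x \<cdot>\<^sub>v v)"
    then have i: "i < n" by (simp add: v_def)
    then show "(N *\<^sub>v v) $ i = (x \<cdot>\<^sub>v v) $ i"
      by (simp add: N_def M_def v_def scalar_prod_def atLeast0LessThan c[OF i])
  qed (use N in \<open>auto simp: v_def\<close>)
  have "v \<noteq> 0\<^sub>v n"
  proof
    assume v0: "v = 0\<^sub>v n"
    have "f i = 0" if "i < n" for i using v0 that by (metis index_vec index_zero_vec(1) v_def)
    moreover obtain c :: "nat \<Rightarrow> int" where "1 = (\<Sum>i<n. of_int (c i) * f i)"
      using span[of 1] S by (auto simp: fg_subring_def)
    ultimately show False by simp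
  qed
  then have "eigenvalue N x" using Nv N unfolding eigenvalue_def eigenvector_def
    by (intro exI[of _ v]) (auto simp: v_def)
  then have "poly (char_poly N) x = 0" using eigenvalue_root_char_poly[OF N] by simp
  moreover have "char_poly N = map_poly of_int (char_poly M)"
    unfolding N_def by (rule of_int_hom.char_poly_hom[OF M])
  moreover have "lead_coeff (char_poly M) = 1" using degree_monic_char_poly[OF M] by simp
  ultimately show ?thesis unfolding algebraic_int_altdef_ipoly by metis
qed

text \<open>The monic equation for \<open>x\<close> expresses the power of exponent \<open>degree p\<close> by lower
  ones, so the combinations of these lower powers with coefficients in \<open>S\<close> form a ring.\<close>

lemma fg_subring_adjoin:
  assumes S: "fg_subring S" and p: "lead_coeff p = 1" "\<And>i. coeff p i \<in> S" "poly p x = 0"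
  obtains S' where "fg_subring S'" "S \<subseteq> S'" "x \<in> S'"
proof -
  have Sr: "1 \<in> S" "\<And>x y. x \<in> S \<Longrightarrow> y \<in> S \<Longrightarrow> x + y \<in> S" "\<And>x y. x \<in> S \<Longrightarrow> y \<in> S \<Longrightarrow> x * y \<in> S"
    "\<And>x. x \<in> S \<Longrightarrow> - x \<in> S" using S by (auto simp: fg_subring_def)
  have S0: "0 \<in> S" by (rule fg_subring_zero[OF S])
  define d where "d = degree p"
  have "d \<noteq> 0"
  proof
    assume "d = 0"
    then obtain a where "p = [:a:]" by (metis d_def degree_eq_zeroE)
    then show False using p by simp
  qed
  then have d: "d > 0" by simp
  define S' where "S' = {\<Sum>j<d. s j * x ^ j | s. \<forall>j. s j \<in> S}"
  have memI: "y \<in> S'" if "y = (\<Sum>j<d. s j * x ^ j)" "\<And>j. s j \<in> S" for y s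
    using that by (auto simp: S'_def)
  have add: "y + z \<in> S'" if "y \<in> S'" "z \<in> S'" for y z
  proof -
    obtain s t where st: "y = (\<Sum>j<d. s j * x ^ j)" "\<And>j. s j \<in> S" "z = (\<Sum>j<d. t j * x ^ j)" "\<And>j. t j \<in> S"
      using \<open>y \<in> S'\<close> \<open>z \<in> S'\<close> by (auto simp: S'_def)
    show ?thesis by (rule memI[of _ "\<lambda>j. s j + t j"]) (use st Sr in \<open>auto simp: sum.distrib ring_distribs\<close>)
  qed
  have smult: "a * y \<in> S'" if "y \<in> S'" "a \<in> S" for y a
  proof -
    obtain s where s: "y = (\<Sum>j<d. s j * x ^ j)" "\<And>j. s j \<in> S"
      using \<open>y \<in> S'\<close> by (auto simp: S'_def)
    show ?thesis by (rule memI[of _ "\<lambda>j. a * s j"]) (use s Sr that in \<open>auto simp: sum_distrib_left mult.assoc\<close>)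
  qed
  have low: "x ^ i \<in> S'" if "i < d" for i
    by (rule memI[of _ "\<lambda>j. if j = i then 1 else 0"]) (use that Sr S0 in \<open>auto simp: if_distrib[of "\<lambda>u. u * _"] cong: if_cong\<close>)
  have S0': "0 \<in> S'" by (rule memI[of _ "\<lambda>_. 0"]) (use S0 in auto)
  have sum': "sum h I \<in> S'" if "\<And>i. i \<in> I \<Longrightarrow> h i \<in> S'" for h and I :: "nat set"
    using that by (induction I rule: infinite_finite_induct) (auto intro: add S0')
  have xd: "x ^ d \<in> S'"
  proof -
    have "0 = (\<Sum>i\<le>d. coeff p i * x ^ i)" using p(3) by (simp add: poly_altdef d_def)
    also have "\<dots> = (\<Sum>i<d. coeff p i * x ^ i) + x ^ d"
      using p(1) by (simp add: lessThan_Suc_atMost[symmetric] d_def)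
    finally have "x ^ d = (\<Sum>i<d. - coeff p i * x ^ i)" by (simp add: sum_negf eq_neg_iff_add_eq_0 add.commute)
    then show ?thesis by (intro memI[of _ "\<lambda>i. - coeff p i"]) (use p(2) Sr in auto)
  qed
  have multx: "x * y \<in> S'" if "y \<in> S'" for y
  proof -
    obtain s where s: "y = (\<Sum>j<d. s j * x ^ j)" "\<And>j. s j \<in> S"
      using \<open>y \<in> S'\<close> by (auto simp: S'_def)
    have "x * y = (\<Sum>j<d. s j * x ^ Suc j)" unfolding s(1) by (simp add: sum_distrib_left mult_ac)
    also have "\<dots> \<in> S'"
    proof (rule sum')
      fix j assume "j \<in> {..<d}"
      then have "x ^ Suc j \<in> S'" using low[of "Suc j"] xd by (cases "Suc j = d") auto
      then show "s j * x ^ Suc j \<in> S'" using smult s(2) by blast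
    qed
    finally show ?thesis .
  qed
  have multxj: "x ^ j * y \<in> S'" if "y \<in> S'" for j y
    using that by (induction j) (auto simp: mult.assoc intro: multx)
  have mult: "y * z \<in> S'" if "y \<in> S'" "z \<in> S'" for y z
  proof -
    obtain s where s: "y = (\<Sum>j<d. s j * x ^ j)" "\<And>j. s j \<in> S"
      using \<open>y \<in> S'\<close> by (auto simp: S'_def)
    have "y * z = (\<Sum>j<d. s j * (x ^ j * z))" unfolding s(1) by (simp add: sum_distrib_right mult.assoc)
    also have "\<dots> \<in> S'" by (rule sum') (use smult multxj that s(2) in blast)
    finally show ?thesis .
  qed
  have sub: "S \<subseteq> S'"
  proof
    fix a assume "a \<in> S"
    then show "a \<in> S'" using smult[OF low[OF d], of a] by simp
  qed
  have neg: "- y \<in> S'" if "y \<in> S'" for y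
    using smult[OF that, of "-1"] Sr by simp
  have x: "x \<in> S'" using multx[OF low[OF d]] by simp
  obtain A where A: "finite A" "A \<subseteq> S" "\<And>y. y \<in> S \<Longrightarrow> \<exists>c. y = (\<Sum>a\<in>A. of_int (c a :: int) * a)"
    using S unfolding fg_subring_def by blast
  define h where "h = (\<lambda>(a, j). a * x ^ j :: complex)"
  define T where "T = A \<times> {..<d}"
  have T: "finite T" using A by (simp add: T_def)
  have "\<exists>c. y = (\<Sum>b\<in>h ` T. of_int (c b :: int) * b)" if "y \<in> S'" for y
  proof -
    obtain s where s: "y = (\<Sum>j<d. s j * x ^ j)" "\<And>j. s j \<in> S"
      using \<open>y \<in> S'\<close> by (auto simp: S'_def)
    have "\<forall>j. \<exists>c :: complex \<Rightarrow> int. s j = (\<Sum>a\<in>A. of_int (c a) * a)"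
      using A(3)[OF s(2)] by blast
    from choice[OF this] obtain c :: "nat \<Rightarrow> complex \<Rightarrow> int"
      where c: "\<And>j. s j = (\<Sum>a\<in>A. of_int (c j a) * a)" by blast
    define e where "e = (\<lambda>(a, j). c j a)"
    have "y = (\<Sum>j<d. \<Sum>a\<in>A. of_int (c j a) * (a * x ^ j))"
      unfolding s(1) c by (simp add: sum_distrib_right mult.assoc)
    also have "\<dots> = (\<Sum>a\<in>A. \<Sum>j<d. of_int (c j a) * (a * x ^ j))" by (rule sum.swap)
    also have "\<dots> = (\<Sum>t\<in>T. of_int (e t) * h t)"
      unfolding T_def sum.cartesian_product by (intro sum.cong) (auto simp: e_def h_def)
    also have "\<dots> = (\<Sum>b\<in>h ` T. \<Sum>t\<in>{t\<in>T. h t = b}. of_int (e t) * h t)"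
      by (rule sum.image_gen[OF T])
    also have "\<dots> = (\<Sum>b\<in>h ` T. of_int (\<Sum>t\<in>{t\<in>T. h t = b}. e t) * b)"
      by (intro sum.cong refl) (simp add: sum_distrib_right)
    finally show ?thesis by (intro exI[of _ "\<lambda>b. \<Sum>t\<in>{t\<in>T. h t = b}. e t"])
  qed
  moreover have "h ` T \<subseteq> S'"
  proof
    fix b assume "b \<in> h ` T"
    then obtain a j where aj: "a \<in> A" "j < d" "b = a * x ^ j" by (auto simp: h_def T_def)
    then show "b \<in> S'" using smult[OF low[OF aj(2)]] A(2) by blast
  qed
  ultimately have "\<exists>A. finite A \<and> A \<subseteq> S' \<and> (\<forall>y\<in>S'. \<exists>c. y = (\<Sum>a\<in>A. of_int (c a :: int) * a))"
    using T by (intro exI[of _ "h ` T"]) blast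
  then have "fg_subring S'" unfolding fg_subring_def using add mult neg sub Sr(1) by blast
  then show thesis using that sub x by blast
qed

lemma algebraic_ints_in_fg_subring:
  assumes "finite X" "\<And>x. x \<in> X \<Longrightarrow> algebraic_int x"
  obtains S where "fg_subring S" "X \<subseteq> S"
proof -
  have "\<exists>S. fg_subring S \<and> X \<subseteq> S \<and> \<int> \<subseteq> S"
    using assms
  proof (induction X rule: finite_induct)
    case empty
    then show ?case using fg_subring_Ints by auto
  next
    case (insert x X)
    then obtain S where S: "fg_subring S" "X \<subseteq> S" "\<int> \<subseteq> S" by auto
    from insert.prems obtain p where p: "lead_coeff p = 1" "\<forall>i. coeff p i \<in> \<int>" "poly p x = 0"
      by (auto simp: algebraic_int.simps)
    then obtain S' where "fg_subring S'" "S \<subseteq> S'" "x \<in> S'"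
      using fg_subring_adjoin[OF S(1), of p x] S(3) by blast
    then show ?case using S by blast
  qed
  then show thesis using that by blast
qed

lemma algebraic_int_plus: "algebraic_int x \<Longrightarrow> algebraic_int y \<Longrightarrow> algebraic_int (x + y)"
  and algebraic_int_times: "algebraic_int x \<Longrightarrow> algebraic_int y \<Longrightarrow> algebraic_int (x * y)" for x y :: complex
proof -
  assume xy: "algebraic_int x" "algebraic_int y"
  obtain S where S: "fg_subring S" "{x,y} \<subseteq> S"
    by (rule algebraic_ints_in_fg_subring[of "{x,y}"]) (use xy in auto)
  show "algebraic_int (x + y)" "algebraic_int (x * y)"
    using S by (auto intro!: fg_subring_algebraic_int[OF S(1)] simp: fg_subring_def)
qed

lemma algebraic_int_sum:
  "(\<And>i. i \<in> I \<Longrightarrow> algebraic_int (f i :: complex)) \<Longrightarrow> algebraic_int (sum f I)"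
  by (induction I rule: infinite_finite_induct) (auto intro: algebraic_int_plus)

lemma algebraic_int_power:
  "algebraic_int (x :: complex) \<Longrightarrow> algebraic_int (x ^ n)"
  by (induction n) (auto intro: algebraic_int_times int_imp_algebraic_int)

text \<open>The coefficients of \<open>p\<close> lie in one finitely generated subring, to which \<open>x\<close> can be
  adjoined.\<close>

lemma algebraic_int_integrally_closed:
  fixes x :: complex
  assumes "lead_coeff p = 1" "\<And>i. algebraic_int (coeff p i)" "poly p x = 0"
  shows "algebraic_int x"
proof -
  obtain S where S: "fg_subring S" "coeff p ` {..degree p} \<subseteq> S"
    by (rule algebraic_ints_in_fg_subring[of "coeff p ` {..degree p}"]) (use assms in auto)
  have "coeff p i \<in> S" for i
    using S(2) fg_subring_zero[OF S(1)] coeff_eq_0[of p i] by (cases "i \<le> degree p") auto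
  then obtain S' where "fg_subring S'" "x \<in> S'"
    using fg_subring_adjoin[OF S(1) assms(1) _ assms(3)] by blast
  then show ?thesis by (rule fg_subring_algebraic_int)
qed

lemma algebraic_int_root_of_unity: "(z :: complex) ^ m = 1 \<Longrightarrow> m > 0 \<Longrightarrow> algebraic_int z"
  by (rule algebraic_int_root[of 1 "monom 1 m"]) (auto simp: poly_monom degree_monom_eq coeff_monom)

lemma algebraic_int_of_nat: "algebraic_int (of_nat n :: complex)"
  by (rule int_imp_algebraic_int) auto

section \<open>The residue field\<close>

locale modular_red =
  fixes p :: nat and r :: "complex \<Rightarrow> 'k :: field"
  assumes prime: "prime p" and red: "modular_reduction p r"
begin

lemma r_one: "r 1 = 1" and r_p: "r (of_nat p) = 0"
  and r_add: "algebraic_int x \<Longrightarrow> algebraic_int y \<Longrightarrow> r (x + y) = r x + r y"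
  and r_mult: "algebraic_int x \<Longrightarrow> algebraic_int y \<Longrightarrow> r (x * y) = r x * r y"
  and r_surj: "\<exists>x. algebraic_int x \<and> r x = a"
proof -
  have "a \<in> r ` {x. algebraic_int x}" using red by (simp add: modular_reduction_def)
  then show "\<exists>x. algebraic_int x \<and> r x = a" by auto
qed (use red in \<open>auto simp: modular_reduction_def\<close>)

lemma r_zero: "r 0 = 0"
  using r_add[of 0 0] by (metis add_cancel_right_right add.right_neutral algebraic_int_0)

lemma r_of_nat: "r (of_nat n) = of_nat n"
  by (induction n) (auto simp: r_zero r_one r_add int_imp_algebraic_int)

lemma r_minus: "algebraic_int x \<Longrightarrow> r (- x) = - r x"
  using r_add[of x "- x"] r_zero by (simp add: eq_neg_iff_add_eq_0 add.commute)

lemma r_of_int: "r (of_int n) = of_int n"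
  by (cases n rule: int_cases2) (auto simp: r_of_nat r_minus int_imp_algebraic_int)

lemma r_sum: "(\<And>i. i \<in> I \<Longrightarrow> algebraic_int (f i)) \<Longrightarrow> r (sum f I) = (\<Sum>i\<in>I. r (f i))"
proof (induction I rule: infinite_finite_induct)
  case (insert x F)
  then have "algebraic_int (sum f F)" by (intro algebraic_int_sum) auto
  then show ?case using insert by (simp add: r_add)
qed (auto simp: r_zero)

lemma r_power: "algebraic_int x \<Longrightarrow> r (x ^ n) = r x ^ n"
  by (induction n) (auto simp: r_one r_mult algebraic_int_power)

lemma char_k: "CHAR('k) = p"
proof (rule CHAR_eqI)
  show "of_nat p = (0 :: 'k)" using r_of_nat[of p] r_p by simp
  fix x assume x: "of_nat x = (0 :: 'k)"
  then have "CHAR('k) dvd x" by (simp add: of_nat_eq_0_iff_char_dvd)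
  moreover have "CHAR('k) dvd p" using \<open>of_nat p = (0 :: 'k)\<close> by (simp add: of_nat_eq_0_iff_char_dvd)
  moreover have "CHAR('k) \<noteq> 1" using of_nat_eq_0_iff_char_dvd[of 1, where 'a = 'k] by auto
  ultimately show "p dvd x" using prime prime_nat_iff by metis
qed

lemma of_int_eq_0_iff_dvd: "of_int c = (0 :: 'k) \<longleftrightarrow> int p dvd c"
  by (metis char_k of_int_eq_0_iff_char_dvd)

text \<open>A monic polynomial over the residue field lifts to a monic polynomial whose coefficients are
  algebraic integers; the reduction of a complex root of the lift is a root.\<close>

lemma alg_closed_k: "alg_closed TYPE('k)"
  unfolding alg_closed_def
proof (intro allI impI)
  fix f :: "'k poly" assume deg: "degree f > 0"
  define n where "n = degree f"
  define c where "c i = coeff f i / lead_coeff f" for i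
  have "\<forall>a :: 'k. \<exists>x. algebraic_int x \<and> r x = a" using r_surj by blast
  from choice[OF this] obtain l :: "'k \<Rightarrow> complex" where l: "\<And>a. algebraic_int (l a)" "\<And>a. r (l a) = a"
    by blast
  define F where "F = monom 1 n + (\<Sum>i<n. monom (l (c i)) i)"
  have cF: "coeff F i = (if i = n then 1 else if i < n then l (c i) else 0)" for i
    by (auto simp: F_def coeff_sum)
  have dF: "degree F = n"
    by (rule antisym[OF degree_le]) (auto simp: cF intro: le_degree)
  then have "degree F > 0" using deg n_def by simp
  then obtain z where z: "poly F z = 0" using alg_closed_complex by (auto simp: alg_closed_def)
  have za: "algebraic_int z"
    by (rule algebraic_int_integrally_closed[of F]) (use dF z l in \<open>auto simp: cF int_imp_algebraic_int\<close>)
  have "r (poly F z) = (\<Sum>i\<le>n. r (coeff F i * z ^ i))"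
    unfolding poly_altdef dF
    by (rule r_sum) (auto simp: cF l za algebraic_int_times algebraic_int_power)
  also have "\<dots> = (\<Sum>i\<le>n. c i * r z ^ i)"
  proof (rule sum.cong[OF refl])
    fix i assume i: "i \<in> {..n}"
    have "r (coeff F i) = c i" using i deg l by (auto simp: cF c_def n_def r_one)
    moreover have "algebraic_int (coeff F i)" using l by (auto simp: cF)
    ultimately show "r (coeff F i * z ^ i) = c i * r z ^ i"
      using za by (simp add: r_mult r_power algebraic_int_power)
  qed
  also have "\<dots> = poly f (r z) / lead_coeff f"
    by (simp add: poly_altdef c_def n_def sum_divide_distrib)
  finally have "poly f (r z) = 0" using z deg r_zero by auto
  then show "\<exists>x. poly f x = 0" ..
qed

text \<open>If \<open>u \<noteq> 1\<close> is an \<open>m\<close>-th root of unity, then \<open>1 + u + \<dots> + u^(m-1) = 0\<close>; if \<open>u\<close> reduced to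
  \<open>1\<close>, then \<open>m\<close> would be zero in the residue field.\<close>

lemma r_inj_roots:
  assumes m: "m > 0" "\<not> p dvd m"
  shows "inj_on r {z. z ^ m = 1}"
proof (rule inj_onI)
  fix x y :: complex assume xy: "x \<in> {z. z ^ m = 1}" "y \<in> {z. z ^ m = 1}" "r x = r y"
  have y0: "y \<noteq> 0" using xy m by (auto simp: power_0_left)
  define u where "u = x / y"
  have um: "u ^ m = 1" using xy by (simp add: u_def power_divide)
  have a: "algebraic_int u" "algebraic_int x" "algebraic_int y"
    using um xy algebraic_int_root_of_unity m by auto
  have "r x = r u * r y" using a r_mult[of u y] y0 by (simp add: u_def)
  moreover have "r y \<noteq> 0"
  proof
    assume "r y = 0"
    then have "r (y ^ m) = 0" using r_power[OF a(3)] m by simp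
    then show False using xy r_one by simp
  qed
  ultimately have ru: "r u = 1" using xy(3) by simp
  have "u = 1"
  proof (rule ccontr)
    assume "u \<noteq> 1"
    then have "(\<Sum>i<m. u ^ i) = 0" using um by (simp add: sum_gp_strict)
    moreover have "r (\<Sum>i<m. u ^ i) = (\<Sum>i<m. r u ^ i)"
      using a by (subst r_sum) (auto simp: r_power algebraic_int_power)
    ultimately have "of_nat m = (0 :: 'k)" using ru r_zero by simp
    then show False using m(2) by (simp add: of_nat_eq_0_iff_char_dvd char_k)
  qed
  then show "x = y" using y0 by (simp add: u_def)
qed

text \<open>By counting: there are \<open>m\<close> roots of unity among the complex numbers, and at most
  \<open>m\<close> in a field.\<close>

lemma r_bij_roots:
  assumes m: "m > 0" "\<not> p dvd m"
  shows "bij_betw r {z. z ^ m = 1} {a. a ^ m = 1}"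
proof -
  have sub: "r ` {z. z ^ m = 1} \<subseteq> {a. a ^ m = 1}"
  proof safe
    fix z :: complex assume z: "z ^ m = 1"
    have "r z ^ m = r (z ^ m)" using r_power algebraic_int_root_of_unity[OF z m(1)] by simp
    then show "r z ^ m = 1" using z r_one by simp
  qed
  let ?f = "monom 1 m - 1 :: 'k poly"
  have c: "coeff ?f m = 1" using m by (simp add: coeff_1)
  then have f0: "?f \<noteq> 0" by (metis coeff_0 zero_neq_one)
  have roots: "{a. a ^ m = (1 :: 'k)} = {a. poly ?f a = 0}" by (auto simp: poly_monom)
  have "degree ?f \<le> m" by (rule degree_le) (auto simp: coeff_1)
  then have card: "card {a. a ^ m = (1 :: 'k)} \<le> m" "finite {a. a ^ m = (1 :: 'k)}"
    unfolding roots using card_poly_roots_bound[OF f0] poly_roots_finite[OF f0] by auto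
  have "card (r ` {z. z ^ m = 1}) = m"
    using card_image[OF r_inj_roots[OF m]] card_roots_unity_eq[OF m(1)] by simp
  then have "r ` {z. z ^ m = 1} = {a. a ^ m = 1}"
    using card sub card_mono[OF card(2) sub] by (intro card_subset_eq) auto
  then show ?thesis using r_inj_roots[OF m] by (simp add: bij_betw_def)
qed

end

section \<open>Brauer characters\<close>

lemma order_prod_linear:
  "Polynomial.order x (\<Prod>a\<leftarrow>as. [:- a, 1:]) = count_list as (x :: 'k :: field)"
proof (induction as)
  case (Cons a as)
  have nz: "(\<Prod>a\<leftarrow>as. [:- a, 1:]) \<noteq> (0 :: 'k poly)" by (auto simp: prod_list_zero_iff)
  then have "[:- a, 1:] * (\<Prod>a\<leftarrow>as. [:- a, 1:]) \<noteq> 0"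
    by (metis mult_eq_0_iff pCons_eq_0_iff one_neq_zero)
  then have "Polynomial.order x ([:- a, 1:] * (\<Prod>a\<leftarrow>as. [:- a, 1:])) =
    Polynomial.order x [:- a, 1:] + count_list as x"
    using order_mult Cons by metis
  moreover have "Polynomial.order x [:- a, 1:] = (if a = x then 1 else 0)"
    using order_power_n_n[of a 1] order_0I[of "[:- a, 1:]" x] by auto
  ultimately show ?case by simp
qed simp

lemma sum_count_list:
  fixes as :: "'k :: field list"
  assumes "finite S" "set as \<subseteq> S"
  shows "(\<Sum>x\<in>S. of_nat (count_list as x) * x) = sum_list as"
  using assms(2)
proof (induction as)
  case (Cons a as)
  have "(\<Sum>x\<in>S. of_nat (count_list (a # as) x) * x) =
     (\<Sum>x\<in>S. of_nat (count_list as x) * x + (if x = a then a else 0))"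
    by (intro sum.cong) (auto simp: algebra_simps)
  also have "\<dots> = sum_list as + a" using Cons assms(1) by (simp add: sum.distrib)
  finally show ?case by simp
qed simp

lemma p_regularD:
  "p_regular p G g \<Longrightarrow> g \<in> carrier G" "p_regular p G g \<Longrightarrow> \<not> p dvd group.ord G g"
  by (auto simp: p_regular_def)

lemma IBr_cases:
  assumes "\<theta> \<in> IBr p r G"
  obtains d R where "irreducible_representation G d R" "\<theta> = brauer_character p r G R"
  using assms by (auto simp: IBr_def)

lemma IBr_outside: "\<theta> \<in> IBr p r G \<Longrightarrow> \<not> p_regular p G g \<Longrightarrow> \<theta> g = 0"
  by (auto simp: IBr_def brauer_character_def)

context modular_red
begin

lemma eigenvalues_root_of_unity:
  fixes R :: "'g \<Rightarrow> 'k mat"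
  assumes G: "group G" and R: "representation G d R" and g: "g \<in> carrier G"
    and a: "poly (char_poly (R g)) a = 0"
  shows "a ^ group.ord G g = 1"
proof -
  interpret group G by fact
  have Rg: "R g \<in> carrier_mat d d" by (rule representationD(1)[OF G R g])
  obtain v where v: "eigenvector (R g) v a" using a eigenvalue_root_char_poly[OF Rg] by (auto simp: eigenvalue_def)
  then have vc: "v \<in> carrier_vec d" "v \<noteq> 0\<^sub>v d" using Rg by (auto simp: eigenvector_def)
  have "R g ^\<^sub>m ord g = 1\<^sub>m d"
    using representation_pow[OF G R g, of "ord g"] representationD(2)[OF G R] g by simp
  then have e: "v = a ^ ord g \<cdot>\<^sub>v v" using eigenvector_pow[OF Rg v, of "ord g"] vc by simp
  obtain i where i: "i < d" "v $ i \<noteq> 0" using vc by (metis eq_vecI carrier_vecD index_zero_vec)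
  have "v $ i = a ^ ord g * v $ i" using arg_cong[OF e, of "\<lambda>v. v $ i"] i vc by simp
  then show ?thesis using i by simp
qed

lemma brauer_algebraic_int:
  assumes G: "group G" "finite (carrier G)"
  shows "algebraic_int (brauer_character p r G R g)"
proof (cases "p_regular p G g")
  case True
  then have "0 < group.ord G g" using G group.ord_ge_1 p_regularD(1) by fastforce
  then show ?thesis unfolding brauer_character_def
    by (auto intro!: algebraic_int_sum algebraic_int_times[OF algebraic_int_of_nat] algebraic_int_root_of_unity)
qed (simp add: brauer_character_def)

text \<open>The reduction map takes the lifted eigenvalues back to the eigenvalues, with their multiplicities.\<close>

lemma brauer_trace:
  fixes R :: "'g \<Rightarrow> 'k mat"
  assumes G: "group G" "finite (carrier G)" and R: "representation G d R" and g: "p_regular p G g"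
  shows "r (brauer_character p r G R g) = mat_trace (R g)"
proof -
  define m where "m = group.ord G g"
  have gc: "g \<in> carrier G" and m: "m > 0" "\<not> p dvd m"
    using G group.ord_ge_1 p_regularD[OF g] by (fastforce simp: m_def)+
  have Rg: "R g \<in> carrier_mat d d" by (rule representationD(1)[OF G(1) R gc])
  obtain as where as: "char_poly (R g) = (\<Prod>a\<leftarrow>as. [:- a, 1:])"
    "\<And>q. mat_trace (R g ^\<^sub>m q) = (\<Sum>a\<leftarrow>as. a ^ q)"
    by (rule eigenvalue_list[OF alg_closed_k Rg]) (rule that)
  have "a ^ m = 1" if "a \<in> set as" for a
  proof -
    have "poly (char_poly (R g)) a = 0" unfolding as(1) using that by (induction as) auto
    then show ?thesis unfolding m_def by (rule eigenvalues_root_of_unity[OF G(1) R gc])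
  qed
  then have sub: "set as \<subseteq> {a. a ^ m = 1}" by auto
  have bij: "bij_betw r {z. z ^ m = 1} {a. a ^ m = 1}" by (rule r_bij_roots[OF m])
  have fin: "finite {a. a ^ m = (1 :: 'k)}"
    using bij_betw_finite[OF bij] finite_roots_unity[of m, where 'a = complex] m by simp
  have al: "algebraic_int (of_nat (count_list as (r z)) * z)" if "z ^ m = 1" for z
    by (rule algebraic_int_times[OF algebraic_int_of_nat algebraic_int_root_of_unity[OF that m(1)]])
  have "r (brauer_character p r G R g) = (\<Sum>z | z ^ m = 1. r (of_nat (count_list as (r z)) * z))"
    unfolding brauer_character_def using g
    by (simp add: m_def[symmetric] as(1) order_prod_linear) (rule r_sum, use al in auto)
  also have "\<dots> = (\<Sum>z | z ^ m = 1. of_nat (count_list as (r z)) * r z)"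
    by (intro sum.cong refl)
      (auto simp: r_mult r_of_nat algebraic_int_root_of_unity[OF _ m(1)] int_imp_algebraic_int)
  also have "\<dots> = (\<Sum>a | a ^ m = 1. of_nat (count_list as a) * a)"
    by (rule sum.reindex_bij_betw[OF bij])
  also have "\<dots> = sum_list as" by (rule sum_count_list[OF fin sub])
  also have "\<dots> = mat_trace (R g)" using as(2)[of 1] Rg by simp
  finally show ?thesis .
qed

lemma frobenius_of_int: "(of_int c :: 'k) ^ (p ^ b) = of_int c"
proof -
  define k where "k = nat (c mod int p)"
  have p0: "p > 0" using prime prime_gt_0_nat by blast
  have "of_int c - of_int (c mod int p) = (0 :: 'k)"
    unfolding of_int_diff[symmetric] of_int_eq_0_iff_dvd by (simp add: minus_mod_eq_mult_div)
  then have e: "(of_int c :: 'k) = of_nat k" using p0 by (simp add: k_def)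
  have "(of_nat k :: 'k) = (\<Sum>i<k. 1)" by simp
  also have "\<dots> ^ (p ^ b) = (\<Sum>i<k. 1 ^ (p ^ b))"
    by (rule freshmans_dream_sum') (use prime char_k in auto)
  finally show ?thesis unfolding e by simp
qed

lemma frobenius_sum_list: "(sum_list as :: 'k) ^ (p ^ b) = (\<Sum>a\<leftarrow>as. a ^ (p ^ b))"
proof (induction as)
  case Nil
  then show ?case using prime prime_gt_0_nat by (auto simp: power_0_left)
next
  case (Cons a as)
  then show ?case using freshmans_dream'[of "p ^ b" b a "sum_list as"] prime char_k by auto
qed

lemma brauer_eq_of_similar:
  fixes R S :: "'g \<Rightarrow> 'k mat"
  assumes "\<And>g. g \<in> carrier G \<Longrightarrow> char_poly (R g) = char_poly (S g)"
  shows "brauer_character p r G R = brauer_character p r G S"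
  by (rule ext) (auto simp: brauer_character_def p_regular_def assms)

text \<open>An integral relation between Brauer characters gives a relation between traces in
  characteristic \<open>p\<close>, first on \<open>p\<close>-regular elements. It holds on all of \<open>G\<close>, since a \<open>p\<close>-power of
  any element is \<open>p\<close>-regular and the trace of \<open>M^q\<close> is the \<open>q\<close>-th power of the trace of \<open>M\<close>
  if \<open>q\<close> is a power of \<open>p\<close>.\<close>

lemma IBr_relation_mod_p:
  assumes G: "group G" "finite (carrier G)" and T: "finite T" "T \<subseteq> IBr p r G"
    and rel: "\<And>g. (\<Sum>\<theta>\<in>T. of_int (c \<theta>) * \<theta> g) = 0" and "\<theta> \<in> T"
  shows "int p dvd c \<theta>"
proof -
  interpret group G by fact
  have "\<forall>\<theta>\<in>T. \<exists>d R. irreducible_representation G d R \<and> \<theta> = brauer_character p r G R"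
    using T(2) by (metis IBr_cases subsetD)
  then obtain d R where R: "\<And>\<theta>. \<theta> \<in> T \<Longrightarrow> irreducible_representation G (d \<theta>) (R \<theta>)"
    "\<And>\<theta>. \<theta> \<in> T \<Longrightarrow> \<theta> = brauer_character p r G (R \<theta>)" by metis
  have "of_int (c \<theta>) = (0 :: 'k)"
  proof (rule traces_independent[where c = "\<lambda>\<theta>. of_int (c \<theta>)" and i = \<theta>, OF alg_closed_k G(1) T(1) R(1)])
    fix \<chi> \<psi> A assume *: "\<chi> \<in> T" "\<psi> \<in> T" "\<chi> \<noteq> \<psi>" "A \<in> carrier_mat (d \<chi>) (d \<psi>)"
      "intertwines G A (R \<chi>) (R \<psi>)"
    show "A = 0\<^sub>m (d \<chi>) (d \<psi>)"
    proof (rule ccontr)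
      assume "A \<noteq> 0\<^sub>m (d \<chi>) (d \<psi>)"
      then have "char_poly (R \<chi> g) = char_poly (R \<psi> g)" if "g \<in> carrier G" for g
        using similar_of_intertwiner(1)[OF G(1) R(1)[OF *(1)] R(1)[OF *(2)] *(4,5) _ that] by blast
      then have "brauer_character p r G (R \<chi>) = brauer_character p r G (R \<psi>)"
        by (rule brauer_eq_of_similar)
      then show False using R(2) *(1-3) by metis
    qed
  next
    fix g assume g: "g \<in> carrier G"
    have o: "ord g > 0" using ord_ge_1[OF G(2) g] by simp
    define b where "b = multiplicity p (ord g)"
    obtain m where m: "ord g = p ^ b * m" "\<not> p dvd m"
      unfolding b_def using multiplicity_decompose'[of "ord g" p] o prime
      by (metis not_prime_unit not_gr_zero)
    define h where "h = g [^]\<^bsub>G\<^esub> (p ^ b)"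
    have hc: "h \<in> carrier G" using g by (simp add: h_def)
    have "h [^]\<^bsub>G\<^esub> m = \<one>\<^bsub>G\<^esub>" using g by (simp add: h_def nat_pow_pow m(1)[symmetric])
    then have "ord h dvd m" using pow_eq_id[OF hc] by simp
    then have h: "p_regular p G h" unfolding p_regular_def using hc m(2) dvd_trans by blast
    have pw: "mat_trace (R \<theta> g) ^ (p ^ b) = r (\<theta> h)" if \<theta>: "\<theta> \<in> T" for \<theta>
    proof -
      note rep = irreducibleD(1)[OF R(1)[OF \<theta>]]
      obtain as where as: "\<And>q. mat_trace (R \<theta> g ^\<^sub>m q) = (\<Sum>a\<leftarrow>as. a ^ q)"
        by (rule eigenvalue_list[OF alg_closed_k representationD(1)[OF G(1) rep g]]) (rule that)
      have "mat_trace (R \<theta> g) = sum_list as" using as[of 1] representationD(1)[OF G(1) rep g] by simp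
      then have "mat_trace (R \<theta> g) ^ (p ^ b) = mat_trace (R \<theta> g ^\<^sub>m (p ^ b))"
        unfolding as by (simp add: frobenius_sum_list)
      also have "\<dots> = mat_trace (R \<theta> h)" unfolding h_def representation_pow[OF G(1) rep g] ..
      also have "\<dots> = r (\<theta> h)" using brauer_trace[OF G rep h] R(2)[OF \<theta>] by simp
      finally show ?thesis .
    qed
    have al: "algebraic_int (\<theta> h)" if "\<theta> \<in> T" for \<theta>
      using brauer_algebraic_int[OF G, of "R \<theta>" h] R(2)[OF that] by simp
    have "(\<Sum>\<theta>\<in>T. of_int (c \<theta>) * mat_trace (R \<theta> g)) ^ (p ^ b) =
      (\<Sum>\<theta>\<in>T. (of_int (c \<theta>) * mat_trace (R \<theta> g)) ^ (p ^ b))"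
      by (rule freshmans_dream_sum') (use prime char_k in auto)
    also have "\<dots> = (\<Sum>\<theta>\<in>T. r (of_int (c \<theta>) * \<theta> h))"
      by (intro sum.cong refl)
        (simp add: power_mult_distrib frobenius_of_int pw r_mult r_of_int al int_imp_algebraic_int)
    also have "\<dots> = r (\<Sum>\<theta>\<in>T. of_int (c \<theta>) * \<theta> h)"
      by (rule r_sum[symmetric]) (intro algebraic_int_times int_imp_algebraic_int Ints_of_int al)
    also have "\<dots> = 0" using rel r_zero by simp
    finally show "(\<Sum>\<theta>\<in>T. of_int (c \<theta>) * mat_trace (R \<theta> g)) = 0" by simp
  qed (use \<open>\<theta> \<in> T\<close> in auto)
  then show ?thesis by (simp add: of_int_eq_0_iff_dvd)
qed

text \<open>Infinite descent: all coefficients of an integral relation are divisible by \<open>p\<close>, and dividing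
  them by \<open>p\<close> leaves a relation.\<close>

lemma IBr_independent:
  assumes G: "group G" "finite (carrier G)" and T: "finite T" "T \<subseteq> IBr p r G"
    and rel: "\<And>g. (\<Sum>\<theta>\<in>T. of_int (c \<theta>) * \<theta> g) = 0" and "\<theta> \<in> T"
  shows "c \<theta> = 0"
proof -
  have dvd: "int p ^ n dvd c \<theta>"
    if "\<And>g. (\<Sum>\<theta>\<in>T. of_int (c \<theta>) * \<theta> g) = 0" "\<theta> \<in> T" for n c \<theta>
    using that
  proof (induction n arbitrary: c)
    case (Suc n)
    have "\<forall>\<theta>\<in>T. \<exists>e. c \<theta> = int p * e"
      using IBr_relation_mod_p[OF G T Suc.prems(1)] by (auto simp: dvd_def)
    then obtain e where e: "\<And>\<theta>. \<theta> \<in> T \<Longrightarrow> c \<theta> = int p * e \<theta>" by metis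
    have "(\<Sum>\<theta>\<in>T. of_int (e \<theta>) * \<theta> g) = 0" for g
    proof -
      have "of_nat p * (\<Sum>\<theta>\<in>T. of_int (e \<theta>) * \<theta> g) = (\<Sum>\<theta>\<in>T. of_int (c \<theta>) * \<theta> g)"
        unfolding sum_distrib_left by (intro sum.cong) (auto simp: e)
      then show ?thesis using Suc.prems(1)[of g] prime by (auto simp: prime_gt_0_nat)
    qed
    then have "int p ^ n dvd e \<theta>" using Suc.IH Suc.prems(2) by blast
    then show ?case using e[OF Suc.prems(2)] by simp
  qed simp
  have p2: "p \<ge> 2" using prime prime_ge_2_nat by blast
  define n where "n = nat \<bar>c \<theta>\<bar>"
  have "\<bar>c \<theta>\<bar> < int p ^ n"
  proof -
    have "n < 2 ^ n" by simp
    also have "(2::nat) ^ n \<le> p ^ n" using p2 by (rule power_mono) simp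
    finally have "int n < int (p ^ n)" by linarith
    then show ?thesis by (simp add: n_def)
  qed
  moreover have "int p ^ n dvd c \<theta>" using dvd[OF rel \<open>\<theta> \<in> T\<close>] .
  ultimately show ?thesis using zdvd_imp_le by (metis abs_of_nonneg dvd_abs_iff linorder_not_less zero_le_power of_nat_0_le_iff zdvd_not_zless zero_less_abs_iff)
qed

end

section \<open>Integrally independent sets of class functions\<close>

text \<open>Linear independence over the integers, the form of independence that Brauer characters inherit from traces
  in characteristic \<open>p\<close> and the one that makes decomposition numbers unique. Only finite subsets are
  tested, so that the set itself may be infinite.\<close>

definition int_independent :: "('g \<Rightarrow> complex) set \<Rightarrow> bool" where
  "int_independent B \<longleftrightarrow> (\<forall>T c. finite T \<longrightarrow> T \<subseteq> B \<longrightarrow>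
     (\<forall>g. (\<Sum>\<theta>\<in>T. of_int (c \<theta>) * \<theta> g) = 0) \<longrightarrow> (\<forall>\<theta>\<in>T. c \<theta> = 0))"

lemma int_independentD:
  assumes "int_independent B" "finite T" "T \<subseteq> B"
    "\<And>g. (\<Sum>\<theta>\<in>T. of_int (c \<theta>) * \<theta> g) = 0" "\<theta> \<in> T"
  shows "c \<theta> = 0"
  using assms unfolding int_independent_def by blast

lemma int_independent_Irr: "group G \<Longrightarrow> int_independent (Irr G)"
  unfolding int_independent_def
proof (intro allI impI ballI)
  fix T c \<theta> assume *: "group G" "finite T" "T \<subseteq> Irr G"
    "\<forall>g. (\<Sum>\<theta>\<in>T. of_int (c \<theta>) * \<theta> g) = 0" "\<theta> \<in> T"
  have "complex_of_int (c \<theta>) = 0"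
    by (rule Irr_independent[where c = "\<lambda>\<theta>. of_int (c \<theta>)", OF *(1-3)]) (use * in auto)
  then show "c \<theta> = 0" by simp
qed

lemma (in modular_red) int_independent_IBr:
  "group G \<Longrightarrow> finite (carrier G) \<Longrightarrow> int_independent (IBr p r G)"
  unfolding int_independent_def using IBr_independent by blast

lemma int_independent_coeffs_eq:
  assumes "int_independent B" "finite T" "T \<subseteq> B"
    and "\<And>g. (\<Sum>\<theta>\<in>T. of_int (a \<theta>) * \<theta> g) = (\<Sum>\<theta>\<in>T. of_int (b \<theta>) * \<theta> g)" "\<theta> \<in> T"
  shows "a \<theta> = b \<theta>"
proof -
  have "a \<theta> - b \<theta> = 0"
    by (rule int_independentD[OF assms(1-3), of "\<lambda>\<theta>. a \<theta> - b \<theta>"])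
      (use assms(4,5) in \<open>auto simp: ring_distribs sum_subtractf\<close>)
  then show ?thesis by simp
qed

lemma sum_indicator:
  fixes T :: "('g \<Rightarrow> complex) set"
  assumes "finite T" "a \<in> T"
  shows "(\<Sum>\<theta>\<in>T. of_int (if \<theta> = a then 1 else 0) * \<theta> g) = a g"
proof -
  have "(\<Sum>\<theta>\<in>T. of_int (if \<theta> = a then 1 else 0) * \<theta> g) = (\<Sum>\<theta>\<in>T. if \<theta> = a then a g else 0)"
    by (intro sum.cong) auto
  then show ?thesis using assms by simp
qed

lemma int_independent_one_not_two:
  assumes B: "int_independent B" and "{a, x, y} \<subseteq> B" "x \<noteq> y" "\<And>g. a g = x g + y g"
  shows False
proof -
  let ?i = "\<lambda>b \<theta>. if \<theta> = b then 1 else 0 :: int"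
  let ?T = "{a, x, y}"
  have "?i a \<theta> = ?i x \<theta> + ?i y \<theta>" if \<theta>: "\<theta> \<in> ?T" for \<theta>
  proof (rule int_independent_coeffs_eq[OF B _ assms(2) _ \<theta>])
    fix g
    show "(\<Sum>\<theta>\<in>?T. of_int (?i a \<theta>) * \<theta> g) = (\<Sum>\<theta>\<in>?T. of_int (?i x \<theta> + ?i y \<theta>) * \<theta> g)"
      unfolding of_int_add distrib_right sum.distrib
      using sum_indicator[of ?T a g] sum_indicator[of ?T x g] sum_indicator[of ?T y g] assms(4)[of g]
      by (simp only: finite.intros insert_iff simp_thms)
  qed simp
  from this[of x] this[of y] show False using assms(3) by (auto split: if_splits)
qed

lemma int_independent_two_two:
  assumes B: "int_independent B" and "{a, b, x, y} \<subseteq> B" "x \<noteq> y" "\<And>g. a g + b g = x g + y g"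
  shows "a = x \<and> b = y \<or> a = y \<and> b = x"
proof -
  let ?i = "\<lambda>b \<theta>. if \<theta> = b then 1 else 0 :: int"
  let ?T = "{a, b, x, y}"
  have "?i a \<theta> + ?i b \<theta> = ?i x \<theta> + ?i y \<theta>" if \<theta>: "\<theta> \<in> ?T" for \<theta>
  proof (rule int_independent_coeffs_eq[OF B _ assms(2) _ \<theta>])
    fix g
    show "(\<Sum>\<theta>\<in>?T. of_int (?i a \<theta> + ?i b \<theta>) * \<theta> g) = (\<Sum>\<theta>\<in>?T. of_int (?i x \<theta> + ?i y \<theta>) * \<theta> g)"
      unfolding of_int_add distrib_right sum.distrib
      using sum_indicator[of ?T a g] sum_indicator[of ?T b g] sum_indicator[of ?T x g]
        sum_indicator[of ?T y g] assms(4)[of g]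
      by (simp only: finite.intros insert_iff simp_thms)
  qed simp
  from this[of x] this[of y] show ?thesis using assms(3) by (auto split: if_splits)
qed

section \<open>Clifford theory for a subgroup of index two\<close>

text \<open>The subgroup \<open>H\<close> is the kernel of a sign \<open>eps\<close>, and \<open>s\<close> represents
  its other coset. For the symmetric group, \<open>eps\<close> is the sign of a permutation and \<open>s\<close> is a
  transposition.\<close>

locale index_two = group G for G :: "('g, 'b) monoid_scheme" (structure) +
  fixes H :: "('g, 'b) monoid_scheme" and eps :: "'g \<Rightarrow> int" and s :: 'g
  assumes fin: "finite (carrier G)"
    and H_eq: "H = G\<lparr>carrier := {g \<in> carrier G. eps g = 1}\<rparr>"
    and eps_mult: "g \<in> carrier G \<Longrightarrow> h \<in> carrier G \<Longrightarrow> eps (g \<otimes> h) = eps g * eps h"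
    and eps_cases: "g \<in> carrier G \<Longrightarrow> eps g = 1 \<or> eps g = -1"
    and s: "s \<in> carrier G" "eps s = -1"
begin

lemma H_carrier: "g \<in> carrier H \<longleftrightarrow> g \<in> carrier G \<and> eps g = 1"
  by (simp add: H_eq)

lemma H_sub: "g \<in> carrier H \<Longrightarrow> g \<in> carrier G"
  by (simp add: H_carrier)

lemma H_simps: "mult H = mult G" "one H = one G"
  by (simp_all add: H_eq)

lemma eps_one: "eps \<one> = 1"
  using eps_mult[of \<one> \<one>] eps_cases[of \<one>] by auto

lemma eps_inv: "g \<in> carrier G \<Longrightarrow> eps (inv g) = eps g"
  using eps_mult[of g "inv g"] eps_one eps_cases[of g] eps_cases[of "inv g"] by auto

lemma subgroup_H: "subgroup {g \<in> carrier G. eps g = 1} G"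
  by (rule subgroupI) (auto simp: eps_mult eps_inv eps_one intro: exI[of _ \<one>])

lemma H_group: "group H"
  unfolding H_eq by (rule subgroup.subgroup_is_group[OF subgroup_H is_group])

lemma fin_H: "finite (carrier H)"
  using fin by (simp add: H_eq)

lemma pow_H: "g [^]\<^bsub>H\<^esub> (q :: nat) = g [^] q"
  unfolding H_eq by (rule nat_pow_consistent[symmetric])

lemma ord_H: "group.ord H g = ord g"
  unfolding group.ord_def[OF H_group] ord_def pow_H H_simps ..

lemma p_regular_H: "p_regular p H g \<longleftrightarrow> g \<in> carrier H \<and> p_regular p G g"
  by (auto simp: p_regular_def ord_H H_carrier)

definition twist :: "('g \<Rightarrow> 'k :: field mat) \<Rightarrow> 'g \<Rightarrow> 'k mat" where
  "twist R g = of_int (eps g) \<cdot>\<^sub>m R g"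

definition eps_times :: "('g \<Rightarrow> complex) \<Rightarrow> 'g \<Rightarrow> complex" where
  "eps_times f g = of_int (eps g) * f g"

definition conj_elt :: "'g \<Rightarrow> 'g" where
  "conj_elt g = inv s \<otimes> g \<otimes> s"

definition conj_fun :: "('g \<Rightarrow> complex) \<Rightarrow> 'g \<Rightarrow> complex" where
  "conj_fun f g = (if g \<in> carrier H then f (conj_elt g) else 0)"

lemma conj_elt_closed: "g \<in> carrier G \<Longrightarrow> conj_elt g \<in> carrier G"
  using s by (simp add: conj_elt_def)

lemma conj_elt_H: "g \<in> carrier H \<Longrightarrow> conj_elt g \<in> carrier H"
  using s eps_cases[OF s(1)] by (auto simp: H_carrier conj_elt_def eps_mult eps_inv)

lemma conj_elt_mult: "g \<in> carrier G \<Longrightarrow> h \<in> carrier G \<Longrightarrow> conj_elt (g \<otimes> h) = conj_elt g \<otimes> conj_elt h"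
  using s by (simp add: conj_elt_def m_assoc) (simp add: m_assoc[symmetric])

lemma conj_elt_one: "conj_elt \<one> = \<one>"
  using s by (simp add: conj_elt_def)

lemma s_conj_elt: "g \<in> carrier G \<Longrightarrow> s \<otimes> conj_elt g = g \<otimes> s"
  using s by (simp add: conj_elt_def m_assoc[symmetric])

lemma ss_H: "s \<otimes> s \<in> carrier H"
  using s by (simp add: H_carrier eps_mult)

lemma conj_elt_conj_elt: "g \<in> carrier G \<Longrightarrow> conj_elt (conj_elt g) = inv (s \<otimes> s) \<otimes> g \<otimes> (s \<otimes> s)"
  using s by (simp add: conj_elt_def m_assoc inv_mult_group)

lemma conj_elt_surj: "g \<in> carrier H \<Longrightarrow> \<exists>h\<in>carrier H. conj_elt h = g"
proof (rule bexI[of _ "s \<otimes> g \<otimes> inv s"])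
  assume g: "g \<in> carrier H"
  show "conj_elt (s \<otimes> g \<otimes> inv s) = g"
    using g s by (simp add: conj_elt_def m_assoc H_carrier) (simp add: m_assoc[symmetric])
  show "s \<otimes> g \<otimes> inv s \<in> carrier H"
    using g s by (auto simp: H_carrier eps_mult eps_inv)
qed

lemma conj_elt_pow: "g \<in> carrier G \<Longrightarrow> conj_elt (g [^] (q :: nat)) = conj_elt g [^] q"
  by (induction q) (auto simp: conj_elt_one conj_elt_mult conj_elt_closed)

lemma conj_elt_eq_one: "g \<in> carrier G \<Longrightarrow> conj_elt g = \<one> \<longleftrightarrow> g = \<one>"
  using s_conj_elt[of g] conj_elt_one right_cancel[of s g \<one>] s(1) by auto

lemma ord_conj_elt: "g \<in> carrier G \<Longrightarrow> ord (conj_elt g) = ord g"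
  unfolding ord_def using conj_elt_pow conj_elt_eq_one by (metis (no_types, opaque_lifting) nat_pow_closed)

lemma p_regular_conj_elt: "g \<in> carrier H \<Longrightarrow> p_regular p H (conj_elt g) \<longleftrightarrow> p_regular p H g"
  by (simp add: p_regular_def ord_H ord_conj_elt conj_elt_H H_sub)

lemma coset: "g \<in> carrier G \<Longrightarrow> g \<notin> carrier H \<Longrightarrow> \<exists>h\<in>carrier H. g = s \<otimes> h"
proof (rule bexI[of _ "inv s \<otimes> g"])
  assume g: "g \<in> carrier G" "g \<notin> carrier H"
  then have "eps g = -1" using eps_cases by (auto simp: H_carrier)
  then show "inv s \<otimes> g \<in> carrier H" using g s by (simp add: H_carrier eps_mult eps_inv)
  show "g = s \<otimes> (inv s \<otimes> g)" using g s by (simp add: m_assoc[symmetric])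
qed

lemma representation_H:
  fixes R :: "'g \<Rightarrow> 'k :: field mat"
  assumes "representation G d R"
  shows "representation H d R"
  using assms unfolding representation_iff[OF is_group] representation_iff[OF H_group]
  by (auto simp: H_simps H_sub)

lemma twist_representation:
  fixes R :: "'g \<Rightarrow> 'k :: field mat"
  assumes R: "representation G d R"
  shows "representation G d (twist R)"
proof -
  note RD = representationD[OF is_group R]
  have "twist R (g \<otimes> h) = twist R g * twist R h" if g: "g \<in> carrier G" "h \<in> carrier G" for g h
  proof -
    note c = RD(1)[OF g(1)] RD(1)[OF g(2)]
    have "twist R g * twist R h = of_int (eps g) \<cdot>\<^sub>m (of_int (eps h) \<cdot>\<^sub>m (R g * R h))"
      unfolding twist_def mult_smult_assoc_mat[OF c(1) smult_carrier_mat[OF c(2)]] mult_smult_distrib[OF c] ..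
    then show ?thesis unfolding twist_def RD(3)[OF g] eps_mult[OF g]
      using c by (intro eq_matI) (auto simp: mult.assoc)
  qed
  then show ?thesis unfolding representation_iff[OF is_group]
    using RD by (auto simp: twist_def eps_one intro!: eq_matI)
qed

lemma twist_irreducible:
  fixes R :: "'g \<Rightarrow> 'k :: field mat"
  assumes R: "irreducible_representation G d R"
  shows "irreducible_representation G d (twist R)"
  unfolding irreducible_iff
proof (intro conjI allI impI)
  show "representation G d (twist R)" by (rule twist_representation[OF irreducibleD(1)[OF R]])
  show "0 < d" by (rule irreducibleD(2)[OF R])
  fix W assume W: "vec_subspace d W \<and> invariant_under G (twist R) W"
  have "invariant_under G R W" unfolding invariant_under_def
  proof (intro ballI)
    fix g v assume g: "g \<in> carrier G" and v: "v \<in> W"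
    have Rg: "R g \<in> carrier_mat d d" using representationD(1)[OF is_group irreducibleD(1)[OF R] g] .
    have vc: "v \<in> carrier_vec d" using W v by (auto simp: vec_subspace_def)
    have "twist R g *\<^sub>v v \<in> W" using W g v by (auto simp: invariant_under_def)
    then have "of_int (eps g) \<cdot>\<^sub>v (twist R g *\<^sub>v v) \<in> W" using W by (auto simp: vec_subspace_def)
    moreover have "of_int (eps g) \<cdot>\<^sub>v (twist R g *\<^sub>v v) = R g *\<^sub>v v"
      using Rg vc eps_cases[OF g] by (intro eq_vecI) (auto simp: twist_def)
    ultimately show "R g *\<^sub>v v \<in> W" by simp
  qed
  then show "W = {0\<^sub>v d} \<or> W = carrier_vec d" using irreducibleD(3)[OF R] W by blast
qed

lemma conj_representation:
  fixes R :: "'g \<Rightarrow> 'k :: field mat"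
  assumes "representation H d R"
  shows "representation H d (\<lambda>g. R (conj_elt g))"
  using assms unfolding representation_iff[OF H_group]
  by (auto simp: H_simps conj_elt_H conj_elt_one conj_elt_mult H_sub)

lemma conj_irreducible:
  fixes R :: "'g \<Rightarrow> 'k :: field mat"
  assumes R: "irreducible_representation H d R"
  shows "irreducible_representation H d (\<lambda>g. R (conj_elt g))"
  unfolding irreducible_iff
proof (intro conjI allI impI)
  show "representation H d (\<lambda>g. R (conj_elt g))" by (rule conj_representation[OF irreducibleD(1)[OF R]])
  show "0 < d" by (rule irreducibleD(2)[OF R])
  fix W assume W: "vec_subspace d W \<and> invariant_under H (\<lambda>g. R (conj_elt g)) W"
  then have "invariant_under H R W"
    using conj_elt_surj unfolding invariant_under_def by metis
  then show "W = {0\<^sub>v d} \<or> W = carrier_vec d" using irreducibleD(3)[OF R] W by blast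
qed

text \<open>If \<open>R\<close> and its twist by \<open>eps\<close> have no nonzero intertwiner, then the matrix
  coefficients of the two are jointly independent on \<open>G\<close>. Adding a coefficient of \<open>R\<close> to that
  of its twist gives twice the coefficient on \<open>H\<close> and zero outside. So a relation between coefficients of
  \<open>R\<close> on \<open>H\<close>, such as a proper invariant subspace provides, would be a relation between the
  two on all of \<open>G\<close>.\<close>

lemma restriction_irreducible:
  fixes R :: "'g \<Rightarrow> 'k :: field mat"
  assumes ac: "alg_closed TYPE('k)" and R: "irreducible_representation G d R"
    and noniso: "\<And>T. T \<in> carrier_mat d d \<Longrightarrow> intertwines G T R (twist R) \<Longrightarrow> T = 0\<^sub>m d d"
  shows "irreducible_representation H d R"
proof (rule ccontr)
  assume "\<not> ?thesis"
  then obtain W where W: "vec_subspace d W" "invariant_under H R W" "W \<noteq> {0\<^sub>v d}" "W \<noteq> carrier_vec d"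
    using representation_H[OF irreducibleD(1)[OF R]] irreducibleD(2)[OF R] unfolding irreducible_iff by blast
  note RD = representationD[OF is_group irreducibleD(1)[OF R]]
  obtain m P Q where PQ: "m \<le> d" "P \<in> carrier_mat d d" "Q \<in> carrier_mat d d"
    "P * Q = 1\<^sub>m d" "Q * P = 1\<^sub>m d"
    and WQ: "\<And>v. v \<in> carrier_vec d \<Longrightarrow> v \<in> W \<longleftrightarrow> (\<forall>i<d. m \<le> i \<longrightarrow> (Q *\<^sub>v v) $ i = 0)"
    using subspace_adapted_basis[OF W(1)] by blast
  have "m < d"
  proof (rule ccontr)
    assume "\<not> m < d"
    then have "v \<in> W" if "v \<in> carrier_vec d" for v using WQ[OF that] by auto
    then show False using W(1,4) by (auto simp: vec_subspace_def)
  qed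
  obtain w where w: "w \<in> W" "w \<noteq> 0\<^sub>v d" using W(1,3) by (auto simp: vec_subspace_def)
  have wc: "w \<in> carrier_vec d" using w W(1) by (auto simp: vec_subspace_def)
  define S where "S b = (if b then R else twist R)" for b
  have S: "irreducible_representation G d (S b)" for b
    using R twist_irreducible[OF R] by (simp add: S_def)
  define v where "v = (\<lambda>(b :: bool, k). Q $$ (m,k) \<cdot>\<^sub>v w)"
  have "\<forall>(b,k)\<in>UNIV \<times> {..<d}. v (b,k) = 0\<^sub>v d"
  proof (rule rows_independent[where I = UNIV and R = S and d = "\<lambda>_. d", OF ac is_group S])
    fix i j T assume ij: "i \<noteq> (j :: bool)" and T: "T \<in> carrier_mat d d" "intertwines G T (S i) (S j)"
    have "intertwines G T R (twist R)"
    proof (cases i)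
      case True
      then show ?thesis using T(2) ij by (simp add: S_def)
    next
      case False
      show ?thesis unfolding intertwines_def
      proof
        fix g assume g: "g \<in> carrier G"
        have Rg: "R g \<in> carrier_mat d d" by (rule RD(1)[OF g])
        have "twist R g * T = T * R g" using T(2) False ij g by (auto simp: S_def intertwines_def)
        then have e: "of_int (eps g) \<cdot>\<^sub>m (R g * T) = T * R g"
          unfolding twist_def by (simp add: mult_smult_assoc_mat[OF Rg T(1)])
        have "R g * T = of_int (eps g) \<cdot>\<^sub>m (of_int (eps g) \<cdot>\<^sub>m (R g * T))"
          using Rg T(1) eps_cases[OF g] by (intro eq_matI) auto
        also have "\<dots> = T * twist R g" unfolding e twist_def
          using Rg T(1) by (simp add: mult_smult_distrib[of _ d d])
        finally show "R g * T = T * twist R g" .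
      qed
    qed
    then show "T = 0\<^sub>m d d" by (rule noniso[OF T(1)])
  next
    fix g assume g: "g \<in> carrier G"
    have Rg: "R g \<in> carrier_mat d d" by (rule RD(1)[OF g])
    have b: "(S b g *\<^sub>v v (b,k)) $ k = (if b then 1 else of_int (eps g)) * (Q $$ (m,k) * (R g *\<^sub>v w) $ k)"
      if "k < d" for b k
      using that Rg wc by (auto simp: S_def v_def twist_def mult_mat_vec[OF Rg wc])
    have "(\<Sum>(b,k)\<in>UNIV \<times> {..<d}. (S b g *\<^sub>v v (b,k)) $ k) =
      (\<Sum>b\<in>UNIV. \<Sum>k<d. (if b then 1 else of_int (eps g)) * (Q $$ (m,k) * (R g *\<^sub>v w) $ k))"
      unfolding sum.cartesian_product by (intro sum.cong) (auto simp: b simp del: index_mult_mat_vec)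
    also have "\<dots> = (1 + of_int (eps g)) * (\<Sum>k<d. Q $$ (m,k) * (R g *\<^sub>v w) $ k)"
      by (simp add: UNIV_bool sum_distrib_left[symmetric] ring_distribs add.commute)
    also have "(\<Sum>k<d. Q $$ (m,k) * (R g *\<^sub>v w) $ k) = (Q *\<^sub>v (R g *\<^sub>v w)) $ m"
      using PQ(3) Rg wc \<open>m < d\<close> by (simp add: scalar_prod_def atLeast0LessThan)
    also have "(1 + of_int (eps g)) * (Q *\<^sub>v (R g *\<^sub>v w)) $ m = 0"
    proof (cases "eps g = 1")
      case True
      then have "R g *\<^sub>v w \<in> W" using W(2) g w(1) by (auto simp: invariant_under_def H_carrier)
      then have "(Q *\<^sub>v (R g *\<^sub>v w)) $ m = 0"
        using WQ[of "R g *\<^sub>v w"] \<open>m < d\<close> mult_mat_vec_carrier[OF Rg wc] by blast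
      then show ?thesis by (simp del: index_mult_mat_vec)
    next
      case False
      then show ?thesis using eps_cases[OF g] by (simp del: index_mult_mat_vec)
    qed
    finally show "(\<Sum>(b,k)\<in>UNIV \<times> {..<d}. (S b g *\<^sub>v v (b,k)) $ k) = 0" .
  qed (use wc in \<open>auto simp: v_def\<close>)
  then have z: "Q $$ (m,k) \<cdot>\<^sub>v w = 0\<^sub>v d" if "k < d" for k using that by (auto simp: v_def)
  obtain i where i: "i < d" "w $ i \<noteq> 0" using w wc by (metis eq_vecI carrier_vecD index_zero_vec)
  have "Q $$ (m,k) = 0" if "k < d" for k
    using arg_cong[OF z[OF that], of "\<lambda>v. v $ i"] i wc by simp
  then have "(Q * P) $$ (m,m) = 0" using PQ(2,3) \<open>m < d\<close> by (simp add: scalar_prod_def)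
  then show False using PQ(5) \<open>m < d\<close> by simp
qed

end

text \<open>The matrix of two blocks \<open>B\<close> and \<open>B'\<close> side by side is encoded as a block matrix
  whose lower blocks have no rows. Below, the columns of such a matrix form a basis of a direct sum of two
  subspaces.\<close>

lemma mult_hcat:
  fixes M :: "'k :: field mat"
  assumes "M \<in> carrier_mat d d" "B \<in> carrier_mat d m" "B' \<in> carrier_mat d m"
  shows "M * four_block_mat B B' (0\<^sub>m 0 m) (0\<^sub>m 0 m) = four_block_mat (M * B) (M * B') (0\<^sub>m 0 m) (0\<^sub>m 0 m)"
proof -
  have "M = four_block_mat M (0\<^sub>m d 0) (0\<^sub>m 0 d) (0\<^sub>m 0 0)"
    by (rule eq_matI) (use assms in auto)
  then have "M * four_block_mat B B' (0\<^sub>m 0 m) (0\<^sub>m 0 m) =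
    four_block_mat M (0\<^sub>m d 0) (0\<^sub>m 0 d) (0\<^sub>m 0 0) * four_block_mat B B' (0\<^sub>m 0 m) (0\<^sub>m 0 m)" by simp
  also have "\<dots> = four_block_mat (M * B + 0\<^sub>m d 0 * 0\<^sub>m 0 m) (M * B' + 0\<^sub>m d 0 * 0\<^sub>m 0 m)
     (0\<^sub>m 0 d * B + 0\<^sub>m 0 0 * 0\<^sub>m 0 m) (0\<^sub>m 0 d * B' + 0\<^sub>m 0 0 * 0\<^sub>m 0 m)"
    by (rule mult_four_block_mat) (use assms in auto)
  also have "\<dots> = four_block_mat (M * B) (M * B') (0\<^sub>m 0 m) (0\<^sub>m 0 m)"
    by (rule eq_matI) (use assms in \<open>auto simp: scalar_prod_def\<close>)
  finally show ?thesis .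
qed

lemma hcat_mult:
  fixes B :: "'k :: field mat"
  assumes "B \<in> carrier_mat d m" "B' \<in> carrier_mat d m"
    and "X \<in> carrier_mat m m" "Y \<in> carrier_mat m m" "Z \<in> carrier_mat m m" "W \<in> carrier_mat m m"
  shows "four_block_mat B B' (0\<^sub>m 0 m) (0\<^sub>m 0 m) * four_block_mat X Y Z W =
    four_block_mat (B * X + B' * Z) (B * Y + B' * W) (0\<^sub>m 0 m) (0\<^sub>m 0 m)"
proof -
  have "four_block_mat B B' (0\<^sub>m 0 m) (0\<^sub>m 0 m) * four_block_mat X Y Z W =
    four_block_mat (B * X + B' * Z) (B * Y + B' * W) (0\<^sub>m 0 m * X + 0\<^sub>m 0 m * Z) (0\<^sub>m 0 m * Y + 0\<^sub>m 0 m * W)"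
    by (rule mult_four_block_mat) (use assms in auto)
  also have "\<dots> = four_block_mat (B * X + B' * Z) (B * Y + B' * W) (0\<^sub>m 0 m) (0\<^sub>m 0 m)"
    by (rule eq_matI) (use assms in auto)
  finally show ?thesis .
qed

lemma hcat_mult_vec:
  fixes B :: "'k :: field mat"
  assumes "B \<in> carrier_mat d m" "B' \<in> carrier_mat d m" "u \<in> carrier_vec m" "w \<in> carrier_vec m"
  shows "four_block_mat B B' (0\<^sub>m 0 m) (0\<^sub>m 0 m) *\<^sub>v (u @\<^sub>v w) = B *\<^sub>v u + B' *\<^sub>v w"
proof (rule eq_vecI)
  fix i assume "i < dim_vec (B *\<^sub>v u + B' *\<^sub>v w)"
  then have i: "i < d" using assms by simp
  have "row (four_block_mat B B' (0\<^sub>m 0 m) (0\<^sub>m 0 m)) i = row B i @\<^sub>v row B' i"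
    by (rule row_four_block_mat(1)[of B d m B' m _ 0]) (use assms i in auto)
  then show "(four_block_mat B B' (0\<^sub>m 0 m) (0\<^sub>m 0 m) *\<^sub>v (u @\<^sub>v w)) $ i = (B *\<^sub>v u + B' *\<^sub>v w) $ i"
    using assms i scalar_prod_append[of "row B i" m "row B' i" m u w] by auto
qed (use assms in auto)

context index_two
begin

text \<open>Take an irreducible \<open>H\<close>-submodule \<open>W\<close>, the image of \<open>B\<close>, and its
  translate \<open>s W\<close>, the image of \<open>B'\<close>. If \<open>W\<close> contains \<open>s W\<close>, then
  it is stable under \<open>G\<close>, hence everything. Otherwise the sum of the two is direct and stable under
  \<open>G\<close>, hence everything, and \<open>H\<close> acts on \<open>s W\<close> by the conjugate
  representation.\<close>

lemma clifford_split:
  fixes R :: "'g \<Rightarrow> 'k :: field mat"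
  assumes R: "irreducible_representation G d R"
  obtains
    (irreducible) m A where "irreducible_representation H m A"
      "\<And>h. h \<in> carrier H \<Longrightarrow> mat_trace (R h) = mat_trace (A h)"
      "\<And>h. h \<in> carrier H \<Longrightarrow> char_poly (R h) = char_poly (A h)"
  | (split) m A where "irreducible_representation H m A"
      "\<And>h. h \<in> carrier H \<Longrightarrow> mat_trace (R h) = mat_trace (A h) + mat_trace (A (conj_elt h))"
      "\<And>h. h \<in> carrier H \<Longrightarrow> char_poly (R h) = char_poly (A h) * char_poly (A (conj_elt h))"
proof -
  note rep = irreducibleD(1)[OF R]
  note RD = representationD[OF is_group rep]
  obtain m A B C where A: "irreducible_representation H m A" and B: "B \<in> carrier_mat d m"
    and C: "C \<in> carrier_mat m d" "C * B = 1\<^sub>m m" and RB: "\<And>h. h \<in> carrier H \<Longrightarrow> R h * B = B * A h"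
    using irreducible_subrepresentation[OF H_group representation_H[OF rep] irreducibleD(2)[OF R]] by metis
  note AD = representationD[OF H_group irreducibleD(1)[OF A]]
  have Rs: "R s \<in> carrier_mat d d" by (rule RD(1)[OF s(1)])
  define B' where "B' = R s * B"
  have B': "B' \<in> carrier_mat d m" using B Rs by (simp add: B'_def)
  have RB': "R h * B' = B' * A (conj_elt h)" if h: "h \<in> carrier H" for h
  proof -
    have hG: "h \<in> carrier G" and ch: "conj_elt h \<in> carrier H" using h by (auto simp: H_sub conj_elt_H)
    have Rh: "R h \<in> carrier_mat d d" and Rc: "R (conj_elt h) \<in> carrier_mat d d" and Ac: "A (conj_elt h) \<in> carrier_mat m m"
      using RD(1) AD(1) hG ch H_sub by auto
    have "R h * B' = R (h \<otimes> s) * B"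
      unfolding B'_def RD(3)[OF hG s(1)] by (rule assoc_mult_mat[symmetric, OF Rh Rs B])
    also have "\<dots> = (R s * R (conj_elt h)) * B" using RD(3)[OF s(1) H_sub[OF ch]] s_conj_elt[OF hG] by simp
    also have "\<dots> = R s * (R (conj_elt h) * B)" by (rule assoc_mult_mat[OF Rs Rc B])
    also have "\<dots> = B' * A (conj_elt h)"
      unfolding RB[OF ch] B'_def by (rule assoc_mult_mat[symmetric, OF Rs B Ac])
    finally show ?thesis .
  qed
  have Ass: "A (s \<otimes> s) \<in> carrier_mat m m" by (rule AD(1)[OF ss_H])
  have RsB': "R s * B' = B * A (s \<otimes> s)"
    unfolding B'_def RB[OF ss_H, symmetric] RD(3)[OF s(1) s(1)]
    by (rule assoc_mult_mat[symmetric, OF Rs Rs B])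
  have Binj: "u = 0\<^sub>v m" if u: "u \<in> carrier_vec m" "B *\<^sub>v u = 0\<^sub>v d" for u
  proof -
    have "u = (C * B) *\<^sub>v u" using u(1) C(2) by simp
    also have "\<dots> = C *\<^sub>v (B *\<^sub>v u)" by (rule assoc_mult_mat_vec[OF C(1) B u(1)])
    finally show ?thesis using u(2) mult_mat_vec_zero[OF C(1)] by simp
  qed
  have m0: "m > 0" by (rule irreducibleD(2)[OF A])
  have RBv: "R h *\<^sub>v (B *\<^sub>v u) = B *\<^sub>v (A h *\<^sub>v u)" if "h \<in> carrier H" "u \<in> carrier_vec m" for h u
    using RB[OF that(1)] assoc_mult_mat_vec[OF RD(1)[OF H_sub[OF that(1)]] B that(2)]
      assoc_mult_mat_vec[OF B AD(1)[OF that(1)] that(2)] by simp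
  have RBv': "R h *\<^sub>v (B' *\<^sub>v u) = B' *\<^sub>v (A (conj_elt h) *\<^sub>v u)" if "h \<in> carrier H" "u \<in> carrier_vec m" for h u
    using RB'[OF that(1)] assoc_mult_mat_vec[OF RD(1)[OF H_sub[OF that(1)]] B' that(2)]
      assoc_mult_mat_vec[OF B' AD(1)[OF conj_elt_H[OF that(1)]] that(2)] by simp
  have RsB: "R s *\<^sub>v (B *\<^sub>v u) = B' *\<^sub>v u" if "u \<in> carrier_vec m" for u
    unfolding B'_def by (rule assoc_mult_mat_vec[symmetric, OF Rs B that])
  have RsB'v: "R s *\<^sub>v (B' *\<^sub>v u) = B *\<^sub>v (A (s \<otimes> s) *\<^sub>v u)" if "u \<in> carrier_vec m" for u
    using RsB' assoc_mult_mat_vec[OF Rs B' that] assoc_mult_mat_vec[OF B Ass that] by simp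
  have invG: "invariant_under G R W"
    if W: "W \<subseteq> carrier_vec d" "\<And>h v. h \<in> carrier H \<Longrightarrow> v \<in> W \<Longrightarrow> R h *\<^sub>v v \<in> W" "\<And>v. v \<in> W \<Longrightarrow> R s *\<^sub>v v \<in> W" for W
    unfolding invariant_under_def
  proof (intro ballI)
    fix g v assume g: "g \<in> carrier G" and v: "v \<in> W"
    show "R g *\<^sub>v v \<in> W"
    proof (cases "g \<in> carrier H")
      case True
      then show ?thesis using W(2) v by blast
    next
      case False
      then obtain h where h: "h \<in> carrier H" "g = s \<otimes> h" using coset g by blast
      have "R g *\<^sub>v v = R s *\<^sub>v (R h *\<^sub>v v)"
        unfolding h(2) RD(3)[OF s(1) H_sub[OF h(1)]]
        by (rule assoc_mult_mat_vec[OF Rs RD(1)[OF H_sub[OF h(1)]]]) (use v W(1) in auto)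
      then show ?thesis using W(2,3) h(1) v by simp
    qed
  qed
  have unit: "unit_vec m 0 \<in> carrier_vec m" "(unit_vec m 0 :: 'k vec) \<noteq> 0\<^sub>v m"
    using m0 by (auto dest: arg_cong[of _ _ "\<lambda>v. v $ 0"])
  show thesis
  proof (cases "(\<lambda>u. B' *\<^sub>v u) ` carrier_vec m \<subseteq> (\<lambda>u. B *\<^sub>v u) ` carrier_vec m")
    case True
    define W where "W = (\<lambda>u. B *\<^sub>v u) ` carrier_vec m"
    have "invariant_under G R W"
    proof (rule invG)
      show "W \<subseteq> carrier_vec d" using B by (auto simp: W_def)
      show "R h *\<^sub>v v \<in> W" if h: "h \<in> carrier H" and v: "v \<in> W" for h v
      proof -
        obtain u where u: "u \<in> carrier_vec m" "v = B *\<^sub>v u" using v by (auto simp: W_def)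
        show ?thesis unfolding W_def u(2) RBv[OF h u(1)]
          by (rule imageI) (rule mult_mat_vec_carrier[OF AD(1)[OF h] u(1)])
      qed
      show "R s *\<^sub>v v \<in> W" if v: "v \<in> W" for v
      proof -
        obtain u where u: "u \<in> carrier_vec m" "v = B *\<^sub>v u" using v by (auto simp: W_def)
        show ?thesis unfolding u(2) RsB[OF u(1)] using True u(1) by (auto simp: W_def)
      qed
    qed
    moreover have "vec_subspace d W" unfolding W_def by (rule vec_subspace_range[OF B])
    moreover have "W \<noteq> {0\<^sub>v d}"
    proof
      assume "W = {0\<^sub>v d}"
      then have "B *\<^sub>v unit_vec m 0 = 0\<^sub>v d" using unit(1) by (auto simp: W_def)
      then show False using Binj unit by blast
    qed
    ultimately have W: "W = carrier_vec d" using irreducibleD(3)[OF R] by blast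
    obtain U where U: "d = m" "U \<in> carrier_mat m d" "B * U = 1\<^sub>m d" "U * B = 1\<^sub>m m"
      by (rule invertible_mat_of_bijective[OF B Binj W[unfolded W_def]])
    have B1: "B \<in> carrier_mat m m" and U1: "U \<in> carrier_mat m m" using B U by auto
    have e: "R h = B * A h * U" if h: "h \<in> carrier H" for h
    proof -
      have Rh: "R h \<in> carrier_mat d d" by (rule RD(1)[OF H_sub[OF h]])
      have "B * A h * U = R h * (B * U)" unfolding RB[OF h, symmetric] by (rule assoc_mult_mat[OF Rh B U(2)])
      then show ?thesis using U(3) Rh by simp
    qed
    show thesis
    proof (rule irreducible[OF A])
      fix h assume h: "h \<in> carrier H"
      show "mat_trace (R h) = mat_trace (A h)" unfolding e[OF h]
        by (rule mat_trace_similar[OF B1 U1 _ AD(1)[OF h]]) (use U in simp)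
      show "char_poly (R h) = char_poly (A h)" unfolding e[OF h]
        by (rule char_poly_similar'[OF B1 U1 _ _ AD(1)[OF h]]) (use U in simp_all)
    qed
  next
    case False
    \<comment> \<open>\<open>K\<close> is the intersection of \<open>W\<close> and \<open>s W\<close> in the coordinates of \<open>W\<close>. It is invariant under \<open>H\<close>
      and not everything, so it is zero and the sum is direct.\<close>
    define K where "K = {u \<in> carrier_vec m. \<exists>w\<in>carrier_vec m. B *\<^sub>v u = B' *\<^sub>v w}"
    have KI: "x \<in> K" if "B *\<^sub>v x = B' *\<^sub>v y" "x \<in> carrier_vec m" "y \<in> carrier_vec m" for x y
      using that by (auto simp: K_def)
    have K: "vec_subspace m K" unfolding vec_subspace_def
    proof (intro conjI ballI allI)
      show "0\<^sub>v m \<in> K" unfolding K_def using mult_mat_vec_zero[OF B] mult_mat_vec_zero[OF B']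
        by (auto intro!: bexI[of _ "0\<^sub>v m"])
      fix u assume "u \<in> K"
      then obtain w where w: "u \<in> carrier_vec m" "w \<in> carrier_vec m" "B *\<^sub>v u = B' *\<^sub>v w" by (auto simp: K_def)
      have "B *\<^sub>v (c \<cdot>\<^sub>v u) = B' *\<^sub>v (c \<cdot>\<^sub>v w)" for c
        unfolding mult_mat_vec[OF B w(1)] mult_mat_vec[OF B' w(2)] w(3) ..
      then show "c \<cdot>\<^sub>v u \<in> K" for c by (rule KI) (use w in auto)
      fix u' assume "u' \<in> K"
      then obtain w' where w': "u' \<in> carrier_vec m" "w' \<in> carrier_vec m" "B *\<^sub>v u' = B' *\<^sub>v w'" by (auto simp: K_def)
      have "B *\<^sub>v (u + u') = B' *\<^sub>v (w + w')"
        unfolding mult_add_distrib_mat_vec[OF B w(1) w'(1)] mult_add_distrib_mat_vec[OF B' w(2) w'(2)] w(3) w'(3) ..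
      then show "u + u' \<in> K" by (rule KI) (use w w' in auto)
    qed (auto simp: K_def)
    have "invariant_under H A K" unfolding invariant_under_def
    proof (intro ballI)
      fix h u assume h: "h \<in> carrier H" and "u \<in> K"
      then obtain w where w: "u \<in> carrier_vec m" "w \<in> carrier_vec m" "B *\<^sub>v u = B' *\<^sub>v w" by (auto simp: K_def)
      have "B *\<^sub>v (A h *\<^sub>v u) = B' *\<^sub>v (A (conj_elt h) *\<^sub>v w)"
        using RBv[OF h w(1)] RBv'[OF h w(2)] w(3) by simp
      moreover have "A h *\<^sub>v u \<in> carrier_vec m" by (rule mult_mat_vec_carrier[OF AD(1)[OF h] w(1)])
      moreover have "A (conj_elt h) *\<^sub>v w \<in> carrier_vec m" by (rule mult_mat_vec_carrier[OF AD(1)[OF conj_elt_H[OF h]] w(2)])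
      ultimately show "A h *\<^sub>v u \<in> K" unfolding K_def by blast
    qed
    moreover have "K \<noteq> carrier_vec m"
    proof
      assume KW: "K = carrier_vec m"
      have "B' *\<^sub>v w \<in> (\<lambda>u. B *\<^sub>v u) ` carrier_vec m" if w: "w \<in> carrier_vec m" for w
      proof -
        obtain w' where w': "w' \<in> carrier_vec m" "B *\<^sub>v w = B' *\<^sub>v w'" using KW w by (auto simp: K_def)
        have "B' *\<^sub>v w = B *\<^sub>v (A (s \<otimes> s) *\<^sub>v w')" unfolding RsB[OF w, symmetric] w'(2) by (rule RsB'v[OF w'(1)])
        then show ?thesis using mult_mat_vec_carrier[OF Ass w'(1)] by blast
      qed
      then show False using False by blast
    qed
    ultimately have K0: "K = {0\<^sub>v m}" using irreducibleD(3)[OF A K] by blast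
    define P where "P = four_block_mat B B' (0\<^sub>m 0 m) (0\<^sub>m 0 m)"
    have P: "P \<in> carrier_mat d (m + m)" by (rule carrier_matI) (simp_all add: P_def carrier_matD[OF B])
    have Pinj: "v = 0\<^sub>v (m + m)" if v: "v \<in> carrier_vec (m + m)" "P *\<^sub>v v = 0\<^sub>v d" for v
    proof -
      define u where "u = vec_first v m"
      define w where "w = vec_last v m"
      have uw: "u \<in> carrier_vec m" "w \<in> carrier_vec m" "v = u @\<^sub>v w"
        using v(1) by (auto simp: u_def w_def)
      have Bu: "B *\<^sub>v u \<in> carrier_vec d" "B' *\<^sub>v w \<in> carrier_vec d" using B B' uw by auto
      have sum: "B *\<^sub>v u + B' *\<^sub>v w = 0\<^sub>v d"
        using v(2) hcat_mult_vec[OF B B' uw(1,2)] by (simp add: P_def uw(3))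
      have "B *\<^sub>v u = B' *\<^sub>v ((-1) \<cdot>\<^sub>v w)"
      proof (rule eq_vecI)
        fix i assume "i < dim_vec (B' *\<^sub>v ((-1) \<cdot>\<^sub>v w))"
        then have i: "i < d" using B' by simp
        have "(B *\<^sub>v u) $ i + (B' *\<^sub>v w) $ i = 0"
          using arg_cong[OF sum, of "\<lambda>v. v $ i"] i carrier_vecD[OF Bu(1)] carrier_vecD[OF Bu(2)]
          by (simp del: index_mult_mat_vec dim_mult_mat_vec)
        then show "(B *\<^sub>v u) $ i = (B' *\<^sub>v ((-1) \<cdot>\<^sub>v w)) $ i"
          unfolding mult_mat_vec[OF B' uw(2)] using i carrier_vecD[OF Bu(2)]
          by (simp del: index_mult_mat_vec dim_mult_mat_vec add: eq_neg_iff_add_eq_0)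
      qed (use B B' in auto)
      moreover have "(-1) \<cdot>\<^sub>v w \<in> carrier_vec m" using uw(2) by simp
      ultimately have "u \<in> K" using uw(1) unfolding K_def by blast
      then have u0: "u = 0\<^sub>v m" using K0 by simp
      then have "B' *\<^sub>v w = 0\<^sub>v d" using sum mult_mat_vec_zero[OF B] Bu(2) by simp
      then have "R s *\<^sub>v (B *\<^sub>v w) = 0\<^sub>v d" by (simp only: RsB[OF uw(2)])
      moreover have "R (inv s) *\<^sub>v (R s *\<^sub>v (B *\<^sub>v w)) = B *\<^sub>v w"
      proof -
        have Ri: "R (inv s) \<in> carrier_mat d d" using RD(1) s(1) by simp
        have Bw: "B *\<^sub>v w \<in> carrier_vec d" using B uw(2) by auto
        show ?thesis
          unfolding assoc_mult_mat_vec[symmetric, OF Ri Rs Bw] representation_inv(1)[OF is_group rep s(1)]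
          using Bw by simp
      qed
      ultimately have "B *\<^sub>v w = 0\<^sub>v d" using mult_mat_vec_zero[OF RD(1)[of "inv s"]] s(1) by simp
      then have "w = 0\<^sub>v m" by (rule Binj[OF uw(2)])
      then show ?thesis unfolding uw(3) u0 by (intro eq_vecI) auto
    qed
    define E where "E h = four_block_mat (A h) (0\<^sub>m m m) (0\<^sub>m m m) (A (conj_elt h))" for h
    have E: "E h \<in> carrier_mat (m + m) (m + m)" if "h \<in> carrier H" for h
      using AD(1)[OF that] AD(1)[OF conj_elt_H[OF that]] by (simp add: E_def)
    have RP: "R h * P = P * E h" if h: "h \<in> carrier H" for h
    proof -
      note c = AD(1)[OF h] AD(1)[OF conj_elt_H[OF h]]
      have "R h * P = four_block_mat (R h * B) (R h * B') (0\<^sub>m 0 m) (0\<^sub>m 0 m)"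
        unfolding P_def by (rule mult_hcat[OF RD(1)[OF H_sub[OF h]] B B'])
      also have "\<dots> = P * E h"
        unfolding P_def E_def hcat_mult[OF B B' c(1) zero_carrier_mat zero_carrier_mat c(2)]
        using RB[OF h] RB'[OF h] B B' c by simp
      finally show ?thesis .
    qed
    define J where "J = four_block_mat (0\<^sub>m m m) (A (s \<otimes> s)) (1\<^sub>m m) (0\<^sub>m m m)"
    have J: "J \<in> carrier_mat (m + m) (m + m)" by (simp add: J_def)
    have RsP: "R s * P = P * J"
    proof -
      have "R s * P = four_block_mat (R s * B) (R s * B') (0\<^sub>m 0 m) (0\<^sub>m 0 m)"
        unfolding P_def by (rule mult_hcat[OF Rs B B'])
      also have "\<dots> = P * J"
        unfolding P_def J_def hcat_mult[OF B B' zero_carrier_mat Ass one_carrier_mat zero_carrier_mat]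
        using RsB' B B' Ass by (simp add: B'_def[symmetric])
      finally show ?thesis .
    qed
    define W where "W = (\<lambda>v. P *\<^sub>v v) ` carrier_vec (m + m)"
    have "invariant_under G R W"
    proof (rule invG)
      show "W \<subseteq> carrier_vec d" using P by (auto simp: W_def)
      show "R h *\<^sub>v v \<in> W" if h: "h \<in> carrier H" and v: "v \<in> W" for h v
      proof -
        obtain u where u: "u \<in> carrier_vec (m + m)" "v = P *\<^sub>v u" using v by (auto simp: W_def)
        have "R h *\<^sub>v v = P *\<^sub>v (E h *\<^sub>v u)"
          using RP[OF h] assoc_mult_mat_vec[OF RD(1)[OF H_sub[OF h]] P u(1)] assoc_mult_mat_vec[OF P E[OF h] u(1)] u(2) by simp
        then show ?thesis unfolding W_def using mult_mat_vec_carrier[OF E[OF h] u(1)] by blast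
      qed
      show "R s *\<^sub>v v \<in> W" if v: "v \<in> W" for v
      proof -
        obtain u where u: "u \<in> carrier_vec (m + m)" "v = P *\<^sub>v u" using v by (auto simp: W_def)
        have "R s *\<^sub>v v = P *\<^sub>v (J *\<^sub>v u)"
          using RsP assoc_mult_mat_vec[OF Rs P u(1)] assoc_mult_mat_vec[OF P J u(1)] u(2) by simp
        then show ?thesis unfolding W_def using mult_mat_vec_carrier[OF J u(1)] by blast
      qed
    qed
    moreover have "vec_subspace d W" unfolding W_def by (rule vec_subspace_range[OF P])
    moreover have "W \<noteq> {0\<^sub>v d}"
    proof
      assume W0: "W = {0\<^sub>v d}"
      have "unit_vec m 0 @\<^sub>v 0\<^sub>v m \<in> carrier_vec (m + m)" by simp
      then have "P *\<^sub>v (unit_vec m 0 @\<^sub>v 0\<^sub>v m) = 0\<^sub>v d" using W0 unfolding W_def by blast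
      then have "B *\<^sub>v unit_vec m 0 = 0\<^sub>v d"
        unfolding P_def hcat_mult_vec[OF B B' unit(1) zero_carrier_vec] mult_mat_vec_zero[OF B'] using B by simp
      then show False using Binj unit by blast
    qed
    ultimately have W: "W = carrier_vec d" using irreducibleD(3)[OF R] by blast
    obtain U where U: "d = m + m" "U \<in> carrier_mat (m + m) d" "P * U = 1\<^sub>m d" "U * P = 1\<^sub>m (m + m)"
      by (rule invertible_mat_of_bijective[OF P Pinj W[unfolded W_def]])
    have P1: "P \<in> carrier_mat (m + m) (m + m)" and U1: "U \<in> carrier_mat (m + m) (m + m)" using P U by auto
    have e: "R h = P * E h * U" if h: "h \<in> carrier H" for h
    proof -
      have Rh: "R h \<in> carrier_mat d d" by (rule RD(1)[OF H_sub[OF h]])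
      have "P * E h * U = R h * (P * U)" unfolding RP[OF h, symmetric] by (rule assoc_mult_mat[OF Rh P U(2)])
      then show ?thesis using U(3) Rh by simp
    qed
    show thesis
    proof (rule split[OF A])
      fix h assume h: "h \<in> carrier H"
      note c = AD(1)[OF h] AD(1)[OF conj_elt_H[OF h]]
      have "mat_trace (R h) = mat_trace (E h)" unfolding e[OF h]
        by (rule mat_trace_similar[OF P1 U1 _ E[OF h]]) (use U in simp)
      then show "mat_trace (R h) = mat_trace (A h) + mat_trace (A (conj_elt h))"
        unfolding E_def mat_trace_four_block[OF c] .
      have "char_poly (R h) = char_poly (E h)" unfolding e[OF h]
        by (rule char_poly_similar'[OF P1 U1 _ _ E[OF h]]) (use U in simp_all)
      then show "char_poly (R h) = char_poly (A h) * char_poly (A (conj_elt h))"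
        unfolding E_def char_poly_four_block_upper[OF c(1) zero_carrier_mat c(2)] .
    qed
  qed
qed

end

context index_two
begin

text \<open>Since \<open>s \<otimes> s\<close> lies in \<open>H\<close>, conjugating twice by \<open>s\<close> is an
  inner automorphism of \<open>H\<close>.\<close>

lemma conj_invariant:
  fixes R :: "'g \<Rightarrow> 'k :: field mat"
  assumes R: "representation H d R" and g: "g \<in> carrier H"
  shows "mat_trace (R (conj_elt (conj_elt g))) = mat_trace (R g)" "char_poly (R (conj_elt (conj_elt g))) = char_poly (R g)"
proof -
  interpret H: group H by (rule H_group)
  define h where "h = s \<otimes> s"
  have h: "h \<in> carrier H" "inv h \<in> carrier H" "h \<in> carrier G"
    using ss_H s by (auto simp: h_def H_carrier eps_inv eps_mult)
  note RD = representationD[OF H_group R]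
  have "R (conj_elt (conj_elt g)) = R ((inv h \<otimes>\<^bsub>H\<^esub> g) \<otimes>\<^bsub>H\<^esub> h)"
    unfolding h_def H_simps conj_elt_conj_elt[OF H_sub[OF g]] ..
  also have "\<dots> = R (inv h) * R g * R h"
    using RD(3)[OF h(2) g] RD(3)[OF H.m_closed[OF h(2) g] h(1)] by simp
  finally have e: "R (conj_elt (conj_elt g)) = R (inv h) * R g * R h" .
  have 1: "R h * R (inv h) = 1\<^sub>m d" "R (inv h) * R h = 1\<^sub>m d"
    using RD(3)[OF h(1,2)] RD(3)[OF h(2,1)] RD(2) h(3) by (simp_all add: H_simps)
  show "mat_trace (R (conj_elt (conj_elt g))) = mat_trace (R g)" unfolding e
    by (rule mat_trace_similar[OF RD(1)[OF h(2)] RD(1)[OF h(1)] 1(1) RD(1)[OF g]])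
  show "char_poly (R (conj_elt (conj_elt g))) = char_poly (R g)" unfolding e
    by (rule char_poly_similar'[OF RD(1)[OF h(2)] RD(1)[OF h(1)] 1(2,1) RD(1)[OF g]])
qed

lemma mat_trace_twist:
  fixes R :: "'g \<Rightarrow> 'k :: field mat"
  assumes "R g \<in> carrier_mat d d"
  shows "mat_trace (twist R g) = of_int (eps g) * mat_trace (R g)"
  using assms by (simp add: mat_trace_def twist_def sum_distrib_left)

section \<open>Ordinary characters and a subgroup of index two\<close>

lemma Res_character: "Res H (character G R) = character H R"
  by (auto simp: Res_def character_def H_sub)

lemma character_twist:
  assumes "representation G d R"
  shows "character G (twist R) = eps_times (character G R)"
proof
  fix g
  show "character G (twist R) g = eps_times (character G R) g"
  proof (cases "g \<in> carrier G")
    case True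
    from mat_trace_twist[of R g d, OF representationD(1)[OF is_group assms True]] show ?thesis
      using True by (simp add: character_eq_trace eps_times_def)
  qed (simp add: character_def eps_times_def)
qed

lemma eps_times_Irr:
  assumes "\<chi> \<in> Irr G"
  shows "eps_times \<chi> \<in> Irr G"
proof -
  obtain d R where R: "irreducible_representation G d R" "\<chi> = character G R"
    using assms by (rule Irr_cases)
  show ?thesis unfolding R(2) character_twist[OF irreducibleD(1)[OF R(1)], symmetric]
    by (rule character_in_Irr[OF twist_irreducible[OF R(1)]])
qed

lemma character_conj: "character H (\<lambda>g. R (conj_elt g)) = conj_fun (character H R)"
  by (auto simp: character_def conj_fun_def conj_elt_H)

lemma conj_fun_Irr:
  assumes "\<rho> \<in> Irr H"
  shows "conj_fun \<rho> \<in> Irr H"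
proof -
  obtain d R where R: "irreducible_representation H d R" "\<rho> = character H R"
    using assms by (rule Irr_cases)
  show ?thesis unfolding R(2) character_conj[symmetric]
    by (rule character_in_Irr[OF conj_irreducible[OF R(1)]])
qed

lemma conj_fun_conj_fun_Irr:
  assumes "\<rho> \<in> Irr H"
  shows "conj_fun (conj_fun \<rho>) = \<rho>"
proof -
  obtain d R where R: "irreducible_representation H d R" "\<rho> = character H R"
    using assms by (rule Irr_cases)
  show ?thesis
  proof
    fix g
    show "conj_fun (conj_fun \<rho>) g = \<rho> g"
      using conj_invariant(1)[OF irreducibleD(1)[OF R(1)], of g]
      by (cases "g \<in> carrier H") (auto simp: conj_fun_def conj_elt_H R(2) character_eq_trace, auto simp: character_def)
  qed
qed

lemma Res_Irr:
  assumes \<chi>: "\<chi> \<in> Irr G" "eps_times \<chi> \<noteq> \<chi>"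
  shows "Res H \<chi> \<in> Irr H"
proof -
  obtain d R where R: "irreducible_representation G d R" "\<chi> = character G R"
    using \<chi>(1) by (rule Irr_cases)
  have "irreducible_representation H d R"
  proof (rule restriction_irreducible[OF alg_closed_complex R(1)], rule ccontr)
    fix T assume T: "T \<in> carrier_mat d d" "intertwines G T R (twist R)" "T \<noteq> 0\<^sub>m d d"
    have "character G R = character G (twist R)"
      using similar_of_intertwiner(2)[OF is_group R(1) twist_irreducible[OF R(1)] T]
      by (auto simp: character_def mat_trace_def)
    then show False using \<chi>(2) character_twist[OF irreducibleD(1)[OF R(1)]] R(2) by simp
  qed
  then show ?thesis unfolding R(2) Res_character by (auto simp: Irr_def)
qed

lemma clifford_Irr:
  assumes \<chi>: "\<chi> \<in> Irr G"
  shows "Res H \<chi> \<in> Irr H \<or> (\<exists>\<psi>\<in>Irr H. \<forall>g. Res H \<chi> g = \<psi> g + conj_fun \<psi> g)"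
proof -
  obtain d R where R: "irreducible_representation G d R" "\<chi> = character G R"
    using \<chi> by (rule Irr_cases)
  from R(1) show ?thesis
  proof (cases rule: clifford_split)
    case (irreducible m A)
    have "character H R = character H A"
    proof
      fix g
      show "character H R g = character H A g"
        using irreducible(2)[of g] by (cases "g \<in> carrier H") (simp_all add: character_eq_trace, simp add: character_def)
    qed
    then show ?thesis using character_in_Irr[OF irreducible(1)] by (simp add: R(2) Res_character)
  next
    case (split m A)
    have "character H R g = character H A g + conj_fun (character H A) g" for g
      using split(2)[of g]
      by (cases "g \<in> carrier H") (simp_all add: character_eq_trace conj_fun_def conj_elt_H, simp add: character_def)
    then show ?thesis unfolding R(2) Res_character using character_in_Irr[OF split(1)] by blast
  qed
qed

text \<open>By independence, the two ways of writing the restriction as a sum of irreducible characters agree.\<close>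

lemma constituents_conjugate_Irr:
  assumes \<chi>: "\<chi> \<in> Irr G" and \<rho>: "\<rho> \<in> Irr H" "\<rho>' \<in> Irr H" "\<rho> \<noteq> \<rho>'"
    and Res: "Res H \<chi> = (\<lambda>g. \<rho> g + \<rho>' g)"
  shows "conj_fun \<rho> = \<rho>'"
proof -
  have ind: "int_independent (Irr H)" by (rule int_independent_Irr[OF H_group])
  from clifford_Irr[OF \<chi>] show ?thesis
  proof
    assume "Res H \<chi> \<in> Irr H"
    then show ?thesis using int_independent_one_not_two[OF ind, of "Res H \<chi>" \<rho> \<rho>'] \<rho> Res by auto
  next
    assume "\<exists>\<psi>\<in>Irr H. \<forall>g. Res H \<chi> g = \<psi> g + conj_fun \<psi> g"
    then obtain \<psi> where \<psi>: "\<psi> \<in> Irr H" "\<And>g. Res H \<chi> g = \<psi> g + conj_fun \<psi> g" by blast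
    have "\<psi> = \<rho> \<and> conj_fun \<psi> = \<rho>' \<or> \<psi> = \<rho>' \<and> conj_fun \<psi> = \<rho>"
      by (rule int_independent_two_two[OF ind _ \<rho>(3)])
        (use \<psi>(1) \<rho>(1,2) conj_fun_Irr[OF \<psi>(1)] \<psi>(2) Res in auto)
    then show ?thesis using conj_fun_conj_fun_Irr[OF \<psi>(1)] by auto
  qed
qed

lemma Res_preg: "preg p H (Res H f) = Res H (preg p G f)"
  by (auto simp: preg_def Res_def p_regular_H)

lemma conj_fun_preg: "preg p H (conj_fun f) = conj_fun (preg p H f)"
  by (auto simp: preg_def conj_fun_def p_regular_conj_elt dest: p_regularD)

lemma eps_times_preg: "preg p G (eps_times f) = eps_times (preg p G f)"
  by (auto simp: preg_def eps_times_def)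

end

section \<open>Brauer characters and a subgroup of index two\<close>

lemma count_list_map_uminus: "count_list (map uminus as) x = count_list as (- x)"
  for x :: "'a :: group_add"
proof (induction as)
  case (Cons a as)
  have "- a = x \<longleftrightarrow> a = - x" by (metis minus_minus)
  then show ?case using Cons by simp
qed simp

locale index_two_modular = index_two G H eps s + modular_red p r
  for G :: "('g, 'b) monoid_scheme" (structure) and H and eps and s
    and p and r :: "complex \<Rightarrow> 'k :: field"
begin

abbreviation br_G :: "('g \<Rightarrow> 'k mat) \<Rightarrow> 'g \<Rightarrow> complex" where "br_G \<equiv> brauer_character p r G"
abbreviation br_H :: "('g \<Rightarrow> 'k mat) \<Rightarrow> 'g \<Rightarrow> complex" where "br_H \<equiv> brauer_character p r H"

lemma Res_brauer: "Res H (br_G R) = br_H R"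
  by (auto simp: Res_def brauer_character_def p_regular_H ord_H)

lemma br_in_IBr:
  fixes R :: "'g \<Rightarrow> 'k mat"
  shows "irreducible_representation G d R \<Longrightarrow> br_G R \<in> IBr p r G"
    "irreducible_representation H d R \<Longrightarrow> br_H R \<in> IBr p r H"
  by (auto simp: IBr_def)

text \<open>If \<open>eps g = -1\<close>, then twisting negates the eigenvalues of \<open>g\<close>. The order of
  \<open>g\<close> is then even, so negation permutes the roots of unity over which the Brauer character sums, and it
  commutes with reduction.\<close>

lemma brauer_twist:
  fixes R :: "'g \<Rightarrow> 'k mat"
  assumes R: "representation G d R"
  shows "br_G (twist R) = eps_times (br_G R)"
proof
  fix g
  show "br_G (twist R) g = eps_times (br_G R) g"
  proof (cases "p_regular p G g")
    case True
    note g = p_regularD(1)[OF True]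
    have Rg: "R g \<in> carrier_mat d d" by (rule representationD(1)[OF is_group R g])
    obtain as where as: "char_poly (R g) = (\<Prod>a\<leftarrow>as. [:- a, 1:])"
      "\<And>c. char_poly (c \<cdot>\<^sub>m R g) = (\<Prod>a\<leftarrow>as. [:- (c * a), 1:])"
      by (rule eigenvalue_list[OF alg_closed_k Rg]) (rule that)
    from eps_cases[OF g] show ?thesis
    proof
      assume e: "eps g = 1"
      have "twist R g = R g" unfolding twist_def e by (rule eq_matI) auto
      then show ?thesis by (simp add: brauer_character_def eps_times_def e)
    next
      assume e: "eps g = -1"
      have "eps (g [^] q) = (-1) ^ q" for q :: nat
        by (induction q) (auto simp: eps_one eps_mult g e)
      from this[of "ord g"] have ev: "even (ord g)" using g by (auto simp: eps_one minus_one_power_iff split: if_splits)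
      have "char_poly (twist R g) = (\<Prod>a\<leftarrow>map uminus as. [:- a, 1:])"
        unfolding twist_def e as(2) by (simp add: o_def)
      then have o: "Polynomial.order x (char_poly (twist R g)) = Polynomial.order (- x) (char_poly (R g))" for x
        unfolding as(1) by (simp only: order_prod_linear count_list_map_uminus)
      have rm: "r (- z) = - r z" if "z ^ ord g = 1" for z
        using r_minus[OF algebraic_int_root_of_unity[OF that]] ord_ge_1[OF fin g] by simp
      have "br_G (twist R) g = (\<Sum>z | z ^ ord g = 1. of_nat (Polynomial.order (- r z) (char_poly (R g))) * z)"
        using True by (simp add: brauer_character_def o)
      also have "\<dots> = (\<Sum>z | z ^ ord g = 1. of_nat (Polynomial.order (r z) (char_poly (R g))) * (- z))"
        by (rule sum.reindex_bij_witness[of _ uminus uminus]) (use ev rm in auto)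
      also have "\<dots> = eps_times (br_G R) g"
        using True by (simp add: brauer_character_def eps_times_def e sum_negf)
      finally show ?thesis .
    qed
  qed (simp add: brauer_character_def eps_times_def)
qed

lemma eps_times_IBr:
  assumes "\<theta> \<in> IBr p r G"
  shows "eps_times \<theta> \<in> IBr p r G"
proof -
  obtain d R where R: "irreducible_representation G d R" "\<theta> = br_G R"
    using assms by (rule IBr_cases)
  then show ?thesis using br_in_IBr(1)[OF twist_irreducible[OF R(1)]] brauer_twist[OF irreducibleD(1)[OF R(1)]] by simp
qed

lemma brauer_conj: "br_H (\<lambda>g. R (conj_elt g)) = conj_fun (br_H R)"
proof
  fix g
  show "br_H (\<lambda>g. R (conj_elt g)) g = conj_fun (br_H R) g"
    by (cases "g \<in> carrier H")
      (auto simp: brauer_character_def conj_fun_def p_regular_conj_elt ord_H ord_conj_elt H_sub dest: p_regularD)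
qed

lemma conj_fun_IBr:
  assumes "\<theta> \<in> IBr p r H"
  shows "conj_fun \<theta> \<in> IBr p r H"
proof -
  obtain d R where R: "irreducible_representation H d R" "\<theta> = br_H R"
    using assms by (rule IBr_cases)
  then show ?thesis using br_in_IBr(2)[OF conj_irreducible[OF R(1)]] brauer_conj[of R] by simp
qed

lemma conj_fun_conj_fun_IBr:
  assumes "\<theta> \<in> IBr p r H"
  shows "conj_fun (conj_fun \<theta>) = \<theta>"
proof -
  obtain d R where R: "irreducible_representation H d R" "\<theta> = br_H R"
    using assms by (rule IBr_cases)
  have "conj_fun (conj_fun (br_H R)) = br_H (\<lambda>g. R (conj_elt (conj_elt g)))"
    using brauer_conj[of "\<lambda>g. R (conj_elt g)"] brauer_conj[of R] by simp
  also have "\<dots> = br_H R"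
    by (rule brauer_eq_of_similar) (rule conj_invariant(2)[OF irreducibleD(1)[OF R(1)]])
  finally show ?thesis by (simp add: R(2))
qed

lemma Res_IBr:
  assumes \<theta>: "\<theta> \<in> IBr p r G" "eps_times \<theta> \<noteq> \<theta>"
  shows "Res H \<theta> \<in> IBr p r H"
proof -
  obtain d R where R: "irreducible_representation G d R" "\<theta> = br_G R"
    using \<theta>(1) by (rule IBr_cases)
  have "irreducible_representation H d R"
  proof (rule restriction_irreducible[OF alg_closed_k R(1)], rule ccontr)
    fix T assume T: "T \<in> carrier_mat d d" "intertwines G T R (twist R)" "T \<noteq> 0\<^sub>m d d"
    have "br_G R = br_G (twist R)"
      by (rule brauer_eq_of_similar)
        (rule similar_of_intertwiner(1)[OF is_group R(1) twist_irreducible[OF R(1)] T])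
    then show False using \<theta>(2) brauer_twist[OF irreducibleD(1)[OF R(1)]] R(2) by simp
  qed
  then show ?thesis unfolding R(2) Res_brauer by (rule br_in_IBr)
qed

lemma conj_fun_Res_IBr:
  assumes "\<theta> \<in> IBr p r G"
  shows "conj_fun (Res H \<theta>) = Res H \<theta>"
proof -
  obtain d R where R: "irreducible_representation G d R" "\<theta> = br_G R"
    using assms by (rule IBr_cases)
  note rep = irreducibleD(1)[OF R(1)]
  note RD = representationD[OF is_group rep]
  have "char_poly (R (conj_elt g)) = char_poly (R g)" if "g \<in> carrier H" for g
  proof -
    have g: "g \<in> carrier G" using H_sub[OF that] .
    have "R (conj_elt g) = R (inv s) * R g * R s"
      using RD(3)[of "inv s" g] RD(3)[of "inv s \<otimes> g" s] s(1) g by (simp add: conj_elt_def)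
    then show ?thesis
      using char_poly_similar'[OF RD(1) RD(1) representation_inv[OF is_group rep s(1)] RD(1)[OF g]] s(1) by simp
  qed
  then have "br_H (\<lambda>g. R (conj_elt g)) = br_H R" by (rule brauer_eq_of_similar)
  then show ?thesis unfolding R(2) Res_brauer brauer_conj .
qed

text \<open>Multiplicities of roots add up in a product of polynomials.\<close>

lemma brauer_product:
  fixes R A B :: "'g \<Rightarrow> 'k mat"
  assumes "representation H d R"
    and "\<And>h. h \<in> carrier H \<Longrightarrow> char_poly (R h) = char_poly (A h) * char_poly (B h)"
  shows "br_H R g = br_H A g + br_H B g"
proof (cases "p_regular p H g")
  case True
  note g = p_regularD(1)[OF True]
  have Rg: "R g \<in> carrier_mat d d" by (rule representationD(1)[OF H_group assms(1) g])
  have "coeff (char_poly (R g)) d = 1" using degree_monic_char_poly[OF Rg] by simp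
  then have "char_poly (R g) \<noteq> 0" by (metis coeff_0 zero_neq_one)
  then have o: "Polynomial.order x (char_poly (R g)) = Polynomial.order x (char_poly (A g)) + Polynomial.order x (char_poly (B g))" for x
    unfolding assms(2)[OF g] by (rule order_mult)
  show ?thesis using True by (simp add: brauer_character_def o ring_distribs sum.distrib)
qed (simp add: brauer_character_def)

lemma clifford_IBr:
  assumes \<theta>: "\<theta> \<in> IBr p r G"
  shows "Res H \<theta> \<in> IBr p r H \<or> (\<exists>\<psi>\<in>IBr p r H. \<forall>g. Res H \<theta> g = \<psi> g + conj_fun \<psi> g)"
proof -
  obtain d R where R: "irreducible_representation G d R" "\<theta> = br_G R"
    using \<theta> by (rule IBr_cases)
  from R(1) show ?thesis
  proof (cases rule: clifford_split)
    case (irreducible m A)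
    have "br_H R = br_H A" by (rule brauer_eq_of_similar) (rule irreducible(3))
    then show ?thesis using br_in_IBr(2)[OF irreducible(1)] by (simp add: R(2) Res_brauer)
  next
    case (split m A)
    have "br_H R g = br_H A g + conj_fun (br_H A) g" for g
      unfolding brauer_conj[symmetric]
      by (rule brauer_product[OF representation_H[OF irreducibleD(1)[OF R(1)]] split(3)])
    then show ?thesis unfolding R(2) Res_brauer using br_in_IBr(2)[OF split(1)] by blast
  qed
qed

lemma constituents_conjugate_IBr:
  assumes \<theta>: "\<theta> \<in> IBr p r G" and \<rho>: "\<rho> \<in> IBr p r H" "\<rho>' \<in> IBr p r H" "\<rho> \<noteq> \<rho>'"
    and Res: "Res H \<theta> = (\<lambda>g. \<rho> g + \<rho>' g)"
  shows "conj_fun \<rho> = \<rho>'"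
proof -
  have ind: "int_independent (IBr p r H)" by (rule int_independent_IBr[OF H_group fin_H])
  from clifford_IBr[OF \<theta>] show ?thesis
  proof
    assume "Res H \<theta> \<in> IBr p r H"
    then show ?thesis using int_independent_one_not_two[OF ind, of "Res H \<theta>" \<rho> \<rho>'] \<rho> Res by auto
  next
    assume "\<exists>\<psi>\<in>IBr p r H. \<forall>g. Res H \<theta> g = \<psi> g + conj_fun \<psi> g"
    then obtain \<psi> where \<psi>: "\<psi> \<in> IBr p r H" "\<And>g. Res H \<theta> g = \<psi> g + conj_fun \<psi> g" by blast
    have "\<psi> = \<rho> \<and> conj_fun \<psi> = \<rho>' \<or> \<psi> = \<rho>' \<and> conj_fun \<psi> = \<rho>"
      by (rule int_independent_two_two[OF ind _ \<rho>(3)])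
        (use \<psi>(1) \<rho>(1,2) conj_fun_IBr[OF \<psi>(1)] \<psi>(2) Res in auto)
    then show ?thesis using conj_fun_conj_fun_IBr[OF \<psi>(1)] by auto
  qed
qed

end

section \<open>Partitions and their diagrams\<close>

definition diagram :: "nat list \<Rightarrow> (nat \<times> nat) set" where
  "diagram la = {(i,j). i < length la \<and> j < la ! i}"

lemma mem_diagram: "(i,j) \<in> diagram la \<longleftrightarrow> i < length la \<and> j < la ! i"
  by (simp add: diagram_def)

lemma diagram_Sigma: "diagram la = Sigma {..<length la} (\<lambda>i. {..<la ! i})"
  by (auto simp: diagram_def)

lemma finite_diagram: "finite (diagram la)"
  unfolding diagram_Sigma by auto

lemma card_diagram: "card (diagram la) = sum_list la"
  unfolding diagram_Sigma by (simp add: sum_list_sum_nth atLeast0LessThan)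

lemma partitionsD:
  assumes "la \<in> partitions n"
  shows "sorted_wrt (\<ge>) la" "0 \<notin> set la" "sum_list la = n"
  using assms by (auto simp: partitions_def)

lemma partition_antimono:
  assumes "la \<in> partitions n" "i \<le> j" "j < length la"
  shows "la ! j \<le> la ! i"
  using sorted_wrt_nth_less[OF partitionsD(1)[OF assms(1)], of i j] assms(2,3)
  by (cases "i = j") auto

lemma diagram_downward_closed:
  assumes "la \<in> partitions n" "(i,j) \<in> diagram la" "i' \<le> i" "j' \<le> j"
  shows "(i',j') \<in> diagram la"
  using partition_antimono[OF assms(1,3)] assms(2-4) by (auto simp: mem_diagram)

lemma downward_closed_eq_lessThan:
  fixes S :: "nat set"
  assumes "finite S" "\<And>i j. i \<in> S \<Longrightarrow> j \<le> i \<Longrightarrow> j \<in> S"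
  shows "S = {..<card S}"
proof -
  obtain k where k: "k \<notin> S" using assms(1) ex_new_if_finite infinite_UNIV_nat by blast
  define m where "m = (LEAST k. k \<notin> S)"
  have "m \<notin> S" unfolding m_def using k by (rule LeastI)
  then have "S = {..<m}"
    using not_less_Least[of _ "\<lambda>k. k \<notin> S"] assms(2) unfolding m_def[symmetric]
    by (auto simp: not_le[symmetric])
  then show ?thesis by simp
qed

lemma mem_diagram_column:
  assumes "la \<in> partitions n"
  shows "i < length (filter (\<lambda>a. j < a) la) \<longleftrightarrow> (i,j) \<in> diagram la"
proof -
  let ?S = "{i. i < length la \<and> j < la ! i}"
  have "?S = {..<card ?S}"
  proof (rule downward_closed_eq_lessThan)
    fix i i' assume "i \<in> ?S" "i' \<le> i"
    then show "i' \<in> ?S" using diagram_downward_closed[OF assms, of i j i' j] by (simp add: mem_diagram)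
  qed simp
  then show ?thesis unfolding length_filter_conv_card mem_diagram by blast
qed

lemma diagram_conj:
  assumes "la \<in> partitions n"
  shows "(i,j) \<in> diagram (conj_part la) \<longleftrightarrow> (j,i) \<in> diagram la"
proof -
  have "i < Max (insert 0 (set la))" if "(j,i) \<in> diagram la"
    using that by (auto simp: mem_diagram Max_gr_iff)
  then show ?thesis
    using mem_diagram_column[OF assms, of j i] by (auto simp: conj_part_def mem_diagram)
qed

lemma diagram_conj_eq:
  assumes "la \<in> partitions n"
  shows "diagram (conj_part la) = prod.swap ` diagram la"
proof (intro Set.set_eqI)
  fix x
  have "(fst x, snd x) \<in> prod.swap ` diagram la \<longleftrightarrow> (snd x, fst x) \<in> diagram la" by force
  then show "x \<in> diagram (conj_part la) \<longleftrightarrow> x \<in> prod.swap ` diagram la"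
    using diagram_conj[OF assms, of "fst x" "snd x"] by simp
qed

lemma conj_part_partitions:
  assumes "la \<in> partitions n"
  shows "conj_part la \<in> partitions n"
proof -
  have "sum_list (conj_part la) = card (diagram la)"
    unfolding card_diagram[symmetric] diagram_conj_eq[OF assms] by (rule card_image) simp
  then have 1: "sum_list (conj_part la) = n"
    using partitionsD(3)[OF assms] by (simp add: card_diagram)
  have 2: "0 \<notin> set (conj_part la)"
    by (auto simp: conj_part_def Max_gr_iff filter_empty_conv split: if_splits)
  have "length (filter (\<lambda>a. j < a) la) \<le> length (filter (\<lambda>a. i < a) la)" if "i < j" for i j
    unfolding length_filter_conv_card using that by (intro card_mono) auto
  then have "sorted_wrt (\<ge>) (conj_part la)"
    unfolding conj_part_def sorted_wrt_iff_nth_less by auto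
  with 1 2 show ?thesis by (simp add: partitions_def)
qed

text \<open>The row lengths are read off the diagram, and they stop where the rows are empty, as no part is
  zero.\<close>

lemma partition_eqI:
  assumes la: "la \<in> partitions n" and mu: "mu \<in> partitions m" and eq: "diagram la = diagram mu"
  shows "la = mu"
proof -
  have rows: "{j. (i,j) \<in> diagram nu} = {..<(if i < length nu then nu ! i else 0)}" for i nu
    by (auto simp: mem_diagram)
  have e: "(if i < length la then la ! i else 0) = (if i < length mu then mu ! i else 0)" for i
  proof -
    have "{..<(if i < length la then la ! i else 0)} = {..<(if i < length mu then mu ! i else 0)}"
      unfolding rows[symmetric] eq ..
    then show ?thesis by (simp only: lessThan_eq_iff)
  qed
  have pos: "nu ! i \<noteq> 0" if "nu \<in> partitions k" "i < length nu" for nu k i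
    using partitionsD(2)[OF that(1)] nth_mem[OF that(2)] by metis
  have len: "i < length la \<longleftrightarrow> i < length mu" for i
    using e[of i] pos[OF la, of i] pos[OF mu, of i] by (auto split: if_splits)
  then have "length la = length mu" by (metis linorder_neqE_nat less_irrefl)
  then show ?thesis using e by (intro nth_equalityI) (auto split: if_splits, metis)
qed

lemma conj_conj_part: "la \<in> partitions n \<Longrightarrow> conj_part (conj_part la) = la"
  by (rule partition_eqI[OF conj_part_partitions[OF conj_part_partitions]])
    (auto simp: diagram_conj[OF conj_part_partitions] diagram_conj)

lemma card_diagram_row: "card {c. (r,c) \<in> diagram la} = (if r < length la then la ! r else 0)"
proof -
  have "{c. (r,c) \<in> diagram la} = {..<(if r < length la then la ! r else 0)}"
    by (auto simp: mem_diagram)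
  then show ?thesis by simp
qed

lemma card_diagram_column:
  "la \<in> partitions n \<Longrightarrow> card {r. (r,c) \<in> diagram la} = (if c < length (conj_part la) then conj_part la ! c else 0)"
  using card_diagram_row[of c "conj_part la"] by (simp add: diagram_conj)

section \<open>Zero-one matrices with prescribed row and column sums\<close>

lemma finite_column: "finite E \<Longrightarrow> finite {r. (r,c) \<in> E}"
  by (rule finite_subset[of _ "fst ` E"]) force+

lemma finite_row: "finite E \<Longrightarrow> finite {c. (r,c) \<in> E}"
  by (rule finite_subset[of _ "snd ` E"]) force+

lemma card_upper_rows_by_columns:
  assumes "finite E" "snd ` E \<subseteq> C" "finite C"
  shows "card {x \<in> E. fst x < k} = (\<Sum>c\<in>C. card {r. (r,c) \<in> E \<and> r < (k::nat)})"
proof -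
  have "{x \<in> E. fst x < k} = prod.swap ` (SIGMA c:C. {r. (r,c) \<in> E \<and> r < k})"
    using assms(2) by (auto simp: image_iff)
  then have "card {x \<in> E. fst x < k} = card (SIGMA c:C. {r. (r,c) \<in> E \<and> r < k})"
    by (simp add: card_image)
  also have "\<dots> = (\<Sum>c\<in>C. card {r. (r,c) \<in> E \<and> r < k})"
    by (rule card_SigmaI) (use assms(3) in auto)
  finally show ?thesis .
qed

lemma diagram_column:
  assumes la: "la \<in> partitions n"
  obtains h where "\<And>r. (r,c) \<in> diagram la \<longleftrightarrow> r < h" "card {r. (r,c) \<in> diagram la} = h"
proof -
  have "{r. (r,c) \<in> diagram la} = {..<card {r. (r,c) \<in> diagram la}}"
    by (rule downward_closed_eq_lessThan[OF finite_column[OF finite_diagram]], unfold mem_Collect_eq,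
        erule diagram_downward_closed[OF la], assumption, rule order_refl)
  then show thesis using that by blast
qed

text \<open>The columns of a diagram are pushed up, so with given column sums the upper rows contain as many cells as
  possible.\<close>

lemma column_bound:
  assumes la: "la \<in> partitions n" and E: "finite E"
    and cols: "\<And>c. card {r. (r,c) \<in> E} = card {r. (r,c) \<in> diagram la}"
  shows "card {r. (r,c) \<in> E \<and> r < k} \<le> card {r. (r,c) \<in> diagram la \<and> r < k}"
proof -
  obtain h where h: "\<And>r. (r,c) \<in> diagram la \<longleftrightarrow> r < h" "card {r. (r,c) \<in> diagram la} = h"
    by (rule diagram_column[OF la]) (rule that)
  have "{r. (r,c) \<in> diagram la \<and> r < k} = {..<min k h}" unfolding h(1) by auto
  moreover have "card {r. (r,c) \<in> E \<and> r < k} \<le> card {..<k}" by (rule card_mono) auto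
  moreover have "card {r. (r,c) \<in> E \<and> r < k} \<le> card {r. (r,c) \<in> E}"
    by (rule card_mono[OF finite_column[OF E]]) auto
  ultimately show ?thesis using cols[of c] h(2) by simp
qed

lemma dominance:
  assumes la: "la \<in> partitions n" and E: "finite E"
    and cols: "\<And>c. card {r. (r,c) \<in> E} = card {r. (r,c) \<in> diagram la}"
  shows "card {x \<in> E. fst x < k} \<le> card {x \<in> diagram la. fst x < k}"
proof -
  let ?C = "snd ` (E \<union> diagram la)"
  have C: "finite ?C" using E finite_diagram by simp
  have sub: "snd ` E \<subseteq> ?C" "snd ` diagram la \<subseteq> ?C" by auto
  show ?thesis
    using card_upper_rows_by_columns[OF E sub(1) C, where k = k] card_upper_rows_by_columns[OF finite_diagram sub(2) C, where k = k]
    by (simp add: sum_mono column_bound[OF la E cols])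
qed

text \<open>Equality in the total forces equality in the bound for each column. For \<open>k\<close> the height of a
  column this says that the column of \<open>E\<close> is pushed up as well.\<close>

lemma dominance_eq:
  assumes la: "la \<in> partitions n" and E: "finite E"
    and cols: "\<And>c. card {r. (r,c) \<in> E} = card {r. (r,c) \<in> diagram la}"
    and eq: "\<And>k. card {x \<in> E. fst x < k} = card {x \<in> diagram la. fst x < k}"
  shows "E = diagram la"
proof -
  let ?C = "snd ` (E \<union> diagram la)"
  have C: "finite ?C" using E finite_diagram by simp
  have sub: "snd ` E \<subseteq> ?C" "snd ` diagram la \<subseteq> ?C" by auto
  have col: "{r. (r,c) \<in> E} = {r. (r,c) \<in> diagram la}" for c
  proof (cases "c \<in> ?C")
    case True
    obtain h where h: "\<And>r. (r,c) \<in> diagram la \<longleftrightarrow> r < h" "card {r. (r,c) \<in> diagram la} = h"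
      by (rule diagram_column[OF la]) (rule that)
    have "(\<Sum>c\<in>?C. card {r. (r,c) \<in> E \<and> r < h}) = (\<Sum>c\<in>?C. card {r. (r,c) \<in> diagram la \<and> r < h})"
      using card_upper_rows_by_columns[OF E sub(1) C, where k = h]
        card_upper_rows_by_columns[OF finite_diagram sub(2) C, where k = h] eq[of h] by simp
    then have "card {r. (r,c) \<in> E \<and> r < h} = card {r. (r,c) \<in> diagram la \<and> r < h}"
      by (rule sum_mono_inv[OF _ column_bound[OF la E cols] True C])
    also have "{r. (r,c) \<in> diagram la \<and> r < h} = {..<h}" unfolding h(1) by auto
    finally have "{r. (r,c) \<in> E \<and> r < h} = {..<h}" by (intro card_subset_eq) auto
    then have "{..<h} \<subseteq> {r. (r,c) \<in> E}" by auto
    then have "{..<h} = {r. (r,c) \<in> E}"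
      by (rule card_subset_eq[OF finite_column[OF E]]) (simp add: cols h(2))
    then show ?thesis unfolding h(1) by auto
  next
    case False
    then have "(r,c) \<notin> E" "(r,c) \<notin> diagram la" for r by force+
    then show ?thesis by simp
  qed
  show ?thesis using col by (auto simp: set_eq_iff)
qed

lemma card_upper_rows:
  assumes "finite E"
  shows "card {x \<in> E. fst x < k} = (\<Sum>r<k. card {c. (r,c) \<in> (E :: (nat \<times> 'c) set)})"
proof -
  have "{x \<in> E. fst x < k} = (SIGMA r:{..<k}. {c. (r,c) \<in> E})" by auto
  moreover have "finite {c. (r,c) \<in> E}" for r
    by (rule finite_row[OF assms])
  ultimately show ?thesis by (simp add: card_SigmaI)
qed

section \<open>Young subgroups\<close>

text \<open>The index of the block that contains \<open>i\<close>, for the blocks that define the Young subgroup. In the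
  tableau that is filled row by row, this is the row of \<open>i\<close>.\<close>

definition blk :: "nat list \<Rightarrow> nat \<Rightarrow> nat" where
  "blk la i = (LEAST j. i \<le> sum_list (take (Suc j) la))"

lemma sum_list_take_mono: "i \<le> j \<Longrightarrow> sum_list (take i la) \<le> sum_list (take j (la :: nat list))"
  by (metis le_add1 le_add_diff_inverse sum_list_append take_add)

lemma blk_iff:
  assumes "j < length la"
  shows "i \<in> {sum_list (take j la)<..sum_list (take (Suc j) la)} \<longleftrightarrow> 1 \<le> i \<and> i \<le> sum_list la \<and> blk la i = j"
proof
  assume i: "i \<in> {sum_list (take j la)<..sum_list (take (Suc j) la)}"
  have "blk la i = j" unfolding blk_def
  proof (rule Least_equality)
    show "i \<le> sum_list (take (Suc j) la)" using i by simp
    fix k assume k: "i \<le> sum_list (take (Suc k) la)"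
    show "j \<le> k"
    proof (rule ccontr)
      assume "\<not> j \<le> k"
      then have "sum_list (take (Suc k) la) \<le> sum_list (take j la)" by (intro sum_list_take_mono) simp
      then show False using i k by simp
    qed
  qed
  moreover have "sum_list (take (Suc j) la) \<le> sum_list la"
    using sum_list_take_mono[of "Suc j" "length la" la] assms by simp
  ultimately show "1 \<le> i \<and> i \<le> sum_list la \<and> blk la i = j" using i by auto
next
  assume i: "1 \<le> i \<and> i \<le> sum_list la \<and> blk la i = j"
  have "i \<le> sum_list (take (Suc (length la)) la)" using i by simp
  then have 1: "i \<le> sum_list (take (Suc j) la)"
    using i LeastI[of "\<lambda>j. i \<le> sum_list (take (Suc j) la)"] unfolding blk_def by blast
  have 2: "sum_list (take j la) < i"
  proof (cases j)
    case 0
    then show ?thesis using i by simp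
  next
    case (Suc j')
    then have "\<not> i \<le> sum_list (take (Suc j') la)"
      using i not_less_Least[of j' "\<lambda>j. i \<le> sum_list (take (Suc j) la)"] unfolding blk_def by auto
    then show ?thesis using Suc by simp
  qed
  from 1 2 show "i \<in> {sum_list (take j la)<..sum_list (take (Suc j) la)}" by simp
qed

lemma blk_less:
  assumes "1 \<le> i" "i \<le> sum_list la"
  shows "blk la i < length la"
proof -
  have "la \<noteq> []" using assms by auto
  then obtain k where k: "length la = Suc k" by (cases "length la") auto
  then have "i \<le> sum_list (take (Suc k) la)" using assms by simp
  then have "blk la i \<le> k" unfolding blk_def by (rule Least_le)
  then show ?thesis using k by simp
qed

lemma young_subgroup_iff:
  assumes "sum_list la = n"
  shows "g \<in> young_subgroup n la \<longleftrightarrow> g permutes {1..n} \<and> (\<forall>i\<in>{1..n}. blk la (g i) = blk la i)"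
proof -
  define B where "B j = {sum_list (take j la)<..sum_list (take (Suc j) la)}" for j
  have B: "i \<in> B j \<longleftrightarrow> i \<in> {1..n} \<and> blk la i = j" if "j < length la" for i j
    using blk_iff[OF that, of i] assms by (simp add: B_def)
  have lt: "blk la i < length la" if "i \<in> {1..n}" for i using blk_less[of i la] that assms by simp
  have "(\<forall>j<length la. g ` B j = B j) \<longleftrightarrow> (\<forall>i\<in>{1..n}. blk la (g i) = blk la i)" if g: "g permutes {1..n}"
  proof
    assume *: "\<forall>j<length la. g ` B j = B j"
    show "\<forall>i\<in>{1..n}. blk la (g i) = blk la i"
    proof
      fix i assume i: "i \<in> {1..n}"
      then have "g i \<in> B (blk la i)" using * lt[OF i] B[OF lt[OF i], of i] by blast
      then show "blk la (g i) = blk la i" using B[OF lt[OF i]] by blast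
    qed
  next
    assume *: "\<forall>i\<in>{1..n}. blk la (g i) = blk la i"
    show "\<forall>j<length la. g ` B j = B j"
    proof (intro allI impI)
      fix j assume j: "j < length la"
      have "g ` B j \<subseteq> B j" using * B[OF j] permutes_in_image[OF g] by auto
      moreover have "inj_on g (B j)" using permutes_inj[OF g] by (rule inj_on_subset) simp
      moreover have "finite (B j)" by (simp add: B_def)
      ultimately show "g ` B j = B j" by (simp add: endo_inj_surj)
    qed
  qed
  then show ?thesis by (auto simp: young_subgroup_def Let_def B_def)
qed

lemma card_blk:
  assumes "j < length la"
  shows "card {i \<in> {1..sum_list la}. blk la i = j} = la ! j"
proof -
  have "{i \<in> {1..sum_list la}. blk la i = j} = {sum_list (take j la)<..sum_list (take (Suc j) la)}"
    (is "?L = ?R")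
  proof (rule Set.set_eqI)
    fix i
    show "i \<in> ?L \<longleftrightarrow> i \<in> ?R" unfolding blk_iff[OF assms, of i] by simp
  qed
  then show ?thesis using assms by (simp add: take_Suc_conv_app_nth)
qed

lemma card_blk':
  "card {i \<in> {1..sum_list la}. blk la i = j} = (if j < length la then la ! j else 0)"
proof (cases "j < length la")
  case False
  then have "{i \<in> {1..sum_list la}. blk la i = j} = {}" using blk_less by auto
  then show ?thesis using False by simp
qed (simp only: card_blk if_True)

section \<open>Pairs of tableaux\<close>

text \<open>The position of \<open>i\<close> relative to two tableaux: its row in the row filling of \<open>la\<close>,
  and its row in the translate by \<open>x\<close> of the row filling of \<open>nu\<close>. The second number plays the
  part of a column; the map is injective if and only if no two numbers share both a row and a column.\<close>

definition cell :: "nat list \<Rightarrow> nat list \<Rightarrow> (nat \<Rightarrow> nat) \<Rightarrow> nat \<Rightarrow> nat \<times> nat" where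
  "cell la nu x i = (blk la i, blk nu (inv' x i))"

lemma card_fibre_fst:
  assumes "inj_on f A"
  shows "card {c. (r,c) \<in> f ` A} = card {i \<in> A. fst (f i) = r}"
proof -
  have "{c. (r,c) \<in> f ` A} = (\<lambda>i. snd (f i)) ` {i \<in> A. fst (f i) = r}"
  proof (intro equalityI subsetI)
    fix c assume "c \<in> {c. (r,c) \<in> f ` A}"
    then obtain i where i: "i \<in> A" "f i = (r,c)" by force
    then show "c \<in> (\<lambda>i. snd (f i)) ` {i \<in> A. fst (f i) = r}" by (intro image_eqI[of _ _ i]) auto
  next
    fix c assume "c \<in> (\<lambda>i. snd (f i)) ` {i \<in> A. fst (f i) = r}"
    then obtain i where "i \<in> A" "fst (f i) = r" "snd (f i) = c" by auto
    then show "c \<in> {c. (r,c) \<in> f ` A}" by (auto intro!: image_eqI[of _ _ i])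
  qed
  moreover have "inj_on (\<lambda>i. snd (f i)) {i \<in> A. fst (f i) = r}"
    using assms by (intro inj_onI) (metis (mono_tags, lifting) inj_onD mem_Collect_eq prod_eqI)
  ultimately show ?thesis by (simp add: card_image)
qed

lemma card_fibre_snd:
  assumes "inj_on f A"
  shows "card {r. (r,c) \<in> f ` A} = card {i \<in> A. snd (f i) = c}"
proof -
  have "{r. (r,c) \<in> f ` A} = (\<lambda>i. fst (f i)) ` {i \<in> A. snd (f i) = c}"
  proof (intro equalityI subsetI)
    fix r assume "r \<in> {r. (r,c) \<in> f ` A}"
    then obtain i where i: "i \<in> A" "f i = (r,c)" by force
    then show "r \<in> (\<lambda>i. fst (f i)) ` {i \<in> A. snd (f i) = c}" by (intro image_eqI[of _ _ i]) auto
  next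
    fix r assume "r \<in> (\<lambda>i. fst (f i)) ` {i \<in> A. snd (f i) = c}"
    then obtain i where "i \<in> A" "fst (f i) = r" "snd (f i) = c" by auto
    then show "r \<in> {r. (r,c) \<in> f ` A}" by (auto intro!: image_eqI[of _ _ i])
  qed
  moreover have "inj_on (\<lambda>i. fst (f i)) {i \<in> A. snd (f i) = c}"
    using assms by (intro inj_onI) (metis (mono_tags, lifting) inj_onD mem_Collect_eq prod_eqI)
  ultimately show ?thesis by (simp add: card_image)
qed

lemma cell_counts:
  assumes la: "sum_list la = n" and nu: "sum_list nu = n" and x: "x permutes {1..n}"
    and inj: "inj_on (cell la nu x) {1..n}"
  shows "card {c. (r,c) \<in> cell la nu x ` {1..n}} = (if r < length la then la ! r else 0)"
    "card {r. (r,c) \<in> cell la nu x ` {1..n}} = (if c < length nu then nu ! c else 0)"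
proof -
  show "card {c. (r,c) \<in> cell la nu x ` {1..n}} = (if r < length la then la ! r else 0)"
    unfolding card_fibre_fst[OF inj] using card_blk'[of la r] la by (simp add: cell_def)
  have "card {r. (r,c) \<in> cell la nu x ` {1..n}} = card {i \<in> {1..n}. blk nu (inv' x i) = c}"
    unfolding card_fibre_snd[OF inj] by (simp add: cell_def)
  also have "{i \<in> {1..n}. blk nu (inv' x i) = c} = x ` {i \<in> {1..n}. blk nu i = c}"
  proof (intro equalityI subsetI)
    fix i assume i: "i \<in> {i \<in> {1..n}. blk nu (inv' x i) = c}"
    then have "inv' x i \<in> {1..n}" using permutes_in_image[OF permutes_inv[OF x]] by simp
    then show "i \<in> x ` {i \<in> {1..n}. blk nu i = c}"
      using i permutes_inverses(1)[OF x, of i] by (intro image_eqI[of _ _ "inv' x i"]) auto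
  next
    fix i assume "i \<in> x ` {i \<in> {1..n}. blk nu i = c}"
    then show "i \<in> {i \<in> {1..n}. blk nu (inv' x i) = c}"
      using permutes_in_image[OF x] permutes_inverses(2)[OF x] by auto
  qed
  also have "card \<dots> = card {i \<in> {1..n}. blk nu i = c}"
    using permutes_inj[OF x] by (intro card_image) (auto simp: inj_on_def)
  finally show "card {r. (r,c) \<in> cell la nu x ` {1..n}} = (if c < length nu then nu ! c else 0)"
    using card_blk'[of nu c] nu by simp
qed

text \<open>The image has the row sums and the column sums of the diagram, and these determine it.\<close>

lemma cell_image_eq_diagram:
  assumes la: "la \<in> partitions n" and x: "x permutes {1..n}"
    and inj: "inj_on (cell la (conj_part la) x) {1..n}"
  shows "cell la (conj_part la) x ` {1..n} = diagram la"
proof -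
  let ?E = "cell la (conj_part la) x ` {1..n}"
  have E: "finite ?E" by simp
  note s = partitionsD(3)[OF la] partitionsD(3)[OF conj_part_partitions[OF la]]
  note cc = cell_counts[OF s x inj]
  show ?thesis
  proof (rule dominance_eq[OF la E])
    show "card {r. (r,c) \<in> ?E} = card {r. (r,c) \<in> diagram la}" for c
      unfolding cc(2) card_diagram_column[OF la] ..
    show "card {x \<in> ?E. fst x < k} = card {x \<in> diagram la. fst x < k}" for k
      unfolding card_upper_rows[OF E] card_upper_rows[OF finite_diagram] cc(1) card_diagram_row ..
  qed
qed

lemma cell_injective_dominance:
  assumes la: "la \<in> partitions n" and mu: "mu \<in> partitions n" and x: "x permutes {1..n}"
    and inj: "inj_on (cell la (conj_part mu) x) {1..n}"
  shows "card {x \<in> diagram la. fst x < k} \<le> card {x \<in> diagram mu. fst x < k}"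
proof -
  let ?E = "cell la (conj_part mu) x ` {1..n}"
  have E: "finite ?E" by simp
  note s = partitionsD(3)[OF la] partitionsD(3)[OF conj_part_partitions[OF mu]]
  note cc = cell_counts[OF s x inj]
  have "card {x \<in> ?E. fst x < k} \<le> card {x \<in> diagram mu. fst x < k}"
    by (rule dominance[OF mu E]) (simp only: cc(2) card_diagram_column[OF mu])
  then show ?thesis
    unfolding card_upper_rows[OF E] card_upper_rows[OF finite_diagram] cc(1) card_diagram_row .
qed

lemma partitions_eq_of_dominance:
  assumes la: "la \<in> partitions n" and mu: "mu \<in> partitions n"
    and eq: "\<And>k. card {x \<in> diagram la. fst x < k} = card {x \<in> diagram mu. fst x < k}"
  shows "la = mu"
proof (rule partition_eqI[OF la mu])
  have row: "card {c. (r,c) \<in> diagram la} = card {c. (r,c) \<in> diagram mu}" for r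
    using eq[of r] eq[of "Suc r"] unfolding card_upper_rows[OF finite_diagram] by simp
  have "{c. (r,c) \<in> diagram nu} = {..<card {c. (r,c) \<in> diagram nu}}" for r nu
    unfolding card_diagram_row by (auto simp: mem_diagram)
  then have "{c. (r,c) \<in> diagram la} = {c. (r,c) \<in> diagram mu}" for r using row by metis
  then show "diagram la = diagram mu" by (auto simp: set_eq_iff)
qed

text \<open>Bijections between the fibres are glued.\<close>

lemma bij_with_equal_fibres:
  assumes fin: "finite A" "finite D"
    and card: "\<And>r. card {a \<in> A. f a = r} = card {b \<in> D. h b = r}"
  obtains T where "bij_betw T A D" "\<And>a. a \<in> A \<Longrightarrow> h (T a) = f a"
proof -
  have "\<exists>t. bij_betw t {a \<in> A. f a = r} {b \<in> D. h b = r}" for r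
    by (rule finite_same_card_bij) (use fin card in auto)
  then obtain t where t: "\<And>r. bij_betw (t r) {a \<in> A. f a = r} {b \<in> D. h b = r}" by metis
  define T where "T a = t (f a) a" for a
  have T: "T a \<in> D" "h (T a) = f a" if "a \<in> A" for a
    using bij_betw_apply[OF t[of "f a"], of a] that by (auto simp: T_def)
  have "inj_on T A"
  proof (rule inj_onI)
    fix a b assume ab: "a \<in> A" "b \<in> A" "T a = T b"
    then have "f a = f b" using T by metis
    then show "a = b" using ab bij_betw_imp_inj_on[OF t[of "f a"]] by (auto simp: T_def inj_on_def)
  qed
  moreover have "T ` A = D"
  proof (intro equalityI subsetI)
    fix b assume b: "b \<in> D"
    then have "b \<in> t (h b) ` {a \<in> A. f a = h b}"
      unfolding bij_betw_imp_surj_on[OF t[of "h b"]] by simp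
    then obtain a where "a \<in> A" "f a = h b" "t (h b) a = b" by auto
    then show "b \<in> T ` A" by (auto simp: T_def intro!: image_eqI[of _ _ a])
  qed (use T in auto)
  ultimately show thesis using that T by (simp add: bij_betw_def)
qed

text \<open>Two fillings of the diagram of \<open>la\<close> are chosen: \<open>T\<close> puts every number into its row
  of the row filling, and \<open>T'\<close> puts the numbers of every block of the conjugate into a column. The
  permutation compares the two.\<close>

lemma exists_injective_cell:
  assumes la: "la \<in> partitions n"
  obtains x where "x permutes {1..n}" "inj_on (cell la (conj_part la) x) {1..n}"
proof -
  let ?nu = "conj_part la"
  note s = partitionsD(3)[OF la] partitionsD(3)[OF conj_part_partitions[OF la]]
  have row: "card {b \<in> diagram la. fst b = r} = card {c. (r,c) \<in> diagram la}" for r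
    using card_fibre_fst[of "\<lambda>b. b" "diagram la" r] by simp
  have col: "card {b \<in> diagram la. snd b = c} = card {r. (r,c) \<in> diagram la}" for c
    using card_fibre_snd[of "\<lambda>b. b" "diagram la" c] by simp
  have card: "card {i \<in> {1..n}. blk la i = r} = card {b \<in> diagram la. fst b = r}"
    "card {i \<in> {1..n}. blk ?nu i = r} = card {b \<in> diagram la. snd b = r}" for r
    unfolding row col card_diagram_row card_diagram_column[OF la]
    using card_blk'[of la r] card_blk'[of ?nu r] unfolding s by simp_all
  obtain T where T: "bij_betw T {1..n} (diagram la)" "\<And>i. i \<in> {1..n} \<Longrightarrow> fst (T i) = blk la i"
    by (rule bij_with_equal_fibres[OF finite_atLeastAtMost finite_diagram card(1)]) (rule that)
  obtain T' where T': "bij_betw T' {1..n} (diagram la)" "\<And>i. i \<in> {1..n} \<Longrightarrow> snd (T' i) = blk ?nu i"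
    by (rule bij_with_equal_fibres[OF finite_atLeastAtMost finite_diagram card(2)]) (rule that)
  define y where "y i = (if i \<in> {1..n} then the_inv_into {1..n} T' (T i) else i)" for i
  have "bij_betw (the_inv_into {1..n} T' \<circ> T) {1..n} {1..n}"
    by (rule bij_betw_trans[OF T(1) bij_betw_the_inv_into[OF T'(1)]])
  then have "bij_betw y {1..n} {1..n}" by (rule bij_betw_cong[THEN iffD1, rotated]) (simp add: y_def)
  then have y: "y permutes {1..n}" by (rule bij_imp_permutes) (auto simp: y_def)
  have Ty: "T' (y i) = T i" if "i \<in> {1..n}" for i
    using that T(1) T'(1) by (simp add: y_def f_the_inv_into_f_bij_betw bij_betw_apply)
  have e: "cell la ?nu (inv' y) i = T i" if i: "i \<in> {1..n}" for i
  proof -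
    have "y i \<in> {1..n}" using permutes_in_image[OF y] i by simp
    then have "snd (T i) = blk ?nu (y i)" using T'(2)[of "y i"] Ty[OF i] by simp
    then show ?thesis unfolding cell_def permutes_inv_inv[OF y] T(2)[OF i, symmetric] by (metis prod.collapse)
  qed
  have "inj_on (cell la ?nu (inv' y)) {1..n}"
    using inj_on_cong[of "{1..n}" "cell la ?nu (inv' y)" T, OF e] bij_betw_imp_inj_on[OF T(1)] by blast
  then show thesis by (rule that[OF permutes_inv[OF y]])
qed

section \<open>Irreducible constituents\<close>

text \<open>The matrix coefficients of pairwise nonisomorphic irreducible representations are independent. This is the
  form in which they occur when a group element is multiplied by fixed elements of the group algebra on both
  sides.\<close>

lemma coefficient_independence:
  fixes R :: "'i \<Rightarrow> 'g \<Rightarrow> 'k :: field mat"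
  assumes ac: "alg_closed TYPE('k)" and G: "group G" and I: "finite I"
    and R: "\<And>i. i \<in> I \<Longrightarrow> irreducible_representation G (d i) (R i)"
    and noniso: "\<And>i j T. i \<in> I \<Longrightarrow> j \<in> I \<Longrightarrow> i \<noteq> j \<Longrightarrow> T \<in> carrier_mat (d i) (d j) \<Longrightarrow>
      intertwines G T (R i) (R j) \<Longrightarrow> T = 0\<^sub>m (d i) (d j)"
    and rel: "\<And>x. x \<in> carrier G \<Longrightarrow> (\<Sum>i\<in>I. \<Sum>k<d i. \<Sum>l<d i. u i k * R i x $$ (k,l) * v i l) = 0"
    and i: "i \<in> I" and kl: "k < d i" "l < d i"
  shows "u i k * v i l = 0"
proof -
  have Rc: "R i g \<in> carrier_mat (d i) (d i)" if "i \<in> I" "g \<in> carrier G" for i g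
    using representationD(1)[OF G irreducibleD(1)[OF R]] that by blast
  define w where "w = (\<lambda>(i,k). u i k \<cdot>\<^sub>v vec (d i) (v i))"
  have "\<forall>(i,k)\<in>Sigma I (\<lambda>i. {..<d i}). w (i,k) = 0\<^sub>v (d i)"
  proof (rule rows_independent[OF ac G R noniso])
    fix g assume g: "g \<in> carrier G"
    have e: "(R i g *\<^sub>v w (i,k)) $ k = (\<Sum>l<d i. u i k * R i g $$ (k,l) * v i l)" if "i \<in> I" "k < d i" for i k
    proof -
      have "(R i g *\<^sub>v w (i,k)) $ k = (\<Sum>l<d i. R i g $$ (k,l) * (u i k * v i l))"
        using Rc[OF that(1) g] that(2) by (simp add: w_def scalar_prod_def atLeast0LessThan)
      then show ?thesis by (simp add: mult_ac)
    qed
    have "(\<Sum>(i,k)\<in>Sigma I (\<lambda>i. {..<d i}). (R i g *\<^sub>v w (i,k)) $ k) =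
      (\<Sum>(i,k)\<in>Sigma I (\<lambda>i. {..<d i}). \<Sum>l<d i. u i k * R i g $$ (k,l) * v i l)"
      by (intro sum.cong) (auto simp: e simp del: index_mult_mat_vec)
    also have "\<dots> = (\<Sum>i\<in>I. \<Sum>k<d i. \<Sum>l<d i. u i k * R i g $$ (k,l) * v i l)"
      by (rule sum.Sigma[symmetric]) (use I in auto)
    finally show "(\<Sum>(i,k)\<in>Sigma I (\<lambda>i. {..<d i}). (R i g *\<^sub>v w (i,k)) $ k) = 0"
      using rel[OF g] by simp
  qed (use I in \<open>auto simp: w_def\<close>)
  then have "w (i,k) = 0\<^sub>v (d i)" using i kl by auto
  then have "w (i,k) $ l = 0" using kl by simp
  then show ?thesis using kl by (simp add: w_def)
qed

text \<open>The functional given by \<open>w\<close> is nonzero on the character of the regular representation, which is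
  \<open>|G|\<close> at the identity and \<open>0\<close> elsewhere. This character is a sum of irreducible ones, so the
  functional is nonzero on one of them.\<close>

lemma exists_irreducible_nonzero:
  fixes w :: "'t \<Rightarrow> complex"
  assumes G: "group G" "finite (carrier G)" and T: "finite T" "\<And>t. t \<in> T \<Longrightarrow> y t \<in> carrier G"
    and nz: "(\<Sum>t\<in>{t\<in>T. y t = \<one>\<^bsub>G\<^esub>}. w t) \<noteq> 0"
  obtains d S where "irreducible_representation G d S" "(\<Sum>t\<in>T. w t * mat_trace (S (y t))) \<noteq> 0"
proof -
  interpret group G by fact
  define N where "N = card (carrier G)"
  obtain f where f: "bij_betw f {..<N} (carrier G)"
    using ex_bij_betw_nat_finite[OF G(2)] by (auto simp: N_def atLeast0LessThan)
  have fc: "f i \<in> carrier G" if "i < N" for i using bij_betw_apply[OF f] that by simp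
  have fi: "f i = f j \<longleftrightarrow> i = j" if "i < N" "j < N" for i j
    using bij_betw_imp_inj_on[OF f] that by (auto simp: inj_on_def)
  define R :: "'a \<Rightarrow> complex mat" where
    "R g = mat N N (\<lambda>(i,j). if f i = g \<otimes>\<^bsub>G\<^esub> f j then 1 else 0)" for g
  have R: "representation G N R" unfolding representation_iff[OF G(1)]
  proof (intro conjI ballI)
    show "R g \<in> carrier_mat N N" for g by (simp add: R_def)
    show "R \<one>\<^bsub>G\<^esub> = 1\<^sub>m N" by (rule eq_matI) (auto simp: R_def fc fi)
    fix g h assume g: "g \<in> carrier G" and h: "h \<in> carrier G"
    show "R (g \<otimes>\<^bsub>G\<^esub> h) = R g * R h"
    proof (rule eq_matI)
      fix i j assume "i < dim_row (R g * R h)" "j < dim_col (R g * R h)"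
      then have ij: "i < N" "j < N" by (auto simp: R_def)
      have "h \<otimes>\<^bsub>G\<^esub> f j \<in> carrier G" using h fc ij by simp
      then obtain k where k: "k < N" "f k = h \<otimes>\<^bsub>G\<^esub> f j"
        using bij_betw_imp_surj_on[OF f] by (metis imageE lessThan_iff)
      have "(R g * R h) $$ (i,j) = (\<Sum>l<N. (if f i = g \<otimes>\<^bsub>G\<^esub> f l then 1 else 0) * (if f l = h \<otimes>\<^bsub>G\<^esub> f j then 1 else 0))"
        using ij by (simp add: R_def scalar_prod_def atLeast0LessThan)
      also have "\<dots> = (\<Sum>l<N. if l = k then (if f i = g \<otimes>\<^bsub>G\<^esub> f k then 1 else 0) else 0)"
        by (rule sum.cong) (auto simp: k(2)[symmetric] fi k(1))
      also have "\<dots> = (if f i = g \<otimes>\<^bsub>G\<^esub> f k then 1 else 0)" using k(1) by simp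
      also have "\<dots> = R (g \<otimes>\<^bsub>G\<^esub> h) $$ (i,j)" using ij g h fc by (simp add: R_def k(2) m_assoc)
      finally show "R (g \<otimes>\<^bsub>G\<^esub> h) $$ (i,j) = (R g * R h) $$ (i,j)" by simp
    qed (auto simp: R_def)
  qed
  have tr: "mat_trace (R g) = (if g = \<one>\<^bsub>G\<^esub> then of_nat N else 0)" if g: "g \<in> carrier G" for g
  proof -
    have "f i = g \<otimes>\<^bsub>G\<^esub> f i \<longleftrightarrow> g = \<one>\<^bsub>G\<^esub>" if "i < N" for i
      using right_cancel[of "f i" "\<one>\<^bsub>G\<^esub>" g] fc[OF that] g by auto
    then show ?thesis by (simp add: mat_trace_def R_def)
  qed
  obtain Rs where Rs: "\<And>S. S \<in> set Rs \<Longrightarrow> \<exists>m. irreducible_representation G m S"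
    "\<And>g. g \<in> carrier G \<Longrightarrow> mat_trace (R g) = (\<Sum>S\<leftarrow>Rs. mat_trace (S g))"
    using composition_factors[OF G(1) R] by metis
  have "(\<Sum>t\<in>T. w t * mat_trace (R (y t))) = (\<Sum>t\<in>T. if y t = \<one>\<^bsub>G\<^esub> then of_nat N * w t else 0)"
    by (intro sum.cong) (auto simp: tr T(2))
  also have "\<dots> = of_nat N * (\<Sum>t\<in>{t\<in>T. y t = \<one>\<^bsub>G\<^esub>}. w t)"
    unfolding sum.inter_filter[OF T(1)] sum_distrib_left by (rule sum.cong) auto
  also have "\<dots> \<noteq> 0" using nz G(2) by (auto simp: N_def card_gt_0_iff)
  finally have nz': "(\<Sum>t\<in>T. w t * mat_trace (R (y t))) \<noteq> 0" .
  have sw: "(\<Sum>t\<in>T. w t * (\<Sum>S\<leftarrow>Ss. mat_trace (S (y t)))) = (\<Sum>S\<leftarrow>Ss. \<Sum>t\<in>T. w t * mat_trace (S (y t)))" for Ss :: "('a \<Rightarrow> complex mat) list"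
    by (induction Ss) (simp_all add: ring_distribs sum.distrib)
  have "(\<Sum>t\<in>T. w t * mat_trace (R (y t))) = (\<Sum>t\<in>T. w t * (\<Sum>S\<leftarrow>Rs. mat_trace (S (y t))))"
    by (intro sum.cong refl) (simp add: Rs(2) T(2))
  then have "(\<Sum>S\<leftarrow>Rs. \<Sum>t\<in>T. w t * mat_trace (S (y t))) \<noteq> 0" using nz' unfolding sw by simp
  then obtain S where "S \<in> set Rs" "(\<Sum>t\<in>T. w t * mat_trace (S (y t))) \<noteq> 0"
    by (metis (mono_tags, lifting) map_eq_conv sum_list_0)
  then show thesis using that Rs(1) by blast
qed

text \<open>On the range of \<open>M\<close>, the matrix acts as the scalar \<open>c\<close>, so its trace is
  \<open>c\<close> times its rank.\<close>

lemma idempotent_trace_zero: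
  fixes M :: "complex mat"
  assumes M: "M \<in> carrier_mat d d" and MM: "M * M = c \<cdot>\<^sub>m M" and c: "c \<noteq> 0" and tr: "mat_trace M = 0"
  shows "M = 0\<^sub>m d d"
proof -
  define W where "W = (\<lambda>v. M *\<^sub>v v) ` carrier_vec d"
  have W: "vec_subspace d W" unfolding W_def by (rule vec_subspace_range[OF M])
  obtain m B C where B: "B \<in> carrier_mat d m" "C \<in> carrier_mat m d" "C * B = 1\<^sub>m m"
    and WB: "W = (\<lambda>u. B *\<^sub>v u) ` carrier_vec m" and m0: "m = 0 \<Longrightarrow> W = {0\<^sub>v d}"
    by (rule invariant_block_form[OF W, of "{}" "\<lambda>_. M"]) (auto intro: that)
  have MW: "M *\<^sub>v w = c \<cdot>\<^sub>v w" if w: "w \<in> W" for w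
  proof -
    obtain v where v: "v \<in> carrier_vec d" "w = M *\<^sub>v v" using w by (auto simp: W_def)
    have "M *\<^sub>v w = (c \<cdot>\<^sub>m M) *\<^sub>v v" unfolding v(2) MM[symmetric] by (rule assoc_mult_mat_vec[symmetric, OF M M v(1)])
    also have "\<dots> = c \<cdot>\<^sub>v w" unfolding v(2) using M v(1) by (intro eq_vecI) auto
    finally show ?thesis .
  qed
  have BC: "B *\<^sub>v (C *\<^sub>v w) = w" if "w \<in> W" for w
  proof -
    obtain u where u: "u \<in> carrier_vec m" "w = B *\<^sub>v u" using \<open>w \<in> W\<close> unfolding WB by auto
    have "C *\<^sub>v w = u" unfolding u(2) assoc_mult_mat_vec[symmetric, OF B(2,1) u(1)] B(3) using u(1) by simp
    then show ?thesis by (simp add: u(2))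
  qed
  have CM: "C * M \<in> carrier_mat m d" using B(2) M by simp
  have fac: "M = B * (C * M)"
  proof (rule mat_eq_of_vec[OF M])
    show "B * (C * M) \<in> carrier_mat d d" using B(1) CM by simp
    fix v :: "complex vec" assume v: "v \<in> carrier_vec d"
    have "M *\<^sub>v v \<in> W" using v by (simp add: W_def)
    from BC[OF this] show "M *\<^sub>v v = (B * (C * M)) *\<^sub>v v"
      unfolding assoc_mult_mat_vec[OF B(1) CM v] assoc_mult_mat_vec[OF B(2) M v] by simp
  qed
  have MB: "M * B = c \<cdot>\<^sub>m B"
  proof (rule mat_eq_of_vec[of _ d m])
    fix u :: "complex vec" assume u: "u \<in> carrier_vec m"
    have "(M * B) *\<^sub>v u = M *\<^sub>v (B *\<^sub>v u)" by (rule assoc_mult_mat_vec[OF M B(1) u])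
    also have "\<dots> = c \<cdot>\<^sub>v (B *\<^sub>v u)" using u by (intro MW) (simp add: WB)
    also have "\<dots> = (c \<cdot>\<^sub>m B) *\<^sub>v u" using B(1) u by (intro eq_vecI) auto
    finally show "(M * B) *\<^sub>v u = (c \<cdot>\<^sub>m B) *\<^sub>v u" .
  qed (use M B in auto)
  have "mat_trace M = mat_trace ((C * M) * B)" by (subst fac) (rule mat_trace_mult_comm[OF B(1) CM])
  also have "(C * M) * B = c \<cdot>\<^sub>m 1\<^sub>m m"
    unfolding assoc_mult_mat[OF B(2) M B(1)] MB mult_smult_distrib[OF B(2,1)] B(3) ..
  also have "mat_trace (c \<cdot>\<^sub>m 1\<^sub>m m) = c * of_nat m" by (simp add: mat_trace_def)
  finally have "m = 0" using tr c by simp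
  then have "M *\<^sub>v v = 0\<^sub>m d d *\<^sub>v v" if "v \<in> carrier_vec d" for v
    using m0 that zero_mult_mat_vec[OF that, of d] by (auto simp: W_def)
  then show ?thesis by (rule mat_eq_of_vec[OF M zero_carrier_mat])
qed

definition wsum :: "nat \<Rightarrow> ('g \<Rightarrow> complex mat) \<Rightarrow> ('g \<Rightarrow> complex) \<Rightarrow> 'g set \<Rightarrow> complex mat" where
  "wsum d R w Y = mat d d (\<lambda>(i,j). \<Sum>g\<in>Y. w g * R g $$ (i,j))"

lemma wsum_carrier: "wsum d R w Y \<in> carrier_mat d d"
  by (simp add: wsum_def)

lemma trace_wsum:
  assumes "\<And>g. g \<in> Y \<Longrightarrow> R g \<in> carrier_mat d d"
  shows "mat_trace (wsum d R w Y) = (\<Sum>g\<in>Y. w g * mat_trace (R g))"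
proof -
  have "mat_trace (wsum d R w Y) = (\<Sum>i<d. \<Sum>g\<in>Y. w g * R g $$ (i,i))"
    by (simp add: wsum_def mat_trace_def)
  also have "\<dots> = (\<Sum>g\<in>Y. \<Sum>i<d. w g * R g $$ (i,i))" by (rule sum.swap)
  also have "\<dots> = (\<Sum>g\<in>Y. w g * mat_trace (R g))"
  proof (intro sum.cong refl)
    fix g assume "g \<in> Y"
    then have "dim_row (R g) = d" using assms by auto
    then show "(\<Sum>i<d. w g * R g $$ (i,i)) = w g * mat_trace (R g)"
      by (simp add: mat_trace_def sum_distrib_left)
  qed
  finally show ?thesis .
qed

text \<open>For a linear character \<open>w\<close> of \<open>Y\<close>, the weighted sum of the matrices is a multiple
  of a projection, so it vanishes if its trace does. The trace is, up to the order of \<open>Y\<close>, a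
  multiplicity.\<close>

lemma wsum_nonzero_trace:
  assumes G: "group G" and R: "representation G d R" and Y: "subgroup Y G" "finite Y"
    and w: "\<And>g h. g \<in> Y \<Longrightarrow> h \<in> Y \<Longrightarrow> w (g \<otimes>\<^bsub>G\<^esub> h) = w g * w h"
    and nz: "wsum d R w Y \<noteq> 0\<^sub>m d d"
  shows "(\<Sum>g\<in>Y. w g * mat_trace (R g)) \<noteq> 0"
proof -
  interpret group G by fact
  interpret Y: subgroup Y G by fact
  note RD = representationD[OF G R]
  have Rc: "R g \<in> carrier_mat d d" if "g \<in> Y" for g using RD(1)[OF Y.mem_carrier[OF that]] .
  let ?M = "wsum d R w Y"
  have "?M * ?M = of_nat (card Y) \<cdot>\<^sub>m ?M"
  proof (rule eq_matI)
    fix i j assume "i < dim_row (of_nat (card Y) \<cdot>\<^sub>m ?M)" "j < dim_col (of_nat (card Y) \<cdot>\<^sub>m ?M)"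
    then have ij: "i < d" "j < d" by (auto simp: wsum_def)
    have "(?M * ?M) $$ (i,j) = (\<Sum>k<d. (\<Sum>g\<in>Y. w g * R g $$ (i,k)) * (\<Sum>h\<in>Y. w h * R h $$ (k,j)))"
      using ij by (simp add: wsum_def scalar_prod_def atLeast0LessThan)
    also have "\<dots> = (\<Sum>k<d. \<Sum>g\<in>Y. \<Sum>h\<in>Y. (w g * w h) * (R g $$ (i,k) * R h $$ (k,j)))"
      unfolding sum_product by (intro sum.cong refl) (simp add: mult_ac)
    also have "\<dots> = (\<Sum>g\<in>Y. \<Sum>k<d. \<Sum>h\<in>Y. (w g * w h) * (R g $$ (i,k) * R h $$ (k,j)))"
      by (rule sum.swap)
    also have "\<dots> = (\<Sum>g\<in>Y. \<Sum>h\<in>Y. \<Sum>k<d. (w g * w h) * (R g $$ (i,k) * R h $$ (k,j)))"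
      by (intro sum.cong refl) (rule sum.swap)
    also have "\<dots> = (\<Sum>g\<in>Y. \<Sum>h\<in>Y. w (g \<otimes>\<^bsub>G\<^esub> h) * R (g \<otimes>\<^bsub>G\<^esub> h) $$ (i,j))"
    proof (intro sum.cong refl)
      fix g h assume g: "g \<in> Y" and h: "h \<in> Y"
      have "R (g \<otimes>\<^bsub>G\<^esub> h) $$ (i,j) = (\<Sum>k<d. R g $$ (i,k) * R h $$ (k,j))"
        unfolding RD(3)[OF Y.mem_carrier[OF g] Y.mem_carrier[OF h]]
        using Rc[OF g] Rc[OF h] ij by (simp add: scalar_prod_def atLeast0LessThan)
      then show "(\<Sum>k<d. (w g * w h) * (R g $$ (i,k) * R h $$ (k,j))) = w (g \<otimes>\<^bsub>G\<^esub> h) * R (g \<otimes>\<^bsub>G\<^esub> h) $$ (i,j)"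
        by (simp add: w[OF g h] sum_distrib_left)
    qed
    also have "\<dots> = (\<Sum>g\<in>Y. \<Sum>h\<in>Y. w h * R h $$ (i,j))"
    proof (rule sum.cong[OF refl])
      fix g assume g: "g \<in> Y"
      show "(\<Sum>h\<in>Y. w (g \<otimes>\<^bsub>G\<^esub> h) * R (g \<otimes>\<^bsub>G\<^esub> h) $$ (i,j)) = (\<Sum>h\<in>Y. w h * R h $$ (i,j))"
        by (rule sum.reindex_bij_witness[of _ "\<lambda>h. inv\<^bsub>G\<^esub> g \<otimes>\<^bsub>G\<^esub> h" "\<lambda>h. g \<otimes>\<^bsub>G\<^esub> h"])
          (use g in \<open>auto simp: m_assoc[symmetric] Y.mem_carrier\<close>)
    qed
    also have "\<dots> = (of_nat (card Y) \<cdot>\<^sub>m ?M) $$ (i,j)" using ij by (simp add: wsum_def)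
    finally show "(?M * ?M) $$ (i,j) = (of_nat (card Y) \<cdot>\<^sub>m ?M) $$ (i,j)" .
  qed (auto simp: wsum_def)
  moreover have "of_nat (card Y) \<noteq> (0 :: complex)" using Y(2) Y.one_closed by (metis card_eq_0_iff empty_iff of_nat_eq_0_iff)
  ultimately have "mat_trace ?M \<noteq> 0" using idempotent_trace_zero[OF wsum_carrier] nz by blast
  then show ?thesis using trace_wsum[of Y R d w, OF Rc] by simp
qed

section \<open>Irreducible characters of symmetric groups\<close>

lemma young_subgroupD:
  assumes "sum_list la = n" "g \<in> young_subgroup n la"
  shows "g permutes {1..n}" "\<And>i. i \<in> {1..n} \<Longrightarrow> blk la (g i) = blk la i"
  using assms by (auto simp: young_subgroup_iff)

lemma young_subgroupI:
  assumes "sum_list la = n" "g permutes {1..n}" "\<And>i. i \<in> {1..n} \<Longrightarrow> blk la (g i) = blk la i"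
  shows "g \<in> young_subgroup n la"
  using assms by (auto simp: young_subgroup_iff)

lemma young_subgroup_comp:
  assumes la: "sum_list la = n" and g: "g \<in> young_subgroup n la" and h: "h \<in> young_subgroup n la"
  shows "g \<circ> h \<in> young_subgroup n la"
proof (rule young_subgroupI[OF la])
  note gD = young_subgroupD[OF la g] and hD = young_subgroupD[OF la h]
  show "g \<circ> h permutes {1..n}" by (rule permutes_compose[OF hD(1) gD(1)])
  fix i assume i: "i \<in> {1..n}"
  then have "h i \<in> {1..n}" using permutes_in_image[OF hD(1)] by simp
  then show "blk la ((g \<circ> h) i) = blk la i" using gD(2) hD(2) i by simp
qed

lemma young_subgroup_inv:
  assumes la: "sum_list la = n" and g: "g \<in> young_subgroup n la"
  shows "inv' g \<in> young_subgroup n la"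
proof (rule young_subgroupI[OF la])
  note gD = young_subgroupD[OF la g]
  show ig: "inv' g permutes {1..n}" by (rule permutes_inv[OF gD(1)])
  fix i assume i: "i \<in> {1..n}"
  then have "inv' g i \<in> {1..n}" using permutes_in_image[OF ig] by simp
  then show "blk la (inv' g i) = blk la i"
    using gD(2)[of "inv' g i"] permutes_inverses(1)[OF gD(1)] by simp
qed

lemma young_subgroup_id: "sum_list la = n \<Longrightarrow> id \<in> young_subgroup n la"
  by (rule young_subgroupI) (auto simp: permutes_id)

lemma finite_young: "finite (young_subgroup n la)"
  by (rule finite_subset[OF _ finite_permutations[of "{1..n}"]]) (auto simp: young_subgroup_def)

lemma young_is_subgroup:
  assumes "sum_list la = n"
  shows "subgroup (young_subgroup n la) (sym_group n)"
proof
  show "young_subgroup n la \<subseteq> carrier (sym_group n)"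
    using young_subgroupD(1)[OF assms] by (auto simp: sym_group_carrier)
  show "\<And>x y. x \<in> young_subgroup n la \<Longrightarrow> y \<in> young_subgroup n la \<Longrightarrow>
     x \<otimes>\<^bsub>sym_group n\<^esub> y \<in> young_subgroup n la"
    unfolding sym_group_mult by (rule young_subgroup_comp[OF assms])
  show "\<one>\<^bsub>sym_group n\<^esub> \<in> young_subgroup n la"
    unfolding sym_group_one by (rule young_subgroup_id[OF assms])
  fix x assume x: "x \<in> young_subgroup n la"
  have "x \<in> carrier (sym_group n)" using young_subgroupD(1)[OF assms x] by (simp add: sym_group_carrier)
  then show "inv\<^bsub>sym_group n\<^esub> x \<in> young_subgroup n la"
    using young_subgroup_inv[OF assms x] by simp
qed

lemma sign_comp_permutes:
  "g permutes {1..n::nat} \<Longrightarrow> h permutes {1..n} \<Longrightarrow> sign (g \<circ> h) = sign g * sign h"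
  by (meson finite_atLeastAtMost permutation_permutes sign_compose)

lemma finite_sym_group: "finite (carrier (sym_group n))"
  by (simp add: sym_group_def finite_permutations)

text \<open>If \<open>\<phi>\<close> is extended linearly to the group algebra, this is its value at the product of the
  row symmetriser of \<open>la\<close>, of \<open>x\<close> and of the antisymmetriser attached to
  \<open>nu\<close>.\<close>

definition young_sum :: "nat \<Rightarrow> nat list \<Rightarrow> nat list \<Rightarrow> ((nat \<Rightarrow> nat) \<Rightarrow> complex) \<Rightarrow> (nat \<Rightarrow> nat) \<Rightarrow> complex" where
  "young_sum n la nu \<phi> x = (\<Sum>g\<in>young_subgroup n la. \<Sum>h\<in>young_subgroup n nu. of_int (sign h) * \<phi> (g \<circ> x \<circ> h))"

lemma transpose_in_young:
  assumes la: "sum_list la = n" and ij: "i \<in> {1..n}" "j \<in> {1..n}" "blk la i = blk la j"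
  shows "transpose i j \<in> young_subgroup n la"
proof (rule young_subgroupI[OF la])
  show "transpose i j permutes {1..n}" using ij by (intro permutes_swap_id) auto
  fix k assume "k \<in> {1..n}"
  show "blk la (transpose i j k) = blk la k" using ij(3) by (auto simp: transpose_def)
qed

text \<open>If two numbers share a row and a translated column, then the transposition exchanging them is
  absorbed by the symmetriser, and by the antisymmetriser up to a sign.\<close>

lemma young_sum_eq_zero:
  assumes la: "sum_list la = n" and nu: "sum_list nu = n" and x: "x permutes {1..n}"
    and ninj: "\<not> inj_on (cell la nu x) {1..n}"
  shows "young_sum n la nu \<phi> x = 0"
proof -
  obtain i j where ij: "i \<in> {1..n}" "j \<in> {1..n}" "i \<noteq> j" "blk la i = blk la j"
    "blk nu (inv' x i) = blk nu (inv' x j)"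
    using ninj by (auto simp: inj_on_def cell_def)
  note ix = permutes_inv[OF x]
  have im: "inv' x i \<in> {1..n}" "inv' x j \<in> {1..n}" using permutes_in_image[OF ix] ij by auto
  have ne: "inv' x i \<noteq> inv' x j" using permutes_inj[OF ix] ij(3) by (auto simp: inj_def)
  define t where "t = transpose i j"
  define t' where "t' = transpose (inv' x i) (inv' x j)"
  have t: "t \<in> young_subgroup n la" unfolding t_def by (rule transpose_in_young[OF la ij(1,2,4)])
  have t': "t' \<in> young_subgroup n nu" unfolding t'_def by (rule transpose_in_young[OF nu im ij(5)])
  have tx: "x \<circ> t' = t \<circ> x"
  proof
    fix k
    show "(x \<circ> t') k = (t \<circ> x) k"
      by (simp add: t_def t'_def transpose_apply_commute[OF permutes_bij[OF x]])
  qed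
  have tt: "t \<circ> t = id" "t' \<circ> t' = id" by (auto simp: t_def t'_def)
  have sg: "sign t' = -1" using ne by (simp add: t'_def sign_swap_id)
  have "young_sum n la nu \<phi> x = (\<Sum>g\<in>young_subgroup n la. \<Sum>h\<in>young_subgroup n nu. of_int (sign (t' \<circ> h)) * \<phi> (g \<circ> x \<circ> (t' \<circ> h)))"
    unfolding young_sum_def
  proof (rule sum.cong[OF refl])
    fix g
    show "(\<Sum>h\<in>young_subgroup n nu. of_int (sign h) * \<phi> (g \<circ> x \<circ> h)) =
      (\<Sum>h\<in>young_subgroup n nu. of_int (sign (t' \<circ> h)) * \<phi> (g \<circ> x \<circ> (t' \<circ> h)))"
      by (rule sum.reindex_bij_witness[of _ "\<lambda>h. t' \<circ> h" "\<lambda>h. t' \<circ> h"])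
        (auto simp: o_assoc tt intro: young_subgroup_comp[OF nu t'])
  qed
  also have "\<dots> = (\<Sum>g\<in>young_subgroup n la. \<Sum>h\<in>young_subgroup n nu. - (of_int (sign h) * \<phi> ((g \<circ> t) \<circ> x \<circ> h)))"
  proof (intro sum.cong refl)
    fix g h :: "nat \<Rightarrow> nat" assume h: "h \<in> young_subgroup n nu"
    have "sign (t' \<circ> h) = - sign h"
      using sign_comp_permutes[OF young_subgroupD(1)[OF nu t'] young_subgroupD(1)[OF nu h]] sg by simp
    moreover have "g \<circ> x \<circ> (t' \<circ> h) = (g \<circ> t) \<circ> x \<circ> h" using tx by (metis comp_assoc)
    ultimately show "of_int (sign (t' \<circ> h)) * \<phi> (g \<circ> x \<circ> (t' \<circ> h)) = - (of_int (sign h) * \<phi> ((g \<circ> t) \<circ> x \<circ> h))"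
      by simp
  qed
  also have "\<dots> = - (\<Sum>g\<in>young_subgroup n la. \<Sum>h\<in>young_subgroup n nu. of_int (sign h) * \<phi> ((g \<circ> t) \<circ> x \<circ> h))"
    by (simp add: sum_negf)
  also have "(\<Sum>g\<in>young_subgroup n la. \<Sum>h\<in>young_subgroup n nu. of_int (sign h) * \<phi> ((g \<circ> t) \<circ> x \<circ> h)) = young_sum n la nu \<phi> x"
    unfolding young_sum_def
    by (rule sum.reindex_bij_witness[of _ "\<lambda>g. g \<circ> t" "\<lambda>g. g \<circ> t"])
      (auto simp: comp_assoc tt intro: young_subgroup_comp[OF la _ t])
  finally show ?thesis by simp
qed

lemma young_sum_translate:
  assumes la: "sum_list la = n" and nu: "sum_list nu = n" and s: "s \<in> young_subgroup n la"
    and t: "t \<in> young_subgroup n nu" and yx: "y \<circ> t = s \<circ> x"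
  shows "young_sum n la nu \<phi> y = of_int (sign t) * young_sum n la nu \<phi> x"
proof -
  note tp = young_subgroupD(1)[OF nu t] and sp = young_subgroupD(1)[OF la s]
  have tt: "t \<circ> inv' t = id" "inv' t \<circ> t = id" using permutes_inv_o[OF tp] by auto
  have ss: "s \<circ> inv' s = id" "inv' s \<circ> s = id" using permutes_inv_o[OF sp] by auto
  have "young_sum n la nu \<phi> y = (\<Sum>g\<in>young_subgroup n la. \<Sum>h\<in>young_subgroup n nu. of_int (sign (t \<circ> h)) * \<phi> (g \<circ> y \<circ> (t \<circ> h)))"
    unfolding young_sum_def
  proof (rule sum.cong[OF refl])
    fix g
    show "(\<Sum>h\<in>young_subgroup n nu. of_int (sign h) * \<phi> (g \<circ> y \<circ> h)) =
      (\<Sum>h\<in>young_subgroup n nu. of_int (sign (t \<circ> h)) * \<phi> (g \<circ> y \<circ> (t \<circ> h)))"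
      by (rule sum.reindex_bij_witness[of _ "\<lambda>h. t \<circ> h" "\<lambda>h. inv' t \<circ> h"])
        (auto simp: o_assoc tt intro: young_subgroup_comp[OF nu t] young_subgroup_comp[OF nu young_subgroup_inv[OF nu t]])
  qed
  also have "\<dots> = (\<Sum>g\<in>young_subgroup n la. \<Sum>h\<in>young_subgroup n nu. of_int (sign t) * (of_int (sign h) * \<phi> ((g \<circ> s) \<circ> x \<circ> h)))"
  proof (intro sum.cong refl)
    fix g h :: "nat \<Rightarrow> nat" assume h: "h \<in> young_subgroup n nu"
    have "sign (t \<circ> h) = sign t * sign h"
      by (rule sign_comp_permutes[OF tp young_subgroupD(1)[OF nu h]])
    moreover have "g \<circ> y \<circ> (t \<circ> h) = (g \<circ> s) \<circ> x \<circ> h" using yx by (metis comp_assoc)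
    ultimately show "of_int (sign (t \<circ> h)) * \<phi> (g \<circ> y \<circ> (t \<circ> h)) = of_int (sign t) * (of_int (sign h) * \<phi> ((g \<circ> s) \<circ> x \<circ> h))"
      by simp
  qed
  also have "\<dots> = of_int (sign t) * (\<Sum>g\<in>young_subgroup n la. \<Sum>h\<in>young_subgroup n nu. of_int (sign h) * \<phi> ((g \<circ> s) \<circ> x \<circ> h))"
    by (simp add: sum_distrib_left)
  also have "(\<Sum>g\<in>young_subgroup n la. \<Sum>h\<in>young_subgroup n nu. of_int (sign h) * \<phi> ((g \<circ> s) \<circ> x \<circ> h)) = young_sum n la nu \<phi> x"
    unfolding young_sum_def
    by (rule sum.reindex_bij_witness[of _ "\<lambda>g. g \<circ> inv' s" "\<lambda>g. g \<circ> s"])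
      (auto simp: comp_assoc ss intro: young_subgroup_comp[OF la _ s] young_subgroup_comp[OF la _ young_subgroup_inv[OF la s]])
  finally show ?thesis .
qed

text \<open>Both maps are bijections onto the diagram of \<open>la\<close>. So \<open>s\<close> can be chosen to match
  the cells of \<open>x\<close> with those of \<open>y\<close>; it preserves rows, and \<open>t\<close>, which is
  \<open>s\<close> seen through \<open>x\<close> and \<open>y\<close>, preserves columns.\<close>

lemma injective_cells_related:
  assumes la: "la \<in> partitions n" and x: "x permutes {1..n}" and y: "y permutes {1..n}"
    and injx: "inj_on (cell la (conj_part la) x) {1..n}" and injy: "inj_on (cell la (conj_part la) y) {1..n}"
  obtains s t where "s \<in> young_subgroup n la" "t \<in> young_subgroup n (conj_part la)" "y \<circ> t = s \<circ> x"
proof -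
  let ?nu = "conj_part la"
  note sl = partitionsD(3)[OF la] partitionsD(3)[OF conj_part_partitions[OF la]]
  have bx: "bij_betw (cell la ?nu x) {1..n} (diagram la)"
    using injx cell_image_eq_diagram[OF la x injx] by (simp add: bij_betw_def)
  have by': "bij_betw (cell la ?nu y) {1..n} (diagram la)"
    using injy cell_image_eq_diagram[OF la y injy] by (simp add: bij_betw_def)
  define s where "s i = (if i \<in> {1..n} then the_inv_into {1..n} (cell la ?nu y) (cell la ?nu x i) else i)" for i
  have "bij_betw (the_inv_into {1..n} (cell la ?nu y) \<circ> cell la ?nu x) {1..n} {1..n}"
    by (rule bij_betw_trans[OF bx bij_betw_the_inv_into[OF by']])
  then have "bij_betw s {1..n} {1..n}" by (rule bij_betw_cong[THEN iffD1, rotated]) (simp add: s_def)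
  then have s: "s permutes {1..n}" by (rule bij_imp_permutes) (auto simp: s_def)
  have sc: "cell la ?nu y (s i) = cell la ?nu x i" if "i \<in> {1..n}" for i
  proof -
    have "cell la ?nu y (the_inv_into {1..n} (cell la ?nu y) (cell la ?nu x i)) = cell la ?nu x i"
      by (rule f_the_inv_into_f_bij_betw[OF by']) (rule bij_betw_apply[OF bx that])
    then show ?thesis using that by (simp add: s_def)
  qed
  define t where "t = inv' y \<circ> (s \<circ> x)"
  have t: "t permutes {1..n}"
    unfolding t_def by (intro permutes_compose permutes_inv x y s)
  have sY: "s \<in> young_subgroup n la"
  proof (rule young_subgroupI[OF sl(1) s])
    show "blk la (s i) = blk la i" if "i \<in> {1..n}" for i using sc[OF that] by (simp add: cell_def)
  qed
  have tY: "t \<in> young_subgroup n ?nu"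
  proof (rule young_subgroupI[OF sl(2) t])
    fix k assume "k \<in> {1..n}"
    then have "x k \<in> {1..n}" using permutes_in_image[OF x] by simp
    from sc[OF this] show "blk ?nu (t k) = blk ?nu k"
      using permutes_inverses(2)[OF x] by (simp add: cell_def t_def)
  qed
  have "y \<circ> t = s \<circ> x"
    unfolding t_def o_assoc using permutes_inv_o(1)[OF y] by simp
  then show thesis using that sY tY by blast
qed

definition row_coeff :: "nat \<Rightarrow> nat list \<Rightarrow> ((nat \<Rightarrow> nat) \<Rightarrow> complex mat) \<Rightarrow> nat \<Rightarrow> nat \<Rightarrow> complex" where
  "row_coeff n la R i k = (\<Sum>g\<in>young_subgroup n la. R g $$ (i,k))"

definition col_coeff :: "nat \<Rightarrow> nat list \<Rightarrow> ((nat \<Rightarrow> nat) \<Rightarrow> complex mat) \<Rightarrow> nat \<Rightarrow> nat \<Rightarrow> complex" where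
  "col_coeff n nu R l j = (\<Sum>h\<in>young_subgroup n nu. of_int (sign h) * R h $$ (l,j))"

lemma mult_entry:
  fixes A B :: "complex mat"
  assumes "A \<in> carrier_mat d d" "B \<in> carrier_mat d d" "i < d" "j < d"
  shows "(A * B) $$ (i,j) = (\<Sum>k<d. A $$ (i,k) * B $$ (k,j))"
  using assms by (simp add: scalar_prod_def atLeast0LessThan)

text \<open>A matrix coefficient at a product of three group elements is a sum over products of coefficients.\<close>

lemma young_sum_coefficients:
  assumes R: "representation (sym_group n) d R" and la: "sum_list la = n" and nu: "sum_list nu = n"
    and x: "x permutes {1..n}" and ij: "i < d" "j < d"
  shows "(\<Sum>k<d. \<Sum>l<d. row_coeff n la R i k * R x $$ (k,l) * col_coeff n nu R l j) = young_sum n la nu (\<lambda>g. R g $$ (i,j)) x"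
proof -
  note RD = representationD[OF sym_group_is_group R]
  let ?Y = "young_subgroup n la" and ?Z = "young_subgroup n nu"
  have e: "R (g \<circ> x \<circ> h) $$ (i,j) = (\<Sum>k<d. \<Sum>l<d. R g $$ (i,k) * R x $$ (k,l) * R h $$ (l,j))"
    if g: "g \<in> ?Y" and h: "h \<in> ?Z" for g h
  proof -
    have c: "g \<in> carrier (sym_group n)" "x \<in> carrier (sym_group n)" "h \<in> carrier (sym_group n)"
      using young_subgroupD(1)[OF la g] young_subgroupD(1)[OF nu h] x by (auto simp: sym_group_carrier)
    have xh: "x \<circ> h \<in> carrier (sym_group n)" using c by (auto simp: sym_group_carrier intro: permutes_compose)
    have "R (g \<circ> x \<circ> h) = R g * (R x * R h)"
      using RD(3)[OF c(1) xh] RD(3)[OF c(2,3)] by (simp add: sym_group_mult comp_assoc)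
    moreover have "(R x * R h) $$ (k,j) = (\<Sum>l<d. R x $$ (k,l) * R h $$ (l,j))" if "k < d" for k
      using that RD(1)[OF c(2)] RD(1)[OF c(3)] ij by (simp add: scalar_prod_def atLeast0LessThan)
    moreover have "(R g * (R x * R h)) $$ (i,j) = (\<Sum>k<d. R g $$ (i,k) * (R x * R h) $$ (k,j))"
    proof -
      have "R x * R h \<in> carrier_mat d d" using RD(1)[OF c(2)] RD(1)[OF c(3)] by simp
      then show ?thesis by (rule mult_entry[OF RD(1)[OF c(1)] _ ij])
    qed
    ultimately show ?thesis by (simp add: sum_distrib_left mult.assoc)
  qed
  have "young_sum n la nu (\<lambda>g. R g $$ (i,j)) x =
    (\<Sum>g\<in>?Y. \<Sum>h\<in>?Z. \<Sum>k<d. \<Sum>l<d. of_int (sign h) * (R g $$ (i,k) * R x $$ (k,l) * R h $$ (l,j)))"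
    unfolding young_sum_def by (intro sum.cong refl) (simp add: e sum_distrib_left)
  also have "\<dots> = (\<Sum>g\<in>?Y. \<Sum>k<d. \<Sum>h\<in>?Z. \<Sum>l<d. of_int (sign h) * (R g $$ (i,k) * R x $$ (k,l) * R h $$ (l,j)))"
    by (rule sum.cong[OF refl], rule sum.swap)
  also have "\<dots> = (\<Sum>k<d. \<Sum>g\<in>?Y. \<Sum>h\<in>?Z. \<Sum>l<d. of_int (sign h) * (R g $$ (i,k) * R x $$ (k,l) * R h $$ (l,j)))"
    by (rule sum.swap)
  also have "\<dots> = (\<Sum>k<d. \<Sum>g\<in>?Y. \<Sum>l<d. \<Sum>h\<in>?Z. of_int (sign h) * (R g $$ (i,k) * R x $$ (k,l) * R h $$ (l,j)))"
    by (rule sum.cong[OF refl], rule sum.cong[OF refl], rule sum.swap)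
  also have "\<dots> = (\<Sum>k<d. \<Sum>l<d. \<Sum>g\<in>?Y. \<Sum>h\<in>?Z. of_int (sign h) * (R g $$ (i,k) * R x $$ (k,l) * R h $$ (l,j)))"
    by (rule sum.cong[OF refl], rule sum.swap)
  also have "\<dots> = (\<Sum>k<d. \<Sum>l<d. row_coeff n la R i k * R x $$ (k,l) * col_coeff n nu R l j)"
  proof (rule sum.cong[OF refl], rule sum.cong[OF refl])
    fix k l
    show "(\<Sum>g\<in>?Y. \<Sum>h\<in>?Z. of_int (sign h) * (R g $$ (i,k) * R x $$ (k,l) * R h $$ (l,j))) =
      row_coeff n la R i k * R x $$ (k,l) * col_coeff n nu R l j"
    proof -
      have "row_coeff n la R i k * R x $$ (k,l) * col_coeff n nu R l j =
        (\<Sum>g\<in>?Y. R g $$ (i,k) * R x $$ (k,l)) * (\<Sum>h\<in>?Z. of_int (sign h) * R h $$ (l,j))"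
        by (simp add: row_coeff_def col_coeff_def sum_distrib_right)
      also have "\<dots> = (\<Sum>g\<in>?Y. \<Sum>h\<in>?Z. R g $$ (i,k) * R x $$ (k,l) * (of_int (sign h) * R h $$ (l,j)))"
        by (rule sum_product)
      also have "\<dots> = (\<Sum>g\<in>?Y. \<Sum>h\<in>?Z. of_int (sign h) * (R g $$ (i,k) * R x $$ (k,l) * R h $$ (l,j)))"
        by (rule sum.cong[OF refl], rule sum.cong[OF refl]) (simp add: mult_ac)
      finally show ?thesis by simp
    qed
  qed
  finally show ?thesis by simp
qed

lemma exists_row_entry:
  assumes R: "representation (sym_group n) d R" and la: "sum_list la = n"
    and nz: "(\<Sum>g\<in>young_subgroup n la. character (sym_group n) R g) \<noteq> 0"
  obtains i k where "i < d" "k < d" "row_coeff n la R i k \<noteq> 0"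
proof -
  have c: "R g \<in> carrier_mat d d" "g \<in> carrier (sym_group n)" if "g \<in> young_subgroup n la" for g
    using young_subgroupD(1)[OF la that] representationD(1)[OF sym_group_is_group R]
    by (auto simp: sym_group_carrier)
  have "character (sym_group n) R g = (\<Sum>i<d. R g $$ (i,i))" if "g \<in> young_subgroup n la" for g
    using c[OF that] by (simp add: character_def)
  then have "(\<Sum>g\<in>young_subgroup n la. character (sym_group n) R g) = (\<Sum>g\<in>young_subgroup n la. \<Sum>i<d. R g $$ (i,i))"
    by (rule sum.cong[OF refl])
  also have "\<dots> = (\<Sum>i<d. row_coeff n la R i i)" unfolding row_coeff_def by (rule sum.swap)
  finally have "(\<Sum>i<d. row_coeff n la R i i) \<noteq> 0" using nz by simp
  then obtain i where "i < d" "row_coeff n la R i i \<noteq> 0" by (metis (no_types, lifting) lessThan_iff sum.neutral)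
  then show thesis using that by blast
qed

lemma exists_col_entry:
  assumes R: "representation (sym_group n) d R" and nu: "sum_list nu = n"
    and nz: "(\<Sum>g\<in>young_subgroup n nu. of_int (sign g) * character (sym_group n) R g) \<noteq> 0"
  obtains l j where "l < d" "j < d" "col_coeff n nu R l j \<noteq> 0"
proof -
  have c: "R g \<in> carrier_mat d d" "g \<in> carrier (sym_group n)" if "g \<in> young_subgroup n nu" for g
    using young_subgroupD(1)[OF nu that] representationD(1)[OF sym_group_is_group R]
    by (auto simp: sym_group_carrier)
  have "of_int (sign g) * character (sym_group n) R g = (\<Sum>i<d. of_int (sign g) * R g $$ (i,i))"
    if "g \<in> young_subgroup n nu" for g
    using c[OF that] by (simp add: character_def sum_distrib_left)
  then have "(\<Sum>g\<in>young_subgroup n nu. of_int (sign g) * character (sym_group n) R g) =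
    (\<Sum>g\<in>young_subgroup n nu. \<Sum>i<d. of_int (sign g) * R g $$ (i,i))"
    by (rule sum.cong[OF refl])
  also have "\<dots> = (\<Sum>i<d. col_coeff n nu R i i)" unfolding col_coeff_def by (rule sum.swap)
  finally have "(\<Sum>i<d. col_coeff n nu R i i) \<noteq> 0" using nz by simp
  then obtain i where "i < d" "col_coeff n nu R i i \<noteq> 0" by (metis (no_types, lifting) lessThan_iff sum.neutral)
  then show thesis using that by blast
qed

text \<open>The condition that selects \<open>chi n la\<close> if \<open>nu\<close> is the conjugate of
  \<open>la\<close>; with two independent partitions it also compares the characters of different partitions.\<close>

definition selects :: "nat \<Rightarrow> nat list \<Rightarrow> nat list \<Rightarrow> ((nat \<Rightarrow> nat) \<Rightarrow> complex) \<Rightarrow> bool" where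
  "selects n la nu \<chi> \<longleftrightarrow> \<chi> \<in> Irr (sym_group n) \<and> (\<Sum>g\<in>young_subgroup n la. \<chi> g) \<noteq> 0 \<and>
     (\<Sum>g\<in>young_subgroup n nu. of_int (sign g) * \<chi> g) \<noteq> 0"

text \<open>The first condition on \<open>\<chi>\<close> gives a nonzero entry of the symmetriser, the second one of the
  antisymmetriser. Their product is the coefficient of a matrix entry in the expansion of the sums
  \<open>young_sum\<close>, so these cannot all vanish.\<close>

lemma selects_witness:
  assumes la: "sum_list la = n" and nu: "sum_list nu = n" and sel: "selects n la nu \<chi>"
  obtains d R i j x where "irreducible_representation (sym_group n) d R" "\<chi> = character (sym_group n) R"
    "i < d" "j < d" "x permutes {1..n}" "inj_on (cell la nu x) {1..n}" "young_sum n la nu (\<lambda>g. R g $$ (i,j)) x \<noteq> 0"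
proof -
  obtain d R where R: "irreducible_representation (sym_group n) d R" "\<chi> = character (sym_group n) R"
    using sel unfolding selects_def by (auto elim: Irr_cases)
  note rep = irreducibleD(1)[OF R(1)]
  obtain i k where ik: "i < d" "k < d" "row_coeff n la R i k \<noteq> 0"
    by (rule exists_row_entry[OF rep la]) (use sel R(2) in \<open>auto simp: selects_def\<close>)
  obtain l j where lj: "l < d" "j < d" "col_coeff n nu R l j \<noteq> 0"
    by (rule exists_col_entry[OF rep nu]) (use sel R(2) in \<open>auto simp: selects_def\<close>)
  have "\<exists>x. x permutes {1..n} \<and> young_sum n la nu (\<lambda>g. R g $$ (i,j)) x \<noteq> 0"
  proof (rule ccontr)
    assume "\<not> ?thesis"
    then have z: "young_sum n la nu (\<lambda>g. R g $$ (i,j)) x = 0" if "x permutes {1..n}" for x using that by blast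
    have "row_coeff n la R i k * col_coeff n nu R l j = 0"
    proof (rule coefficient_independence[where I = "{()}" and R = "\<lambda>_. R" and d = "\<lambda>_. d"
          and u = "\<lambda>_. row_coeff n la R i" and v = "\<lambda>_ l. col_coeff n nu R l j" and i = "()",
          OF alg_closed_complex sym_group_is_group])
      fix x assume "x \<in> carrier (sym_group n)"
      then have x: "x permutes {1..n}" by (simp add: sym_group_carrier)
      show "(\<Sum>i'\<in>{()}. \<Sum>k<d. \<Sum>l<d. row_coeff n la R i k * R x $$ (k,l) * col_coeff n nu R l j) = 0"
        using young_sum_coefficients[OF rep la nu x ik(1) lj(2)] z[OF x] by simp
    qed (use R(1) ik lj in auto)
    then show False using ik lj by simp
  qed
  then obtain x where x: "x permutes {1..n}" "young_sum n la nu (\<lambda>g. R g $$ (i,j)) x \<noteq> 0" by blast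
  then have "inj_on (cell la nu x) {1..n}" using young_sum_eq_zero[OF la nu x(1)] by blast
  then show thesis using that R ik(1) lj(2) x by blast
qed

lemma selects_dominance:
  assumes la: "la \<in> partitions n" and mu: "mu \<in> partitions n" and sel: "selects n la (conj_part mu) \<chi>"
  shows "card {x \<in> diagram la. fst x < k} \<le> card {x \<in> diagram mu. fst x < k}"
proof -
  obtain x where "x permutes {1..n}" "inj_on (cell la (conj_part mu) x) {1..n}"
    using selects_witness[OF partitionsD(3)[OF la] partitionsD(3)[OF conj_part_partitions[OF mu]] sel] by metis
  then show ?thesis by (rule cell_injective_dominance[OF la mu])
qed

text \<open>By \<open>young_sum_eq_zero\<close> and \<open>injective_cells_related\<close>, for all
  \<open>\<phi>\<close> the functions \<^term>\<open>young_sum n la (conj_part la) \<phi>\<close> are proportional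
  to each other. If two different irreducible characters were selected, this would be a linear relation between their
  matrix coefficients.\<close>

lemma selects_unique:
  assumes la: "la \<in> partitions n" and s1: "selects n la (conj_part la) \<chi>" and s2: "selects n la (conj_part la) \<psi>"
  shows "\<chi> = \<psi>"
proof (rule ccontr)
  assume ne: "\<chi> \<noteq> \<psi>"
  let ?nu = "conj_part la"
  note sl = partitionsD(3)[OF la] partitionsD(3)[OF conj_part_partitions[OF la]]
  note G = sym_group_is_group[of n]
  obtain d R i j x where R: "irreducible_representation (sym_group n) d R" "\<chi> = character (sym_group n) R"
    "i < d" "j < d" and x: "x permutes {1..n}" "inj_on (cell la ?nu x) {1..n}"
    and xR: "young_sum n la ?nu (\<lambda>g. R g $$ (i,j)) x \<noteq> 0"
    by (rule selects_witness[OF sl s1]) (rule that)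
  obtain d' R' i' j' y where R': "irreducible_representation (sym_group n) d' R'" "\<psi> = character (sym_group n) R'"
    "i' < d'" "j' < d'" and y: "y permutes {1..n}" "inj_on (cell la ?nu y) {1..n}"
    and yR: "young_sum n la ?nu (\<lambda>g. R' g $$ (i',j')) y \<noteq> 0"
    by (rule selects_witness[OF sl s2]) (rule that)
  define \<phi> where "\<phi> = (\<lambda>g. R g $$ (i,j))"
  define \<phi>' where "\<phi>' = (\<lambda>g. R' g $$ (i',j'))"
  define D where "D = young_sum n la ?nu"
  have Dx: "D \<phi> x \<noteq> 0" using xR by (simp add: D_def \<phi>_def)
  have ratio: "D \<phi> z * D \<phi>' x = D \<phi>' z * D \<phi> x" if z: "z permutes {1..n}" for z
  proof (cases "inj_on (cell la ?nu z) {1..n}")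
    case True
    obtain s t where st: "s \<in> young_subgroup n la" "t \<in> young_subgroup n ?nu" "z \<circ> t = s \<circ> x"
      by (rule injective_cells_related[OF la x(1) z x(2) True])
    show ?thesis unfolding D_def young_sum_translate[OF sl st] by simp
  next
    case False
    then show ?thesis unfolding D_def using young_sum_eq_zero[OF sl z] by simp
  qed
  have Dx': "D \<phi>' x \<noteq> 0"
  proof
    assume "D \<phi>' x = 0"
    then have "D \<phi>' y = 0" using ratio[OF y(1)] Dx by simp
    then show False using yR by (simp add: D_def \<phi>'_def)
  qed
  define I where "I = (UNIV :: bool set)"
  define RR where "RR b = (if b then R else R')" for b
  define dd where "dd b = (if b then d else d')" for b
  define u where "u b k = (if b then D \<phi>' x * row_coeff n la R i k else - (D \<phi> x * row_coeff n la R' i' k))" for b k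
  define v where "v b l = (if b then col_coeff n ?nu R l j else col_coeff n ?nu R' l j')" for b l
  have irr: "irreducible_representation (sym_group n) (dd b) (RR b)" for b
    using R(1) R'(1) by (simp add: RR_def dd_def)
  have zero: "u True k * v True l = 0" if "k < d" "l < d" for k l
  proof (rule coefficient_independence[where I = I and R = RR and d = dd and i = True,
        OF alg_closed_complex G])
    show "irreducible_representation (sym_group n) (dd b) (RR b)" for b by (rule irr)
    fix b b' T assume T: "b \<noteq> (b' :: bool)" "T \<in> carrier_mat (dd b) (dd b')" "intertwines (sym_group n) T (RR b) (RR b')"
    show "T = 0\<^sub>m (dd b) (dd b')"
    proof (rule ccontr)
      assume "T \<noteq> 0\<^sub>m (dd b) (dd b')"
      then have "mat_trace (RR b g) = mat_trace (RR b' g)" if "g \<in> carrier (sym_group n)" for g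
        using similar_of_intertwiner(2)[OF G irr irr T(2,3) _ that] by blast
      then have "character (sym_group n) (RR b) = character (sym_group n) (RR b')"
        by (auto simp: character_def mat_trace_def)
      then show False using ne T(1) R(2) R'(2) by (cases b; cases b') (auto simp: RR_def)
    qed
  next
    fix z assume "z \<in> carrier (sym_group n)"
    then have z: "z permutes {1..n}" by (simp add: sym_group_carrier)
    have "(\<Sum>b\<in>I. \<Sum>k<dd b. \<Sum>l<dd b. u b k * RR b z $$ (k,l) * v b l) =
      D \<phi>' x * (\<Sum>k<d. \<Sum>l<d. row_coeff n la R i k * R z $$ (k,l) * col_coeff n ?nu R l j)
      - D \<phi> x * (\<Sum>k<d'. \<Sum>l<d'. row_coeff n la R' i' k * R' z $$ (k,l) * col_coeff n ?nu R' l j')"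
      by (simp add: I_def UNIV_bool u_def v_def dd_def RR_def sum_distrib_left sum_negf mult.assoc)
    also have "\<dots> = D \<phi>' x * D \<phi> z - D \<phi> x * D \<phi>' z"
      unfolding D_def \<phi>_def \<phi>'_def
      by (simp only: young_sum_coefficients[OF irreducibleD(1)[OF R(1)] sl z R(3,4)]
          young_sum_coefficients[OF irreducibleD(1)[OF R'(1)] sl z R'(3,4)])
    also have "\<dots> = 0" using ratio[OF z] by (simp add: mult.commute)
    finally show "(\<Sum>b\<in>I. \<Sum>k<dd b. \<Sum>l<dd b. u b k * RR b z $$ (k,l) * v b l) = 0" .
  qed (use that in \<open>auto simp: I_def dd_def\<close>)
  have "D \<phi> x = (\<Sum>k<d. \<Sum>l<d. row_coeff n la R i k * R x $$ (k,l) * col_coeff n ?nu R l j)"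
    unfolding D_def \<phi>_def by (rule young_sum_coefficients[OF irreducibleD(1)[OF R(1)] sl x(1) R(3,4), symmetric])
  also have "\<dots> = 0"
  proof (intro sum.neutral ballI)
    fix k l assume "k \<in> {..<d}" "l \<in> {..<d}"
    then have "row_coeff n la R i k * col_coeff n ?nu R l j = 0" using zero[of k l] Dx' by (simp add: u_def v_def)
    then show "row_coeff n la R i k * R x $$ (k,l) * col_coeff n ?nu R l j = 0" by auto
  qed
  finally show False using Dx by simp
qed

lemma trace_product:
  fixes R :: "(nat \<Rightarrow> nat) \<Rightarrow> complex mat"
  assumes R: "representation (sym_group n) d R" and ab: "a permutes {1..n}" "b permutes {1..n}"
  shows "mat_trace (R (a \<circ> b)) = (\<Sum>i<d. \<Sum>k<d. R a $$ (i,k) * R b $$ (k,i))"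
proof -
  note RD = representationD[OF sym_group_is_group R]
  have c: "a \<in> carrier (sym_group n)" "b \<in> carrier (sym_group n)" using ab by (auto simp: sym_group_carrier)
  have e: "R (a \<circ> b) = R a * R b" using RD(3)[OF c] by (simp add: sym_group_mult)
  have "dim_row (R a * R b) = d" using RD(1)[OF c(1)] by simp
  then show ?thesis unfolding e mat_trace_def
    using mult_entry[OF RD(1)[OF c(1)] RD(1)[OF c(2)]] by simp
qed

text \<open>The element \<open>g\<close> preserves the rows, and it is the inverse of a conjugate of \<open>h\<close>,
  which preserves the columns. So it fixes every cell.\<close>

lemma injective_cell_trivial:
  assumes la: "sum_list la = n" and nu: "sum_list nu = n" and x: "x permutes {1..n}"
    and inj: "inj_on (cell la nu x) {1..n}"
    and g: "g \<in> young_subgroup n la" and h: "h \<in> young_subgroup n nu" and e: "g \<circ> x \<circ> h \<circ> inv' x = id"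
  shows "g = id \<and> h = id"
proof -
  note gD = young_subgroupD[OF la g] and hD = young_subgroupD[OF nu h]
  have e': "g (x (h k)) = x k" for k
    using fun_cong[OF e, of "x k"] permutes_inverses(2)[OF x] by simp
  have hk: "h k = k" for k
  proof (cases "k \<in> {1..n}")
    case True
    have xk: "x k \<in> {1..n}" "x (h k) \<in> {1..n}"
      using True permutes_in_image[OF x] permutes_in_image[OF hD(1)] by auto
    have "blk la (x (h k)) = blk la (x k)" using gD(2)[OF xk(2)] e' by simp
    moreover have "blk nu (h k) = blk nu k" by (rule hD(2)[OF True])
    ultimately have "cell la nu x (x (h k)) = cell la nu x (x k)"
      using permutes_inverses(2)[OF x] by (simp add: cell_def)
    then have "x (h k) = x k" using inj xk by (auto dest: inj_onD)
    then show ?thesis using permutes_inj[OF x] by (auto dest: injD)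
  next
    case False
    then show ?thesis using hD(1) by (simp add: permutes_not_in)
  qed
  have "g i = i" for i
    using e'[of "inv' x i"] permutes_inverses(1)[OF x] hk by simp
  then show ?thesis using hk by auto
qed

text \<open>In the group algebra, the product of the symmetriser, \<open>x\<close>, the antisymmetriser and the inverse of
  \<open>x\<close> has coefficient \<open>1\<close> at the identity. So it has nonzero trace on some irreducible
  representation, and there both symmetrisers act nontrivially.\<close>

lemma selects_exists:
  assumes la: "la \<in> partitions n"
  obtains \<chi> where "selects n la (conj_part la) \<chi>"
proof -
  let ?nu = "conj_part la" and ?G = "sym_group n"
  note sl = partitionsD(3)[OF la] partitionsD(3)[OF conj_part_partitions[OF la]]
  let ?Y = "young_subgroup n la" and ?Z = "young_subgroup n ?nu"
  obtain x where x: "x permutes {1..n}" "inj_on (cell la ?nu x) {1..n}"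
    by (rule exists_injective_cell[OF la])
  note ix = permutes_inv[OF x(1)]
  define w where "w = (\<lambda>(g :: nat \<Rightarrow> nat, h). complex_of_int (sign (h :: nat \<Rightarrow> nat)))"
  define y where "y = (\<lambda>(g :: nat \<Rightarrow> nat, h). g \<circ> x \<circ> h \<circ> inv' x)"
  have Yp: "g permutes {1..n}" if "g \<in> ?Y" for g by (rule young_subgroupD(1)[OF sl(1) that])
  have Zp: "h permutes {1..n}" if "h \<in> ?Z" for h by (rule young_subgroupD(1)[OF sl(2) that])
  have "{t \<in> ?Y \<times> ?Z. y t = \<one>\<^bsub>?G\<^esub>} = {(id, id)}"
  proof (intro equalityI subsetI)
    fix t assume t: "t \<in> {t \<in> ?Y \<times> ?Z. y t = \<one>\<^bsub>?G\<^esub>}"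
    then obtain g h where gh: "t = (g,h)" "g \<in> ?Y" "h \<in> ?Z" "g \<circ> x \<circ> h \<circ> inv' x = id"
      by (cases t) (auto simp: y_def sym_group_one)
    then show "t \<in> {(id, id)}" using injective_cell_trivial[OF sl x gh(2-4)] by simp
  next
    fix t assume "t \<in> {(id :: nat \<Rightarrow> nat, id :: nat \<Rightarrow> nat)}"
    then show "t \<in> {t \<in> ?Y \<times> ?Z. y t = \<one>\<^bsub>?G\<^esub>}"
      using young_subgroup_id[OF sl(1)] young_subgroup_id[OF sl(2)] permutes_inv_o(1)[OF x(1)]
      by (auto simp: y_def sym_group_one)
  qed
  then have wn: "(\<Sum>t\<in>{t \<in> ?Y \<times> ?Z. y t = \<one>\<^bsub>?G\<^esub>}. w t) \<noteq> 0" by (simp add: w_def)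
  have yc: "y t \<in> carrier ?G" if "t \<in> ?Y \<times> ?Z" for t
    using that Yp Zp x(1) ix by (auto simp: y_def sym_group_carrier intro!: permutes_compose)
  have finT: "finite (?Y \<times> ?Z)" using finite_young by blast
  obtain d S where S: "irreducible_representation ?G d S"
    and nz: "(\<Sum>t\<in>?Y \<times> ?Z. w t * mat_trace (S (y t))) \<noteq> 0"
    by (rule exists_irreducible_nonzero[OF sym_group_is_group finite_sym_group finT _ wn], erule yc) (rule that)
  note rep = irreducibleD(1)[OF S]
  have nz': "(\<Sum>g\<in>?Y. \<Sum>h\<in>?Z. of_int (sign h) * mat_trace (S (g \<circ> x \<circ> h \<circ> inv' x))) \<noteq> 0"
    using nz by (simp add: sum.cartesian_product w_def y_def case_prod_beta)
  have Y0: "wsum d S (\<lambda>_. 1) ?Y \<noteq> 0\<^sub>m d d"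
  proof
    assume z: "wsum d S (\<lambda>_. 1) ?Y = 0\<^sub>m d d"
    have z': "(\<Sum>g\<in>?Y. S g $$ (i,k)) = 0" if "i < d" "k < d" for i k
      using arg_cong[OF z, of "\<lambda>M. M $$ (i,k)"] that by (simp add: wsum_def)
    have "(\<Sum>g\<in>?Y. mat_trace (S (g \<circ> u))) = 0" if u: "u permutes {1..n}" for u
    proof -
      have "(\<Sum>g\<in>?Y. mat_trace (S (g \<circ> u))) = (\<Sum>g\<in>?Y. \<Sum>i<d. \<Sum>k<d. S g $$ (i,k) * S u $$ (k,i))"
        by (rule sum.cong[OF refl]) (rule trace_product[OF rep Yp u])
      also have "\<dots> = (\<Sum>i<d. \<Sum>g\<in>?Y. \<Sum>k<d. S g $$ (i,k) * S u $$ (k,i))" by (rule sum.swap)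
      also have "\<dots> = (\<Sum>i<d. \<Sum>k<d. \<Sum>g\<in>?Y. S g $$ (i,k) * S u $$ (k,i))"
        by (rule sum.cong[OF refl]) (rule sum.swap)
      also have "\<dots> = 0" by (rule sum.neutral, rule ballI, rule sum.neutral, rule ballI)
            (simp add: sum_distrib_right[symmetric] z')
      finally show ?thesis .
    qed
    then have "(\<Sum>g\<in>?Y. mat_trace (S (g \<circ> (x \<circ> h \<circ> inv' x)))) = 0" if "h \<in> ?Z" for h
      using that Zp x(1) ix by (auto intro!: permutes_compose)
    then have "(\<Sum>h\<in>?Z. of_int (sign h) * (\<Sum>g\<in>?Y. mat_trace (S (g \<circ> x \<circ> h \<circ> inv' x)))) = 0"
      by (intro sum.neutral ballI) (simp add: comp_assoc)
    moreover have "(\<Sum>g\<in>?Y. \<Sum>h\<in>?Z. of_int (sign h) * mat_trace (S (g \<circ> x \<circ> h \<circ> inv' x))) =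
      (\<Sum>h\<in>?Z. of_int (sign h) * (\<Sum>g\<in>?Y. mat_trace (S (g \<circ> x \<circ> h \<circ> inv' x))))"
      unfolding sum_distrib_left by (rule sum.swap)
    ultimately show False using nz' by simp
  qed
  have Z0: "wsum d S (\<lambda>h. of_int (sign h)) ?Z \<noteq> 0\<^sub>m d d"
  proof
    assume z: "wsum d S (\<lambda>h. of_int (sign h)) ?Z = 0\<^sub>m d d"
    have z': "(\<Sum>h\<in>?Z. of_int (sign h) * S h $$ (i,k)) = 0" if "i < d" "k < d" for i k
      using arg_cong[OF z, of "\<lambda>M. M $$ (i,k)"] that by (simp add: wsum_def)
    have "(\<Sum>h\<in>?Z. of_int (sign h) * mat_trace (S (h \<circ> u))) = 0" if u: "u permutes {1..n}" for u
    proof -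
      have "(\<Sum>h\<in>?Z. of_int (sign h) * mat_trace (S (h \<circ> u))) =
        (\<Sum>h\<in>?Z. \<Sum>i<d. \<Sum>k<d. (of_int (sign h) * S h $$ (i,k)) * S u $$ (k,i))"
        by (rule sum.cong[OF refl]) (simp add: trace_product[OF rep Zp u] sum_distrib_left mult.assoc)
      also have "\<dots> = (\<Sum>i<d. \<Sum>h\<in>?Z. \<Sum>k<d. (of_int (sign h) * S h $$ (i,k)) * S u $$ (k,i))" by (rule sum.swap)
      also have "\<dots> = (\<Sum>i<d. \<Sum>k<d. \<Sum>h\<in>?Z. (of_int (sign h) * S h $$ (i,k)) * S u $$ (k,i))"
        by (rule sum.cong[OF refl]) (rule sum.swap)
      also have "\<dots> = 0" by (rule sum.neutral, rule ballI, rule sum.neutral, rule ballI)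
            (simp add: sum_distrib_right[symmetric] z')
      finally show ?thesis .
    qed
    moreover have "mat_trace (S (g \<circ> x \<circ> h \<circ> inv' x)) = mat_trace (S (h \<circ> (inv' x \<circ> g \<circ> x)))"
      if g: "g \<in> ?Y" and h: "h \<in> ?Z" for g h
    proof -
      have p: "g \<circ> x permutes {1..n}" "h \<circ> inv' x permutes {1..n}"
        using Yp[OF g] Zp[OF h] x(1) ix by (auto intro: permutes_compose)
      have "mat_trace (S (g \<circ> x \<circ> h \<circ> inv' x)) = mat_trace (S ((g \<circ> x) \<circ> (h \<circ> inv' x)))"
        by (simp add: comp_assoc)
      also have "\<dots> = mat_trace (S ((h \<circ> inv' x) \<circ> (g \<circ> x)))"
        unfolding trace_product[OF rep p] trace_product[OF rep p(2,1)]
        by (subst sum.swap) (simp add: mult.commute)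
      finally show ?thesis by (simp add: comp_assoc)
    qed
    ultimately have "(\<Sum>h\<in>?Z. of_int (sign h) * mat_trace (S (g \<circ> x \<circ> h \<circ> inv' x))) = 0" if "g \<in> ?Y" for g
      using that Yp[OF that] x(1) ix by (auto intro!: permutes_compose)
    then show False using nz' by simp
  qed
  have n1: "(\<Sum>g\<in>?Y. 1 * mat_trace (S g)) \<noteq> 0"
    by (rule wsum_nonzero_trace[OF sym_group_is_group rep young_is_subgroup[OF sl(1)] finite_young _ Y0]) simp
  have n2: "(\<Sum>h\<in>?Z. of_int (sign h) * mat_trace (S h)) \<noteq> 0"
    by (rule wsum_nonzero_trace[OF sym_group_is_group rep young_is_subgroup[OF sl(2)] finite_young _ Z0])
      (simp only: sym_group_mult sign_comp_permutes[OF Zp Zp] of_int_mult)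
  have tr: "character ?G S g = mat_trace (S g)" if "g permutes {1..n}" for g
    using that by (intro character_eq_trace) (simp add: sym_group_carrier)
  have e1: "(\<Sum>g\<in>?Y. character ?G S g) = (\<Sum>g\<in>?Y. 1 * mat_trace (S g))"
    by (rule sum.cong[OF refl]) (simp only: tr[OF Yp] mult_1_left)
  have e2: "(\<Sum>h\<in>?Z. of_int (sign h) * character ?G S h) = (\<Sum>h\<in>?Z. of_int (sign h) * mat_trace (S h))"
    by (rule sum.cong[OF refl]) (simp only: tr[OF Zp])
  have "selects n la ?nu (character ?G S)"
    unfolding selects_def e1 e2 using n1 n2 character_in_Irr[OF S] by blast
  then show thesis by (rule that)
qed

lemma selects_chi:
  assumes "la \<in> partitions n"
  shows "selects n la (conj_part la) (chi n la)"
proof -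
  have "\<exists>!\<chi>. selects n la (conj_part la) \<chi>"
    using selects_exists[OF assms] selects_unique[OF assms] by metis
  then show ?thesis unfolding chi_def selects_def by (rule theI')
qed

lemma chi_Irr: "la \<in> partitions n \<Longrightarrow> chi n la \<in> Irr (sym_group n)"
  using selects_chi by (simp add: selects_def)

lemma chi_eqI: "la \<in> partitions n \<Longrightarrow> selects n la (conj_part la) \<chi> \<Longrightarrow> chi n la = \<chi>"
  using selects_unique selects_chi by blast

text \<open>Each of the two diagrams dominates the other.\<close>

lemma chi_inj:
  assumes la: "la \<in> partitions n" and mu: "mu \<in> partitions n" and eq: "chi n la = chi n mu"
  shows "la = mu"
proof (rule partitions_eq_of_dominance[OF la mu])
  fix k
  have "selects n la (conj_part mu) (chi n la)" "selects n mu (conj_part la) (chi n la)"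
    using selects_chi[OF la] selects_chi[OF mu] eq by (auto simp: selects_def)
  then show "card {x \<in> diagram la. fst x < k} = card {x \<in> diagram mu. fst x < k}"
    using selects_dominance[OF la mu] selects_dominance[OF mu la] by (meson antisym)
qed

lemma index_two_sym:
  assumes "n \<ge> 2"
  shows "index_two (sym_group n) (alt_group n) sign (transpose 1 2)"
proof -
  interpret group "sym_group n" by (rule sym_group_is_group)
  show ?thesis
  proof
    show "finite (carrier (sym_group n))" by (rule finite_sym_group)
    show "alt_group n = (sym_group n)\<lparr>carrier := {g \<in> carrier (sym_group n). sign g = 1}\<rparr>"
    proof -
      have "{g. g permutes {1..n} \<and> evenperm g} = {g \<in> carrier (sym_group n). sign g = (1 :: int)}"
        by (auto simp: sym_group_carrier sign_def)
      then show ?thesis by (simp only: alt_group_def)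
    qed
    show "sign (g \<otimes>\<^bsub>sym_group n\<^esub> h) = sign g * sign h" if "g \<in> carrier (sym_group n)" "h \<in> carrier (sym_group n)" for g h
      using that by (simp add: sym_group_mult sym_group_carrier sign_comp_permutes)
    show "sign g = 1 \<or> sign g = -1" for g :: "nat \<Rightarrow> nat" by (simp add: sign_def)
    show "transpose 1 2 \<in> carrier (sym_group n)"
      using assms by (auto simp: sym_group_carrier intro!: permutes_swap_id)
    show "sign (transpose 1 (2 :: nat)) = -1" by (simp add: sign_swap_id)
  qed
qed

text \<open>Multiplication by the sign exchanges the two conditions that select the character.\<close>

lemma chi_conj:
  assumes n: "n \<ge> 2" and la: "la \<in> partitions n"
  shows "chi n (conj_part la) = sgn_times (chi n la)"
proof (rule chi_eqI[OF conj_part_partitions[OF la]])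
  interpret index_two "sym_group n" "alt_group n" sign "transpose 1 2" by (rule index_two_sym[OF n])
  have "sgn_times (chi n la) \<in> Irr (sym_group n)"
  proof -
    have "sgn_times (chi n la) = eps_times (chi n la)" by (rule ext) (simp add: eps_times_def sgn_times_def)
    then show ?thesis using eps_times_Irr[OF chi_Irr[OF la]] by simp
  qed
  moreover have "of_int (sign g) * sgn_times (chi n la) g = chi n la g" for g
    by (simp add: sgn_times_def sign_def)
  ultimately show "selects n (conj_part la) (conj_part (conj_part la)) (sgn_times (chi n la))"
    using selects_chi[OF la] unfolding conj_conj_part[OF la] by (simp add: selects_def) (simp add: sgn_times_def)
qed

section \<open>Conjugation and the middle part of the quotient\<close>

definition part_at :: "nat list \<Rightarrow> nat \<Rightarrow> nat" where
  "part_at la i = (if i < length la then la ! i else 0)"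

lemma X_set_iff: "x \<in> X_set la \<longleftrightarrow> (\<exists>i. x = int (part_at la i) - int i - 1)"
proof -
  have e: "int (if i < length la then la ! i else 0) - int (i + 1) = int (part_at la i) - int i - 1" for i
    by (simp add: part_at_def)
  show ?thesis unfolding X_set_def e by simp
qed

lemma less_part_at_iff: "j < part_at la i \<longleftrightarrow> (i,j) \<in> diagram la"
  by (simp add: part_at_def mem_diagram)

lemma X_set_low: "x < - int (length la) \<Longrightarrow> x \<in> X_set la"
  unfolding X_set_iff by (rule exI[of _ "nat (- x - 1)"]) (simp add: part_at_def)

lemma X_set_bounded: "x \<in> X_set la \<Longrightarrow> x \<le> int (sum_list la)"
proof -
  assume "x \<in> X_set la"
  then obtain i where i: "x = int (part_at la i) - int i - 1" by (auto simp: X_set_iff)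
  have "part_at la i \<le> sum_list la" by (auto simp: part_at_def intro: member_le_sum_list)
  then show ?thesis using i by simp
qed

text \<open>Walk along the boundary of the diagram: the steps are labelled by the integers, and \<open>X_set la\<close>
  consists of the labels of the steps at the ends of the rows. The steps at the ends of the columns have the remaining
  labels, and reflecting the diagram reverses the walk.\<close>

lemma X_set_conj:
  assumes la: "la \<in> partitions n"
  shows "y \<in> X_set (conj_part la) \<longleftrightarrow> - 1 - y \<notin> X_set la"
proof -
  let ?a = "part_at la" and ?b = "part_at (conj_part la)"
  have ab: "j < ?a i \<longleftrightarrow> i < ?b j" for i j
    by (simp add: less_part_at_iff diagram_conj[OF la])
  have anti: "?a j \<le> ?a i" if "i \<le> j" for i j
  proof (rule ccontr)
    assume "\<not> ?a j \<le> ?a i"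
    then have "(j, ?a i) \<in> diagram la" by (simp add: less_part_at_iff[symmetric])
    then have "(i, ?a i) \<in> diagram la" using diagram_downward_closed[OF la _ that order_refl] by blast
    then show False by (simp add: less_part_at_iff[symmetric])
  qed
  show ?thesis
  proof
    assume "y \<in> X_set (conj_part la)"
    then obtain j where j: "y = int (?b j) - int j - 1" by (auto simp: X_set_iff)
    show "- 1 - y \<notin> X_set la"
    proof
      assume "- 1 - y \<in> X_set la"
      then obtain i where i: "- 1 - y = int (?a i) - int i - 1" by (auto simp: X_set_iff)
      show False using ab[of j i] i j by (cases "j < ?a i") auto
    qed
  next
    assume nX: "- 1 - y \<notin> X_set la"
    define z where "z = - 1 - y"
    have nz: "int (?a i) - int i - 1 \<noteq> z" for i using nX unfolding X_set_iff z_def[symmetric] by metis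
    \<comment> \<open>The numbers \<open>?a i - i - 1\<close> decrease and skip \<open>z\<close>; the index \<open>i0\<close> at which they pass it is the
      length of the column \<open>j\<close> with \<open>z = j - i0\<close>.\<close>
    define i0 where "i0 = (LEAST i. int (?a i) - int i - 1 < z)"
    have ex: "int (?a (nat \<bar>z\<bar> + ?a 0)) - int (nat \<bar>z\<bar> + ?a 0) - 1 < z"
      using anti[of 0 "nat \<bar>z\<bar> + ?a 0"] by simp
    have i0: "int (?a i0) - int i0 - 1 < z" unfolding i0_def by (rule LeastI[of _ "nat \<bar>z\<bar> + ?a 0"]) (rule ex)
    have less: "int (?a i) - int i - 1 > z" if "i < i0" for i
      using not_less_Least[of i "\<lambda>i. int (?a i) - int i - 1 < z"] that nz[of i] unfolding i0_def by fastforce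
    define j where "j = nat (z + int i0)"
    have j: "int j = z + int i0" using i0 by (simp add: j_def)
    have "i < ?b j \<longleftrightarrow> i < i0" for i
    proof (cases "i < i0")
      case True
      have "?a (i0 - 1) \<le> ?a i" by (rule anti) (use True in simp)
      moreover have "int (?a (i0 - 1)) > int j" using less[of "i0 - 1"] True j by (simp add: of_nat_diff)
      ultimately show ?thesis using True ab[of j i] by simp
    next
      case False
      then have "?a i \<le> ?a i0" by (intro anti) simp
      then have "\<not> j < ?a i" using i0 j by simp
      then show ?thesis using False ab[of j i] by simp
    qed
    then have "?b j = i0" by (metis linorder_neqE_nat less_irrefl)
    then have "y = int (?b j) - int j - 1" using j by (simp add: z_def)
    then show "y \<in> X_set (conj_part la)" by (auto simp: X_set_iff)
  qed
qed

text \<open>The parts count the gaps below the elements of a residue class in \<open>X_set la\<close>, so they vanish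
  if there are no gaps. Since \<open>X_set la\<close> contains all very small integers and no large ones, the sets that
  are counted are finite, and neither \<open>card\<close> nor \<open>mset_set\<close> takes its default value.\<close>

lemma p_quotient_part_empty_iff:
  assumes p: "p > 0"
  shows "p_quotient_part p la j = [] \<longleftrightarrow>
    (\<forall>m m'. m' < m \<longrightarrow> int p * m + (int j - 1) \<in> X_set la \<longrightarrow> int p * m' + (int j - 1) \<in> X_set la)"
proof -
  define c where "c = int j - 1"
  define S where "S = {m. int p * m + c \<in> X_set la \<and> quotient_count p la j m \<noteq> 0}"
  have inj: "inj (\<lambda>m. int p * m + c)" using p by (auto simp: inj_def)
  have fin: "finite {m. int p * m + c \<in> {- int (length la)..b}}" for b
    using finite_vimageI[OF finite_atLeastAtMost inj, of "- int (length la)" b] by (simp add: vimage_def)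
  have low: "- int (length la) \<le> x" if "x \<notin> X_set la" for x
    using X_set_low[of x la] that by fastforce
  have mono: "int p * m' \<le> int p * m" if "m' < m" for m m' :: int
    using that by (intro mult_left_mono) auto
  have finc: "finite {m'. m' < m \<and> int p * m' + c \<notin> X_set la}" for m
    by (rule finite_subset[OF _ fin[of "int p * m + c"]]) (use low mono in auto)
  have count: "quotient_count p la j m \<noteq> 0 \<longleftrightarrow> (\<exists>m'<m. int p * m' + c \<notin> X_set la)" for m
    using finc[of m] by (auto simp: quotient_count_def c_def)
  have finS: "finite S"
  proof (rule finite_subset[OF _ fin[of "int (sum_list la)"]])
    show "S \<subseteq> {m. int p * m + c \<in> {- int (length la)..int (sum_list la)}}"
    proof
      fix m assume "m \<in> S"
      then obtain m' where m: "int p * m + c \<in> X_set la" "m' < m" "int p * m' + c \<notin> X_set la"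
        unfolding S_def mem_Collect_eq count by blast
      then show "m \<in> {m. int p * m + c \<in> {- int (length la)..int (sum_list la)}}"
        using low[OF m(3)] mono[OF m(2)] X_set_bounded[OF m(1)] by auto
    qed
  qed
  have "p_quotient_part p la j = [] \<longleftrightarrow> image_mset (quotient_count p la j) (mset_set S) = {#}"
  proof -
    have "rev (sorted_list_of_multiset M) = [] \<longleftrightarrow> M = {#}" for M :: "nat multiset"
      by (metis mset_rev mset_sorted_list_of_multiset mset_zero_iff)
    then show ?thesis unfolding p_quotient_part_def S_def c_def .
  qed
  also have "\<dots> \<longleftrightarrow> S = {}" using finS by (simp add: mset_set_empty_iff)
  also have "\<dots> \<longleftrightarrow> (\<forall>m m'. m' < m \<longrightarrow> int p * m + c \<in> X_set la \<longrightarrow> int p * m' + c \<in> X_set la)"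
    unfolding S_def count by blast
  finally show ?thesis unfolding c_def .
qed

text \<open>Conjugation replaces \<open>X_set la\<close> by the complement of its mirror image. The mirror maps the
  middle residue class to itself, and the complement of the mirror image of a downward closed set is downward
  closed.\<close>

lemma Lam_conj:
  assumes p: "odd p" and la: "la \<in> Lam p n"
  shows "conj_part la \<in> Lam p n"
proof -
  have lap: "la \<in> partitions n" and e: "p_quotient_part p la ((p + 1) div 2) = []"
    using la by (auto simp: Lam_def)
  have p0: "p > 0" using p by (cases p) auto
  define c where "c = int ((p + 1) div 2) - 1"
  have c: "2 * c = int p - 1" using p by (auto simp: c_def elim!: oddE)
  have refl: "- 1 - (int p * m + c) = int p * (- m - 1) + c" for m
    using c by (simp add: algebra_simps)
  have dc: "int p * m' + c \<in> X_set la" if "m' < m" "int p * m + c \<in> X_set la" for m m'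
    using e that unfolding p_quotient_part_empty_iff[OF p0] c_def by blast
  have "int p * m' + c \<in> X_set (conj_part la)" if "m' < m" "int p * m + c \<in> X_set (conj_part la)" for m m'
    using that dc[of "- m - 1" "- m' - 1"] unfolding X_set_conj[OF lap] refl by auto
  then have "p_quotient_part p (conj_part la) ((p + 1) div 2) = []"
    unfolding p_quotient_part_empty_iff[OF p0] c_def by blast
  then show ?thesis using conj_part_partitions[OF lap] by (simp add: Lam_def)
qed

section \<open>Decomposition numbers\<close>

lemma decomposition_numbersD:
  assumes "decomposition_numbers p r G d" "\<chi> \<in> Irr G"
  shows "preg p G \<chi> g = (\<Sum>\<theta>\<in>IBr p r G. of_nat (d \<chi> \<theta>) * \<theta> g)"
  using fun_cong[OF bspec[OF assms(1)[unfolded decomposition_numbers_def] assms(2)]] by simp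

text \<open>An infinite sum would be zero by convention, but the degree of a character is not.\<close>

lemma finite_IBr:
  assumes G: "group G" and p: "prime p" and dec: "decomposition_numbers p r G d" and \<chi>: "\<chi> \<in> Irr G"
  shows "finite (IBr p r G)"
proof (rule ccontr)
  assume inf: "infinite (IBr p r G)"
  interpret group G by fact
  obtain e R where R: "irreducible_representation G e R" "\<chi> = character G R"
    using \<chi> by (rule Irr_cases)
  have "ord \<one>\<^bsub>G\<^esub> = 1" using pow_eq_id[of "\<one>\<^bsub>G\<^esub>" 1] by simp
  then have "p_regular p G \<one>\<^bsub>G\<^esub>" using p by (auto simp: p_regular_def)
  then have "\<chi> \<one>\<^bsub>G\<^esub> = 0" using decomposition_numbersD[OF dec \<chi>, of "\<one>\<^bsub>G\<^esub>"] inf by (simp add: preg_def)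
  moreover have "\<chi> \<one>\<^bsub>G\<^esub> = of_nat e"
    using representationD(2)[OF G irreducibleD(1)[OF R(1)]] by (simp add: R(2) character_eq_trace mat_trace_def)
  ultimately show False using irreducibleD(2)[OF R(1)] by simp
qed

lemma int_independent_nat_coeffs_eq:
  assumes "int_independent B" "finite B"
    and "\<And>g. (\<Sum>\<theta>\<in>B. of_nat (a \<theta>) * \<theta> g) = (\<Sum>\<theta>\<in>B. of_nat (b \<theta>) * \<theta> g)" "\<theta> \<in> B"
  shows "a \<theta> = b \<theta>"
proof -
  have "int (a \<theta>) = int (b \<theta>)"
    by (rule int_independent_coeffs_eq[OF assms(1,2) subset_refl _ assms(4), of "\<lambda>\<theta>. int (a \<theta>)" "\<lambda>\<theta>. int (b \<theta>)"])
      (simp add: assms(3))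
  then show ?thesis by simp
qed

text \<open>Apply \<open>\<sigma>\<close> to the expansion of \<open>\<chi>\<close> and compare coefficients. The cases
  of interest are the twist by a linear character and the conjugation by an automorphism.\<close>

lemma decomposition_equivariant:
  assumes ind: "int_independent (IBr p r G)" and fin: "finite (IBr p r G)"
    and dec: "decomposition_numbers p r G d" and \<chi>: "\<chi> \<in> Irr G" "\<sigma> \<chi> \<in> Irr G"
    and preg: "preg p G (\<sigma> \<chi>) = \<sigma> (preg p G \<chi>)"
    and closed: "\<And>\<theta>. \<theta> \<in> IBr p r G \<Longrightarrow> \<sigma> \<theta> \<in> IBr p r G"
    and inj: "inj_on \<sigma> (IBr p r G)"
    and lin: "\<And>c g. \<sigma> (\<lambda>g. \<Sum>\<theta>\<in>IBr p r G. of_nat (c \<theta>) * \<theta> g) g = (\<Sum>\<theta>\<in>IBr p r G. of_nat (c \<theta>) * \<sigma> \<theta> g)"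
    and \<theta>: "\<theta> \<in> IBr p r G"
  shows "d (\<sigma> \<chi>) (\<sigma> \<theta>) = d \<chi> \<theta>"
proof -
  let ?B = "IBr p r G"
  have bij: "bij_betw \<sigma> ?B ?B"
    using inj closed endo_inj_surj[OF fin _ inj] by (auto simp: bij_betw_def)
  define \<tau> where "\<tau> = the_inv_into ?B \<sigma>"
  have \<tau>: "\<tau> (\<sigma> \<theta>) = \<theta>" if "\<theta> \<in> ?B" for \<theta>
    unfolding \<tau>_def by (rule the_inv_into_f_f[OF inj that])
  have e: "preg p G \<chi> = (\<lambda>g. \<Sum>\<theta>\<in>?B. of_nat (d \<chi> \<theta>) * \<theta> g)"
    by (rule ext) (rule decomposition_numbersD[OF dec \<chi>(1)])
  have "d (\<sigma> \<chi>) (\<sigma> \<theta>) = (\<lambda>\<theta>. d \<chi> (\<tau> \<theta>)) (\<sigma> \<theta>)"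
  proof (rule int_independent_nat_coeffs_eq[OF ind fin _ closed[OF \<theta>]])
    fix g
    have "(\<Sum>\<theta>\<in>?B. of_nat (d (\<sigma> \<chi>) \<theta>) * \<theta> g) = preg p G (\<sigma> \<chi>) g"
      by (rule decomposition_numbersD[OF dec \<chi>(2), symmetric])
    also have "\<dots> = (\<Sum>\<theta>\<in>?B. of_nat (d \<chi> \<theta>) * \<sigma> \<theta> g)" unfolding preg e by (rule lin)
    also have "\<dots> = (\<Sum>\<theta>\<in>?B. of_nat (d \<chi> (\<tau> (\<sigma> \<theta>))) * \<sigma> \<theta> g)" by (rule sum.cong) (simp_all add: \<tau>)
    also have "\<dots> = (\<Sum>\<theta>\<in>?B. of_nat (d \<chi> (\<tau> \<theta>)) * \<theta> g)"
      by (rule sum.reindex_bij_betw[OF bij, of "\<lambda>\<theta>. of_nat (d \<chi> (\<tau> \<theta>)) * \<theta> g"])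
    finally show "(\<Sum>\<theta>\<in>?B. of_nat (d (\<sigma> \<chi>) \<theta>) * \<theta> g) = (\<Sum>\<theta>\<in>?B. of_nat (d \<chi> (\<tau> \<theta>)) * \<theta> g)" .
  qed
  then show ?thesis by (simp add: \<tau>[OF \<theta>])
qed

context index_two_modular
begin

lemma eps_times_eps_times: "eps_times (eps_times \<theta>) g = \<theta> g" if "g \<in> carrier G"
  using eps_cases[OF that] by (auto simp: eps_times_def)

lemma decomposition_eps_times:
  assumes fin: "finite (IBr p r G)" and dec: "decomposition_numbers p r G d" and \<chi>: "\<chi> \<in> Irr G"
    and \<theta>: "\<theta> \<in> IBr p r G"
  shows "d (eps_times \<chi>) (eps_times \<theta>) = d \<chi> \<theta>"
proof (rule decomposition_equivariant[OF int_independent_IBr[OF is_group index_two.fin[OF index_two_axioms]] fin dec \<chi> eps_times_Irr[OF \<chi>] eps_times_preg eps_times_IBr _ _ \<theta>])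
  show "inj_on eps_times (IBr p r G)"
  proof (rule inj_onI)
    fix \<theta> \<theta>' assume *: "\<theta> \<in> IBr p r G" "\<theta>' \<in> IBr p r G" "eps_times \<theta> = eps_times \<theta>'"
    show "\<theta> = \<theta>'"
    proof
      fix g
      show "\<theta> g = \<theta>' g"
      proof (cases "g \<in> carrier G")
        case True
        then show ?thesis using eps_times_eps_times[OF True, of \<theta>] eps_times_eps_times[OF True, of \<theta>'] *(3) by simp
      next
        case False
        then show ?thesis using *(1,2) by (auto simp: IBr_outside p_regular_def)
      qed
    qed
  qed
  show "eps_times (\<lambda>g. \<Sum>\<theta>\<in>IBr p r G. of_nat (c \<theta>) * \<theta> g) g = (\<Sum>\<theta>\<in>IBr p r G. of_nat (c \<theta>) * eps_times \<theta> g)" for c :: "('g \<Rightarrow> complex) \<Rightarrow> nat" and g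
    by (simp add: eps_times_def sum_distrib_left mult_ac)
qed

lemma decomposition_conj_fun:
  assumes fin: "finite (IBr p r H)" and dec: "decomposition_numbers p r H d" and \<rho>: "\<rho> \<in> Irr H"
    and \<theta>: "\<theta> \<in> IBr p r H"
  shows "d (conj_fun \<rho>) (conj_fun \<theta>) = d \<rho> \<theta>"
proof (rule decomposition_equivariant[OF int_independent_IBr[OF H_group fin_H] fin dec \<rho> conj_fun_Irr[OF \<rho>] conj_fun_preg conj_fun_IBr _ _ \<theta>])
  show "inj_on conj_fun (IBr p r H)" by (rule inj_on_inverseI[of _ conj_fun]) (rule conj_fun_conj_fun_IBr)
  show "conj_fun (\<lambda>g. \<Sum>\<theta>\<in>IBr p r H. of_nat (c \<theta>) * \<theta> g) g = (\<Sum>\<theta>\<in>IBr p r H. of_nat (c \<theta>) * conj_fun \<theta> g)" for c :: "('g \<Rightarrow> complex) \<Rightarrow> nat" and g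
    by (simp add: conj_fun_def)
qed

lemma preg_Res:
  assumes dec: "decomposition_numbers p r G d" and \<chi>: "\<chi> \<in> Irr G"
  shows "preg p H (Res H \<chi>) g = (\<Sum>\<theta>\<in>IBr p r G. of_nat (d \<chi> \<theta>) * Res H \<theta> g)"
  unfolding Res_preg using decomposition_numbersD[OF dec \<chi>, of g] by (simp add: Res_def)

lemma Res_eps_times: "Res H (eps_times \<theta>) = Res H \<theta>"
  by (auto simp: Res_def eps_times_def H_carrier)

text \<open>A class function equal to its twist vanishes outside \<open>H\<close>.\<close>

lemma eq_of_Res_eq:
  assumes "\<theta> \<in> IBr p r G" "\<theta>' \<in> IBr p r G" "eps_times \<theta> = \<theta>" "eps_times \<theta>' = \<theta>'" "Res H \<theta> = Res H \<theta>'"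
  shows "\<theta> = \<theta>'"
proof
  fix g
  consider "g \<in> carrier H" | "g \<in> carrier G" "eps g = -1" | "g \<notin> carrier G"
    using eps_cases[of g] by (auto simp: H_carrier)
  then show "\<theta> g = \<theta>' g"
  proof cases
    case 1
    then show ?thesis using fun_cong[OF assms(5), of g] by (simp add: Res_def)
  next
    case 2
    then have "\<theta> g = - \<theta> g" "\<theta>' g = - \<theta>' g"
      using fun_cong[OF assms(3), of g] fun_cong[OF assms(4), of g] by (simp_all add: eps_times_def)
    then show ?thesis by simp
  next
    case 3
    then show ?thesis using assms(1,2) by (simp add: IBr_outside p_regular_def)
  qed
qed

text \<open>By independence, \<open>b \<psi>0\<close> is the sum of the \<open>a \<theta>\<close> weighted by the
  multiplicities of \<open>\<psi>0\<close> in the restrictions of the \<open>\<theta>\<close>.\<close>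

lemma restriction_coefficient:
  assumes fin: "finite (IBr p r G)" "finite (IBr p r H)"
    and exp: "\<And>g. (\<Sum>\<psi>\<in>IBr p r H. of_nat (b \<psi>) * \<psi> g) = (\<Sum>\<theta>\<in>IBr p r G. of_nat (a \<theta>) * Res H \<theta> g)"
    and mult: "\<And>\<theta>. \<theta> \<in> IBr p r G \<Longrightarrow> \<exists>m :: _ \<Rightarrow> nat.
      (\<forall>g. Res H \<theta> g = (\<Sum>\<psi>\<in>IBr p r H. of_nat (m \<psi>) * \<psi> g)) \<and> m \<psi>0 = (if \<theta> \<in> T then 1 else 0)"
    and T: "T \<subseteq> IBr p r G" and \<psi>0: "\<psi>0 \<in> IBr p r H"
  shows "b \<psi>0 = sum a T"
proof -
  let ?G = "IBr p r G" and ?H = "IBr p r H"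
  obtain m :: "('g \<Rightarrow> complex) \<Rightarrow> ('g \<Rightarrow> complex) \<Rightarrow> nat" where
    m: "\<And>\<theta> g. \<theta> \<in> ?G \<Longrightarrow> Res H \<theta> g = (\<Sum>\<psi>\<in>?H. of_nat (m \<theta> \<psi>) * \<psi> g)"
      "\<And>\<theta>. \<theta> \<in> ?G \<Longrightarrow> m \<theta> \<psi>0 = (if \<theta> \<in> T then 1 else 0)"
    using bchoice[of ?G "\<lambda>\<theta> m. (\<forall>g. Res H \<theta> g = (\<Sum>\<psi>\<in>?H. of_nat (m \<psi>) * \<psi> g)) \<and> m \<psi>0 = (if \<theta> \<in> T then 1 else 0)"] mult
    by blast
  have "b \<psi>0 = (\<lambda>\<psi>. \<Sum>\<theta>\<in>?G. a \<theta> * m \<theta> \<psi>) \<psi>0"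
  proof (rule int_independent_nat_coeffs_eq[OF int_independent_IBr[OF H_group fin_H] fin(2) _ \<psi>0])
    fix g
    have "(\<Sum>\<psi>\<in>?H. of_nat (b \<psi>) * \<psi> g) = (\<Sum>\<theta>\<in>?G. \<Sum>\<psi>\<in>?H. of_nat (a \<theta>) * (of_nat (m \<theta> \<psi>) * \<psi> g))"
      unfolding exp by (rule sum.cong[OF refl]) (simp add: m(1) sum_distrib_left)
    also have "\<dots> = (\<Sum>\<psi>\<in>?H. \<Sum>\<theta>\<in>?G. of_nat (a \<theta>) * (of_nat (m \<theta> \<psi>) * \<psi> g))" by (rule sum.swap)
    also have "\<dots> = (\<Sum>\<psi>\<in>?H. of_nat (\<Sum>\<theta>\<in>?G. a \<theta> * m \<theta> \<psi>) * \<psi> g)"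
      by (rule sum.cong[OF refl]) (simp add: sum_distrib_right mult.assoc)
    finally show "(\<Sum>\<psi>\<in>?H. of_nat (b \<psi>) * \<psi> g) = (\<Sum>\<psi>\<in>?H. of_nat (\<Sum>\<theta>\<in>?G. a \<theta> * m \<theta> \<psi>) * \<psi> g)" .
  qed
  also have "(\<lambda>\<psi>. \<Sum>\<theta>\<in>?G. a \<theta> * m \<theta> \<psi>) \<psi>0 = (\<Sum>\<theta>\<in>?G. if \<theta> \<in> T then a \<theta> else 0)"
    by (rule sum.cong) (auto simp: m(2))
  also have "\<dots> = sum a T" using T by (simp add: sum.inter_restrict[OF fin(1), symmetric] Int_absorb1)
  finally show ?thesis .
qed

lemma sum_nat_indicator:
  assumes "finite (IBr p r H)" "a \<in> IBr p r H"
  shows "(\<Sum>\<psi>\<in>IBr p r H. of_nat (if \<psi> = a then 1 else 0) * \<psi> g) = (a g :: complex)"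
proof -
  have "(\<Sum>\<psi>\<in>IBr p r H. of_nat (if \<psi> = a then 1 else 0) * \<psi> g) = (\<Sum>\<psi>\<in>IBr p r H. if \<psi> = a then a g else 0)"
    by (intro sum.cong) auto
  then show ?thesis using assms by simp
qed

text \<open>The Brauer character \<open>\<psi>0\<close> differs from its conjugate, but a restriction that is
  irreducible equals its own. So \<open>\<psi>0\<close> occurs only in restrictions of the form
  \<open>\<psi>0 + conj_fun \<psi>0\<close>. A Brauer character with such a restriction equals its twist, so it
  vanishes outside \<open>H\<close> and is determined by the restriction.\<close>

lemma coefficient_of_constituent:
  assumes fin: "finite (IBr p r G)" "finite (IBr p r H)"
    and exp: "\<And>g. (\<Sum>\<psi>\<in>IBr p r H. of_nat (b \<psi>) * \<psi> g) = (\<Sum>\<theta>\<in>IBr p r G. of_nat (a \<theta>) * Res H \<theta> g)"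
    and \<theta>0: "\<theta>0 \<in> IBr p r G" and \<psi>0: "\<psi>0 \<in> IBr p r H" "conj_fun \<psi>0 \<noteq> \<psi>0"
    and Res0: "\<And>g. Res H \<theta>0 g = \<psi>0 g + conj_fun \<psi>0 g"
  shows "b \<psi>0 = a \<theta>0"
proof -
  have ind: "int_independent (IBr p r H)" by (rule int_independent_IBr[OF H_group fin_H])
  note cj0 = conj_fun_IBr[OF \<psi>0(1)]
  have notirr: "Res H \<theta>0 \<notin> IBr p r H"
    using int_independent_one_not_two[OF ind, of "Res H \<theta>0" \<psi>0 "conj_fun \<psi>0"] \<psi>0 cj0 Res0 by auto
  have "b \<psi>0 = sum a {\<theta>0}"
  proof (rule restriction_coefficient[OF fin exp _ _ \<psi>0(1)])
    fix \<theta> assume \<theta>: "\<theta> \<in> IBr p r G"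
    from clifford_IBr[OF \<theta>]
    show "\<exists>m :: _ \<Rightarrow> nat. (\<forall>g. Res H \<theta> g = (\<Sum>\<psi>\<in>IBr p r H. of_nat (m \<psi>) * \<psi> g)) \<and>
      m \<psi>0 = (if \<theta> \<in> {\<theta>0} then 1 else 0)"
    proof
      assume irr: "Res H \<theta> \<in> IBr p r H"
      have "\<psi>0 \<noteq> Res H \<theta>" using conj_fun_Res_IBr[OF \<theta>] \<psi>0(2) by auto
      moreover have "\<theta> \<noteq> \<theta>0" using irr notirr by auto
      ultimately show ?thesis using sum_nat_indicator[OF fin(2) irr]
        by (intro exI[of _ "\<lambda>\<psi>. if \<psi> = Res H \<theta> then 1 else 0"]) simp
    next
      assume "\<exists>\<psi>\<in>IBr p r H. \<forall>g. Res H \<theta> g = \<psi> g + conj_fun \<psi> g"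
      then obtain \<psi> where \<psi>: "\<psi> \<in> IBr p r H" "\<And>g. Res H \<theta> g = \<psi> g + conj_fun \<psi> g" by blast
      note conj_in = conj_fun_IBr[OF \<psi>(1)]
      let ?m = "\<lambda>\<psi>'. (if \<psi>' = \<psi> then 1 else 0) + (if \<psi>' = conj_fun \<psi> then 1 else 0) :: nat"
      have 1: "Res H \<theta> g = (\<Sum>\<psi>\<in>IBr p r H. of_nat (?m \<psi>) * \<psi> g)" for g
        unfolding of_nat_add distrib_right sum.distrib sum_nat_indicator[OF fin(2) \<psi>(1)]
          sum_nat_indicator[OF fin(2) conj_in] by (rule \<psi>(2))
      have 2: "?m \<psi>0 = (if \<theta> = \<theta>0 then 1 else 0)"
      proof (cases "\<psi>0 = \<psi> \<or> \<psi>0 = conj_fun \<psi>")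
        case True
        then have pair: "\<psi>0 = \<psi> \<and> conj_fun \<psi>0 = conj_fun \<psi> \<or> \<psi>0 = conj_fun \<psi> \<and> conj_fun \<psi>0 = \<psi>"
          using conj_fun_conj_fun_IBr[OF \<psi>(1)] by auto
        then have "Res H \<theta> = Res H \<theta>0" using \<psi>(2) Res0 by (intro ext) auto
        moreover have "eps_times \<theta> = \<theta>"
          using Res_IBr[OF \<theta>] notirr \<open>Res H \<theta> = Res H \<theta>0\<close> by auto
        moreover have "eps_times \<theta>0 = \<theta>0" using Res_IBr[OF \<theta>0] notirr by auto
        ultimately have "\<theta> = \<theta>0" by (intro eq_of_Res_eq[OF \<theta> \<theta>0])
        moreover have "?m \<psi>0 = 1" using pair \<psi>0(2) by auto
        ultimately show ?thesis by simp
      next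
        case False
        have "\<theta> \<noteq> \<theta>0"
        proof
          assume "\<theta> = \<theta>0"
          then have "\<psi> g + conj_fun \<psi> g = \<psi>0 g + conj_fun \<psi>0 g" for g using \<psi>(2)[of g] Res0[of g] by simp
          then have "\<psi> = \<psi>0 \<and> conj_fun \<psi> = conj_fun \<psi>0 \<or> \<psi> = conj_fun \<psi>0 \<and> conj_fun \<psi> = \<psi>0"
            by (intro int_independent_two_two[OF ind]) (use \<psi>(1) conj_in \<psi>0 cj0 in auto)
          with False show False by auto
        qed
        then show ?thesis using False by simp
      qed
      show ?thesis by (rule exI[of _ ?m]) (use 1 2 in auto)
    qed
  qed (use \<theta>0 in auto)
  then show ?thesis by simp
qed

text \<open>If \<open>\<theta>\<close> restricts to \<open>Res H \<theta>0\<close>, then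
  \<open>\<theta> + eps_times \<theta> = \<theta>0 + eps_times \<theta>0\<close>, since both sides are twice the
  restriction, extended by zero. So \<open>\<theta>\<close> is \<open>\<theta>0\<close> or its twist.\<close>

lemma coefficient_of_restriction:
  assumes fin: "finite (IBr p r G)" "finite (IBr p r H)"
    and exp: "\<And>g. (\<Sum>\<psi>\<in>IBr p r H. of_nat (b \<psi>) * \<psi> g) = (\<Sum>\<theta>\<in>IBr p r G. of_nat (a \<theta>) * Res H \<theta> g)"
    and \<theta>0: "\<theta>0 \<in> IBr p r G" "eps_times \<theta>0 \<noteq> \<theta>0"
  shows "b (Res H \<theta>0) = a \<theta>0 + a (eps_times \<theta>0)"
proof -
  have indG: "int_independent (IBr p r G)" by (rule int_independent_IBr[OF is_group index_two.fin[OF index_two_axioms]])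
  have ind: "int_independent (IBr p r H)" by (rule int_independent_IBr[OF H_group fin_H])
  note e0 = eps_times_IBr[OF \<theta>0(1)]
  note irr0 = Res_IBr[OF \<theta>0]
  have sum_eps: "\<theta> g + eps_times \<theta> g = 2 * Res H \<theta> g" if "\<theta> \<in> IBr p r G" for \<theta> g
    using eps_cases[of g] IBr_outside[OF that, of g]
    by (cases "g \<in> carrier G") (auto simp: eps_times_def Res_def H_carrier p_regular_def)
  have "b (Res H \<theta>0) = sum a {\<theta>0, eps_times \<theta>0}"
  proof (rule restriction_coefficient[OF fin exp _ _ irr0])
    fix \<theta> assume \<theta>: "\<theta> \<in> IBr p r G"
    from clifford_IBr[OF \<theta>]
    show "\<exists>m :: _ \<Rightarrow> nat. (\<forall>g. Res H \<theta> g = (\<Sum>\<psi>\<in>IBr p r H. of_nat (m \<psi>) * \<psi> g)) \<and>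
      m (Res H \<theta>0) = (if \<theta> \<in> {\<theta>0, eps_times \<theta>0} then 1 else 0)"
    proof
      assume irr: "Res H \<theta> \<in> IBr p r H"
      have "Res H \<theta>0 = Res H \<theta> \<longleftrightarrow> \<theta> \<in> {\<theta>0, eps_times \<theta>0}"
      proof
        assume eq: "Res H \<theta>0 = Res H \<theta>"
        have "\<theta> = \<theta>0 \<and> eps_times \<theta> = eps_times \<theta>0 \<or> \<theta> = eps_times \<theta>0 \<and> eps_times \<theta> = \<theta>0"
          by (rule int_independent_two_two[OF indG])
            (use \<theta> \<theta>0 e0 eps_times_IBr[OF \<theta>] sum_eps eq in auto)
        then show "\<theta> \<in> {\<theta>0, eps_times \<theta>0}" by auto
      qed (auto simp: Res_eps_times)
      then show ?thesis using sum_nat_indicator[OF fin(2) irr]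
        by (intro exI[of _ "\<lambda>\<psi>. if \<psi> = Res H \<theta> then 1 else 0"]) auto
    next
      assume "\<exists>\<psi>\<in>IBr p r H. \<forall>g. Res H \<theta> g = \<psi> g + conj_fun \<psi> g"
      then obtain \<psi> where \<psi>: "\<psi> \<in> IBr p r H" "\<And>g. Res H \<theta> g = \<psi> g + conj_fun \<psi> g" by blast
      note conj_in = conj_fun_IBr[OF \<psi>(1)]
      let ?m = "\<lambda>\<psi>'. (if \<psi>' = \<psi> then 1 else 0) + (if \<psi>' = conj_fun \<psi> then 1 else 0) :: nat"
      have 1: "Res H \<theta> g = (\<Sum>\<psi>\<in>IBr p r H. of_nat (?m \<psi>) * \<psi> g)" for g
        unfolding of_nat_add distrib_right sum.distrib sum_nat_indicator[OF fin(2) \<psi>(1)]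
          sum_nat_indicator[OF fin(2) conj_in] by (rule \<psi>(2))
      have notirr: "Res H \<theta> \<notin> IBr p r H"
      proof
        assume irr: "Res H \<theta> \<in> IBr p r H"
        have "(\<lambda>\<psi>'. if \<psi>' = Res H \<theta> then 1 else 0) \<psi> = ?m \<psi>"
          by (rule int_independent_nat_coeffs_eq[OF ind fin(2) _ \<psi>(1)])
            (simp only: sum_nat_indicator[OF fin(2) irr] 1[symmetric])
        moreover have "(\<lambda>\<psi>'. if \<psi>' = Res H \<theta> then 1 else 0) (conj_fun \<psi>) = ?m (conj_fun \<psi>)"
          by (rule int_independent_nat_coeffs_eq[OF ind fin(2) _ conj_in])
            (simp only: sum_nat_indicator[OF fin(2) irr] 1[symmetric])
        ultimately show False by (auto split: if_splits)
      qed
      have 2: "\<theta> \<notin> {\<theta>0, eps_times \<theta>0}" using notirr irr0 by (auto simp: Res_eps_times)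
      \<comment> \<open>If the restriction of \<open>\<theta>0\<close> were a constituent, it would be the only one, twice,
        and \<open>\<theta>\<close> would be the sum of \<open>\<theta>0\<close> and its twist.\<close>
      have 3: "Res H \<theta>0 \<noteq> \<psi> \<and> Res H \<theta>0 \<noteq> conj_fun \<psi>"
      proof (rule ccontr)
        assume "\<not> ?thesis"
        then have "\<psi> = Res H \<theta>0" "conj_fun \<psi> = Res H \<theta>0"
          using conj_fun_Res_IBr[OF \<theta>0(1)] conj_fun_conj_fun_IBr[OF \<psi>(1)] by metis+
        then have r: "Res H \<theta> g = 2 * Res H \<theta>0 g" for g using \<psi>(2)[of g] by simp
        have "eps_times \<theta> = \<theta>" using Res_IBr[OF \<theta>] notirr by auto
        then have "\<theta> g = Res H \<theta> g" for g using sum_eps[OF \<theta>, of g] by simp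
        then have "\<theta> g = \<theta>0 g + eps_times \<theta>0 g" for g using r[of g] sum_eps[OF \<theta>0(1), of g] by simp
        then show False
          using int_independent_one_not_two[OF indG, of \<theta> \<theta>0 "eps_times \<theta>0"] \<theta> \<theta>0 e0 by auto
      qed
      show ?thesis by (rule exI[of _ ?m]) (use 1 2 3 in auto)
    qed
  qed (use \<theta>0 e0 in auto)
  then show ?thesis using \<theta>0(2) by simp
qed

end

theorem theorem6p2:
  fixes p n :: nat
    and r :: "complex \<Rightarrow> 'k :: field"
    and \<Phi> :: "((nat \<Rightarrow> nat) \<Rightarrow> complex) \<Rightarrow> (nat \<Rightarrow> nat) \<Rightarrow> complex"
    and sel :: "nat list set \<Rightarrow> nat list"
    and rho_p rho_m theta_p theta_m :: "nat list \<Rightarrow> (nat \<Rightarrow> nat) \<Rightarrow> complex"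
    and decS decA :: "((nat \<Rightarrow> nat) \<Rightarrow> complex) \<Rightarrow> ((nat \<Rightarrow> nat) \<Rightarrow> complex) \<Rightarrow> nat"
  defines "S \<equiv> sym_group n" and "A \<equiv> alt_group n"
  defines "theta \<equiv> (\<lambda>mu. \<Phi> (chi n mu))"
  defines "d \<equiv> (\<lambda>la mu. decS (chi n la) (theta mu))"
  defines "rhoA \<equiv> (\<lambda>la. Res A (chi n la))"
    and "thetaA \<equiv> (\<lambda>mu. Res A (theta mu))"
  assumes "prime p" and "odd p" and "n \<ge> 2"
    and "modular_reduction p r"
    and "bij_betw \<Phi> (B_empty p n) (IBr p r S)"
    and "\<And>\<chi>. \<chi> \<in> B_empty p n \<Longrightarrow> \<Phi> (sgn_times \<chi>) = sgn_times (\<Phi> \<chi>)"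
    and "\<And>w. w \<in> Lam2 p n \<Longrightarrow> sel w \<in> w"
    and "\<And>la. la \<in> Lam1 p n \<Longrightarrow>
           rho_p la \<in> Irr A \<and> rho_m la \<in> Irr A \<and> rho_p la \<noteq> rho_m la \<and>
           Res A (chi n la) = (\<lambda>g. rho_p la g + rho_m la g)"
    and "\<And>mu. mu \<in> Lam1 p n \<Longrightarrow>
           theta_p mu \<in> IBr p r A \<and> theta_m mu \<in> IBr p r A \<and> theta_p mu \<noteq> theta_m mu \<and>
           Res A (theta mu) = (\<lambda>g. theta_p mu g + theta_m mu g)"
    and "decomposition_numbers p r S decS"
    and "decomposition_numbers p r A decA"
  shows
    \<comment> \<open>(i)\<close>
    "((\<forall>la\<in>Lam1 p n. \<forall>w\<in>Lam2 p n. d la (sel w) = d la (conj_part (sel w))) \<and>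
      (\<forall>w'\<in>Lam2 p n. \<forall>mu\<in>Lam1 p n. d (sel w') mu = d (conj_part (sel w')) mu) \<and>
      (\<forall>w'\<in>Lam2 p n. \<forall>w\<in>Lam2 p n.
        d (sel w') (sel w) = d (conj_part (sel w')) (conj_part (sel w)) \<and>
        d (sel w') (conj_part (sel w)) = d (conj_part (sel w')) (sel w))) \<and>
    \<comment> \<open>(ii)\<close>
     ((\<forall>la\<in>Lam1 p n. \<forall>mu\<in>Lam1 p n.
        decA (rho_p la) (theta_p mu) + decA (rho_m la) (theta_p mu) = d la mu \<and>
        d la mu = decA (rho_p la) (theta_m mu) + decA (rho_m la) (theta_m mu) \<and>
        decA (rho_p la) (theta_p mu) = decA (rho_m la) (theta_m mu) \<and>
        decA (rho_p la) (theta_m mu) = decA (rho_m la) (theta_p mu)) \<and>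
      (\<forall>la\<in>Lam1 p n. \<forall>w\<in>Lam2 p n.
        decA (rho_p la) (thetaA (sel w)) = decA (rho_m la) (thetaA (sel w)) \<and>
        decA (rho_m la) (thetaA (sel w)) = d la (sel w))) \<and>
    \<comment> \<open>(iii)\<close>
     ((\<forall>w'\<in>Lam2 p n. \<forall>w\<in>Lam2 p n.
        d (sel w') (sel w) + d (sel w') (conj_part (sel w)) =
          decA (rhoA (sel w')) (thetaA (sel w))) \<and>
      (\<forall>w'\<in>Lam2 p n. \<forall>mu\<in>Lam1 p n.
        decA (rhoA (sel w')) (theta_p mu) = decA (rhoA (sel w')) (theta_m mu) \<and>
        decA (rhoA (sel w')) (theta_m mu) = d (sel w') mu))"
proof -
  have p: "prime p" "odd p" and n: "n \<ge> 2" and red: "modular_reduction p r" by fact+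
  note Phi_bij = assms(11)[unfolded S_def] and Phi_eps = assms(12) and sel = assms(13) and rho = assms(14)[unfolded A_def]
    and th = assms(15)[unfolded A_def] and decS = assms(16)[unfolded S_def] and decA = assms(17)[unfolded A_def]
  interpret index_two "sym_group n" "alt_group n" sign "transpose 1 2" by (rule index_two_sym[OF n])
  interpret index_two_modular "sym_group n" "alt_group n" sign "transpose 1 2" p r
    by unfold_locales (use p red in auto)
  have eps: "eps_times = sgn_times" by (intro ext) (simp add: eps_times_def sgn_times_def)
  have lam: "la \<in> partitions n" if "la \<in> Lam p n" for la using that by (simp add: Lam_def)
  have chiS: "chi n la \<in> Irr (sym_group n)" if "la \<in> Lam p n" for la
    by (rule chi_Irr[OF lam[OF that]])
  have B: "chi n la \<in> B_empty p n" if "la \<in> Lam p n" for la using that by (simp add: B_empty_def)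
  have theta: "theta mu \<in> IBr p r (sym_group n)" if "mu \<in> Lam p n" for mu
    using bij_betw_apply[OF Phi_bij B[OF that]] by (simp add: theta_def)
  have chi_eps: "chi n (conj_part la) = eps_times (chi n la)" if "la \<in> Lam p n" for la
    unfolding eps by (rule chi_conj[OF n lam[OF that]])
  have theta_eps: "theta (conj_part mu) = eps_times (theta mu)" if "mu \<in> Lam p n" for mu
    using Phi_eps[OF B[OF that]] chi_eps[OF that] by (simp add: theta_def eps)
  have L1: "la \<in> Lam p n" "conj_part la = la" if "la \<in> Lam1 p n" for la using that by (auto simp: Lam1_def)
  have L2: "sel w \<in> Lam p n" "conj_part (sel w) \<noteq> sel w" if w: "w \<in> Lam2 p n" for w
  proof -
    obtain la where la: "w = {la, conj_part la}" "la \<in> Lam p n" "conj_part la \<noteq> la"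
      using w by (auto simp: Lam2_def)
    have "sel w = la \<or> sel w = conj_part la" using sel[OF w] la(1) by auto
    then show "sel w \<in> Lam p n" "conj_part (sel w) \<noteq> sel w"
      using la Lam_conj[OF p(2) la(2)] conj_conj_part[OF lam[OF la(2)]] by auto
  qed
  have chi_ne: "eps_times (chi n (sel w)) \<noteq> chi n (sel w)" if w: "w \<in> Lam2 p n" for w
    using chi_inj[OF lam[OF Lam_conj[OF p(2) L2(1)[OF w]]] lam[OF L2(1)[OF w]]] L2(2)[OF w]
    by (auto simp: chi_eps[OF L2(1)[OF w], symmetric])
  \<comment> \<open>This is where the equivariance and the injectivity of \<open>\<Phi>\<close> enter: a chosen character that is moved by
    the sign has a Brauer character that is moved.\<close>
  have theta_ne: "eps_times (theta (sel w)) \<noteq> theta (sel w)" if w: "w \<in> Lam2 p n" for w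
  proof
    assume "eps_times (theta (sel w)) = theta (sel w)"
    then have "\<Phi> (chi n (conj_part (sel w))) = \<Phi> (chi n (sel w))"
      using theta_eps[OF L2(1)[OF w]] by (simp add: theta_def)
    then have "chi n (conj_part (sel w)) = chi n (sel w)"
      using bij_betw_imp_inj_on[OF Phi_bij] B[OF L2(1)[OF w]] B[OF Lam_conj[OF p(2) L2(1)[OF w]]]
      by (auto dest: inj_onD)
    then show False using chi_ne[OF w] chi_eps[OF L2(1)[OF w]] by simp
  qed
  \<comment> \<open>Finiteness is deduced from the decomposition numbers of some character; the one of \<open>[n]\<close> will do.\<close>
  have "[n] \<in> partitions n" using n by (simp add: partitions_def)
  then have triv: "chi n [n] \<in> Irr (sym_group n)" by (rule chi_Irr)
  obtain \<rho>0 where \<rho>0: "\<rho>0 \<in> Irr (alt_group n)" using clifford_Irr[OF triv] by blast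
  have fin: "finite (IBr p r (sym_group n))" "finite (IBr p r (alt_group n))"
    by (rule finite_IBr[OF is_group p(1) decS triv], rule finite_IBr[OF H_group p(1) decA \<rho>0])
  have d_conj: "d (conj_part la) (conj_part mu) = d la mu" if "la \<in> Lam p n" "mu \<in> Lam p n" for la mu
    unfolding d_def chi_eps[OF that(1)] theta_eps[OF that(2)]
    by (rule decomposition_eps_times[OF fin(1) decS chiS[OF that(1)] theta[OF that(2)]])
  have conj2: "conj_part (conj_part (sel w)) = sel w" if "w \<in> Lam2 p n" for w
    by (rule conj_conj_part[OF lam[OF L2(1)[OF that]]])
  have part1: "d la (sel w) = d la (conj_part (sel w))" if "la \<in> Lam1 p n" "w \<in> Lam2 p n" for la w
    using d_conj[OF L1(1)[OF that(1)] L2(1)[OF that(2)]] L1(2)[OF that(1)] by simp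
  have part2: "d (sel w') mu = d (conj_part (sel w')) mu" if "w' \<in> Lam2 p n" "mu \<in> Lam1 p n" for w' mu
    using d_conj[OF L2(1)[OF that(1)] L1(1)[OF that(2)]] L1(2)[OF that(2)] by simp
  have part3: "d (sel w') (sel w) = d (conj_part (sel w')) (conj_part (sel w)) \<and>
      d (sel w') (conj_part (sel w)) = d (conj_part (sel w')) (sel w)"
    if "w' \<in> Lam2 p n" "w \<in> Lam2 p n" for w' w
    using d_conj[OF L2(1)[OF that(1)] L2(1)[OF that(2)]]
      d_conj[OF L2(1)[OF that(1)] Lam_conj[OF p(2) L2(1)[OF that(2)]]] conj2[OF that(2)] by simp
  have conj_fun_th: "conj_fun (theta_p mu) = theta_m mu" "conj_fun (theta_m mu) = theta_p mu" if "mu \<in> Lam1 p n" for mu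
  proof -
    note t = th[OF that]
    show c: "conj_fun (theta_p mu) = theta_m mu"
      by (rule constituents_conjugate_IBr[OF theta[OF L1(1)[OF that]]]) (use t in auto)
    show "conj_fun (theta_m mu) = theta_p mu" using conj_fun_conj_fun_IBr[of "theta_p mu"] t c by simp
  qed
  have Res_th: "Res (alt_group n) (theta mu) g = theta_p mu g + theta_m mu g" if "mu \<in> Lam1 p n" for mu g
    using th[OF that] by simp
  have conj_fun_rho: "conj_fun (rho_p la) = rho_m la" "conj_fun (rho_m la) = rho_p la" if "la \<in> Lam1 p n" for la
  proof -
    note t = rho[OF that]
    show c: "conj_fun (rho_p la) = rho_m la"
      by (rule constituents_conjugate_Irr[OF chiS[OF L1(1)[OF that]]]) (use t in auto)
    show "conj_fun (rho_m la) = rho_p la" using conj_fun_conj_fun_Irr[of "rho_p la"] t c by simp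
  qed
  have constituent: "b (theta_p mu) = a (theta mu) \<and> b (theta_m mu) = a (theta mu)"
    if mu: "mu \<in> Lam1 p n" and exp: "\<And>g. (\<Sum>\<psi>\<in>IBr p r (alt_group n). of_nat (b \<psi>) * \<psi> g) =
      (\<Sum>\<theta>\<in>IBr p r (sym_group n). of_nat (a \<theta>) * Res (alt_group n) \<theta> g)" for mu a b
  proof
    show "b (theta_p mu) = a (theta mu)"
      by (rule coefficient_of_constituent[OF fin exp theta[OF L1(1)[OF mu]]])
        (use th[OF mu] conj_fun_th[OF mu] in auto)
    show "b (theta_m mu) = a (theta mu)"
      by (rule coefficient_of_constituent[OF fin exp theta[OF L1(1)[OF mu]]])
        (use th[OF mu] conj_fun_th[OF mu] in \<open>auto simp: add.commute\<close>)
  qed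
  \<comment> \<open>The expansions of the restrictions of ordinary characters, once by the decomposition numbers of the
    alternating group and once by those of the symmetric group; the coefficients are compared below.\<close>
  have exp1: "(\<Sum>\<psi>\<in>IBr p r (alt_group n). of_nat (decA (rho_p la) \<psi> + decA (rho_m la) \<psi>) * \<psi> g) =
      (\<Sum>\<theta>\<in>IBr p r (sym_group n). of_nat (decS (chi n la) \<theta>) * Res (alt_group n) \<theta> g)"
    if la: "la \<in> Lam1 p n" for la g
  proof -
    have "preg p (alt_group n) (Res (alt_group n) (chi n la)) g =
      preg p (alt_group n) (rho_p la) g + preg p (alt_group n) (rho_m la) g"
      using rho[OF la] by (simp add: preg_def)
    then show ?thesis
      using preg_Res[OF decS chiS[OF L1(1)[OF la]], of g] rho[OF la]
      by (simp add: decomposition_numbersD[OF decA] distrib_right sum.distrib)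
  qed
  have irr2: "Res (alt_group n) (chi n (sel w)) \<in> Irr (alt_group n)" if "w \<in> Lam2 p n" for w
    by (rule Res_Irr[OF chiS[OF L2(1)[OF that]] chi_ne[OF that]])
  have exp2: "(\<Sum>\<psi>\<in>IBr p r (alt_group n). of_nat (decA (Res (alt_group n) (chi n (sel w))) \<psi>) * \<psi> g) =
      (\<Sum>\<theta>\<in>IBr p r (sym_group n). of_nat (decS (chi n (sel w)) \<theta>) * Res (alt_group n) \<theta> g)"
    if w: "w \<in> Lam2 p n" for w g
    unfolding decomposition_numbersD[OF decA irr2[OF w], symmetric]
    by (rule preg_Res[OF decS chiS[OF L2(1)[OF w]]])
  have part4: "decA (rho_p la) (theta_p mu) + decA (rho_m la) (theta_p mu) = d la mu \<and>
        d la mu = decA (rho_p la) (theta_m mu) + decA (rho_m la) (theta_m mu) \<and>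
        decA (rho_p la) (theta_p mu) = decA (rho_m la) (theta_m mu) \<and>
        decA (rho_p la) (theta_m mu) = decA (rho_m la) (theta_p mu)"
    if la: "la \<in> Lam1 p n" and mu: "mu \<in> Lam1 p n" for la mu
  proof -
    have "decA (conj_fun (rho_p la)) (conj_fun \<psi>) = decA (rho_p la) \<psi>" if "\<psi> \<in> IBr p r (alt_group n)" for \<psi>
      using decomposition_conj_fun[OF fin(2) decA _ that] rho[OF la] by blast
    then show ?thesis
      using constituent[OF mu exp1[OF la]] th[OF mu] unfolding d_def conj_fun_rho[OF la]
      by (metis conj_fun_th[OF mu])
  qed
  have part5: "decA (rho_p la) (thetaA (sel w)) = decA (rho_m la) (thetaA (sel w)) \<and>
        decA (rho_m la) (thetaA (sel w)) = d la (sel w)"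
    if la: "la \<in> Lam1 p n" and w: "w \<in> Lam2 p n" for la w
  proof -
    note tw = theta[OF L2(1)[OF w]]
    let ?\<psi> = "Res (alt_group n) (theta (sel w))"
    \<comment> \<open>Conjugation by a transposition exchanges \<open>rho_p la\<close> and \<open>rho_m la\<close>, and it fixes restrictions from the
      symmetric group. So the two numbers are equal, and by (i) their sum is twice a decomposition number.\<close>
    have "decA (conj_fun (rho_p la)) (conj_fun ?\<psi>) = decA (rho_p la) ?\<psi>"
      using decomposition_conj_fun[OF fin(2) decA _ Res_IBr[OF tw theta_ne[OF w]]] rho[OF la] by blast
    then have eq: "decA (rho_m la) ?\<psi> = decA (rho_p la) ?\<psi>"
      unfolding conj_fun_rho[OF la] conj_fun_Res_IBr[OF tw] .
    have "decA (rho_p la) ?\<psi> + decA (rho_m la) ?\<psi> = d la (sel w) + d la (conj_part (sel w))"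
      unfolding d_def theta_eps[OF L2(1)[OF w]]
      by (rule coefficient_of_restriction[OF fin exp1[OF la] tw theta_ne[OF w]])
    then show ?thesis using eq part1[OF la w] by (simp add: thetaA_def A_def)
  qed
  have part6: "d (sel w') (sel w) + d (sel w') (conj_part (sel w)) = decA (rhoA (sel w')) (thetaA (sel w))"
    if w': "w' \<in> Lam2 p n" and w: "w \<in> Lam2 p n" for w' w
    unfolding d_def theta_eps[OF L2(1)[OF w]] rhoA_def thetaA_def A_def
    by (rule coefficient_of_restriction[OF fin exp2[OF w'] theta[OF L2(1)[OF w]] theta_ne[OF w], symmetric])
  have part7: "decA (rhoA (sel w')) (theta_p mu) = decA (rhoA (sel w')) (theta_m mu) \<and>
        decA (rhoA (sel w')) (theta_m mu) = d (sel w') mu"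
    if w': "w' \<in> Lam2 p n" and mu: "mu \<in> Lam1 p n" for w' mu
    using constituent[OF mu exp2[OF w']] by (simp add: d_def rhoA_def A_def)
  show ?thesis
    using part1 part2 part3 part4 part5 part6 part7 by blast
qed

end
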